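(* Given $A \in \mathbb{R}^{n \times d}$, $p \in [1,2)$ and $\epsilon>0$, one can compute, in $O(\mathrm{nnz}(A)\cdot\log n)$ time, a sampling matrix $S \in \mathbb{R}^{s \times n}$ with $s = O(\mathrm{poly}(d)\log(1/\epsilon)/\epsilon^2)$ such that, with a constant probability, $S$ embeds $\mathcal{A}_p$ into $(\mathbb{R}^s,\|\cdot\|_p)$ with distortion $1\pm\epsilon$, i.e. $$(1-\epsilon)\|Ax\|_p \le \|SAx\|_p \le (1+\epsilon)\|Ax\|_p \quad \text{for all } x \in \mathbb{R}^d.$$
   Context: $\mathrm{nnz}(A)$ is the number of nonzero entries of $A$. $\mathcal{A}_p$ denotes the column space of $A$ equipped with the $\ell_p$ norm. A sampling matrix is a matrix with exactly one nonzero entry per row. The paper's standing assumption is $n \gg \mathrm{poly}(d) \ge d \gg \log n$. *)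

theory Defs
  imports "HOL-Probability.Probability" "Jordan_Normal_Form.Matrix"
begin

unbundle no vec_syntax

section \<open>Matrices and the $\ell_p$ norm\<close>

definition nnz :: "real mat \<Rightarrow> nat" where
  "nnz A = card {(i, j). i < dim_row A \<and> j < dim_col A \<and> A $$ (i, j) \<noteq> 0}"

definition lp_norm :: "real \<Rightarrow> real vec \<Rightarrow> real" where
  "lp_norm p v = (\<Sum>i<dim_vec v. \<bar>v $ i\<bar> powr p) powr (1 / p)"

definition sampling_matrix :: "real mat \<Rightarrow> bool" where
  "sampling_matrix S \<longleftrightarrow> (\<forall>r<dim_row S. \<exists>!j. j < dim_col S \<and> S $$ (r, j) \<noteq> 0)"

definition embeds_col_space :: "real \<Rightarrow> real \<Rightarrow> real mat \<Rightarrow> real mat \<Rightarrow> bool" where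
  "embeds_col_space p \<epsilon> A S \<longleftrightarrow>
     (\<forall>x\<in>carrier_vec (dim_col A).
        (1 - \<epsilon>) * lp_norm p (A *\<^sub>v x) \<le> lp_norm p (S *\<^sub>v (A *\<^sub>v x)) \<and>
        lp_norm p (S *\<^sub>v (A *\<^sub>v x)) \<le> (1 + \<epsilon>) * lp_norm p (A *\<^sub>v x))"


section \<open>A randomized real RAM\<close>

text \<open>
  Running times refer to a random-access machine with exact real arithmetic and unit-cost
  instructions, given as a small imperative language with fixed, finite program texts. The memory
  consists of arrays of natural numbers (for addresses and counters) and arrays of reals. An array
  is selected by a literal in the program text, a cell of it by a computed index.

  Two restrictions keep the unit-cost convention honest: natural numbers can only be added,
  subtracted (truncated at 0) and compared, and there is no conversion from reals to natural numbers
  (no floor function). Programs contain only natural-number literals (and $\pi$), so no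
  information about an input can be hidden in a real constant. The elementary real functions
  are those needed to evaluate $p$-th powers and to draw a $p$-stable variable from uniform ones
  in constant time.
\<close>

datatype nexp =
    NLit nat
  | NGet nat nexp
  | NAdd nexp nexp
  | NSub nexp nexp

datatype rexp =
    ROfNat nexp
  | RPi
  | RGet nat nexp
  | RAdd rexp rexp
  | RSub rexp rexp
  | RMul rexp rexp
  | RDiv rexp rexp
  | RPowr rexp rexp
  | RLn rexp
  | RSin rexp
  | RCos rexp

datatype test =
    NLe nexp nexp
  | RLe rexp rexp
  | TNot test
  | TAnd test test

datatype com =
    Skip
  | NSet nat nexp nexp
  | RSet nat nexp rexp
  | Draw nat nexp
  | Seq com com
  | Cond test com com
  | Loop test com

text \<open>The field \<open>drawn\<close> counts the cells of the random tape consumed so far.\<close>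

record store =
  nmem :: "nat \<Rightarrow> nat \<Rightarrow> nat"
  rmem :: "nat \<Rightarrow> nat \<Rightarrow> real"
  drawn :: nat

primrec nval :: "nexp \<Rightarrow> store \<Rightarrow> nat" where
  "nval (NLit k) \<sigma> = k"
| "nval (NGet a e) \<sigma> = nmem \<sigma> a (nval e \<sigma>)"
| "nval (NAdd e f) \<sigma> = nval e \<sigma> + nval f \<sigma>"
| "nval (NSub e f) \<sigma> = nval e \<sigma> - nval f \<sigma>"

primrec rval :: "rexp \<Rightarrow> store \<Rightarrow> real" where
  "rval (ROfNat e) \<sigma> = real (nval e \<sigma>)"
| "rval RPi \<sigma> = pi"
| "rval (RGet a e) \<sigma> = rmem \<sigma> a (nval e \<sigma>)"
| "rval (RAdd e f) \<sigma> = rval e \<sigma> + rval f \<sigma>"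
| "rval (RSub e f) \<sigma> = rval e \<sigma> - rval f \<sigma>"
| "rval (RMul e f) \<sigma> = rval e \<sigma> * rval f \<sigma>"
| "rval (RDiv e f) \<sigma> = rval e \<sigma> / rval f \<sigma>"
| "rval (RPowr e f) \<sigma> = rval e \<sigma> powr rval f \<sigma>"
| "rval (RLn e) \<sigma> = ln (rval e \<sigma>)"
| "rval (RSin e) \<sigma> = sin (rval e \<sigma>)"
| "rval (RCos e) \<sigma> = cos (rval e \<sigma>)"

primrec tval :: "test \<Rightarrow> store \<Rightarrow> bool" where
  "tval (NLe e f) \<sigma> \<longleftrightarrow> nval e \<sigma> \<le> nval f \<sigma>"
| "tval (RLe e f) \<sigma> \<longleftrightarrow> rval e \<sigma> \<le> rval f \<sigma>"
| "tval (TNot b) \<sigma> \<longleftrightarrow> \<not> tval b \<sigma>"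
| "tval (TAnd b c) \<sigma> \<longleftrightarrow> tval b \<sigma> \<and> tval c \<sigma>"

definition nwrite :: "nat \<Rightarrow> nat \<Rightarrow> nat \<Rightarrow> store \<Rightarrow> store" where
  "nwrite a i k \<sigma> = \<sigma>\<lparr>nmem := (nmem \<sigma>)(a := (nmem \<sigma> a)(i := k))\<rparr>"

definition rwrite :: "nat \<Rightarrow> nat \<Rightarrow> real \<Rightarrow> store \<Rightarrow> store" where
  "rwrite a i v \<sigma> = \<sigma>\<lparr>rmem := (rmem \<sigma>)(a := (rmem \<sigma> a)(i := v))\<rparr>"

text \<open>
  \<open>exec \<omega> c \<sigma> t \<sigma>'\<close>: on the random tape \<open>\<omega>\<close>, the program \<open>c\<close> started in \<open>\<sigma>\<close> halts in \<open>\<sigma>'\<close> after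
  \<open>t\<close> steps. Each assignment, draw and test costs one step; expressions are part of the fixed
  program text, so their evaluation only contributes a constant factor.
\<close>

inductive exec :: "(nat \<Rightarrow> real) \<Rightarrow> com \<Rightarrow> store \<Rightarrow> nat \<Rightarrow> store \<Rightarrow> bool" for \<omega> where
  Skip: "exec \<omega> Skip \<sigma> 1 \<sigma>"
| NSet: "exec \<omega> (NSet a e f) \<sigma> 1 (nwrite a (nval e \<sigma>) (nval f \<sigma>) \<sigma>)"
| RSet: "exec \<omega> (RSet a e f) \<sigma> 1 (rwrite a (nval e \<sigma>) (rval f \<sigma>) \<sigma>)"
| Draw: "exec \<omega> (Draw a e) \<sigma> 1
           ((rwrite a (nval e \<sigma>) (\<omega> (drawn \<sigma>)) \<sigma>)\<lparr>drawn := Suc (drawn \<sigma>)\<rparr>)"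
| Seq: "exec \<omega> c \<sigma> t \<sigma>' \<Longrightarrow> exec \<omega> c' \<sigma>' t' \<sigma>'' \<Longrightarrow> exec \<omega> (Seq c c') \<sigma> (t + t') \<sigma>''"
| CondTrue: "tval b \<sigma> \<Longrightarrow> exec \<omega> c \<sigma> t \<sigma>' \<Longrightarrow> exec \<omega> (Cond b c c') \<sigma> (Suc t) \<sigma>'"
| CondFalse: "\<not> tval b \<sigma> \<Longrightarrow> exec \<omega> c' \<sigma> t \<sigma>' \<Longrightarrow> exec \<omega> (Cond b c c') \<sigma> (Suc t) \<sigma>'"
| LoopFalse: "\<not> tval b \<sigma> \<Longrightarrow> exec \<omega> (Loop b c) \<sigma> 1 \<sigma>"
| LoopTrue: "tval b \<sigma> \<Longrightarrow> exec \<omega> c \<sigma> t \<sigma>' \<Longrightarrow> exec \<omega> (Loop b c) \<sigma>' t' \<sigma>'' \<Longrightarrow>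
             exec \<omega> (Loop b c) \<sigma> (Suc (t + t')) \<sigma>''"

lemma exec_deterministic:
  "exec \<omega> c \<sigma> t \<sigma>' \<Longrightarrow> exec \<omega> c \<sigma> u \<tau> \<Longrightarrow> u = t \<and> \<tau> = \<sigma>'"
proof (induction arbitrary: u \<tau> rule: exec.induct)
  case (Skip \<sigma>)
  then show ?case by cases simp_all
next
  case (NSet a e f \<sigma>)
  then show ?case by cases simp_all
next
  case (RSet a e f \<sigma>)
  then show ?case by cases simp_all
next
  case (Draw a e \<sigma>)
  then show ?case by cases simp_all
next
  case (Seq c \<sigma> t \<sigma>' c' t' \<sigma>'')
  from Seq.prems show ?case
    by cases (metis Seq.IH)
next
  case (CondTrue b \<sigma> c t \<sigma>' c')
  from CondTrue.prems show ?case
    by cases (metis CondTrue.IH, metis CondTrue.hyps(1))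
next
  case (CondFalse b \<sigma> c' t \<sigma>' c)
  from CondFalse.prems show ?case
    by cases (metis CondFalse.hyps(1), metis CondFalse.IH)
next
  case (LoopFalse b \<sigma> c)
  from LoopFalse.prems show ?case
    by cases (simp, metis LoopFalse.hyps(1))
next
  case (LoopTrue b \<sigma> c t \<sigma>' t' \<sigma>'')
  from LoopTrue.prems show ?case
    by cases (metis LoopTrue.hyps(1), metis LoopTrue.IH)
qed

text \<open>The random tape: independent uniform reals from the unit interval.\<close>

definition uniform_tape :: "(nat \<Rightarrow> real) measure" where
  "uniform_tape = Pi\<^sub>M UNIV (\<lambda>_::nat. restrict_space lborel {0..1::real})"


section \<open>Input and output\<close>

text \<open>
  A matrix is handed to the program as the list of its nonzero entries
  (row, column, value), in an arbitrary order. Row and column indices start from 0.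
\<close>

definition lists_entries :: "real mat \<Rightarrow> (nat \<times> nat \<times> real) list \<Rightarrow> bool" where
  "lists_entries A es \<longleftrightarrow> distinct es \<and>
     set es = {(i, j, v). i < dim_row A \<and> j < dim_col A \<and> v = A $$ (i, j) \<and> v \<noteq> 0}"

lemma lists_entries_length:
  assumes "lists_entries A es"
  shows "length es = nnz A"
proof -
  have "set es = (\<lambda>(i, j). (i, j, A $$ (i, j))) `
          {(i, j). i < dim_row A \<and> j < dim_col A \<and> A $$ (i, j) \<noteq> 0}"
    using assms by (auto simp: lists_entries_def)
  moreover have "inj_on (\<lambda>(i, j). (i, j, A $$ (i, j)))
          {(i, j). i < dim_row A \<and> j < dim_col A \<and> A $$ (i, j) \<noteq> 0}"
    by (auto simp: inj_on_def)
  ultimately have "card (set es) = nnz A"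
    by (simp add: nnz_def card_image)
  then show ?thesis
    using assms distinct_card[of es] unfolding lists_entries_def by metis
qed

text \<open>
  Input layout: natural-number array 0 holds \<open>n\<close>, \<open>d\<close> and the number of nonzero entries, real array 0
  holds \<open>p\<close> and \<open>\<epsilon>\<close>; the rows, columns and values of the listed entries are in natural-number
  arrays 1 and 2 and in real array 1. All other cells are 0.
\<close>

definition input_store ::
    "nat \<Rightarrow> nat \<Rightarrow> real \<Rightarrow> real \<Rightarrow> (nat \<times> nat \<times> real) list \<Rightarrow> store" where
  "input_store n d p \<epsilon> es =
     \<lparr>nmem = (\<lambda>_ _. 0)
        (0 := (\<lambda>_. 0)(0 := n, 1 := d, 2 := length es),
         1 := (\<lambda>k. if k < length es then fst (es ! k) else 0),
         2 := (\<lambda>k. if k < length es then fst (snd (es ! k)) else 0)),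
      rmem = (\<lambda>_ _. 0)
        (0 := (\<lambda>_. 0)(0 := p, 1 := \<epsilon>),
         1 := (\<lambda>k. if k < length es then snd (snd (es ! k)) else 0)),
      drawn = 0\<rparr>"

text \<open>
  Output layout: cell 0 of natural-number array 3 holds the number of rows of the sampling matrix.
  For each row, natural-number array 4 holds the column and real array 2 the value of its
  nonzero entry.
\<close>

definition output_matrix :: "nat \<Rightarrow> store \<Rightarrow> real mat" where
  "output_matrix n \<sigma> =
     mat (nmem \<sigma> 3 0) n (\<lambda>(r, j). if j = nmem \<sigma> 4 r then rmem \<sigma> 2 r else 0)"

definition computes ::
    "com \<Rightarrow> real \<Rightarrow> real \<Rightarrow> nat \<Rightarrow> nat \<Rightarrow> (nat \<times> nat \<times> real) list \<Rightarrow>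
     (nat \<Rightarrow> real) \<Rightarrow> nat \<Rightarrow> real mat \<Rightarrow> bool" where
  "computes prog p \<epsilon> n d es \<omega> t S \<longleftrightarrow>
     (\<exists>\<sigma>. exec \<omega> prog (input_store n d p \<epsilon> es) t \<sigma> \<and> S = output_matrix n \<sigma>)"

end

theory Submission
  imports Defs
begin

text \<open>Let \<open>B\<close> be the matrix of the \<open>R\<close> nonzero rows of \<open>A\<close>. If \<open>R\<close> is at most the allowed size, all
  of these rows are kept; if \<open>\<epsilon> \<ge> 1\<close>, none is needed. Otherwise row \<open>r\<close> is scaled by \<open>u r\<close> to the power
  \<open>-1/p\<close> with \<open>u r\<close> uniform in \<open>[0,1]\<close>. With constant probability, simultaneously for all \<open>x\<close>, the
  \<open>\<ell>\<^sub>2\<close> norm of the scaled \<open>B x\<close> agrees with the \<open>\<ell>\<^sub>p\<close> norm of \<open>B x\<close> up to factors polynomial in \<open>d\<close>: from below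
  because the largest scaled entry is already that large (a union bound over a net), from above because the
  \<open>\<ell>\<^sub>p\<close> sensitivities of the rows sum to at most \<open>d\<close>. A sparse sign sketch with \<open>O(d\<^sup>2)\<close> buckets
  preserves that \<open>\<ell>\<^sub>2\<close> norm up to a constant, and orthonormalising the sketched columns gives \<open>T\<close> for which the row norms of
  \<open>B T\<close>, estimated by \<open>O(log n)\<close> random projections, bound the sensitivities up to polynomial factors.
  Keeping every row independently with probability proportional to the \<open>p\<close>-th power of its estimate (capped at 1) yields
  the embedding by a Bernstein bound on a net. Only the sketch and the projections touch all
  nonzero entries, which gives the running time; since \<open>d\<close> dominates \<open>log n\<close>, all remaining logarithms are
  absorbed into powers of \<open>d\<close>.\<close>

section \<open>The random tape\<close>

text \<open>Three devices shape the proof. Randomness is exposed one tape cell at a time: redrawing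
  a cell preserves the law of the tape, so the probability bounds need no independence of derived
  variables. The rank of \<open>A\<close> is arbitrary, so Gram--Schmidt has to survive vanishing
  columns; that its result still represents \<open>B\<close> follows from the lower norm bound.
  Finally, sampling is entered only if \<open>R\<close> exceeds \<open>Cap\<close>, which is of
  order \<open>d^21 / \<epsilon>^2\<close>. This pays for the work polynomial in \<open>d\<close>,
  then at most \<open>R\<close> and hence at most \<open>nnz A\<close>. It also gives
  \<open>1 / \<epsilon>^2 \<le> R\<close>, so that the mesh of the net depends on \<open>R\<close>
  and \<open>d\<close> only and, by \<open>1000 * ln R \<le> d\<close>, the logarithm of the net
  size is at most \<open>d^2\<close>. Both the failure exponent \<open>\<tau>\<close> and the norm
  bound \<open>\<kappa>\<close> can then be \<open>d^3\<close>. The exponent 21 is 11 from the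
  factor \<open>\<tau> * (\<kappa> * d)^2\<close> of the rates plus 10 from the bound
  \<open>L * d^3 * \<tau>^2\<close> on the sum of scores, with \<open>L \<le> d\<close>.\<close>

definition unif :: "real measure" where
  "unif = restrict_space lborel {0..1}"

lemma space_unif [simp]: "space unif = {0..1}"
  by (simp add: unif_def space_restrict_space)

lemma prob_space_unif: "prob_space unif"
  by (rule prob_spaceI) (simp add: unif_def emeasure_restrict_space space_restrict_space)

lemma sets_unif_iff: "A \<in> sets unif \<longleftrightarrow> A \<in> sets borel \<and> A \<subseteq> {0..1}"
  unfolding unif_def by (subst sets_restrict_space_iff) auto

lemma measurable_ident_unif: "(\<lambda>x. x) \<in> borel_measurable unif"
  unfolding unif_def by (rule measurable_restrict_space1) simp

lemma uniform_tape_eq: "uniform_tape = Pi\<^sub>M UNIV (\<lambda>_. unif)"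
  by (simp add: uniform_tape_def unif_def)

lemma prob_space_tape: "prob_space uniform_tape"
  unfolding uniform_tape_eq by (intro prob_space_PiM prob_space_unif)

lemma space_tape: "space uniform_tape = {w. \<forall>i. 0 \<le> w i \<and> w i \<le> 1}"
  by (auto simp: uniform_tape_eq space_PiM PiE_def Pi_def)

lemma measurable_tape_component: "(\<lambda>w. w i) \<in> borel_measurable uniform_tape"
proof -
  have "(\<lambda>w. w i) \<in> uniform_tape \<rightarrow>\<^sub>M unif"
    unfolding uniform_tape_eq by (rule measurable_component_singleton) simp
  from measurable_compose[OF this measurable_ident_unif] show ?thesis by simp
qed

lemma measurable_tape_update:
  "(\<lambda>(x, w). w(i := x)) \<in> unif \<Otimes>\<^sub>M uniform_tape \<rightarrow>\<^sub>M uniform_tape"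
proof -
  have "(\<lambda>p. (snd p)(i := fst p)) \<in> unif \<Otimes>\<^sub>M Pi\<^sub>M UNIV (\<lambda>_. unif) \<rightarrow>\<^sub>M Pi\<^sub>M UNIV (\<lambda>_. unif)"
    by (rule measurable_fun_upd[where J=UNIV]) auto
  then show ?thesis
    by (simp add: uniform_tape_eq case_prod_beta')
qed

text \<open>Redrawing cell \<open>i\<close> independently does not change the law of the tape. The
  inner integral thus serves as the conditional expectation given all other cells.\<close>

lemma resample:
  fixes f :: "(nat \<Rightarrow> real) \<Rightarrow> ennreal"
  assumes f: "f \<in> borel_measurable uniform_tape"
  shows "(\<integral>\<^sup>+w. f w \<partial>uniform_tape) = (\<integral>\<^sup>+w. (\<integral>\<^sup>+x. f (w(i := x)) \<partial>unif) \<partial>uniform_tape)"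
proof -
  interpret U: prob_space unif by (rule prob_space_unif)
  interpret P: prob_space uniform_tape by (rule prob_space_tape)
  interpret pair_sigma_finite unif uniform_tape ..
  have d: "distr (unif \<Otimes>\<^sub>M uniform_tape) uniform_tape (\<lambda>(x, w). w(i := x)) = uniform_tape"
    using distr_pair_PiM_eq_PiM[of UNIV "\<lambda>_. unif" i] prob_space_unif
    by (simp add: uniform_tape_eq)
  have m: "(\<lambda>p. f ((snd p)(i := fst p))) \<in> borel_measurable (unif \<Otimes>\<^sub>M uniform_tape)"
    using measurable_compose[OF measurable_tape_update f] by (simp add: case_prod_beta')
  have "(\<integral>\<^sup>+w. f w \<partial>uniform_tape)
      = (\<integral>\<^sup>+w. f w \<partial>distr (unif \<Otimes>\<^sub>M uniform_tape) uniform_tape (\<lambda>(x, w). w(i := x)))"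
    by (simp add: d)
  also have "\<dots> = (\<integral>\<^sup>+p. f ((snd p)(i := fst p)) \<partial>(unif \<Otimes>\<^sub>M uniform_tape))"
    by (subst nn_integral_distr) (use measurable_tape_update f in \<open>auto simp: case_prod_beta'\<close>)
  also have "\<dots> = (\<integral>\<^sup>+w. (\<integral>\<^sup>+x. f (w(i := x)) \<partial>unif) \<partial>uniform_tape)"
    using nn_integral_snd[of "\<lambda>p. f ((snd p)(i := fst p))"] m
    by (simp add: case_prod_beta')
  finally show ?thesis .
qed

text \<open>\<open>Y m\<close> may read any cells: a step only has to be nonincreasing after
  averaging over cell \<open>c m\<close> with the rest of the tape fixed. Iterating
  \<open>resample\<close> replaces a filtration.\<close>

lemma supermartingale:
  fixes Y :: "nat \<Rightarrow> (nat \<Rightarrow> real) \<Rightarrow> ennreal"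
  assumes "\<And>m. m \<le> N \<Longrightarrow> Y m \<in> borel_measurable uniform_tape"
    and "\<And>m w. m < N \<Longrightarrow> w \<in> space uniform_tape \<Longrightarrow>
           (\<integral>\<^sup>+x. Y (Suc m) (w(c m := x)) \<partial>unif) \<le> Y m w"
  shows "(\<integral>\<^sup>+w. Y N w \<partial>uniform_tape) \<le> (\<integral>\<^sup>+w. Y 0 w \<partial>uniform_tape)"
  using assms
proof (induction N)
  case (Suc N)
  have "(\<integral>\<^sup>+w. Y (Suc N) w \<partial>uniform_tape)
      = (\<integral>\<^sup>+w. (\<integral>\<^sup>+x. Y (Suc N) (w(c N := x)) \<partial>unif) \<partial>uniform_tape)"
    by (rule resample) (use Suc in auto)
  also have "\<dots> \<le> (\<integral>\<^sup>+w. Y N w \<partial>uniform_tape)"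
    by (intro nn_integral_mono Suc.prems(2)) auto
  also have "\<dots> \<le> (\<integral>\<^sup>+w. Y 0 w \<partial>uniform_tape)"
    using Suc by simp
  finally show ?case .
qed simp

lemma nn_integral_unif_step:
  assumes c: "0 \<le> c" "c \<le> 1" and ab: "0 \<le> a" "0 \<le> b"
  shows "(\<integral>\<^sup>+x. ennreal (if x < c then a else b) \<partial>unif) = ennreal (c * a + (1 - c) * b)"
proof -
  have A: "{0..<c} \<in> sets unif" "{c..1} \<in> sets unif" using c by (auto simp: sets_unif_iff)
  have "(\<integral>\<^sup>+x. ennreal (if x < c then a else b) \<partial>unif)
     = (\<integral>\<^sup>+x. ennreal a * indicator {0..<c} x + ennreal b * indicator {c..1} x \<partial>unif)"
    using c by (intro nn_integral_cong) (auto split: split_indicator)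
  also have "\<dots> = ennreal a * emeasure unif {0..<c} + ennreal b * emeasure unif {c..1}"
    using A by (subst nn_integral_add) (auto simp: nn_integral_cmult_indicator)
  also have "emeasure unif {0..<c} = ennreal c"
    using c unfolding unif_def by (subst emeasure_restrict_space) auto
  also have "emeasure unif {c..1} = ennreal (1 - c)"
    using c unfolding unif_def by (subst emeasure_restrict_space) auto
  also have "ennreal a * ennreal c + ennreal b * ennreal (1 - c) = ennreal (c * a + (1 - c) * b)"
    using c ab by (simp add: ennreal_mult[symmetric] ennreal_plus[symmetric] mult.commute del: ennreal_plus)
  finally show ?thesis .
qed

lemma nn_integral_unif_step_le:
  assumes c: "0 \<le> c" "c \<le> 1" and ab: "0 \<le> a" "0 \<le> b"
  shows "(\<integral>\<^sup>+x. ennreal (if x \<le> c then a else b) \<partial>unif) = ennreal (c * a + (1 - c) * b)"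
proof -
  have "AE x in lborel. x \<noteq> c" by (rule AE_lborel_singleton)
  then have "AE x in unif. x \<noteq> c"
    unfolding unif_def by (subst AE_restrict_space_iff) auto
  then have "(\<integral>\<^sup>+x. ennreal (if x \<le> c then a else b) \<partial>unif)
      = (\<integral>\<^sup>+x. ennreal (if x < c then a else b) \<partial>unif)"
    by (intro nn_integral_cong_AE) (erule eventually_mono, simp)
  then show ?thesis using nn_integral_unif_step[OF assms] by simp
qed

lemma nn_integral_unif_interval:
  assumes "\<And>x. x \<in> {0..1} \<Longrightarrow> \<not> (a \<le> x \<and> x \<le> b) \<Longrightarrow> f x = 0" and "\<And>x. f x \<le> c" and "a \<le> b" "0 \<le> c"
  shows "(\<integral>\<^sup>+x. ennreal (f x) \<partial>unif) \<le> ennreal (c * (b - a))"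
proof -
  have m: "{a..b} \<inter> {0..1} \<in> sets unif" by (auto simp: sets_unif_iff)
  have "(\<integral>\<^sup>+x. ennreal (f x) \<partial>unif) \<le> (\<integral>\<^sup>+x. ennreal c * indicator ({a..b} \<inter> {0..1}) x \<partial>unif)"
    using assms by (intro nn_integral_mono) (auto split: split_indicator intro!: ennreal_leI)
  also have "\<dots> = ennreal c * emeasure unif ({a..b} \<inter> {0..1})"
    by (rule nn_integral_cmult_indicator[OF m])
  also have "\<dots> \<le> ennreal c * emeasure lborel {a..b}"
    unfolding unif_def
    by (intro mult_left_mono) (auto simp: emeasure_restrict_space intro!: emeasure_mono)
  also have "\<dots> = ennreal (c * (b - a))"
    using assms by (simp add: ennreal_mult)
  finally show ?thesis .
qed

text \<open>\<open>1 / x\<close> has no finite mean on the unit interval, but truncating it at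
  \<open>B\<close> costs only a logarithm: the part below \<open>1 / B\<close> contributes 1 and the
  rest \<open>ln B\<close>. This is where the factor \<open>1 + ln (100 * real R)\<close> in the
  condition on \<open>\<kappa>\<close> comes from.\<close>

lemma nn_integral_unif_inverse:
  assumes B: "1 \<le> B"
  shows "(\<integral>\<^sup>+x. ennreal (min (1 / x) B) \<partial>unif) \<le> ennreal (1 + ln B)"
proof -
  have "(\<integral>\<^sup>+x. ennreal (min (1 / x) B) \<partial>unif)
      \<le> (\<integral>\<^sup>+x. ennreal (min (1 / x) B) * indicator {0..1} x \<partial>lborel)"
    unfolding unif_def by (subst nn_integral_restrict_space) auto
  also have "\<dots> \<le> (\<integral>\<^sup>+x. ennreal B * indicator {0..1/B} x
                       + ennreal (1 / x) * indicator {1/B..1} x \<partial>lborel)"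
    using B by (intro nn_integral_mono)
      (auto split: split_indicator intro!: ennreal_leI simp: min_le_iff_disj)
  also have "\<dots> = ennreal B * emeasure lborel {0..1/B} + (\<integral>\<^sup>+x. ennreal (1 / x) * indicator {1/B..1} x \<partial>lborel)"
    by (subst nn_integral_add) (auto simp: nn_integral_cmult_indicator)
  also have "ennreal B * emeasure lborel {0..1/B} = ennreal 1"
    using B by (simp add: ennreal_mult[symmetric])
  also have "(\<integral>\<^sup>+x. ennreal (1 / x) * indicator {1/B..1} x \<partial>lborel) = ennreal (ln 1 - ln (1 / B))"
  proof (rule nn_integral_FTC_Icc)
    fix x assume "x \<in> {1 / B..1}"
    moreover have "0 < 1 / B" using B by simp
    ultimately have "0 < x" unfolding atLeastAtMost_iff by linarith
    then show "DERIV ln x :> 1 / x" "0 \<le> 1 / x"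
      by (auto intro!: derivative_eq_intros)
  qed (use B in auto)
  also have "ennreal 1 + ennreal (ln 1 - ln (1 / B)) = ennreal (1 + ln B)"
    using B by (subst ennreal_plus[symmetric]) (auto simp: ln_div)
  finally show ?thesis .
qed

section \<open>Gram--Schmidt orthonormalisation\<close>

definition ip :: "nat \<Rightarrow> (nat \<Rightarrow> nat \<Rightarrow> real) \<Rightarrow> nat \<Rightarrow> nat \<Rightarrow> real" where
  "ip s W j k = (\<Sum>i<s. W j i * W k i)"

text \<open>Inner products range over the first \<open>s\<close> rows only, whereas all rows are
  updated. The rows from \<open>s\<close> on can thus record the column operations.\<close>

definition gs_step :: "nat \<Rightarrow> (nat \<Rightarrow> nat \<Rightarrow> real) \<Rightarrow> nat \<Rightarrow> nat \<Rightarrow> nat \<Rightarrow> real" where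
  "gs_step s W j = (let V = (\<lambda>i. W j i / sqrt (ip s W j j)) in
     (\<lambda>k i. if k = j then V i
            else if j < k then W k i - (\<Sum>i'<s. V i' * W k i') * V i
            else W k i))"

primrec gs :: "nat \<Rightarrow> nat \<Rightarrow> (nat \<Rightarrow> nat \<Rightarrow> real) \<Rightarrow> nat \<Rightarrow> nat \<Rightarrow> real" where
  "gs s 0 W = W"
| "gs s (Suc j) W = gs_step s (gs s j W) j"

lemma gs_step_eq: "gs_step s W j j i = W j i / sqrt (ip s W j j)"
  by (simp add: gs_step_def Let_def)

lemma gs_step_lt: "k < j \<Longrightarrow> gs_step s W j k i = W k i"
  by (simp add: gs_step_def Let_def)

lemma gs_step_gt:
  "j < k \<Longrightarrow> gs_step s W j k i
     = W k i - (\<Sum>i'<s. gs_step s W j j i' * W k i') * gs_step s W j j i"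
  by (simp add: gs_step_def Let_def)

lemma ip_commute: "ip s W j k = ip s W k j"
  by (simp add: ip_def mult.commute)

lemma ip_nonneg: "0 \<le> ip s W j j"
  by (auto simp: ip_def intro!: sum_nonneg)

lemma ip_self_eq_0: "ip s W j j = 0 \<Longrightarrow> i < s \<Longrightarrow> W j i = 0"
  unfolding ip_def by (subst (asm) sum_nonneg_eq_0_iff) auto

lemma gs_step_norm: "ip s (gs_step s W j) j j = (if ip s W j j = 0 then 0 else 1)"
proof -
  have "ip s (gs_step s W j) j j = (\<Sum>i<s. W j i * W j i / ip s W j j)"
    using ip_nonneg[of s W j] unfolding ip_def[of s "gs_step s W j"] gs_step_eq
    by (simp add: ip_nonneg)
  also have "\<dots> = ip s W j j / ip s W j j"
    by (simp only: ip_def[of s W] sum_divide_distrib)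
  finally show ?thesis by simp
qed

text \<open>A column whose norm is \<open>0\<close> is divided by \<open>0\<close> and vanishes entirely, also beyond row \<open>s\<close>.\<close>

lemma gs_orthogonal:
  shows "a < j \<Longrightarrow> a \<noteq> b \<Longrightarrow> ip s (gs s j W) a b = 0"
    and "a < j \<Longrightarrow> ip s (gs s j W) a a = 1 \<or>
           (ip s (gs s j W) a a = 0 \<and> (\<forall>i. gs s j W a i = 0))"
proof (induction j arbitrary: a b)
  case (Suc j)
  let ?W = "gs s j W" and ?V = "gs s (Suc j) W"
  have V: "?V = gs_step s ?W j" by simp
  have new: "ip s ?V j b = 0" if "b \<noteq> j" for b
  proof (cases "b < j")
    case True
    then have "ip s ?V j b = (\<Sum>i<s. ?W j i * ?W b i) / sqrt (ip s ?W j j)"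
      by (simp add: ip_def[of s "gs_step s ?W j"] gs_step_eq gs_step_lt sum_divide_distrib)
    also have "(\<Sum>i<s. ?W j i * ?W b i) = ip s ?W b j" by (simp add: ip_def mult.commute)
    also have "\<dots> = 0" using Suc.IH(1)[of b j] True by auto
    finally show ?thesis by simp
  next
    case False
    with that have b: "j < b" by simp
    define c where "c = (\<Sum>i'<s. ?V j i' * ?W b i')"
    have gt: "?V b i = ?W b i - c * ?V j i" for i
      using gs_step_gt[OF b, of s ?W i] by (simp add: c_def)
    have "ip s ?V j b = (\<Sum>i<s. ?V j i * ?W b i - c * (?V j i * ?V j i))"
      unfolding ip_def gt by (simp add: algebra_simps del: gs.simps)
    also have "\<dots> = c * (1 - ip s ?V j j)"
      by (simp add: sum_subtractf c_def ip_def sum_distrib_left[symmetric] right_diff_distrib)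
    \<comment> \<open>The norm is 1, or the new column vanishes on the first \<open>s\<close> rows
      and then \<open>c\<close> is 0.\<close>
    also have "\<dots> = 0"
    proof (cases "ip s ?V j j = 0")
      case True
      then have "c = 0" unfolding c_def by (intro sum.neutral) (use ip_self_eq_0 in auto)
      then show ?thesis by simp
    next
      case False
      then have "ip s ?V j j = 1" unfolding V gs_step_norm by (simp split: if_splits)
      then show ?thesis by simp
    qed
    finally show ?thesis .
  qed
  have old: "ip s ?V a b = 0" if a: "a < j" "a \<noteq> b" for a b
  proof -
    consider "b = j" | "b < j" | "j < b" by linarith
    then show ?thesis
    proof cases
      case 1 then show ?thesis using new[of a] a ip_commute by simp
    next
      case 2 then show ?thesis
        using Suc.IH(1)[of a b] a by (simp add: ip_def gs_step_lt)
    next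
      case 3
      have j0: "(\<Sum>i<s. ?W a i * ?V j i) = 0"
        using new[of a] a by (simp add: ip_def gs_step_lt mult.commute)
      define c where "c = (\<Sum>i'<s. ?V j i' * ?W b i')"
      have gt: "?V b i = ?W b i - c * ?V j i" for i
        using gs_step_gt[OF 3, of s ?W i] by (simp add: c_def)
      have lt: "?V a i = ?W a i" for i using a by (simp add: gs_step_lt)
      have "ip s ?V a b = (\<Sum>i<s. ?W a i * ?W b i - c * (?W a i * ?V j i))"
        unfolding ip_def gt lt by (simp add: algebra_simps del: gs.simps)
      also have "\<dots> = ip s ?W a b"
        using j0 by (simp add: sum_subtractf sum_distrib_left[symmetric] ip_def)
      finally show ?thesis using Suc.IH(1)[of a b] a by simp
    qed
  qed
  show "ip s ?V a b = 0" if "a < Suc j" "a \<noteq> b" for a b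
    using new[of b] old[of a b] that by (cases "a = j") auto
  show "ip s ?V a a = 1 \<or> (ip s ?V a a = 0 \<and> (\<forall>i. ?V a i = 0))" if "a < Suc j" for a
  proof (cases "a = j")
    case True
    then show ?thesis using gs_step_norm[of s ?W j] by (auto simp: gs_step_eq)
  next
    case False
    with that have "a < j" by simp
    then show ?thesis using Suc.IH(2)[of a] by (simp add: ip_def gs_step_lt)
  qed
qed simp_all

text \<open>The identities are claimed for the first \<open>s\<close> rows only. A column that is 0
  there is erased by the division by 0, and its remaining rows cannot be recovered.\<close>

lemma gs_spans:
  shows "j \<le> k \<Longrightarrow> \<exists>b. \<forall>i<s. W k i = gs s j W k i + (\<Sum>a<j. b a * gs s j W a i)"
    and "k < j \<Longrightarrow> \<exists>b. \<forall>i<s. W k i = (\<Sum>a<j. b a * gs s j W a i)"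
proof (induction j arbitrary: k)
  case (Suc j)
  let ?W = "gs s j W" and ?V = "gs s (Suc j) W"
  have norm: "?W j i = sqrt (ip s ?W j j) * ?V j i" if "i < s" for i
  proof (cases "ip s ?W j j = 0")
    case True then show ?thesis using ip_self_eq_0[OF True that] by simp
  next
    case False then show ?thesis by (simp add: gs_step_eq ip_nonneg)
  qed
  have lt: "?V a i = ?W a i" if "a < j" for a i using that by (simp add: gs_step_lt)
  { fix k assume "Suc j \<le> k"
    then obtain b where b: "\<forall>i<s. W k i = ?W k i + (\<Sum>a<j. b a * ?W a i)"
      using Suc.IH(1)[of k] by auto
    define c where "c = (\<Sum>i'<s. ?V j i' * ?W k i')"
    have "\<forall>i<s. W k i = ?V k i + (\<Sum>a<Suc j. (b(j := c)) a * ?V a i)"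
    proof (intro allI impI)
      fix i assume i: "i < s"
      have "?V k i = ?W k i - c * ?V j i"
        using \<open>Suc j \<le> k\<close> gs_step_gt[of j k s ?W i] by (simp add: c_def)
      moreover have "(\<Sum>a<j. (b(j := c)) a * ?V a i) = (\<Sum>a<j. b a * ?W a i)"
        by (intro sum.cong) (auto simp: gs_step_lt)
      ultimately show "W k i = ?V k i + (\<Sum>a<Suc j. (b(j := c)) a * ?V a i)"
        using b i by simp
    qed
    then show "\<exists>b. \<forall>i<s. W k i = ?V k i + (\<Sum>a<Suc j. b a * ?V a i)" by blast }
  { fix k assume "k < Suc j"
    then obtain b c where b: "\<forall>i<s. W k i = c * ?W j i + (\<Sum>a<j. b a * ?W a i)"
    proof (cases "k = j")
      case True
      then show ?thesis using Suc.IH(1)[of k] that[of 1] by auto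
    next
      case False
      with \<open>k < Suc j\<close> have "k < j" by simp
      then show ?thesis using Suc.IH(2)[of k] that[of 0] by auto
    qed
    have "\<forall>i<s. W k i = (\<Sum>a<Suc j. (b(j := c * sqrt (ip s ?W j j))) a * ?V a i)"
    proof (intro allI impI)
      fix i assume i: "i < s"
      have "(\<Sum>a<j. (b(j := c * sqrt (ip s ?W j j))) a * ?V a i) = (\<Sum>a<j. b a * ?W a i)"
        by (intro sum.cong) (auto simp: gs_step_lt)
      then show "W k i = (\<Sum>a<Suc j. (b(j := c * sqrt (ip s ?W j j))) a * ?V a i)"
        using b i norm[OF i] by simp
    qed
    then show "\<exists>b. \<forall>i<s. W k i = (\<Sum>a<Suc j. b a * ?V a i)" by blast }
qed auto

text \<open>Each step combines columns linearly, so a linear relation expressing the first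
  \<open>s\<close> rows by the later ones survives. Started with \<open>M\<close> on top of the
  identity, the lower block ends as a matrix \<open>T\<close> and the upper one as
  \<open>M T\<close>.\<close>

lemma gs_linear:
  assumes "\<And>k i. k < d \<Longrightarrow> i < s \<Longrightarrow> W k i = (\<Sum>c<d. M i c * W k (s + c))"
    and "k < d" "i < s" "j \<le> d"
  shows "gs s j W k i = (\<Sum>c<d. M i c * gs s j W k (s + c))"
  using assms(2-)
proof (induction j arbitrary: k i)
  case (Suc j)
  let ?W = "gs s j W" and ?V = "gs s (Suc j) W"
  have jj: "?V j i = (\<Sum>c<d. M i c * ?V j (s + c))" if "i < s" for i
    using Suc.IH[of j i] Suc.prems that by (simp add: gs_step_eq sum_divide_distrib)
  consider "k = j" | "k < j" | "j < k" by linarith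
  then show ?case
  proof cases
    case 1 then show ?thesis using jj Suc.prems by simp
  next
    case 2 then show ?thesis using Suc.IH[of k i] Suc.prems by (simp add: gs_step_lt)
  next
    case 3
    define c where "c = (\<Sum>i'<s. ?V j i' * ?W k i')"
    have gt: "?V k i = ?W k i - c * ?V j i" for i
      using 3 gs_step_gt[of j k s ?W i] by (simp add: c_def)
    have "?V k i = (\<Sum>c<d. M i c * ?W k (s + c)) - c * (\<Sum>c<d. M i c * ?V j (s + c))"
      unfolding gt using Suc.IH[of k i] Suc.prems jj by simp
    also have "\<dots> = (\<Sum>e<d. M i e * ?V k (s + e))"
      unfolding gt by (simp add: algebra_simps sum_subtractf sum_distrib_left)
    finally show ?thesis .
  qed
qed (use assms(1) in auto)

section \<open>Orthonormalised columns of a matrix and the transformation producing them\<close>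

definition mv :: "nat \<Rightarrow> (nat \<Rightarrow> nat \<Rightarrow> real) \<Rightarrow> (nat \<Rightarrow> real) \<Rightarrow> nat \<Rightarrow> real" where
  "mv d M x i = (\<Sum>j<d. M i j * x j)"

definition stack :: "nat \<Rightarrow> (nat \<Rightarrow> nat \<Rightarrow> real) \<Rightarrow> nat \<Rightarrow> nat \<Rightarrow> real" where
  "stack s M k i = (if i < s then M i k else if i = s + k then 1 else 0)"

text \<open>The transformation read off from the lower block. The columns of \<open>M T\<close>,
  denoted by \<open>gsV\<close>, are orthonormal or 0 on the first \<open>s\<close> rows.\<close>

definition gsT :: "nat \<Rightarrow> nat \<Rightarrow> (nat \<Rightarrow> nat \<Rightarrow> real) \<Rightarrow> nat \<Rightarrow> nat \<Rightarrow> real" where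
  "gsT s d M j k = gs s d (stack s M) k (s + j)"

definition gsV :: "nat \<Rightarrow> nat \<Rightarrow> (nat \<Rightarrow> nat \<Rightarrow> real) \<Rightarrow> nat \<Rightarrow> nat \<Rightarrow> real" where
  "gsV s d M i k = mv d M (\<lambda>j. gsT s d M j k) i"

lemma mv_add: "mv d M (\<lambda>j. x j + y j) i = mv d M x i + mv d M y i"
  by (simp add: mv_def sum.distrib algebra_simps)

lemma mv_diff: "mv d M (\<lambda>j. x j - y j) i = mv d M x i - mv d M y i"
  by (simp add: mv_def sum_subtractf algebra_simps)

lemma mv_scale: "mv d M (\<lambda>j. c * x j) i = c * mv d M x i"
  by (simp add: mv_def sum_distrib_left algebra_simps)

lemma mv_mv: "mv d M (mv e N x) i = (\<Sum>k<e. mv d M (\<lambda>j. N j k) i * x k)"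
  unfolding mv_def sum_distrib_left sum_distrib_right
  by (subst sum.swap) (simp add: algebra_simps)

lemma gsV_eq: "k < d \<Longrightarrow> i < s \<Longrightarrow> gsV s d M i k = gs s d (stack s M) k i"
  unfolding gsV_def gsT_def mv_def
  by (rule gs_linear[symmetric]) (auto simp: stack_def if_distrib if_distribR cong: if_cong)

lemma gsV_orthogonal:
  assumes "j < d" "k < d"
  shows "j \<noteq> k \<Longrightarrow> (\<Sum>i<s. gsV s d M i j * gsV s d M i k) = 0"
    and "(\<Sum>i<s. (gsV s d M i j)\<^sup>2) = 1 \<or>
         (\<Sum>i<s. (gsV s d M i j)\<^sup>2) = 0 \<and> (\<forall>i<s. gsV s d M i j = 0) \<and> (\<forall>i. gsT s d M i j = 0)"
proof -
  have *: "(\<Sum>i<s. gsV s d M i j * gsV s d M i k) = ip s (gs s d (stack s M)) j k"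
    if "k < d" for k
    unfolding ip_def using assms that by (intro sum.cong) (auto simp: gsV_eq)
  show "j \<noteq> k \<Longrightarrow> (\<Sum>i<s. gsV s d M i j * gsV s d M i k) = 0"
    using * assms gs_orthogonal(1)[of j d k s] by auto
  show "(\<Sum>i<s. (gsV s d M i j)\<^sup>2) = 1 \<or>
        (\<Sum>i<s. (gsV s d M i j)\<^sup>2) = 0 \<and> (\<forall>i<s. gsV s d M i j = 0) \<and> (\<forall>i. gsT s d M i j = 0)"
    using *[of j] assms gs_orthogonal(2)[of j d s "stack s M"]
    by (auto simp: power2_eq_square gsT_def gsV_eq)
qed

lemma gsV_norm_le: "k < d \<Longrightarrow> (\<Sum>i<s. (gsV s d M i k)\<^sup>2) \<le> 1"
  using gsV_orthogonal(2)[of k d k s M] by auto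

lemma gsV_abs_le:
  assumes "k < d" "i < s" shows "\<bar>gsV s d M i k\<bar> \<le> 1"
proof -
  have "(gsV s d M i k)\<^sup>2 \<le> (\<Sum>i<s. (gsV s d M i k)\<^sup>2)"
    using assms by (intro member_le_sum) auto
  with gsV_norm_le[OF assms(1), of s M] have "(gsV s d M i k)\<^sup>2 \<le> 1" by linarith
  then show ?thesis by (simp add: abs_square_le_1)
qed

text \<open>Coefficients with respect to the orthonormalised columns; Parseval's identity holds
  because the coefficient at a vanishing column is \<open>0\<close>.\<close>

definition gsc :: "nat \<Rightarrow> nat \<Rightarrow> (nat \<Rightarrow> nat \<Rightarrow> real) \<Rightarrow> (nat \<Rightarrow> real) \<Rightarrow> nat \<Rightarrow> real" where
  "gsc s d M x k = (\<Sum>i<s. gsV s d M i k * mv d M x i)"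

lemma gsV_combination_coeff:
  assumes "\<And>i. i < s \<Longrightarrow> y i = (\<Sum>a<d. b a * gsV s d M i a)" "k < d"
  shows "(\<Sum>i<s. gsV s d M i k * y i) = b k * (\<Sum>i<s. (gsV s d M i k)\<^sup>2)"
proof -
  have "(\<Sum>i<s. gsV s d M i k * y i) = (\<Sum>i<s. \<Sum>a<d. b a * (gsV s d M i k * gsV s d M i a))"
    using assms by (intro sum.cong) (auto simp: sum_distrib_left algebra_simps)
  also have "\<dots> = (\<Sum>a<d. b a * (\<Sum>i<s. gsV s d M i k * gsV s d M i a))"
    by (subst sum.swap) (simp add: sum_distrib_left)
  also have "\<dots> = (\<Sum>a<d. if a = k then b k * (\<Sum>i<s. (gsV s d M i k)\<^sup>2) else 0)"
    using assms gsV_orthogonal(1)[of k d _ s M]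
    by (intro sum.cong) (auto simp: power2_eq_square)
  also have "\<dots> = b k * (\<Sum>i<s. (gsV s d M i k)\<^sup>2)" using assms by simp
  finally show ?thesis .
qed

text \<open>In any expansion over the orthogonal columns, \<open>gsc\<close> returns the coefficient
  times the squared norm of the column. That norm is 1, or it is 0 and the column does not
  contribute.\<close>

lemma gsV_expansion:
  assumes "i < s"
  shows "mv d M x i = (\<Sum>k<d. gsc s d M x k * gsV s d M i k)"
proof -
  have "\<exists>b. \<forall>i<s. M i k = (\<Sum>a<d. b a * gsV s d M i a)" if k: "k < d" for k
  proof -
    obtain b where "\<forall>i<s. stack s M k i = (\<Sum>a<d. b a * gs s d (stack s M) a i)"
      using gs_spans(2)[OF k] by blast
    then have "\<forall>i<s. M i k = (\<Sum>a<d. b a * gsV s d M i a)"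
      by (simp add: gsV_eq stack_def)
    then show ?thesis by blast
  qed
  then obtain b where b: "\<And>k i. k < d \<Longrightarrow> i < s \<Longrightarrow> M i k = (\<Sum>a<d. b k a * gsV s d M i a)"
    by metis
  define e where "e a = (\<Sum>k<d. x k * b k a)" for a
  have y: "mv d M x i = (\<Sum>a<d. e a * gsV s d M i a)" if "i < s" for i
  proof -
    have "mv d M x i = (\<Sum>k<d. (\<Sum>a<d. b k a * gsV s d M i a) * x k)"
      unfolding mv_def using b that by (intro sum.cong) auto
    also have "\<dots> = (\<Sum>a<d. e a * gsV s d M i a)"
      unfolding e_def sum_distrib_right by (subst sum.swap) (simp add: algebra_simps)
    finally show ?thesis .
  qed
  have f: "gsc s d M x k * gsV s d M i k = e k * gsV s d M i k" if k: "k < d" for k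
  proof -
    have "gsc s d M x k = e k * (\<Sum>i<s. (gsV s d M i k)\<^sup>2)"
      unfolding gsc_def by (rule gsV_combination_coeff) (use y k in auto)
    then show ?thesis using gsV_orthogonal(2)[OF k k, of s M] assms by auto
  qed
  show ?thesis unfolding y[OF assms] by (intro sum.cong) (auto simp only: lessThan_iff f)
qed

lemma gsc_norm: "(\<Sum>k<d. (gsc s d M x k)\<^sup>2) = (\<Sum>i<s. (mv d M x i)\<^sup>2)"
proof -
  have "(\<Sum>i<s. (mv d M x i)\<^sup>2) = (\<Sum>i<s. \<Sum>k<d. gsc s d M x k * (gsV s d M i k * mv d M x i))"
    by (intro sum.cong) (auto simp: power2_eq_square gsV_expansion[of _ s d M x] sum_distrib_right algebra_simps)
  also have "\<dots> = (\<Sum>k<d. gsc s d M x k * (\<Sum>i<s. gsV s d M i k * mv d M x i))"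
    by (subst sum.swap) (simp add: sum_distrib_left)
  also have "\<dots> = (\<Sum>k<d. (gsc s d M x k)\<^sup>2)"
    by (simp add: gsc_def power2_eq_square)
  finally show ?thesis by simp
qed

lemma gsc_abs_le: "k < d \<Longrightarrow> (gsc s d M x k)\<^sup>2 \<le> (\<Sum>i<s. (mv d M x i)\<^sup>2)"
  unfolding gsc_norm[symmetric] by (intro member_le_sum) auto

text \<open>Passing to coordinates and back preserves only the image under \<open>M\<close>: for a
  rank-deficient \<open>M\<close> the vector \<open>x\<close> itself may change.\<close>

lemma mv_gsT: "i < s \<Longrightarrow> mv d M (mv d (gsT s d M) (gsc s d M x)) i = mv d M x i"
  by (simp add: mv_mv gsV_def[symmetric] gsV_expansion[of i s d M x] mult.commute)

lemma measurable_gs: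
  assumes "\<And>k i. (\<lambda>w. W w k i) \<in> borel_measurable N"
  shows "(\<lambda>w. gs s j (W w) k i) \<in> borel_measurable N"
proof (induction j arbitrary: k i)
  case (Suc j)
  note [measurable] = Suc
  consider "k = j" | "k < j" | "j < k" by linarith
  then show ?case
    by cases (simp_all add: gs_step_gt gs_step_eq gs_step_lt ip_def)
qed (simp add: assms)

lemma measurable_gsT:
  assumes "\<And>i j. (\<lambda>w. M w i j) \<in> borel_measurable N"
  shows "(\<lambda>w. gsT s d (M w) j k) \<in> borel_measurable N"
  unfolding gsT_def
proof (rule measurable_gs)
  show "(\<lambda>w. stack s (M w) k i) \<in> borel_measurable N" for k i
    by (cases "i < s"; cases "i = s + k") (simp_all add: stack_def assms)
qed

section \<open>Power sums and sensitivities\<close>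

definition pn :: "nat \<Rightarrow> real \<Rightarrow> (nat \<Rightarrow> real) \<Rightarrow> real" where
  "pn R p y = (\<Sum>r<R. \<bar>y r\<bar> powr p)"

lemma pn_nonneg: "0 \<le> pn R p y"
  by (auto simp: pn_def intro!: sum_nonneg)

lemma pn_member: "r < R \<Longrightarrow> \<bar>y r\<bar> powr p \<le> pn R p y"
  unfolding pn_def by (rule member_le_sum) auto

lemma pn_eq_0: "pn R p y = 0 \<Longrightarrow> r < R \<Longrightarrow> y r = 0"
  unfolding pn_def by (subst (asm) sum_nonneg_eq_0_iff) auto

lemma pn_scale: "pn R p (\<lambda>r. c * y r) = \<bar>c\<bar> powr p * pn R p y"
  by (simp add: pn_def abs_mult powr_mult sum_distrib_left)

lemma powr_neg_inverse_powr:
  fixes N p :: real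
  assumes "0 < p" "0 < N" shows "(N powr (- 1 / p)) powr p = 1 / N"
proof -
  have "(N powr (- 1 / p)) powr p = N powr (- 1)" unfolding powr_powr using assms by simp
  then show ?thesis using assms by (simp add: powr_minus divide_inverse)
qed

lemma pn_mv_normalize:
  assumes p: "1 \<le> p" and x: "0 < pn R p (mv d B x)"
  shows "pn R p (mv d B (\<lambda>j. pn R p (mv d B x) powr (- 1 / p) * x j)) = 1"
proof -
  have "mv d B (\<lambda>j. pn R p (mv d B x) powr (- 1 / p) * x j)
      = (\<lambda>r. pn R p (mv d B x) powr (- 1 / p) * mv d B x r)"
    by (rule ext) (rule mv_scale)
  moreover have "(pn R p (mv d B x) powr (- 1 / p)) powr p = 1 / pn R p (mv d B x)"
    using assms by (intro powr_neg_inverse_powr) auto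
  ultimately show ?thesis using x by (simp only: pn_scale) simp
qed

lemma pn_1_abs_le:
  assumes "0 < p" "pn R p y = 1" "r < R" shows "\<bar>y r\<bar> \<le> 1"
proof (rule ccontr)
  assume "\<not> \<bar>y r\<bar> \<le> 1"
  then have "1 powr p < \<bar>y r\<bar> powr p" using assms by (intro powr_less_mono2) auto
  with pn_member[OF assms(3), of y p] assms show False by simp
qed

lemma square_le_powr:
  fixes a :: real
  assumes "\<bar>a\<bar> \<le> 1" "p \<le> 2" shows "a\<^sup>2 \<le> \<bar>a\<bar> powr p"
proof (cases "a = 0")
  case False
  then have "\<bar>a\<bar> powr 2 \<le> \<bar>a\<bar> powr p" using assms by (intro powr_mono') auto
  then show ?thesis using False by (simp add: powr_numeral)
qed simp

lemma pn_1_squares: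
  assumes "0 < p" "p \<le> 2" "pn R p y = 1" shows "(\<Sum>r<R. (y r)\<^sup>2) \<le> 1"
proof -
  have "(\<Sum>r<R. (y r)\<^sup>2) \<le> pn R p y"
    unfolding pn_def using pn_1_abs_le[OF assms(1,3)] assms(2) by (intro sum_mono square_le_powr) auto
  with assms show ?thesis by simp
qed

text \<open>Convexity of the \<open>p\<close>-th power with weights \<open>1 / (1 + t)\<close> and
  \<open>t / (1 + t)\<close>. A triangle inequality for \<open>p\<close>-th powers with loss
  \<open>1 + t\<close> fits better than Minkowski's, because sampling estimates power sums and not
  norms.\<close>

lemma abs_add_powr_le:
  fixes a b p t :: real
  assumes p: "1 \<le> p" "p \<le> 2" and t: "0 < t" "t \<le> 1"
  shows "\<bar>a + b\<bar> powr p \<le> (1 + t) * (\<bar>a\<bar> powr p + \<bar>b\<bar> powr p / t)"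
proof -
  consider "a = 0" | "b = 0" | "a \<noteq> 0" "b \<noteq> 0" by blast
  then show ?thesis
  proof cases
    case 1
    have "\<bar>b\<bar> powr p * 1 \<le> \<bar>b\<bar> powr p * ((1 + t) / t)"
      using t by (intro mult_left_mono) (auto simp: field_simps)
    with 1 show ?thesis by (simp add: field_simps)
  next
    case 2
    have "\<bar>a\<bar> powr p * 1 \<le> \<bar>a\<bar> powr p * (1 + t)"
      using t by (intro mult_left_mono) auto
    with 2 show ?thesis by (simp add: field_simps)
  next
    case 3
    \<comment> \<open>Scaled so that the weighted mean of \<open>?x\<close> and \<open>?y\<close> is
      \<open>\<bar>a\<bar> + \<bar>b\<bar>\<close>.\<close>
    let ?x = "(1 + t) * \<bar>a\<bar>" and ?y = "(1 + t) / t * \<bar>b\<bar>"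
    have pos: "0 < ?x" "0 < ?y" using 3 t by auto
    have t0: "t \<noteq> 0" "1 + t \<noteq> 0" using t by auto
    have e1: "1 / (1 + t) * ?x + t / (1 + t) * ?y = \<bar>a\<bar> + \<bar>b\<bar>"
      using t0 by simp
    have w: "1 / (1 + t) + t / (1 + t) = 1" using t by (simp add: field_simps)
    have "(1 / (1 + t) * ?x + t / (1 + t) * ?y) powr p
        \<le> 1 / (1 + t) * ?x powr p + t / (1 + t) * ?y powr p"
      using convex_onD[OF powr_convex[OF p(1)], of "t / (1 + t)" ?x ?y] pos t w
      by (simp add: field_simps)
    moreover have "1 / (1 + t) * ?x powr p = (1 + t) powr (p - 1) * \<bar>a\<bar> powr p"
      using t 3 by (simp add: powr_mult powr_diff)
    moreover have "t / (1 + t) * ?y powr p = (1 + t) powr (p - 1) * (\<bar>b\<bar> powr p * t powr (1 - p))"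
      using t 3 by (simp add: powr_mult powr_divide powr_diff)
    ultimately have "(\<bar>a\<bar> + \<bar>b\<bar>) powr p
        \<le> (1 + t) powr (p - 1) * (\<bar>a\<bar> powr p + \<bar>b\<bar> powr p * t powr (1 - p))"
      unfolding e1 by (simp add: algebra_simps)
    \<comment> \<open>By \<open>p \<le> 2\<close> and \<open>t \<le> 1\<close>, the exponents
      \<open>p - 1\<close> and \<open>1 - p\<close> may be replaced by 1 and -1.\<close>
    also have "\<dots> \<le> (1 + t) powr 1 * (\<bar>a\<bar> powr p + \<bar>b\<bar> powr p * t powr (- 1))"
      using t p by (intro mult_mono add_mono mult_left_mono powr_mono powr_mono' order_refl) auto
    also have "\<dots> = (1 + t) * (\<bar>a\<bar> powr p + \<bar>b\<bar> powr p / t)"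
      using t by (simp add: powr_minus divide_inverse)
    finally have "(\<bar>a\<bar> + \<bar>b\<bar>) powr p \<le> (1 + t) * (\<bar>a\<bar> powr p + \<bar>b\<bar> powr p / t)" .
    moreover have "\<bar>a + b\<bar> powr p \<le> (\<bar>a\<bar> + \<bar>b\<bar>) powr p"
      using p by (intro powr_mono2) auto
    ultimately show ?thesis by linarith
  qed
qed

lemma weighted_pn_add_le:
  fixes p t :: real
  assumes p: "1 \<le> p" "p \<le> 2" and t: "0 < t" "t \<le> 1" and w: "\<And>r. r < R \<Longrightarrow> 0 \<le> w r"
  shows "(\<Sum>r<R. w r * \<bar>y r + z r\<bar> powr p)
       \<le> (1 + t) * ((\<Sum>r<R. w r * \<bar>y r\<bar> powr p) + (\<Sum>r<R. w r * \<bar>z r\<bar> powr p) / t)"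
proof -
  have "(\<Sum>r<R. w r * \<bar>y r + z r\<bar> powr p)
      \<le> (\<Sum>r<R. w r * ((1 + t) * (\<bar>y r\<bar> powr p + \<bar>z r\<bar> powr p / t)))"
    by (rule sum_mono, rule mult_left_mono[OF abs_add_powr_le[OF p t]]) (use w in auto)
  also have "\<dots> = (1 + t) * ((\<Sum>r<R. w r * \<bar>y r\<bar> powr p) + (\<Sum>r<R. w r * \<bar>z r\<bar> powr p) / t)"
    by (simp add: sum_distrib_left sum_divide_distrib sum.distrib algebra_simps)
  finally show ?thesis .
qed

lemma pn_add_le:
  assumes "1 \<le> p" "p \<le> 2" "0 < t" "t \<le> 1"
  shows "pn R p (\<lambda>r. y r + z r) \<le> (1 + t) * (pn R p y + pn R p z / t)"
  using weighted_pn_add_le[OF assms, of R "\<lambda>_. 1" y z] by (simp add: pn_def)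

lemma cauchy_schwarz_sum:
  fixes a b :: "nat \<Rightarrow> real"
  shows "(\<Sum>k<d. a k * b k)\<^sup>2 \<le> (\<Sum>k<d. (a k)\<^sup>2) * (\<Sum>k<d. (b k)\<^sup>2)"
  by (rule Cauchy_Schwarz_ineq_sum)

text \<open>The supremum \<open>\<sigma> r\<close> of \<open>\<bar>(B x) r\<bar>\<^sup>p\<close> over the \<open>\<ell>\<^sub>p\<close> unit sphere is at most the \<open>\<ell>\<^sub>2\<close> leverage
  score of row \<open>r\<close> after rescaling every row by \<open>\<sigma> r\<close> to the power \<open>1/2 - 1/p\<close>: the
  rescaled image of a unit vector has \<open>\<ell>\<^sub>2\<close> norm at most \<open>1\<close>.\<close>

lemma sensitivities:
  assumes p: "1 \<le> p" "p \<le> 2"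
  obtains \<sigma> :: "nat \<Rightarrow> real" where "\<And>r. 0 \<le> \<sigma> r" "(\<Sum>r<R. \<sigma> r) \<le> real d"
    and "\<And>x r. r < R \<Longrightarrow> \<bar>mv d B x r\<bar> powr p \<le> \<sigma> r * pn R p (mv d B x)"
proof -
  \<comment> \<open>The inserted 0 keeps the set nonempty if no \<open>x\<close> has norm 1.\<close>
  define A where "A r = insert 0 {\<bar>mv d B x r\<bar> powr p | x. pn R p (mv d B x) = 1}" for r
  define \<sigma> where "\<sigma> r = (if r < R then Sup (A r) else 0)" for r
  have bdd: "bdd_above (A r)" if "r < R" for r
  proof (rule bdd_aboveI)
    fix a assume "a \<in> A r"
    then show "a \<le> 1" using pn_member[OF that, of _ p] by (auto simp: A_def) (metis)
  qed
  have nonneg: "0 \<le> \<sigma> r" for r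
    using bdd[of r] by (auto simp: \<sigma>_def A_def intro!: cSup_upper)
  have upper1: "\<bar>mv d B x r\<bar> powr p \<le> \<sigma> r" if "r < R" "pn R p (mv d B x) = 1" for r x
    using bdd[of r] that by (auto simp: \<sigma>_def A_def intro!: cSup_upper)
  have upper: "\<bar>mv d B x r\<bar> powr p \<le> \<sigma> r * pn R p (mv d B x)" if r: "r < R" for r x
  proof (cases "pn R p (mv d B x) = 0")
    case True
    then show ?thesis using pn_eq_0[OF True r] by simp
  next
    case False
    define N where "N = pn R p (mv d B x)"
    have N: "0 < N" using False pn_nonneg[of R p "mv d B x"] by (simp add: N_def)
    have "\<bar>mv d B (\<lambda>j. N powr (- 1 / p) * x j) r\<bar> powr p \<le> \<sigma> r"
      using upper1[OF r] pn_mv_normalize[of p R d B x] N p by (simp add: N_def)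
    moreover have "(N powr (- 1 / p)) powr p = 1 / N"
      using N p by (intro powr_neg_inverse_powr) auto
    ultimately have "1 / N * \<bar>mv d B x r\<bar> powr p \<le> \<sigma> r"
      by (simp only: mv_scale abs_mult powr_mult) simp
    then show ?thesis using N by (simp add: N_def field_simps)
  qed
  define C where "C r j = \<sigma> r powr (1 / 2 - 1 / p) * B r j" for r j
  define l where "l r = (\<Sum>k<d. (gsV R d C r k)\<^sup>2)" for r
  have Cx: "mv d C x r = \<sigma> r powr (1 / 2 - 1 / p) * mv d B x r" for x r
    by (simp add: mv_def C_def sum_distrib_left mult.assoc)
  have ptw: "(mv d C x r)\<^sup>2 = \<sigma> r powr (1 - 2 / p) * (\<bar>mv d B x r\<bar> powr p) powr (2 / p)" for x r
  proof -
    have "(\<sigma> r powr (1 / 2 - 1 / p))\<^sup>2 = \<sigma> r powr (1 - 2 / p)"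
      by (simp add: power2_eq_square powr_add[symmetric])
    moreover have "(mv d B x r)\<^sup>2 = (\<bar>mv d B x r\<bar> powr p) powr (2 / p)"
      using p by (cases "mv d B x r = 0") (auto simp: powr_powr powr_numeral)
    ultimately show ?thesis by (simp add: Cx power_mult_distrib)
  qed
  have two: "1 \<le> 2 / p" using p by simp
  have norm: "(\<Sum>r<R. (mv d C x r)\<^sup>2) \<le> 1" if x: "pn R p (mv d B x) = 1" for x
  proof -
    have "(mv d C x r)\<^sup>2 \<le> \<bar>mv d B x r\<bar> powr p" if r: "r < R" for r
    proof (cases "mv d B x r = 0")
      case False
      define a where "a = \<bar>mv d B x r\<bar> powr p"
      have a: "0 < a" "a \<le> \<sigma> r" using upper1[OF r x] False by (auto simp: a_def)
      have "\<sigma> r powr (1 - 2 / p) * a powr (2 / p) \<le> a powr (1 - 2 / p) * a powr (2 / p)"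
        using a two by (intro mult_right_mono powr_mono2') auto
      also have "\<dots> = a" using a by (simp add: powr_add[symmetric])
      finally show ?thesis unfolding ptw by (simp add: a_def)
    qed (simp add: ptw)
    then have "(\<Sum>r<R. (mv d C x r)\<^sup>2) \<le> pn R p (mv d B x)"
      unfolding pn_def by (intro sum_mono) auto
    with x show ?thesis by simp
  qed
  have lev: "(mv d C x r)\<^sup>2 \<le> l r" if r: "r < R" and x: "pn R p (mv d B x) = 1" for r x
  proof -
    have "(mv d C x r)\<^sup>2 \<le> (\<Sum>k<d. (gsc R d C x k)\<^sup>2) * l r"
      unfolding gsV_expansion[OF r, of d C x] l_def by (rule cauchy_schwarz_sum)
    also have "\<dots> \<le> 1 * l r"
      unfolding gsc_norm using norm[OF x] by (intro mult_right_mono) (auto simp: l_def intro!: sum_nonneg)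
    finally show ?thesis by simp
  qed
  have \<sigma>_le: "\<sigma> r \<le> l r" if r: "r < R" for r
  proof (cases "\<sigma> r = 0")
    case True
    then show ?thesis by (auto simp: l_def intro!: sum_nonneg)
  next
    case False
    then have pos: "0 < \<sigma> r" using nonneg[of r] by simp
    have l0: "0 \<le> l r" by (auto simp: l_def intro!: sum_nonneg)
    have "a \<le> (l r * \<sigma> r powr (2 / p - 1)) powr (p / 2)" if a: "a \<in> A r" for a
    proof (cases "a = 0")
      case False
      with a obtain x where x: "a = \<bar>mv d B x r\<bar> powr p" "pn R p (mv d B x) = 1"
        by (auto simp: A_def)
      have "a powr (2 / p) = (\<sigma> r powr (1 - 2 / p) * a powr (2 / p)) * \<sigma> r powr (2 / p - 1)"
        using pos by (simp add: powr_add[symmetric] mult.commute mult.left_commute)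
      also have "\<dots> \<le> l r * \<sigma> r powr (2 / p - 1)"
        using lev[OF r x(2)] unfolding ptw x(1) by (intro mult_right_mono) auto
      finally have "(a powr (2 / p)) powr (p / 2) \<le> (l r * \<sigma> r powr (2 / p - 1)) powr (p / 2)"
        using p by (intro powr_mono2) auto
      moreover have "(a powr (2 / p)) powr (p / 2) = a"
      proof -
        have "0 \<le> a" "2 / p * (p / 2) = 1" using x(1) p by simp_all
        then show ?thesis unfolding powr_powr by simp
      qed
      ultimately show ?thesis by simp
    qed simp
    \<comment> \<open>Taking the supremum bounds \<open>\<sigma> r\<close> by a power of
      \<open>l r\<close> times a power of itself; cancelling the latter leaves
      \<open>\<sigma> r \<le> l r\<close>.\<close>
    then have "\<sigma> r \<le> (l r * \<sigma> r powr (2 / p - 1)) powr (p / 2)"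
      using r by (simp add: \<sigma>_def) (rule cSup_least, auto simp: A_def)
    then have "\<sigma> r powr (2 / p) \<le> ((l r * \<sigma> r powr (2 / p - 1)) powr (p / 2)) powr (2 / p)"
      using pos p by (intro powr_mono2) auto
    also have "\<dots> = l r * \<sigma> r powr (2 / p - 1)"
      using l0 p by (simp add: powr_powr)
    finally have "\<sigma> r * \<sigma> r powr (2 / p - 1) \<le> l r * \<sigma> r powr (2 / p - 1)"
      using pos powr_add[of "\<sigma> r" 1 "2 / p - 1"] by simp
    then show ?thesis using pos by simp
  qed
  have "(\<Sum>r<R. \<sigma> r) \<le> (\<Sum>r<R. l r)" using \<sigma>_le by (intro sum_mono) auto
  also have "\<dots> = (\<Sum>k<d. \<Sum>r<R. (gsV R d C r k)\<^sup>2)"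
    unfolding l_def by (rule sum.swap)
  \<comment> \<open>The leverage scores add up to the squared norms of the \<open>d\<close>
    orthonormalised columns, each at most 1.\<close>
  also have "\<dots> \<le> (\<Sum>k<d. 1)"
    by (intro sum_mono) (auto intro: gsV_norm_le)
  finally show ?thesis using that[of \<sigma>] nonneg upper by simp
qed

text \<open>Grid coordinates with respect to an \<open>\<ell>\<^sub>2\<close>-orthonormal basis: fine enough meshes cost only
  the logarithm of the number of rows.\<close>

lemma net:
  assumes p: "0 < p" "p \<le> 2" and m: "0 < m"
  obtains X :: "(nat \<Rightarrow> real) set" where "finite X" "card X \<le> (2 * m + 1) ^ d"
    and "\<And>x. pn R p (mv d B x) = 1 \<Longrightarrow>
           \<exists>x'\<in>X. \<forall>r<R. \<bar>mv d B x r - mv d B x' r\<bar> \<le> real d / real m"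
proof -
  define G where "G = ({..<d} \<rightarrow>\<^sub>E {- int m..int m})"
  define f where "f g = mv d (gsT R d B) (\<lambda>k. of_int (g k) / real m)" for g :: "nat \<Rightarrow> int"
  have fin: "finite G" unfolding G_def by (intro finite_PiE) auto
  have "card (f ` G) \<le> card G" by (rule card_image_le[OF fin])
  also have "card G = (2 * m + 1) ^ d"
    unfolding G_def by (subst card_PiE) (auto simp: nat_add_distrib nat_mult_distrib)
  finally have card: "card (f ` G) \<le> (2 * m + 1) ^ d" .
  have close: "\<exists>x'\<in>f ` G. \<forall>r<R. \<bar>mv d B x r - mv d B x' r\<bar> \<le> real d / real m"
    if x: "pn R p (mv d B x) = 1" for x
  proof -
    \<comment> \<open>For \<open>p \<le> 2\<close> a power sum of 1 bounds the sum of squares by 1,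
      and hence each orthonormal coordinate. Rounding each coordinate by at most
      \<open>1 / m\<close> moves an entry by at most \<open>d / m\<close>.\<close>
    define c where "c = gsc R d B x"
    define g where "g k = (if k < d then \<lfloor>c k * real m\<rfloor> else undefined)" for k
    have c1: "\<bar>c k\<bar> \<le> 1" if "k < d" for k
    proof -
      have "(c k)\<^sup>2 \<le> 1"
        using gsc_abs_le[OF that, of R B x] pn_1_squares[OF p x] by (simp add: c_def)
      then show ?thesis by (simp add: abs_square_le_1)
    qed
    have "g \<in> G"
    proof -
      have "- int m \<le> \<lfloor>c k * real m\<rfloor> \<and> \<lfloor>c k * real m\<rfloor> \<le> int m" if "k < d" for k
      proof -
        have "- real m \<le> c k * real m" "c k * real m \<le> real m"
          using c1[OF that] m mult_right_mono[of "-1" "c k" "real m"]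
            mult_right_mono[of "c k" 1 "real m"] by auto
        then show ?thesis by (auto simp: le_floor_iff floor_le_iff)
      qed
      then show ?thesis by (auto simp: G_def g_def PiE_def extensional_def)
    qed
    moreover have "\<bar>mv d B x r - mv d B (f g) r\<bar> \<le> real d / real m" if r: "r < R" for r
    proof -
      have "mv d B x r - mv d B (f g) r = (\<Sum>k<d. (c k - of_int (g k) / real m) * gsV R d B r k)"
      proof -
        have "mv d B (f g) r = (\<Sum>k<d. of_int (g k) / real m * gsV R d B r k)"
          unfolding f_def mv_mv gsV_def[symmetric] by (simp add: mult.commute)
        then show ?thesis
          using gsV_expansion[OF r, of d B x]
          by (simp add: c_def sum_subtractf left_diff_distrib)
      qed
      also have "\<bar>\<dots>\<bar> \<le> (\<Sum>k<d. 1 / real m)"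
      proof (rule sum_abs[THEN order_trans], rule sum_mono)
        fix k assume "k \<in> {..<d}"
        then have k: "k < d" by simp
        have "\<bar>c k - of_int (g k) / real m\<bar> = \<bar>(c k * real m - of_int (g k)) / real m\<bar>"
          using m by (simp add: diff_divide_distrib)
        also have "\<dots> = \<bar>c k * real m - of_int (g k)\<bar> / real m" by simp
        also have "\<dots> \<le> 1 / real m"
          using k by (intro divide_right_mono) (auto simp: g_def, linarith)
        finally have "\<bar>c k - of_int (g k) / real m\<bar> * \<bar>gsV R d B r k\<bar> \<le> 1 / real m * 1"
          using gsV_abs_le[OF k r, of B] by (intro mult_mono) auto
        then show "\<bar>(c k - of_int (g k) / real m) * gsV R d B r k\<bar> \<le> 1 / real m"
          by (simp add: abs_mult)
      qed
      also have "\<dots> = real d / real m" by simp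
      finally show ?thesis .
    qed
    ultimately show ?thesis by blast
  qed
  show ?thesis by (rule that[of "f ` G"]) (use fin card close in auto)
qed

section \<open>Concentration\<close>

text \<open>An upper bound on outer probability, so that events involving suprema over all \<open>x\<close> need not be measurable.\<close>

definition small :: "((nat \<Rightarrow> real) \<Rightarrow> bool) \<Rightarrow> real \<Rightarrow> bool" where
  "small Q c \<longleftrightarrow> 0 \<le> c \<and> (\<exists>A\<in>sets uniform_tape.
     {w \<in> space uniform_tape. Q w} \<subseteq> A \<and> emeasure uniform_tape A \<le> ennreal c)"

lemma pred_le_real:
  fixes f g :: "'a \<Rightarrow> real"
  assumes "f \<in> borel_measurable M" "g \<in> borel_measurable M"
  shows "Measurable.pred M (\<lambda>w. f w \<le> g w)"
  unfolding pred_def by (rule borel_measurable_le[OF assms])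

lemma pred_less_real:
  fixes f g :: "'a \<Rightarrow> real"
  assumes "f \<in> borel_measurable M" "g \<in> borel_measurable M"
  shows "Measurable.pred M (\<lambda>w. f w < g w)"
  unfolding pred_def by (rule borel_measurable_less[OF assms])

lemma pred_neq_0_real:
  fixes f :: "'a \<Rightarrow> real"
  assumes "f \<in> borel_measurable M"
  shows "Measurable.pred M (\<lambda>w. f w \<noteq> 0)"
  unfolding pred_def by (rule borel_measurable_neq[OF assms]) simp

lemma measurable_if_ennreal:
  assumes "Measurable.pred M P" "f \<in> borel_measurable M"
  shows "(\<lambda>w. ennreal (if P w then f w else 0)) \<in> borel_measurable M"
  by (rule measurable_compose[OF _ measurable_ennreal], rule measurable_If)
    (use assms in \<open>auto simp: pred_def\<close>)

lemma pred_all_less: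
  fixes P :: "'a \<Rightarrow> nat \<Rightarrow> bool"
  assumes "\<And>r. r < R \<Longrightarrow> Measurable.pred M (\<lambda>w. P w r)"
  shows "Measurable.pred M (\<lambda>w. \<forall>r<R. P w r)"
  using pred_intros_finite(3)[where I="{..<R}" and M=M and P=P] assms by (simp add: Ball_def)

lemma small_mono:
  assumes "small Q c" "\<And>w. w \<in> space uniform_tape \<Longrightarrow> Q' w \<Longrightarrow> Q w" "c \<le> c'"
  shows "small Q' c'"
proof -
  obtain A where A: "A \<in> sets uniform_tape" "{w \<in> space uniform_tape. Q w} \<subseteq> A"
      "emeasure uniform_tape A \<le> ennreal c" and c: "0 \<le> c"
    using assms(1) unfolding small_def by blast
  have "{w \<in> space uniform_tape. Q' w} \<subseteq> A" using A(2) assms(2) by blast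
  moreover have "emeasure uniform_tape A \<le> ennreal c'"
    using A(3) ennreal_leI[OF assms(3)] by (rule order_trans)
  ultimately show ?thesis using A(1) c assms(3) unfolding small_def by auto
qed

lemma small_disj:
  assumes "small Q c" "small Q' c'"
  shows "small (\<lambda>w. Q w \<or> Q' w) (c + c')"
proof -
  obtain A A' where A: "A \<in> sets uniform_tape" "{w \<in> space uniform_tape. Q w} \<subseteq> A"
      "emeasure uniform_tape A \<le> ennreal c"
    and A': "A' \<in> sets uniform_tape" "{w \<in> space uniform_tape. Q' w} \<subseteq> A'"
      "emeasure uniform_tape A' \<le> ennreal c'"
    and c: "0 \<le> c" "0 \<le> c'"
    using assms unfolding small_def by blast
  have "emeasure uniform_tape (A \<union> A') \<le> emeasure uniform_tape A + emeasure uniform_tape A'"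
    using A A' by (intro emeasure_subadditive) auto
  also have "\<dots> \<le> ennreal (c + c')" using A(3) A'(3) c by (simp add: add_mono)
  finally show ?thesis unfolding small_def using A A' c
    by (intro conjI bexI[of _ "A \<union> A'"]) auto
qed

lemma small_UN:
  assumes "finite I" "\<And>i. i \<in> I \<Longrightarrow> small (Q i) c" "0 \<le> c"
  shows "small (\<lambda>w. \<exists>i\<in>I. Q i w) (real (card I) * c)"
  using assms
proof (induction I rule: finite_induct)
  case empty
  show ?case unfolding small_def by (intro conjI bexI[of _ "{}"]) auto
next
  case (insert i I)
  then have "small (\<lambda>w. Q i w \<or> (\<exists>i\<in>I. Q i w)) (c + real (card I) * c)"
    by (intro small_disj) auto
  then show ?case using insert by (auto elim!: small_mono simp: algebra_simps)
qed

lemma small_markov: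
  assumes f: "f \<in> borel_measurable uniform_tape" and c: "0 < c" and a: "0 \<le> a"
    and int: "(\<integral>\<^sup>+w. f w \<partial>uniform_tape) \<le> ennreal a"
    and bad: "\<And>w. w \<in> space uniform_tape \<Longrightarrow> Q w \<Longrightarrow> ennreal c \<le> f w"
  shows "small Q (a / c)"
proof -
  let ?A = "{w \<in> space uniform_tape. 1 \<le> ennreal (1 / c) * f w}"
  have "?A \<in> sets uniform_tape" using f by measurable
  moreover have "{w \<in> space uniform_tape. Q w} \<subseteq> ?A"
  proof safe
    fix w assume "w \<in> space uniform_tape" "Q w"
    then have "ennreal (1 / c) * ennreal c \<le> ennreal (1 / c) * f w"
      by (intro mult_left_mono bad) auto
    then show "1 \<le> ennreal (1 / c) * f w" using c by (simp add: ennreal_mult[symmetric])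
  qed
  moreover have "emeasure uniform_tape ?A \<le> ennreal (a / c)"
  proof -
    have "emeasure uniform_tape ({w \<in> space uniform_tape. 1 \<le> ennreal (1 / c) * f w})
        \<le> ennreal (1 / c) * (\<integral>\<^sup>+w. f w * indicator (space uniform_tape) w \<partial>uniform_tape)"
      using f by (intro nn_integral_Markov_inequality) auto
    also have "(\<integral>\<^sup>+w. f w * indicator (space uniform_tape) w \<partial>uniform_tape) = (\<integral>\<^sup>+w. f w \<partial>uniform_tape)"
      by (intro nn_integral_cong) auto
    also have "ennreal (1 / c) * \<dots> \<le> ennreal (1 / c) * ennreal a"
      using int by (intro mult_left_mono) auto
    also have "\<dots> = ennreal (a / c)" using a c by (simp add: ennreal_mult[symmetric])
    finally show ?thesis .
  qed
  ultimately show ?thesis unfolding small_def using a c by auto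
qed

lemma small_imp_measure_ge:
  assumes "small (\<lambda>w. \<not> Q w) c" "{w \<in> space uniform_tape. Q w} \<in> sets uniform_tape"
  shows "1 - c \<le> measure uniform_tape {w \<in> space uniform_tape. Q w}"
proof -
  interpret P: prob_space uniform_tape by (rule prob_space_tape)
  obtain A where A: "A \<in> sets uniform_tape" "{w \<in> space uniform_tape. \<not> Q w} \<subseteq> A"
      "emeasure uniform_tape A \<le> ennreal c" and c: "0 \<le> c"
    using assms unfolding small_def by blast
  have "P.prob (space uniform_tape - A) \<le> P.prob {w \<in> space uniform_tape. Q w}"
    using A assms by (intro P.finite_measure_mono) auto
  moreover have "P.prob (space uniform_tape - A) = 1 - P.prob A"
    using A by (simp add: P.prob_compl)
  moreover have "P.prob A \<le> c"
    using A(3) c by (simp add: P.emeasure_eq_measure)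
  ultimately show ?thesis by simp
qed

section \<open>Tail bounds obtained by averaging one tape cell at a time\<close>

lemma resample_le:
  assumes "f \<in> borel_measurable uniform_tape"
    and "\<And>w. w \<in> space uniform_tape \<Longrightarrow> (\<integral>\<^sup>+x. f (w(i := x)) \<partial>unif) \<le> g w"
  shows "(\<integral>\<^sup>+w. f w \<partial>uniform_tape) \<le> (\<integral>\<^sup>+w. g w \<partial>uniform_tape)"
  unfolding resample[OF assms(1), of i] by (intro nn_integral_mono assms(2))

lemma nn_integral_tape_const: "(\<integral>\<^sup>+w. c \<partial>uniform_tape) = c"
  by (simp only: nn_integral_const prob_space.emeasure_space_1[OF prob_space_tape] mult_1_right)

lemma nn_integral_unif_const: "(\<integral>\<^sup>+x. c \<partial>unif) = c"
  by (simp only: nn_integral_const prob_space.emeasure_space_1[OF prob_space_unif] mult_1_right)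

text \<open>Sampling rates may exceed 1; capping them at 1 changes the event only at the null point
  \<open>x = 1\<close>.\<close>

lemma nn_integral_unif_step_min:
  assumes "0 \<le> q" "0 \<le> a" "0 \<le> b"
  shows "(\<integral>\<^sup>+x. ennreal (if x < q then a else b) \<partial>unif) = ennreal (min 1 q * a + (1 - min 1 q) * b)"
proof -
  have "AE x in lborel. x \<noteq> 1" by (rule AE_lborel_singleton)
  then have "AE x in unif. x \<noteq> 1"
    unfolding unif_def by (subst AE_restrict_space_iff) auto
  then have "AE x in unif. x < 1"
    using AE_space by eventually_elim auto
  then have "(\<integral>\<^sup>+x. ennreal (if x < q then a else b) \<partial>unif)
      = (\<integral>\<^sup>+x. ennreal (if x < min 1 q then a else b) \<partial>unif)"
    by (intro nn_integral_cong_AE) (erule eventually_mono, auto)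
  then show ?thesis using nn_integral_unif_step[of "min 1 q" a b] assms by simp
qed

text \<open>One cell exceeds \<open>t * y r\<close> with probability at most
  \<open>exp (- t * y r)\<close>. Multiplying the indicator of survival by \<open>exp\<close> of
  \<open>t\<close> times the sum so far gives a supermartingale that starts at 1.\<close>

lemma all_above_small:
  fixes c :: "nat \<Rightarrow> nat" and y :: "nat \<Rightarrow> real"
  assumes c: "inj_on c {..<R}" and y: "\<And>r. r < R \<Longrightarrow> 0 \<le> y r" and t: "0 \<le> t"
  shows "small (\<lambda>w. \<forall>r<R. t * y r < w (c r)) (exp (- t * (\<Sum>r<R. y r)))"
proof -
  define Y where "Y m w = ennreal (if \<forall>r<m. t * y r < w (c r) then exp (t * (\<Sum>r<m. y r)) else 0)"
    for m :: nat and w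
  have meas: "Y m \<in> borel_measurable uniform_tape" for m
  proof -
    show ?thesis unfolding Y_def
      by (intro measurable_if_ennreal pred_all_less pred_less_real borel_measurable_const
          measurable_tape_component)
  qed
  have "(\<integral>\<^sup>+w. Y R w \<partial>uniform_tape) \<le> (\<integral>\<^sup>+w. Y 0 w \<partial>uniform_tape)"
  proof (rule supermartingale[where c=c])
    fix m w assume m: "m < R"
    let ?a = "t * y m" and ?e = "exp (t * (\<Sum>r<Suc m. y r))"
    have ne: "c r \<noteq> c m" if "r < m" for r using inj_onD[OF c, of r m] m that by auto
    show "(\<integral>\<^sup>+x. Y (Suc m) (w(c m := x)) \<partial>unif) \<le> Y m w"
    proof (cases "\<forall>r<m. t * y r < w (c r)")
      case True
      have a: "0 \<le> ?a" using y[OF m] t by simp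
      have "(\<integral>\<^sup>+x. Y (Suc m) (w(c m := x)) \<partial>unif) = (\<integral>\<^sup>+x. ennreal (if x \<le> min 1 ?a then 0 else ?e) \<partial>unif)"
      proof (rule nn_integral_cong)
        fix x assume "x \<in> space unif"
        then have x: "x \<le> 1" by simp
        have "(\<forall>r<Suc m. t * y r < (w(c m := x)) (c r)) \<longleftrightarrow> ?a < x"
          using True ne by (metis fun_upd_other fun_upd_same less_SucE less_SucI lessI)
        with x show "Y (Suc m) (w(c m := x)) = ennreal (if x \<le> min 1 ?a then 0 else ?e)"
          unfolding Y_def by auto
      qed
      also have "\<dots> = ennreal ((1 - min 1 ?a) * ?e)"
        using a by (subst nn_integral_unif_step_le) auto
      also have "\<dots> \<le> ennreal (exp (- ?a) * ?e)"
        using exp_ge_add_one_self[of "- ?a"] by (intro ennreal_leI mult_right_mono) (auto simp: min_def)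
      also have "exp (- ?a) * ?e = exp (t * (\<Sum>r<m. y r))"
        by (simp add: exp_add[symmetric] algebra_simps)
      finally show ?thesis using True by (simp add: Y_def)
    next
      case False
      then have "Y (Suc m) (w(c m := x)) = 0" for x
        using ne unfolding Y_def by (auto simp: less_Suc_eq)
      then show ?thesis by simp
    qed
  qed (rule meas)
  also have "\<dots> = ennreal 1" by (simp add: Y_def nn_integral_tape_const del: nn_integral_const)
  finally have "small (\<lambda>w. \<forall>r<R. t * y r < w (c r)) (1 / exp (t * (\<Sum>r<R. y r)))"
    by (intro small_markov[OF meas]) (auto simp: Y_def)
  then show ?thesis by (simp add: exp_minus divide_inverse)
qed

text \<open>With the other cells fixed, a projection is an affine function of cell
  \<open>c l k0\<close> with slope \<open>a w k0\<close>, so it lies within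
  \<open>\<theta> * \<bar>a w k0\<bar>\<close> of 0 only on an interval of length
  \<open>2 * \<theta>\<close>. One nonzero coefficient is enough, and the coefficients may be random
  as long as they do not read these cells.\<close>

lemma projections_small:
  fixes c :: "nat \<Rightarrow> nat \<Rightarrow> nat" and a :: "(nat \<Rightarrow> real) \<Rightarrow> nat \<Rightarrow> real"
  assumes inj: "\<And>l l' k. l < L \<Longrightarrow> l' < L \<Longrightarrow> k < d \<Longrightarrow> c l k = c l' k0 \<longleftrightarrow> l = l' \<and> k = k0"
    and a: "\<And>k. k < d \<Longrightarrow> (\<lambda>w. a w k) \<in> borel_measurable uniform_tape"
    and indep: "\<And>w l x k. l < L \<Longrightarrow> k < d \<Longrightarrow> a (w(c l k0 := x)) k = a w k"
    and k0: "k0 < d" and \<theta>: "0 < \<theta>"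
  shows "small (\<lambda>w. a w k0 \<noteq> 0 \<and> (\<forall>l<L. \<bar>\<Sum>k<d. a w k * w (c l k)\<bar> \<le> \<theta> * \<bar>a w k0\<bar>)) ((2 * \<theta>) ^ L)"
proof -
  define E where "E m w \<longleftrightarrow> a w k0 \<noteq> 0 \<and> (\<forall>l<m. \<bar>\<Sum>k<d. a w k * w (c l k)\<bar> \<le> \<theta> * \<bar>a w k0\<bar>)" for m w
  define Y where "Y m w = ennreal (if E m w then (1 / (2 * \<theta>)) ^ m else 0)" for m w
  have meas: "Y m \<in> borel_measurable uniform_tape" for m
  proof -
    define S where "S l w = (\<Sum>k<d. a w k * w (c l k))" for l w
    define a0 where "a0 w = a w k0" for w
    have S: "S l \<in> borel_measurable uniform_tape" for l
      unfolding S_def using a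
      by (intro borel_measurable_sum borel_measurable_times measurable_tape_component) auto
    have a0: "a0 \<in> borel_measurable uniform_tape"
      unfolding a0_def using a k0 by simp
    have "Y m = (\<lambda>w. ennreal (if a0 w \<noteq> 0 \<and> (\<forall>l<m. \<bar>S l w\<bar> \<le> \<theta> * \<bar>a0 w\<bar>)
        then (1 / (2 * \<theta>)) ^ m else 0))"
      unfolding Y_def E_def S_def a0_def ..
    also have "\<dots> \<in> borel_measurable uniform_tape"
      by (intro measurable_if_ennreal pred_intros_logic(3) pred_neq_0_real pred_all_less pred_le_real
          borel_measurable_abs borel_measurable_times borel_measurable_const S a0)
    finally show ?thesis .
  qed
  have "(\<integral>\<^sup>+w. Y L w \<partial>uniform_tape) \<le> (\<integral>\<^sup>+w. Y 0 w \<partial>uniform_tape)"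
  proof (rule supermartingale[where c="\<lambda>m. c m k0"])
    fix m w assume m: "m < L"
    have ak: "a (w(c m k0 := x)) k = a w k" if "k < d" for k x using indep m that by simp
    have prev: "(\<Sum>k<d. a (w(c m k0 := x)) k * (w(c m k0 := x)) (c l k)) = (\<Sum>k<d. a w k * w (c l k))"
      if "l < m" for l x
      using inj[of l m] m that ak by (intro sum.cong) auto
    show "(\<integral>\<^sup>+x. Y (Suc m) (w(c m k0 := x)) \<partial>unif) \<le> Y m w"
    proof (cases "E m w")
      case True
      then have a0: "a w k0 \<noteq> 0" by (simp add: E_def)
      define b where "b = (\<Sum>k\<in>{..<d} - {k0}. a w k * w (c m k)) / a w k0"
      have cur: "(\<Sum>k<d. a (w(c m k0 := x)) k * (w(c m k0 := x)) (c m k)) = a w k0 * (x + b)" for x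
      proof -
        have "(\<Sum>k<d. a (w(c m k0 := x)) k * (w(c m k0 := x)) (c m k))
            = (\<Sum>k<d. a w k * (if k = k0 then x else w (c m k)))"
          using inj[of m m] m ak by (intro sum.cong) auto
        also have "\<dots> = a w k0 * x + (\<Sum>k\<in>{..<d} - {k0}. a w k * w (c m k))"
          using k0 by (subst sum.remove[of _ k0]) auto
        finally show ?thesis using a0 by (simp add: b_def distrib_left)
      qed
      have "(\<integral>\<^sup>+x. Y (Suc m) (w(c m k0 := x)) \<partial>unif) \<le> ennreal ((1 / (2 * \<theta>)) ^ Suc m * ((\<theta> - b) - (- \<theta> - b)))"
        unfolding Y_def
      proof (rule nn_integral_unif_interval)
        fix x :: real assume "\<not> (- \<theta> - b \<le> x \<and> x \<le> \<theta> - b)"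
        then have "\<not> \<bar>x + b\<bar> \<le> \<theta>" by auto
        then have "\<not> \<bar>a w k0\<bar> * \<bar>x + b\<bar> \<le> \<bar>a w k0\<bar> * \<theta>" using a0 by simp
        then have "\<not> \<bar>a w k0 * (x + b)\<bar> \<le> \<theta> * \<bar>a w k0\<bar>" by (simp add: abs_mult mult.commute)
        then have "\<not> E (Suc m) (w(c m k0 := x))"
          unfolding E_def using cur[of x] ak[OF k0, of x] by (metis lessI)
        then show "(if E (Suc m) (w(c m k0 := x)) then (1 / (2 * \<theta>)) ^ Suc m else 0) = 0" by simp
      qed (use \<theta> in auto)
      also have "(1 / (2 * \<theta>)) ^ Suc m * ((\<theta> - b) - (- \<theta> - b)) = (1 / (2 * \<theta>)) ^ m"
        using \<theta> by simp
      also have "ennreal ((1 / (2 * \<theta>)) ^ m) = Y m w" using True by (simp add: Y_def)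
      finally show ?thesis .
    next
      case False
      then have "\<not> E (Suc m) (w(c m k0 := x))" for x
        unfolding E_def ak[OF k0] using prev by (metis less_SucI)
      then show ?thesis by (simp add: Y_def)
    qed
  qed (rule meas)
  also have "\<dots> \<le> (\<integral>\<^sup>+w. 1 \<partial>uniform_tape)" by (intro nn_integral_mono) (simp add: Y_def)
  also have "\<dots> = ennreal 1" by (simp only: nn_integral_tape_const ennreal_1)
  finally have "small (E L) (1 / (1 / (2 * \<theta>)) ^ L)"
    using \<theta> by (intro small_markov[OF meas]) (auto simp: Y_def)
  then show ?thesis unfolding E_def by (simp add: power_divide)
qed

lemma exp_le_quadratic:
  fixes z :: real assumes "\<bar>z\<bar> \<le> 1" shows "exp z \<le> 1 + z + z\<^sup>2"
proof (cases "0 \<le> z")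
  case True then show ?thesis using assms by (intro exp_bound) auto
next
  case False
  define t where "t = - z"
  have t: "0 \<le> t" "t \<le> 1" using False assms by (auto simp: t_def)
  have "1 \<le> (1 - t + t\<^sup>2) * (1 + t + t\<^sup>2 / 2)"
  proof -
    have "(1 - t + t\<^sup>2) * (1 + t + t\<^sup>2 / 2) = 1 + t\<^sup>2 / 2 + t ^ 3 / 2 + t ^ 4 / 2"
      by (simp add: field_simps power2_eq_square power3_eq_cube power4_eq_xxxx)
    then show ?thesis using t by simp
  qed
  also have "\<dots> \<le> (1 - t + t\<^sup>2) * exp t"
    using exp_lower_Taylor_quadratic[OF t(1)] t by (intro mult_left_mono) auto
  finally have "exp (- t) \<le> 1 - t + t\<^sup>2" by (simp add: exp_minus field_simps)
  then show ?thesis by (simp add: t_def)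
qed

text \<open>Bernstein's estimate for one row. For \<open>0 < q < 1\<close> the variable has mean
  \<open>y\<close> and variance \<open>y * (y / q - y) \<le> b * y\<close>, and the condition on
  \<open>\<theta>\<close> keeps the exponents within the range of \<open>exp_le_quadratic\<close>.
  For \<open>1 \<le> q\<close> the variable is almost surely constant, and \<open>q = 0\<close>
  forces \<open>y = 0\<close>.\<close>

lemma bernoulli_mgf:
  assumes q: "0 \<le> q" and y: "0 \<le> y" and b: "0 \<le> b" "y \<le> q * b" and \<theta>: "\<bar>\<theta>\<bar> * b \<le> 1"
  shows "(\<integral>\<^sup>+x. ennreal (exp (\<theta> * ((if x < q then y / min 1 q else 0) - y))) \<partial>unif)
       \<le> ennreal (exp (\<theta>\<^sup>2 * b * y))"
proof -
  let ?p = "min 1 q"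
  have "(\<integral>\<^sup>+x. ennreal (exp (\<theta> * ((if x < q then y / ?p else 0) - y))) \<partial>unif)
      = (\<integral>\<^sup>+x. ennreal (if x < q then exp (\<theta> * (y / ?p - y)) else exp (- \<theta> * y)) \<partial>unif)"
    by (intro nn_integral_cong) auto
  also have "\<dots> = ennreal (?p * exp (\<theta> * (y / ?p - y)) + (1 - ?p) * exp (- \<theta> * y))"
    using q by (intro nn_integral_unif_step_min) auto
  also have "?p * exp (\<theta> * (y / ?p - y)) + (1 - ?p) * exp (- \<theta> * y) \<le> exp (\<theta>\<^sup>2 * b * y)"
  proof (cases "q < 1 \<and> q \<noteq> 0")
    case False
    then show ?thesis using q b y by (cases "q = 0") (auto simp: min_def)
  next
    case True
    then have p: "?p = q" "0 < q" "q < 1" using q by auto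
    have yb: "y / q \<le> b" "0 \<le> y / q" "y \<le> y / q"
      using p b y by (auto simp: field_simps mult_left_le_one_le)
    have m1: "\<bar>\<theta>\<bar> * (y / q) \<le> 1"
      using mult_left_mono[OF yb(1), of "\<bar>\<theta>\<bar>"] \<theta> by linarith
    have z1: "\<bar>\<theta> * (y / q - y)\<bar> \<le> 1"
    proof -
      have "\<bar>\<theta> * (y / q - y)\<bar> = \<bar>\<theta>\<bar> * (y / q - y)" using yb by (simp add: abs_mult)
      also have "\<dots> \<le> \<bar>\<theta>\<bar> * (y / q)" using y by (intro mult_left_mono) auto
      finally show ?thesis using m1 by linarith
    qed
    have z2: "\<bar>- \<theta> * y\<bar> \<le> 1"
      using mult_left_mono[OF yb(3), of "\<bar>\<theta>\<bar>"] m1 y by (simp add: abs_mult)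
    have "q * exp (\<theta> * (y / q - y)) + (1 - q) * exp (- \<theta> * y)
        \<le> q * (1 + \<theta> * (y / q - y) + (\<theta> * (y / q - y))\<^sup>2) + (1 - q) * (1 + - \<theta> * y + (- \<theta> * y)\<^sup>2)"
      using p by (intro add_mono mult_left_mono exp_le_quadratic z1 z2) auto
    also have "\<dots> = 1 + \<theta>\<^sup>2 * y * (y / q - y)"
      using p by (simp add: field_simps power2_eq_square)
    also have "\<dots> \<le> 1 + \<theta>\<^sup>2 * y * b"
      using yb y by (intro add_left_mono mult_left_mono) auto
    also have "\<dots> \<le> exp (\<theta>\<^sup>2 * b * y)"
      using exp_ge_add_one_self[of "\<theta>\<^sup>2 * b * y"] by (simp add: algebra_simps)
    finally show ?thesis using p by simp
  qed
  finally show ?thesis by (simp add: ennreal_leI)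
qed

text \<open>The rates are themselves random, but they do not read the selection cells. The condition
  on them therefore stays fixed during the averaging and is carried along as an indicator, which
  avoids conditioning.\<close>

lemma sampled_sum_tail:
  fixes c :: "nat \<Rightarrow> nat" and q :: "(nat \<Rightarrow> real) \<Rightarrow> nat \<Rightarrow> real"
  assumes c: "inj_on c {..<R}"
    and q: "\<And>r. r < R \<Longrightarrow> (\<lambda>w. q w r) \<in> borel_measurable uniform_tape"
    and q0: "\<And>w r. 0 \<le> q w r"
    and indep: "\<And>w r r' x. r < R \<Longrightarrow> r' < R \<Longrightarrow> q (w(c r := x)) r' = q w r'"
    and y: "\<And>r. r < R \<Longrightarrow> 0 \<le> y r" and N: "N = (\<Sum>r<R. y r)" "0 < N"
    and b: "0 < b" and \<eta>: "0 < \<eta>" "\<eta> \<le> 1"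
  shows "small (\<lambda>w. (\<forall>r<R. y r \<le> q w r * (b * N)) \<and>
           \<eta> * N < \<bar>(\<Sum>r<R. if w (c r) < q w r then y r / min 1 (q w r) else 0) - N\<bar>)
         (2 * exp (- \<eta>\<^sup>2 / (4 * b)))"
proof -
  define G where "G w \<longleftrightarrow> (\<forall>r<R. y r \<le> q w r * (b * N))" for w
  define X where "X w r = (if w (c r) < q w r then y r / min 1 (q w r) else 0)" for w r
  have G_meas: "Measurable.pred uniform_tape G"
    unfolding G_def
    by (intro pred_all_less pred_le_real borel_measurable_const borel_measurable_times q)
  have X_meas: "(\<lambda>w. X w r) \<in> borel_measurable uniform_tape" if "r < R" for r
    unfolding X_def
    by (rule measurable_If) (use q[OF that] pred_less_real[OF measurable_tape_component q[OF that]]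
        in \<open>auto simp: pred_def\<close>)
  have G_indep: "G (w(c m := x)) = G w" if "m < R" for w m x
    using indep that by (simp add: G_def)
  have one: "small (\<lambda>w. G w \<and> \<eta> * N < s * ((\<Sum>r<R. X w r) - N)) (exp (- \<eta>\<^sup>2 / (4 * b)))"
    if s: "\<bar>s\<bar> = 1" for s
  proof -
    \<comment> \<open>Up to the sign \<open>s\<close>, which selects the tail, this is the maximiser
      of \<open>\<theta> * \<eta> * N - \<theta>\<^sup>2 * b * N\<^sup>2\<close>, whose maximum is
      \<open>\<eta>\<^sup>2 / (4 * b)\<close>.\<close>
    define \<theta> where "\<theta> = s * \<eta> / (2 * b * N)"
    have \<theta>b: "\<bar>\<theta>\<bar> * (b * N) \<le> 1"
      using N b \<eta> s by (simp add: \<theta>_def abs_mult)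
    define A where "A m w = (\<Sum>r<m. \<theta> * (X w r - y r) - \<theta>\<^sup>2 * (b * N) * y r)" for m w
    define Y where "Y m w = ennreal (if G w then exp (A m w) else 0)" for m w
    have A_meas: "A m \<in> borel_measurable uniform_tape" if "m \<le> R" for m
      unfolding A_def using X_meas that by (intro borel_measurable_sum) auto
    have meas: "Y m \<in> borel_measurable uniform_tape" if "m \<le> R" for m
      unfolding Y_def
      by (intro measurable_if_ennreal G_meas measurable_compose[OF A_meas[OF that] borel_measurable_exp])
    have "(\<integral>\<^sup>+w. Y R w \<partial>uniform_tape) \<le> (\<integral>\<^sup>+w. Y 0 w \<partial>uniform_tape)"
    proof (rule supermartingale[where c=c])
      fix m w assume m: "m < R"
      have ne: "c r \<noteq> c m" if "r < m" for r using inj_onD[OF c, of r m] m that by auto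
      have A: "A (Suc m) (w(c m := x)) = A m w - \<theta>\<^sup>2 * (b * N) * y m
          + \<theta> * ((if x < q w m then y m / min 1 (q w m) else 0) - y m)" for x
      proof -
        have "A m (w(c m := x)) = A m w"
          unfolding A_def X_def using ne indep m by (intro sum.cong) auto
        then show ?thesis using m indep[of m m] by (simp add: A_def X_def)
      qed
      show "(\<integral>\<^sup>+x. Y (Suc m) (w(c m := x)) \<partial>unif) \<le> Y m w"
      proof (cases "G w")
        case True
        let ?e = "exp (A m w - \<theta>\<^sup>2 * (b * N) * y m)"
        have "(\<integral>\<^sup>+x. Y (Suc m) (w(c m := x)) \<partial>unif)
            = (\<integral>\<^sup>+x. ennreal ?e * ennreal (exp (\<theta> * ((if x < q w m then y m / min 1 (q w m) else 0) - y m))) \<partial>unif)"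
          unfolding Y_def G_indep[OF m] A using True
          by (intro nn_integral_cong) (simp add: exp_add ennreal_mult)
        also have "\<dots> = ennreal ?e * (\<integral>\<^sup>+x. ennreal (exp (\<theta> * ((if x < q w m then y m / min 1 (q w m) else 0) - y m))) \<partial>unif)"
          by (intro nn_integral_cmult) (use measurable_ident_unif in measurable)
        also have "\<dots> \<le> ennreal ?e * ennreal (exp (\<theta>\<^sup>2 * (b * N) * y m))"
          using True m q0 y N b \<theta>b by (intro mult_left_mono bernoulli_mgf) (auto simp: G_def)
        also have "\<dots> = Y m w" using True by (simp add: Y_def ennreal_mult[symmetric] exp_add[symmetric])
        finally show ?thesis .
      next
        case False then show ?thesis by (simp add: Y_def G_indep[OF m])
      qed
    qed (rule meas)
    also have "\<dots> \<le> (\<integral>\<^sup>+w. 1 \<partial>uniform_tape)" by (intro nn_integral_mono) (simp add: Y_def A_def)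
    also have "\<dots> = ennreal 1" by (simp only: nn_integral_tape_const ennreal_1)
    finally have "small (\<lambda>w. G w \<and> \<eta> * N < s * ((\<Sum>r<R. X w r) - N)) (1 / exp (\<eta>\<^sup>2 / (4 * b)))"
    proof (intro small_markov[OF meas])
      fix w assume w: "G w \<and> \<eta> * N < s * ((\<Sum>r<R. X w r) - N)"
      have ss: "s * s = 1" using s by (auto simp: abs_if split: if_splits)
      have "A R w = \<theta> * ((\<Sum>r<R. X w r) - N) - \<theta>\<^sup>2 * (b * N) * N"
        by (simp add: A_def N(1) sum_subtractf sum_distrib_left[symmetric])
      also have "\<theta> * ((\<Sum>r<R. X w r) - N) = \<eta> / (2 * b * N) * (s * ((\<Sum>r<R. X w r) - N))"
        by (simp add: \<theta>_def)
      also have "\<theta>\<^sup>2 * (b * N) * N = \<eta>\<^sup>2 / (4 * b)"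
        using N b ss by (simp add: \<theta>_def field_simps power2_eq_square)
      finally have A: "A R w = \<eta> / (2 * b * N) * (s * ((\<Sum>r<R. X w r) - N)) - \<eta>\<^sup>2 / (4 * b)" .
      have "\<eta> / (2 * b * N) * (\<eta> * N) \<le> \<eta> / (2 * b * N) * (s * ((\<Sum>r<R. X w r) - N))"
        using w N b \<eta> by (intro mult_left_mono) auto
      moreover have "\<eta> / (2 * b * N) * (\<eta> * N) = \<eta>\<^sup>2 / (4 * b) + \<eta>\<^sup>2 / (4 * b)"
        using N b by (simp add: field_simps power2_eq_square)
      ultimately have "\<eta>\<^sup>2 / (4 * b) \<le> A R w" unfolding A by linarith
      then show "ennreal (exp (\<eta>\<^sup>2 / (4 * b))) \<le> Y R w" using w by (simp add: Y_def)
    qed auto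
    also have "1 / exp (\<eta>\<^sup>2 / (4 * b)) = exp (- \<eta>\<^sup>2 / (4 * b))"
      by (simp only: minus_divide_left[symmetric] exp_minus inverse_eq_divide)
    finally show ?thesis .
  qed
  have "small (\<lambda>w. (G w \<and> \<eta> * N < 1 * ((\<Sum>r<R. X w r) - N)) \<or> (G w \<and> \<eta> * N < -1 * ((\<Sum>r<R. X w r) - N)))
     (exp (- \<eta>\<^sup>2 / (4 * b)) + exp (- \<eta>\<^sup>2 / (4 * b)))"
    by (intro small_disj one) auto
  then show ?thesis by (rule small_mono) (auto simp: G_def X_def)
qed

text \<open>A first-moment bound: averaged over its own cell, row \<open>r\<close> is kept with
  probability at most \<open>q w r\<close>, and Markov's inequality passes from the sum of the rates
  to the number of kept rows.\<close>

lemma sampled_count_tail: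
  fixes c :: "nat \<Rightarrow> nat" and q :: "(nat \<Rightarrow> real) \<Rightarrow> nat \<Rightarrow> real"
  assumes q: "\<And>r. r < R \<Longrightarrow> (\<lambda>w. q w r) \<in> borel_measurable uniform_tape"
    and q0: "\<And>w r. 0 \<le> q w r"
    and indep: "\<And>w r r' x. r < R \<Longrightarrow> r' < R \<Longrightarrow> q (w(c r := x)) r' = q w r'"
    and a: "0 < a" "0 < C"
  shows "small (\<lambda>w. (\<Sum>r<R. q w r) \<le> a \<and> C < (\<Sum>r<R. if w (c r) < q w r then 1 else 0)) (a / C)"
proof -
  define G where "G w \<longleftrightarrow> (\<Sum>r<R. q w r) \<le> a" for w
  have G_meas: "Measurable.pred uniform_tape G"
    unfolding G_def using q by (intro pred_le_real borel_measurable_const borel_measurable_sum) auto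
  define f where "f r w = ennreal (if G w \<and> w (c r) < q w r then 1 else 0)" for r w
  define g where "g r w = ennreal (if G w then q w r else 0)" for r w
  have fm: "f r \<in> borel_measurable uniform_tape" if "r < R" for r
    unfolding f_def
    by (intro measurable_if_ennreal pred_intros_logic(3) pred_less_real measurable_tape_component
        G_meas q[OF that] borel_measurable_const)
  have gm: "g r \<in> borel_measurable uniform_tape" if "r < R" for r
    unfolding g_def by (intro measurable_if_ennreal G_meas q[OF that])
  have fg: "(\<integral>\<^sup>+w. f r w \<partial>uniform_tape) \<le> (\<integral>\<^sup>+w. g r w \<partial>uniform_tape)" if r: "r < R" for r
  proof (rule resample_le[OF fm[OF r], of "c r"])
    fix w
    have "G (w(c r := x)) = G w" for x using indep r by (simp add: G_def)
    then have "(\<integral>\<^sup>+x. f r (w(c r := x)) \<partial>unif)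
        = (\<integral>\<^sup>+x. ennreal (if x < q w r then (if G w then 1 else 0) else 0) \<partial>unif)"
      unfolding f_def using indep[OF r r] by (intro nn_integral_cong) auto
    also have "\<dots> = ennreal (min 1 (q w r) * (if G w then 1 else 0))"
      using q0 by (subst nn_integral_unif_step_min) auto
    also have "\<dots> \<le> g r w" unfolding g_def by (intro ennreal_leI) auto
    finally show "(\<integral>\<^sup>+x. f r (w(c r := x)) \<partial>unif) \<le> g r w" .
  qed
  have "(\<integral>\<^sup>+w. (\<Sum>r<R. f r w) \<partial>uniform_tape) = (\<Sum>r<R. \<integral>\<^sup>+w. f r w \<partial>uniform_tape)"
    using fm by (intro nn_integral_sum) auto
  also have "\<dots> \<le> (\<Sum>r<R. \<integral>\<^sup>+w. g r w \<partial>uniform_tape)" using fg by (intro sum_mono) auto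
  also have "\<dots> = (\<integral>\<^sup>+w. (\<Sum>r<R. g r w) \<partial>uniform_tape)"
    using gm by (intro nn_integral_sum[symmetric]) auto
  also have "\<dots> \<le> (\<integral>\<^sup>+w. ennreal a \<partial>uniform_tape)"
  proof (rule nn_integral_mono)
    fix w show "(\<Sum>r<R. g r w) \<le> ennreal a"
    proof (cases "G w")
      case True
      then have "(\<Sum>r<R. g r w) = ennreal (\<Sum>r<R. q w r)"
        using q0 by (simp add: g_def sum_ennreal)
      with True show ?thesis by (simp add: G_def ennreal_leI)
    qed (simp add: g_def)
  qed
  finally have int: "(\<integral>\<^sup>+w. (\<Sum>r<R. f r w) \<partial>uniform_tape) \<le> ennreal a"
    by (simp only: nn_integral_tape_const ennreal_1)
  show ?thesis
  proof (rule small_markov[OF _ a(2) _ int])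
    show "(\<lambda>w. \<Sum>r<R. f r w) \<in> borel_measurable uniform_tape"
      using fm by (intro borel_measurable_sum) auto
    fix w assume *: "(\<Sum>r<R. q w r) \<le> a \<and> C < (\<Sum>r<R. if w (c r) < q w r then 1 else 0)"
    then have "(\<Sum>r<R. f r w) = ennreal (\<Sum>r<R. if w (c r) < q w r then 1 else 0)"
      unfolding f_def G_def by (subst sum_ennreal) auto
    then show "ennreal C \<le> (\<Sum>r<R. f r w)" using * by (auto intro!: ennreal_leI)
  qed (use a in auto)
qed

section \<open>Sparse sign sketches\<close>

text \<open>The leading \<open>b\<close> binary digits, read as a number, and the remaining fraction.\<close>

primrec bits :: "nat \<Rightarrow> real \<Rightarrow> nat \<times> real" where
  "bits 0 v = (0, v)"
| "bits (Suc b) v = (let (h, x) = bits b v in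
     if 1 \<le> x + x then (h + h + 1, x + x - 1) else (h + h, x + x))"

definition bucket :: "nat \<Rightarrow> real \<Rightarrow> nat" where
  "bucket b v = fst (bits b v)"

text \<open>The interval of the remainder is closed at 1, because the tape may contain 1: there
  every digit is 1, the remainder stays 1 and the number remains below \<open>2 ^ b\<close>.\<close>

lemma bits_invariant:
  assumes "0 \<le> v" "v \<le> 1"
  shows "v * 2 ^ b = real (fst (bits b v)) + snd (bits b v)
       \<and> 0 \<le> snd (bits b v) \<and> snd (bits b v) \<le> 1 \<and> fst (bits b v) < 2 ^ b"
proof (induction b)
  case 0 then show ?case using assms by simp
next
  case (Suc b)
  obtain h x where hx: "bits b v = (h, x)" by force
  have *: "v * 2 ^ b = real h + x" "0 \<le> x" "x \<le> 1" "h < 2 ^ b" using Suc hx by auto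
  have "v * 2 ^ Suc b = 2 * (real h + x)" using *(1) by simp
  then show ?case using * hx by (auto simp: Let_def)
qed

lemma bucket_less: "0 \<le> v \<Longrightarrow> v \<le> 1 \<Longrightarrow> bucket b v < 2 ^ b"
  using bits_invariant[of v b] by (simp add: bucket_def)

lemma bucket_interval:
  assumes "0 \<le> v" "v \<le> 1" "bucket b v = \<beta>"
  shows "real \<beta> / 2 ^ b \<le> v \<and> v \<le> (real \<beta> + 1) / 2 ^ b"
  using bits_invariant[OF assms(1,2), of b] assms(3)
  by (auto simp: bucket_def field_simps)

lemma measurable_bits:
  "(\<lambda>v. fst (bits b v)) \<in> measurable borel (count_space UNIV) \<and> (\<lambda>v. snd (bits b v)) \<in> borel_measurable borel"
proof (induction b)
  case 0 then show ?case by simp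
next
  case (Suc b)
  then have [measurable]: "(\<lambda>v. fst (bits b v)) \<in> measurable borel (count_space UNIV)"
     "(\<lambda>v. snd (bits b v)) \<in> borel_measurable borel" by auto
  have "(\<lambda>v. if 1 \<le> snd (bits b v) + snd (bits b v) then fst (bits b v) + fst (bits b v) + 1
      else fst (bits b v) + fst (bits b v)) \<in> measurable borel (count_space UNIV)"
     by measurable
  moreover have "(\<lambda>v. if 1 \<le> snd (bits b v) + snd (bits b v) then snd (bits b v) + snd (bits b v) - 1
      else snd (bits b v) + snd (bits b v)) \<in> borel_measurable borel"
     by measurable
  ultimately show ?case by (simp add: case_prod_beta' Let_def if_distrib[of fst] if_distrib[of snd] cong: if_cong)
qed

lemma measurable_bucket: "bucket b \<in> measurable borel (count_space UNIV)"
  using measurable_bits[of b] unfolding bucket_def[abs_def] by simp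

definition sign_of :: "real \<Rightarrow> real" where
  "sign_of e = (if e \<le> 1 / 2 then 1 else - 1)"

lemma sign_of_square: "sign_of e * sign_of e = 1"
  by (simp add: sign_of_def)

lemma measurable_sign_of: "sign_of \<in> borel_measurable borel"
  unfolding sign_of_def[abs_def] by measurable

text \<open>The Gram matrix error of a sparse sign sketch is controlled by its second moment; the
  rows are added one at a time, so that only the newest sign has to be averaged out.\<close>

locale sign_sketch =
  fixes R d b :: nat and pv pe :: "nat \<Rightarrow> nat" and Q :: "(nat \<Rightarrow> real) \<Rightarrow> nat \<Rightarrow> nat \<Rightarrow> real"
  assumes pos: "inj_on pv {..<R}" "inj_on pe {..<R}" "\<And>r r'. r < R \<Longrightarrow> r' < R \<Longrightarrow> pv r \<noteq> pe r'"
    and Q_meas: "\<And>r k. r < R \<Longrightarrow> k < d \<Longrightarrow> (\<lambda>w. Q w r k) \<in> borel_measurable uniform_tape"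
    and Q_indep: "\<And>w r r' k x. r < R \<Longrightarrow> r' < R \<Longrightarrow> k < d \<Longrightarrow> Q (w(pv r := x)) r' k = Q w r' k"
      "\<And>w r r' k x. r < R \<Longrightarrow> r' < R \<Longrightarrow> k < d \<Longrightarrow> Q (w(pe r := x)) r' k = Q w r' k"
begin

definition cell :: "(nat \<Rightarrow> real) \<Rightarrow> nat \<Rightarrow> nat \<Rightarrow> nat \<Rightarrow> real" where
  "cell w m \<beta> k = (\<Sum>r<m. if bucket b (w (pv r)) = \<beta> then sign_of (w (pe r)) * Q w r k else 0)"

definition err :: "(nat \<Rightarrow> real) \<Rightarrow> nat \<Rightarrow> nat \<Rightarrow> nat \<Rightarrow> real" where
  "err w m k l = (\<Sum>\<beta><2 ^ b. cell w m \<beta> k * cell w m \<beta> l) - (\<Sum>r<m. Q w r k * Q w r l)"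

definition err2 :: "(nat \<Rightarrow> real) \<Rightarrow> nat \<Rightarrow> real" where
  "err2 w m = (\<Sum>k<d. \<Sum>l<d. (err w m k l)\<^sup>2)"

definition mass :: "(nat \<Rightarrow> real) \<Rightarrow> nat \<Rightarrow> nat \<Rightarrow> real" where
  "mass w m \<beta> = (\<Sum>k<d. (cell w m \<beta> k)\<^sup>2)"

definition row2 :: "(nat \<Rightarrow> real) \<Rightarrow> nat \<Rightarrow> real" where
  "row2 w r = (\<Sum>k<d. (Q w r k)\<^sup>2)"

definition rest :: "(nat \<Rightarrow> real) \<Rightarrow> nat \<Rightarrow> real" where
  "rest w m = (\<Sum>r\<in>{m..<R}. row2 w r)"

text \<open>An upper bound on the expected final \<open>err2\<close> once the first \<open>m\<close>
  rows are placed. A later row costs on average at most \<open>4 / 2 ^ b\<close> times the current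
  mass times its squared norm, and the mass grows on average by that squared norm; the last term
  covers the mass that the remaining rows create for each other.\<close>

definition pot :: "(nat \<Rightarrow> real) \<Rightarrow> nat \<Rightarrow> real" where
  "pot w m = err2 w m + 4 / 2 ^ b * (\<Sum>\<beta><2 ^ b. mass w m \<beta>) * rest w m + 4 / 2 ^ b * (rest w m)\<^sup>2"

text \<open>The potential halfway through a row: its sign has been averaged out, its bucket is still
  fixed.\<close>

definition mid :: "(nat \<Rightarrow> real) \<Rightarrow> nat \<Rightarrow> real" where
  "mid w m = err2 w m + 4 * mass w m (bucket b (w (pv m))) * row2 w m
     + 4 / 2 ^ b * ((\<Sum>\<beta><2 ^ b. mass w m \<beta>) + row2 w m) * rest w (Suc m)
     + 4 / 2 ^ b * (rest w (Suc m))\<^sup>2"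

lemma row2_nonneg: "0 \<le> row2 w r" by (auto simp: row2_def intro!: sum_nonneg)
lemma mass_nonneg: "0 \<le> mass w m \<beta>" by (auto simp: mass_def intro!: sum_nonneg)
lemma err2_nonneg: "0 \<le> err2 w m" by (auto simp: err2_def intro!: sum_nonneg)
lemma rest_nonneg: "0 \<le> rest w m" by (auto simp: rest_def intro!: sum_nonneg row2_nonneg)

lemma rest_Suc: "m < R \<Longrightarrow> rest w m = row2 w m + rest w (Suc m)"
  by (simp add: rest_def sum.atLeast_Suc_lessThan)

lemma cell_Suc:
  "cell w (Suc m) \<beta> k = cell w m \<beta> k
     + (if bucket b (w (pv m)) = \<beta> then sign_of (w (pe m)) * Q w m k else 0)"
  by (simp add: cell_def)

lemma sum_bucket_update:
  fixes f g :: "nat \<Rightarrow> real"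
  assumes "h < n"
  shows "(\<Sum>\<beta><n. (f \<beta> + (if h = \<beta> then s * x else 0)) * (g \<beta> + (if h = \<beta> then s * y else 0)))
    = (\<Sum>\<beta><n. f \<beta> * g \<beta>) + s * (f h * y + x * g h) + s * s * (x * y)"
proof -
  have "(\<Sum>\<beta><n. (f \<beta> + (if h = \<beta> then s * x else 0)) * (g \<beta> + (if h = \<beta> then s * y else 0)))
     = (\<Sum>\<beta><n. f \<beta> * g \<beta> + (if h = \<beta> then s * (f h * y + x * g h) + s * s * (x * y) else 0))"
    by (intro sum.cong) (auto simp: algebra_simps)
  then show ?thesis using assms by (simp add: sum.distrib)
qed

text \<open>The product of the new row with itself enters both Gram matrices and cancels, as its
  sign squares to 1. Only cross terms linear in the sign remain.\<close>

lemma err_Suc: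
  assumes "bucket b (w (pv m)) < 2 ^ b"
  shows "err w (Suc m) k l = err w m k l + sign_of (w (pe m)) *
     (cell w m (bucket b (w (pv m))) k * Q w m l + Q w m k * cell w m (bucket b (w (pv m))) l)"
  unfolding err_def cell_Suc sum_bucket_update[OF assms] sign_of_square by simp

lemma mass_Suc:
  assumes "bucket b (w (pv m)) < 2 ^ b"
  shows "(\<Sum>\<beta><2 ^ b. mass w (Suc m) \<beta>) = (\<Sum>\<beta><2 ^ b. mass w m \<beta>)
     + sign_of (w (pe m)) * (2 * (\<Sum>k<d. cell w m (bucket b (w (pv m))) k * Q w m k)) + row2 w m"
proof -
  have "(\<Sum>\<beta><2 ^ b. mass w (Suc m) \<beta>) = (\<Sum>k<d. \<Sum>\<beta><2 ^ b. cell w (Suc m) \<beta> k * cell w (Suc m) \<beta> k)"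
    unfolding mass_def power2_eq_square by (rule sum.swap)
  also have "\<dots> = (\<Sum>k<d. (\<Sum>\<beta><2 ^ b. cell w m \<beta> k * cell w m \<beta> k)
      + sign_of (w (pe m)) * (2 * (cell w m (bucket b (w (pv m))) k * Q w m k)) + Q w m k * Q w m k)"
    unfolding cell_Suc sum_bucket_update[OF assms] sign_of_square by (simp add: mult.commute)
  also have "\<dots> = (\<Sum>\<beta><2 ^ b. mass w m \<beta>)
     + sign_of (w (pe m)) * (2 * (\<Sum>k<d. cell w m (bucket b (w (pv m))) k * Q w m k)) + row2 w m"
    unfolding mass_def row2_def power2_eq_square
      sum.swap[of "\<lambda>\<beta> k. cell w m \<beta> k * cell w m \<beta> k" "{..<d}"]
    by (simp add: sum.distrib sum_distrib_left)
  finally show ?thesis .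
qed

lemma square_cross_le:
  "(\<Sum>k<d. \<Sum>l<d. (x k * y l + y k * x l)\<^sup>2) \<le> 4 * (\<Sum>k<d. (x k)\<^sup>2) * (\<Sum>k<d. (y k :: real)\<^sup>2)"
proof -
  have "(x k * y l + y k * x l)\<^sup>2 \<le> 2 * ((x k)\<^sup>2 * (y l)\<^sup>2) + 2 * ((y k)\<^sup>2 * (x l)\<^sup>2)" for k l
    using zero_le_power2[of "x k * y l - y k * x l"] by (simp add: power2_eq_square algebra_simps)
  then have "(\<Sum>k<d. \<Sum>l<d. (x k * y l + y k * x l)\<^sup>2)
     \<le> (\<Sum>k<d. \<Sum>l<d. 2 * ((x k)\<^sup>2 * (y l)\<^sup>2) + 2 * ((y k)\<^sup>2 * (x l)\<^sup>2))"
    by (intro sum_mono)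
  also have "\<dots> = 4 * (\<Sum>k<d. (x k)\<^sup>2) * (\<Sum>k<d. (y k)\<^sup>2)"
    by (simp add: sum.distrib sum_distrib_left[symmetric] sum_distrib_right[symmetric] sum_product[symmetric])
  finally show ?thesis .
qed

lemma cell_indep:
  assumes "m \<le> i" "i < R" "k < d"
  shows "cell (w(pv i := x)) m \<beta> k = cell w m \<beta> k" "cell (w(pe i := x)) m \<beta> k = cell w m \<beta> k"
proof -
  have ne: "pv r \<noteq> pv i" "pe r \<noteq> pe i" "pv r \<noteq> pe i" "pe r \<noteq> pv i" if "r < m" for r
    using assms that inj_onD[OF pos(1), of r i] inj_onD[OF pos(2), of r i] pos(3)[of r i] pos(3)[of i r]
    by auto
  show "cell (w(pv i := x)) m \<beta> k = cell w m \<beta> k" "cell (w(pe i := x)) m \<beta> k = cell w m \<beta> k"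
    unfolding cell_def using ne assms Q_indep by (auto intro!: sum.cong)
qed

lemma indep_simps:
  assumes "m \<le> i" "i < R"
  shows "err2 (w(pv i := x)) m = err2 w m" "err2 (w(pe i := x)) m = err2 w m"
    "mass (w(pv i := x)) m \<beta> = mass w m \<beta>" "mass (w(pe i := x)) m \<beta> = mass w m \<beta>"
  unfolding err2_def err_def mass_def
  using assms by (simp_all add: cell_indep Q_indep cong: sum.cong_simp)

lemma row_indep_simps:
  assumes "i < R"
  shows "r < R \<Longrightarrow> row2 (w(pv i := x)) r = row2 w r" "r < R \<Longrightarrow> row2 (w(pe i := x)) r = row2 w r"
    "rest (w(pv i := x)) m' = rest w m'" "rest (w(pe i := x)) m' = rest w m'"
  unfolding row2_def rest_def
  using assms by (simp_all add: Q_indep cong: sum.cong_simp)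

text \<open>The sign enters \<open>err\<close> and the mass linearly, so averaging its two values
  leaves only the squares of the cross terms.\<close>

lemma step_pe:
  assumes m: "m < R" and w: "w \<in> space uniform_tape"
  shows "(\<integral>\<^sup>+x. ennreal (pot (w(pe m := x)) (Suc m)) \<partial>unif) \<le> ennreal (mid w m)"
proof -
  let ?h = "bucket b (w (pv m))"
  have h: "?h < 2 ^ b" using w by (intro bucket_less) (auto simp: space_tape)
  have ne: "pv m \<noteq> pe m" using pos(3) m by auto
  define c where "c k l = cell w m ?h k * Q w m l + Q w m k * cell w m ?h l" for k l
  define t where "t = 2 * (\<Sum>k<d. cell w m ?h k * Q w m k)"
  define f where "f s = (\<Sum>k<d. \<Sum>l<d. (err w m k l + s * c k l)\<^sup>2)
     + 4 / 2 ^ b * ((\<Sum>\<beta><2 ^ b. mass w m \<beta>) + s * t + row2 w m) * rest w (Suc m)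
     + 4 / 2 ^ b * (rest w (Suc m))\<^sup>2" for s
  have pot: "pot (w(pe m := x)) (Suc m) = f (sign_of x)" for x
  proof -
    have e: "err (w(pe m := x)) m k l = err w m k l" if "k < d" "l < d" for k l
      unfolding err_def using m that by (simp add: cell_indep Q_indep cong: sum.cong_simp)
    have 1: "err (w(pe m := x)) (Suc m) k l = err w m k l + sign_of x * c k l" if "k < d" "l < d" for k l
      using err_Suc[of "w(pe m := x)" m k l] h ne m that
      by (simp add: e cell_indep Q_indep c_def)
    have 2: "(\<Sum>\<beta><2 ^ b. mass (w(pe m := x)) (Suc m) \<beta>) = (\<Sum>\<beta><2 ^ b. mass w m \<beta>) + sign_of x * t + row2 w m"
      using mass_Suc[of "w(pe m := x)" m] h ne m
      by (simp add: indep_simps row_indep_simps cell_indep Q_indep t_def cong: sum.cong_simp)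
    show ?thesis unfolding pot_def err2_def 2 f_def using m
      by (simp add: 1 indep_simps row_indep_simps cong: sum.cong_simp)
  qed
  have f0: "0 \<le> f (sign_of x)" for x
    unfolding pot[symmetric] pot_def
    by (intro add_nonneg_nonneg mult_nonneg_nonneg err2_nonneg sum_nonneg mass_nonneg rest_nonneg) auto
  have f01: "0 \<le> f 1" "0 \<le> f (- 1)" using f0[of 0] f0[of 1] by (simp_all add: sign_of_def)
  have "(\<integral>\<^sup>+x. ennreal (pot (w(pe m := x)) (Suc m)) \<partial>unif)
      = (\<integral>\<^sup>+x. ennreal (if x \<le> 1 / 2 then f 1 else f (- 1)) \<partial>unif)"
    unfolding pot sign_of_def by (intro nn_integral_cong) auto
  also have "\<dots> = ennreal (1 / 2 * f 1 + (1 - 1 / 2) * f (- 1))"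
    using f01 by (intro nn_integral_unif_step_le) auto
  also have "1 / 2 * f 1 + (1 - 1 / 2) * f (- 1) = err2 w m + (\<Sum>k<d. \<Sum>l<d. (c k l)\<^sup>2)
     + 4 / 2 ^ b * ((\<Sum>\<beta><2 ^ b. mass w m \<beta>) + row2 w m) * rest w (Suc m)
     + 4 / 2 ^ b * (rest w (Suc m))\<^sup>2"
  proof -
    have sq: "(\<Sum>k<d. \<Sum>l<d. (err w m k l + 1 * c k l)\<^sup>2) + (\<Sum>k<d. \<Sum>l<d. (err w m k l + (- 1) * c k l)\<^sup>2)
        = 2 * err2 w m + 2 * (\<Sum>k<d. \<Sum>l<d. (c k l)\<^sup>2)"
      unfolding err2_def sum_distrib_left sum.distrib[symmetric]
      by (intro sum.cong refl) (simp add: power2_eq_square algebra_simps)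
    have alg: "1 / 2 * (P + a * (S + 1 * t + \<rho>) * r + z) + (1 - 1 / 2) * (P' + a * (S + (- 1) * t + \<rho>) * r + z)
        = (P + P') / 2 + a * (S + \<rho>) * r + z" for P P' a S \<rho> r z :: real
      by (simp add: algebra_simps add_divide_distrib)
    show ?thesis unfolding f_def alg sq by simp
  qed
  also have "ennreal \<dots> \<le> ennreal (mid w m)"
    unfolding mid_def c_def using square_cross_le[of "cell w m ?h" "Q w m"]
    by (intro ennreal_leI add_right_mono add_left_mono) (simp add: mass_def row2_def)
  finally show ?thesis .
qed

text \<open>The mass collected so far does not read the fresh bucket, and each bucket is hit with
  probability at most \<open>1 / 2 ^ b\<close>. Averaging thus replaces the mass of the chosen
  bucket by at most the mean mass of a bucket.\<close>

lemma step_pv: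
  assumes m: "m < R" and w: "w \<in> space uniform_tape"
  shows "(\<integral>\<^sup>+x. ennreal (mid (w(pv m := x)) m) \<partial>unif) \<le> ennreal (pot w m)"
proof -
  let ?S = "\<Sum>\<beta><2 ^ b. mass w m \<beta>"
  define C where "C = err2 w m + 4 / 2 ^ b * (?S + row2 w m) * rest w (Suc m) + 4 / 2 ^ b * (rest w (Suc m))\<^sup>2"
  have C0: "0 \<le> C" unfolding C_def
    by (intro add_nonneg_nonneg mult_nonneg_nonneg err2_nonneg sum_nonneg mass_nonneg rest_nonneg row2_nonneg) auto
  have mid: "mid (w(pv m := x)) m = C + 4 * row2 w m * mass w m (bucket b x)" for x
    unfolding mid_def C_def using m by (simp add: indep_simps row_indep_simps)
  have "(\<integral>\<^sup>+x. ennreal (mid (w(pv m := x)) m) \<partial>unif)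
      = (\<integral>\<^sup>+x. ennreal C + (\<Sum>\<beta><2 ^ b. ennreal (if bucket b x = \<beta> then 4 * row2 w m * mass w m \<beta> else 0)) \<partial>unif)"
  proof (rule nn_integral_cong)
    fix x assume "x \<in> space unif"
    then have h: "bucket b x < 2 ^ b" by (intro bucket_less) auto
    have "(\<Sum>\<beta><2 ^ b. ennreal (if bucket b x = \<beta> then 4 * row2 w m * mass w m \<beta> else 0))
        = ennreal (\<Sum>\<beta><2 ^ b. if bucket b x = \<beta> then 4 * row2 w m * mass w m \<beta> else 0)"
      by (subst sum_ennreal) (auto simp: row2_nonneg mass_nonneg)
    also have "\<dots> = ennreal (4 * row2 w m * mass w m (bucket b x))" using h by simp
    finally show "ennreal (mid (w(pv m := x)) m)
      = ennreal C + (\<Sum>\<beta><2 ^ b. ennreal (if bucket b x = \<beta> then 4 * row2 w m * mass w m \<beta> else 0))"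
      unfolding mid using C0 by (simp add: ennreal_plus row2_nonneg mass_nonneg)
  qed
  also have "\<dots> = ennreal C + (\<Sum>\<beta><2 ^ b. \<integral>\<^sup>+x. ennreal (if bucket b x = \<beta> then 4 * row2 w m * mass w m \<beta> else 0) \<partial>unif)"
  proof -
    have "(\<lambda>x. ennreal (if bucket b x = \<beta> then 4 * row2 w m * mass w m \<beta> else 0)) \<in> borel_measurable unif" for \<beta>
    proof (rule measurable_if_ennreal)
      have "bucket b \<in> measurable unif (count_space UNIV)"
        using measurable_compose[OF measurable_ident_unif measurable_bucket] by simp
      then show "Measurable.pred unif (\<lambda>x. bucket b x = \<beta>)" by measurable
    qed simp
    then show ?thesis
      by (subst nn_integral_add)
         (auto simp: nn_integral_unif_const nn_integral_sum simp del: nn_integral_const intro!: borel_measurable_sum)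
  qed
  also have "\<dots> \<le> ennreal C + (\<Sum>\<beta><2 ^ b. ennreal (4 * row2 w m * mass w m \<beta> * ((real \<beta> + 1) / 2 ^ b - real \<beta> / 2 ^ b)))"
  proof (intro add_left_mono sum_mono nn_integral_unif_interval)
    fix \<beta> x assume "x \<in> {0..1::real}" "\<not> (real \<beta> / 2 ^ b \<le> x \<and> x \<le> (real \<beta> + 1) / 2 ^ b)"
    then show "(if bucket b x = \<beta> then 4 * row2 w m * mass w m \<beta> else 0) = 0"
      using bucket_interval[of x b \<beta>] by auto
  qed (auto simp: row2_nonneg mass_nonneg divide_right_mono)
  also have "\<dots> = ennreal (C + (\<Sum>\<beta><2 ^ b. 4 * row2 w m * mass w m \<beta> / 2 ^ b))"
    using C0 by (subst sum_ennreal) (auto simp: row2_nonneg mass_nonneg diff_divide_distrib[symmetric] sum_nonneg ennreal_plus)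
  also have "C + (\<Sum>\<beta><2 ^ b. 4 * row2 w m * mass w m \<beta> / 2 ^ b) = C + 4 / 2 ^ b * ?S * row2 w m"
    by (simp add: sum_distrib_left sum_distrib_right sum_divide_distrib mult_ac)
  also have "ennreal \<dots> \<le> ennreal (pot w m)"
  proof (rule ennreal_leI)
    have "4 / 2 ^ b * (row2 w m * rest w (Suc m) + (rest w (Suc m))\<^sup>2) \<le> 4 / 2 ^ b * (rest w m)\<^sup>2"
      unfolding rest_Suc[OF m] using row2_nonneg[of w m] rest_nonneg[of w "Suc m"]
      by (intro mult_left_mono) (auto simp: power2_eq_square algebra_simps)
    then show "C + 4 / 2 ^ b * ?S * row2 w m \<le> pot w m"
      unfolding C_def pot_def rest_Suc[OF m] by (simp add: algebra_simps add_divide_distrib)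
  qed
  finally show ?thesis .
qed

lemma measurable_cell:
  assumes "m \<le> R" "k < d" shows "(\<lambda>w. cell w m \<beta> k) \<in> borel_measurable uniform_tape"
  unfolding cell_def
proof (rule borel_measurable_sum)
  fix r assume "r \<in> {..<m}"
  then have r: "r < R" using assms by simp
  have h: "(\<lambda>w. bucket b (w (pv r))) \<in> measurable uniform_tape (count_space UNIV)"
    by (rule measurable_compose[OF measurable_tape_component measurable_bucket])
  have s: "(\<lambda>w. sign_of (w (pe r))) \<in> borel_measurable uniform_tape"
    by (rule measurable_compose[OF measurable_tape_component measurable_sign_of])
  have "Measurable.pred uniform_tape (\<lambda>w. bucket b (w (pv r)) = \<beta>)"
    using h by measurable
  then show "(\<lambda>w. if bucket b (w (pv r)) = \<beta> then sign_of (w (pe r)) * Q w r k else 0)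
      \<in> borel_measurable uniform_tape"
    by (intro measurable_If borel_measurable_times s Q_meas[OF r assms(2)] borel_measurable_const) (simp add: pred_def)
qed

lemma measurable_pot:
  assumes "m \<le> R" shows "(\<lambda>w. ennreal (pot w m)) \<in> borel_measurable uniform_tape"
  unfolding pot_def err2_def err_def mass_def rest_def row2_def
  by (intro measurable_compose[OF _ measurable_ennreal] borel_measurable_add borel_measurable_times
      borel_measurable_const borel_measurable_sum borel_measurable_power borel_measurable_diff
      measurable_cell Q_meas) (use assms in auto)

lemma measurable_mid:
  assumes "m < R" shows "(\<lambda>w. ennreal (mid w m)) \<in> borel_measurable uniform_tape"
proof -
  have h: "(\<lambda>w. bucket b (w (pv m))) \<in> measurable uniform_tape (count_space UNIV)"
    by (rule measurable_compose[OF measurable_tape_component measurable_bucket])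
  have M: "(\<lambda>w. mass w m \<beta>) \<in> borel_measurable uniform_tape" for \<beta>
    unfolding mass_def using assms by (intro borel_measurable_sum borel_measurable_power measurable_cell) auto
  have "(\<lambda>w. mass w m (bucket b (w (pv m)))) \<in> borel_measurable uniform_tape"
    by (rule measurable_compose_countable[OF M h])
  then show ?thesis
    unfolding mid_def err2_def err_def rest_def row2_def
    by (intro measurable_compose[OF _ measurable_ennreal] borel_measurable_add borel_measurable_times
        borel_measurable_const borel_measurable_sum borel_measurable_power borel_measurable_diff
        measurable_cell Q_meas M) (use assms in auto)
qed

lemma expected_pot: "m \<le> R \<Longrightarrow>
  (\<integral>\<^sup>+w. ennreal (pot w m) \<partial>uniform_tape) \<le> (\<integral>\<^sup>+w. ennreal (pot w 0) \<partial>uniform_tape)"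
proof (induction m)
  case (Suc m)
  have "(\<integral>\<^sup>+w. ennreal (pot w (Suc m)) \<partial>uniform_tape) \<le> (\<integral>\<^sup>+w. ennreal (mid w m) \<partial>uniform_tape)"
    by (rule resample_le[OF measurable_pot step_pe]) (use Suc in auto)
  also have "\<dots> \<le> (\<integral>\<^sup>+w. ennreal (pot w m) \<partial>uniform_tape)"
    by (rule resample_le[OF measurable_mid step_pv]) (use Suc in auto)
  finally show ?case using Suc by simp
qed simp

lemma err2_small:
  assumes Q: "\<And>w. (\<Sum>r<R. row2 w r) \<le> D" and D: "0 \<le> D" and c: "0 < c"
  shows "small (\<lambda>w. c < err2 w R) (4 * D\<^sup>2 / 2 ^ b / c)"
proof (rule small_markov[OF measurable_pot[of R]])
  have "(\<integral>\<^sup>+w. ennreal (pot w 0) \<partial>uniform_tape) \<le> (\<integral>\<^sup>+w. ennreal (4 * D\<^sup>2 / 2 ^ b) \<partial>uniform_tape)"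
  proof (intro nn_integral_mono ennreal_leI)
    fix w
    have "(rest w 0)\<^sup>2 \<le> D\<^sup>2"
      using Q[of w] rest_nonneg[of w 0] by (intro power_mono) (auto simp: rest_def atLeast0LessThan)
    then show "pot w 0 \<le> 4 * D\<^sup>2 / 2 ^ b"
      by (simp add: pot_def err2_def err_def cell_def mass_def divide_right_mono)
  qed
  also have "\<dots> = ennreal (4 * D\<^sup>2 / 2 ^ b)" by (rule nn_integral_tape_const)
  finally show "(\<integral>\<^sup>+w. ennreal (pot w R) \<partial>uniform_tape) \<le> ennreal (4 * D\<^sup>2 / 2 ^ b)"
    using expected_pot[of R] by simp
  show "ennreal c \<le> ennreal (pot w R)" if "c < err2 w R" for w
  proof (rule ennreal_leI)
    have "err2 w R \<le> pot w R"
    proof -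
      have "0 \<le> 4 / 2 ^ b * (\<Sum>\<beta><2 ^ b. mass w R \<beta>) * rest w R"
        by (intro mult_nonneg_nonneg sum_nonneg mass_nonneg rest_nonneg) auto
      then show ?thesis by (simp add: pot_def)
    qed
    then show "c \<le> pot w R" using that by simp
  qed
qed (use c in auto)

text \<open>The error of the squared norm at \<open>c\<close> is the quadratic form of
  \<open>err\<close>, whose Frobenius norm is at most 1/2; two uses of Cauchy--Schwarz bound
  it.\<close>

lemma sketch_distortion:
  assumes "err2 w R \<le> 1 / 4"
  shows "\<bar>(\<Sum>\<beta><2 ^ b. (\<Sum>k<d. c k * cell w R \<beta> k)\<^sup>2) - (\<Sum>r<R. (\<Sum>k<d. c k * Q w r k)\<^sup>2)\<bar>
       \<le> (\<Sum>k<d. (c k)\<^sup>2) / 2"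
proof -
  let ?C = "\<Sum>k<d. (c k)\<^sup>2"
  have C0: "0 \<le> ?C" by (auto intro!: sum_nonneg)
  have sq: "(\<Sum>\<beta>\<in>I. (\<Sum>k<d. c k * F \<beta> k)\<^sup>2) = (\<Sum>k<d. \<Sum>l<d. c k * c l * (\<Sum>\<beta>\<in>I. F \<beta> k * F \<beta> l))"
    for I and F :: "nat \<Rightarrow> nat \<Rightarrow> real"
  proof -
    have "(\<Sum>\<beta>\<in>I. (\<Sum>k<d. c k * F \<beta> k)\<^sup>2) = (\<Sum>\<beta>\<in>I. \<Sum>k<d. \<Sum>l<d. c k * c l * (F \<beta> k * F \<beta> l))"
      by (simp add: power2_eq_square sum_product algebra_simps)
    also have "\<dots> = (\<Sum>k<d. \<Sum>\<beta>\<in>I. \<Sum>l<d. c k * c l * (F \<beta> k * F \<beta> l))" by (rule sum.swap)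
    also have "\<dots> = (\<Sum>k<d. \<Sum>l<d. \<Sum>\<beta>\<in>I. c k * c l * (F \<beta> k * F \<beta> l))"
      by (intro sum.cong refl sum.swap)
    finally show ?thesis by (simp add: sum_distrib_left)
  qed
  have "(\<Sum>\<beta><2 ^ b. (\<Sum>k<d. c k * cell w R \<beta> k)\<^sup>2) - (\<Sum>r<R. (\<Sum>k<d. c k * Q w r k)\<^sup>2)
      = (\<Sum>k<d. c k * (\<Sum>l<d. err w R k l * c l))"
    unfolding sq err_def by (simp add: sum_subtractf[symmetric] sum_distrib_left algebra_simps)
  moreover have "(\<Sum>k<d. c k * (\<Sum>l<d. err w R k l * c l))\<^sup>2 \<le> (?C / 2)\<^sup>2"
  proof -
    have "(\<Sum>k<d. c k * (\<Sum>l<d. err w R k l * c l))\<^sup>2 \<le> ?C * (\<Sum>k<d. (\<Sum>l<d. err w R k l * c l)\<^sup>2)"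
      by (rule cauchy_schwarz_sum)
    also have "\<dots> \<le> ?C * (\<Sum>k<d. (\<Sum>l<d. (err w R k l)\<^sup>2) * ?C)"
      using C0 by (intro mult_left_mono sum_mono cauchy_schwarz_sum)
    also have "\<dots> = ?C * ?C * err2 w R" by (simp add: err2_def sum_distrib_right[symmetric])
    also have "\<dots> \<le> ?C * ?C * (1 / 4)" using assms C0 by (intro mult_left_mono) auto
    finally show ?thesis by (simp add: power2_eq_square)
  qed
  then have "\<bar>\<Sum>k<d. c k * (\<Sum>l<d. err w R k l * c l)\<bar> \<le> ?C / 2"
    using C0 abs_le_square_iff[of "\<Sum>k<d. c k * (\<Sum>l<d. err w R k l * c l)" "?C / 2"] by simp
  ultimately show ?thesis by simp
qed

end

section \<open>Sampling by sketched scores\<close>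

text \<open>The maps \<open>pu\<close>, \<open>pv\<close>, \<open>pe\<close>, \<open>pw\<close>, \<open>pz\<close> are tape positions: of the scaling, bucket, sign and selection
  variables of a row, and of the random directions of the projections.\<close>

locale sampler =
  fixes R d b L m :: nat and p \<epsilon> \<kappa> \<tau> Cap :: real and B :: "nat \<Rightarrow> nat \<Rightarrow> real"
    and pu pv pe pw :: "nat \<Rightarrow> nat" and pz :: "nat \<Rightarrow> nat \<Rightarrow> nat"
  assumes p: "1 \<le> p" "p \<le> 2" and \<epsilon>: "0 < \<epsilon>" "\<epsilon> < 1" and d: "1 \<le> d" and R: "1 \<le> \<epsilon>\<^sup>2 * real R"
    and \<kappa>: "100 * real d * (1 + ln (100 * real R)) \<le> \<kappa>" and \<tau>: "1 \<le> \<tau>"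
    and m: "1000 * real R ^ 3 * real d * \<tau> \<le> real m"
    and net_small: "2 * real ((2 * m + 1) ^ d) * exp (- \<tau>) \<le> 1 / 100"
    and b: "1600 * (real d)\<^sup>2 \<le> 2 ^ b"
    and L: "1 \<le> L" "real R * real d * (1 / 16) ^ L \<le> 1 / 100"
    and Cap: "100 * (64 * \<tau> / \<epsilon>\<^sup>2 * (64 * \<kappa> * real d)\<^sup>2 * (128 * real L * real d ^ 3 * \<tau>\<^sup>2)) \<le> Cap"
    and inj: "inj_on pu {..<R}" "inj_on pv {..<R}" "inj_on pe {..<R}" "inj_on pw {..<R}"
    and pos: "\<And>r r'. r < R \<Longrightarrow> r' < R \<Longrightarrow> pu r \<noteq> pv r' \<and> pu r \<noteq> pe r' \<and> pv r \<noteq> pe r'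
          \<and> pw r \<noteq> pu r' \<and> pw r \<noteq> pv r' \<and> pw r \<noteq> pe r'"
    and pz: "\<And>l l' k k'. l < L \<Longrightarrow> l' < L \<Longrightarrow> k < d \<Longrightarrow> k' < d \<Longrightarrow> pz l k = pz l' k' \<longleftrightarrow> l = l' \<and> k = k'"
    and pz_pos: "\<And>l k r. l < L \<Longrightarrow> k < d \<Longrightarrow> r < R \<Longrightarrow>
          pz l k \<noteq> pu r \<and> pz l k \<noteq> pv r \<and> pz l k \<noteq> pe r \<and> pz l k \<noteq> pw r"
begin

definition scaled :: "(nat \<Rightarrow> real) \<Rightarrow> nat \<Rightarrow> nat \<Rightarrow> real" where
  "scaled w r j = w (pu r) powr (- 1 / p) * B r j"

definition sk :: "(nat \<Rightarrow> real) \<Rightarrow> nat \<Rightarrow> nat \<Rightarrow> real" where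
  "sk w i j = (\<Sum>r<R. if bucket b (w (pv r)) = i then sign_of (w (pe r)) * scaled w r j else 0)"

definition sT :: "(nat \<Rightarrow> real) \<Rightarrow> nat \<Rightarrow> nat \<Rightarrow> real" where
  "sT w = gsT (2 ^ b) d (sk w)"

definition coef :: "(nat \<Rightarrow> real) \<Rightarrow> nat \<Rightarrow> nat \<Rightarrow> real" where
  "coef w r k = mv d B (\<lambda>j. sT w j k) r"

definition proj :: "(nat \<Rightarrow> real) \<Rightarrow> nat \<Rightarrow> nat \<Rightarrow> real" where
  "proj w l r = mv d B (mv d (sT w) (\<lambda>k. w (pz l k))) r"

definition wt :: "(nat \<Rightarrow> real) \<Rightarrow> nat \<Rightarrow> real" where
  "wt w r = (\<Sum>l<L. (proj w l r)\<^sup>2)"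

text \<open>Balances the sampling tail: with rates at least \<open>\<Lambda>\<close> times the
  relative size of the entries, a relative deviation of \<open>\<epsilon> / 4\<close> has
  probability at most \<open>2 * exp (- \<tau>)\<close>.\<close>

definition \<Lambda> :: real where "\<Lambda> = 64 * \<tau> / \<epsilon>\<^sup>2"

text \<open>The factor \<open>64 * \<kappa> * real d\<close> is 32 from the projections, times
  \<open>2 * \<kappa>\<close> for the size of a coordinate of a unit vector, times \<open>d\<close>
  coordinates. Its square dominates its \<open>p\<close>-th power for every
  \<open>p \<le> 2\<close>.\<close>

definition lam :: real where "lam = \<Lambda> * (64 * \<kappa> * real d)\<^sup>2"

definition q :: "(nat \<Rightarrow> real) \<Rightarrow> nat \<Rightarrow> real" where
  "q w r = lam * wt w r powr (p / 2)"

definition sampled :: "(nat \<Rightarrow> real) \<Rightarrow> (nat \<Rightarrow> real) \<Rightarrow> real" where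
  "sampled w x = (\<Sum>r<R. if w (pw r) < q w r then \<bar>mv d B x r\<bar> powr p / min 1 (q w r) else 0)"

definition count :: "(nat \<Rightarrow> real) \<Rightarrow> real" where
  "count w = (\<Sum>r<R. if w (pw r) < q w r then 1 else 0)"

lemma R_ge: "1 \<le> R" "1 \<le> real R"
  using R \<epsilon> by (cases R; simp)+

lemma eps_R: "1 / real R \<le> \<epsilon>\<^sup>2"
  using R R_ge by (simp add: field_simps)

lemma \<kappa>_ge_1: "1 \<le> \<kappa>"
proof -
  have "0 \<le> ln (100 * real R)" using R_ge by simp
  then have "100 * 1 * (1 + 0) \<le> 100 * real d * (1 + ln (100 * real R))"
    using d by (intro mult_mono) auto
  with \<kappa> show ?thesis by simp
qed

lemma m_pos: "0 < m"
proof -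
  have "0 < 1000 * real R ^ 3 * real d * \<tau>" using R_ge d \<tau> by simp
  with m show ?thesis by (cases m) auto
qed

lemma measurable_scaled: "(\<lambda>w. scaled w r j) \<in> borel_measurable uniform_tape"
proof -
  have "(\<lambda>w. w (pu r) powr (- 1 / p)) \<in> borel_measurable uniform_tape"
    by (rule measurable_compose[OF measurable_tape_component]) measurable
  then show ?thesis unfolding scaled_def by (intro borel_measurable_times borel_measurable_const)
qed

text \<open>The sketch is linear, so it can be analysed on an orthonormal basis of the scaled
  columns. There the squared row norms sum to at most \<open>d\<close>, however large individual
  scalings are.\<close>

sublocale sk: sign_sketch R d b pv pe "\<lambda>w. gsV R d (scaled w)"
proof
  show "(\<lambda>w. gsV R d (scaled w) r k) \<in> borel_measurable uniform_tape" for r k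
    unfolding gsV_def mv_def
    by (intro borel_measurable_sum borel_measurable_times measurable_scaled measurable_gsT)
  have sc: "scaled (w(pv r := x)) r' = scaled w r'" "scaled (w(pe r := x)) r' = scaled w r'"
    if "r < R" "r' < R" for w r r' x
    using pos[OF that(2,1)] by (auto simp: scaled_def)
  have st: "stack R (scaled (w(pv r := x))) = stack R (scaled w)"
    "stack R (scaled (w(pe r := x))) = stack R (scaled w)" if "r < R" for w r x
    using sc[OF that] by (auto simp: stack_def fun_eq_iff)
  show "gsV R d (scaled (w(pv r := x))) r' k = gsV R d (scaled w) r' k"
    "gsV R d (scaled (w(pe r := x))) r' k = gsV R d (scaled w) r' k"
    if "r < R" "r' < R" for w r r' k x
    unfolding gsV_def mv_def gsT_def st[OF that(1)] sc[OF that] by (rule refl)+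
qed (use inj pos in auto)

lemma mv_scaled: "mv d (scaled w) x r = w (pu r) powr (- 1 / p) * mv d B x r"
  by (simp add: mv_def scaled_def sum_distrib_left mult.assoc)

lemma mv_sk:
  "mv d (sk w) x i = (\<Sum>k<d. gsc R d (scaled w) x k * sk.cell w R i k)"
proof -
  have "mv d (sk w) x i = (\<Sum>r<R. if bucket b (w (pv r)) = i then sign_of (w (pe r)) * mv d (scaled w) x r else 0)"
    unfolding mv_def sk_def sum_distrib_right sum_distrib_left
    by (subst sum.swap) (intro sum.cong, auto simp: sum_distrib_left mult.assoc)
  also have "\<dots> = (\<Sum>r<R. \<Sum>k<d. gsc R d (scaled w) x k *
      (if bucket b (w (pv r)) = i then sign_of (w (pe r)) * gsV R d (scaled w) r k else 0))"
    by (intro sum.cong) (auto simp: gsV_expansion sum_distrib_left mult_ac)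
  also have "\<dots> = (\<Sum>k<d. gsc R d (scaled w) x k * sk.cell w R i k)"
    unfolding sk.cell_def sum_distrib_left by (rule sum.swap)
  finally show ?thesis .
qed

section \<open>Norm distortion caused by scaling and sketching\<close>

definition snorm :: "(nat \<Rightarrow> real) \<Rightarrow> (nat \<Rightarrow> real) \<Rightarrow> real" where
  "snorm w x = (\<Sum>i<2 ^ b. (mv d (sk w) x i)\<^sup>2)"

definition dnorm :: "(nat \<Rightarrow> real) \<Rightarrow> (nat \<Rightarrow> real) \<Rightarrow> real" where
  "dnorm w x = (\<Sum>r<R. (mv d (scaled w) x r)\<^sup>2)"

lemma snorm_bounds:
  assumes "sk.err2 w R \<le> 1 / 4"
  shows "dnorm w x / 2 \<le> snorm w x" "snorm w x \<le> 2 * dnorm w x"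
proof -
  have 1: "snorm w x = (\<Sum>i<2 ^ b. (\<Sum>k<d. gsc R d (scaled w) x k * sk.cell w R i k)\<^sup>2)"
    unfolding snorm_def mv_sk ..
  have 2: "dnorm w x = (\<Sum>r<R. (\<Sum>k<d. gsc R d (scaled w) x k * gsV R d (scaled w) r k)\<^sup>2)"
    unfolding dnorm_def by (intro sum.cong) (auto simp: gsV_expansion)
  have 3: "(\<Sum>k<d. (gsc R d (scaled w) x k)\<^sup>2) = dnorm w x"
    unfolding dnorm_def by (rule gsc_norm)
  have "\<bar>snorm w x - dnorm w x\<bar> \<le> dnorm w x / 2"
    unfolding 1 2 using sk.sketch_distortion[OF assms, of "gsc R d (scaled w) x"] unfolding 3 2 .
  moreover have "0 \<le> dnorm w x" by (auto simp: dnorm_def intro!: sum_nonneg)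
  ultimately show "dnorm w x / 2 \<le> snorm w x" "snorm w x \<le> 2 * dnorm w x" by linarith+
qed

text \<open>No row is scaled by more than \<open>100 * real R\<close>. This makes the truncation in
  \<open>good_\<sigma>\<close> harmless and keeps scaled net errors small.\<close>

definition good_u :: "(nat \<Rightarrow> real) \<Rightarrow> bool" where
  "good_u w \<longleftrightarrow> (\<forall>r<R. 1 / (100 * real R) \<le> w (pu r))"

lemma good_u_small: "small (\<lambda>w. \<not> good_u w) (1 / 100)"
proof -
  let ?c = "1 / (100 * real R)"
  have c: "0 \<le> ?c" "?c \<le> 1" using R_ge by (auto simp: field_simps)
  have "small (\<lambda>w. w (pu r) < ?c) (?c / 1)" if "r < R" for r
  proof (rule small_markov)
    let ?f = "\<lambda>w. ennreal (if w (pu r) < ?c then 1 else 0)"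
    show m: "?f \<in> borel_measurable uniform_tape"
      by (intro measurable_if_ennreal pred_less_real measurable_tape_component borel_measurable_const)
    have "(\<integral>\<^sup>+w. ?f w \<partial>uniform_tape) \<le> (\<integral>\<^sup>+w. ennreal ?c \<partial>uniform_tape)"
    proof (rule resample_le[OF m, of "pu r"])
      fix w :: "nat \<Rightarrow> real"
      have "(\<integral>\<^sup>+x. ennreal (if (w(pu r := x)) (pu r) < ?c then 1 else 0) \<partial>unif)
          = (\<integral>\<^sup>+x. ennreal (if x < ?c then 1 else 0) \<partial>unif)" by simp
      also have "\<dots> = ennreal (?c * 1 + (1 - ?c) * 0)" using c by (intro nn_integral_unif_step) auto
      finally show "(\<integral>\<^sup>+x. ennreal (if (w(pu r := x)) (pu r) < ?c then 1 else 0) \<partial>unif) \<le> ennreal ?c"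
        by simp
    qed
    also have "\<dots> = ennreal ?c" by (rule nn_integral_tape_const)
    finally show "(\<integral>\<^sup>+w. ?f w \<partial>uniform_tape) \<le> ennreal ?c" .
  qed (use c in auto)
  then have "small (\<lambda>w. \<exists>r\<in>{..<R}. w (pu r) < ?c) (real (card {..<R}) * (?c / 1))"
    using c by (intro small_UN) auto
  then show ?thesis
    by (rule small_mono) (use R_ge in \<open>auto simp: good_u_def not_le\<close>)
qed

text \<open>Without truncation the sum has infinite mean unless all \<open>\<sigma> r\<close>
  vanish. With it the mean is at most \<open>d * (1 + ln (100 * real R))\<close>, and Markov's
  inequality loses the factor 100 in \<open>\<kappa>\<close>.\<close>

definition good_\<sigma> :: "(nat \<Rightarrow> real) \<Rightarrow> (nat \<Rightarrow> real) \<Rightarrow> bool" where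
  "good_\<sigma> \<sigma> w \<longleftrightarrow> (\<Sum>r<R. \<sigma> r * min (1 / w (pu r)) (100 * real R)) \<le> \<kappa>"

lemma good_\<sigma>_small:
  assumes \<sigma>: "\<And>r. 0 \<le> \<sigma> r" "(\<Sum>r<R. \<sigma> r) \<le> real d"
  shows "small (\<lambda>w. \<not> good_\<sigma> \<sigma> w) (1 / 100)"
proof -
  let ?l = "1 + ln (100 * real R)"
  have l: "0 < ?l" using R_ge by (simp add: add_pos_nonneg)
  let ?g = "\<lambda>r w. ennreal (\<sigma> r) * ennreal (min (1 / w (pu r)) (100 * real R))"
  have gm: "?g r \<in> borel_measurable uniform_tape" for r
  proof -
    have "(\<lambda>w. ennreal (min (1 / w (pu r)) (100 * real R))) \<in> borel_measurable uniform_tape"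
      by (rule measurable_compose[OF measurable_tape_component]) measurable
    then show ?thesis by simp
  qed
  have one: "(\<integral>\<^sup>+w. ?g r w \<partial>uniform_tape) \<le> ennreal (\<sigma> r * ?l)" for r
  proof -
    have "(\<integral>\<^sup>+w. ?g r w \<partial>uniform_tape) \<le> (\<integral>\<^sup>+w. ennreal (\<sigma> r * ?l) \<partial>uniform_tape)"
    proof (rule resample_le[OF gm[of r], of "pu r"])
      fix w :: "nat \<Rightarrow> real"
      have "(\<integral>\<^sup>+x. ?g r (w(pu r := x)) \<partial>unif)
          = ennreal (\<sigma> r) * (\<integral>\<^sup>+x. ennreal (min (1 / x) (100 * real R)) \<partial>unif)"
        unfolding fun_upd_same
        by (intro nn_integral_cmult measurable_compose[OF measurable_ident_unif]) measurable
      also have "\<dots> \<le> ennreal (\<sigma> r) * ennreal ?l"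
        using R_ge by (intro mult_left_mono nn_integral_unif_inverse) auto
      also have "\<dots> = ennreal (\<sigma> r * ?l)" using \<sigma> l by (simp add: ennreal_mult)
      finally show "(\<integral>\<^sup>+x. ?g r (w(pu r := x)) \<partial>unif) \<le> ennreal (\<sigma> r * ?l)" .
    qed
    also have "\<dots> = ennreal (\<sigma> r * ?l)" by (rule nn_integral_tape_const)
    finally show ?thesis .
  qed
  have "(\<integral>\<^sup>+w. (\<Sum>r<R. ?g r w) \<partial>uniform_tape) = (\<Sum>r<R. \<integral>\<^sup>+w. ?g r w \<partial>uniform_tape)"
    using gm by (intro nn_integral_sum) auto
  also have "\<dots> \<le> (\<Sum>r<R. ennreal (\<sigma> r * ?l))" using one by (intro sum_mono)
  also have "\<dots> = ennreal (\<Sum>r<R. \<sigma> r * ?l)"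
    using \<sigma> l by (intro sum_ennreal mult_nonneg_nonneg) auto
  also have "\<dots> \<le> ennreal (real d * ?l)"
    using \<sigma> l by (intro ennreal_leI) (simp add: sum_distrib_right[symmetric])
  finally have int: "(\<integral>\<^sup>+w. (\<Sum>r<R. ?g r w) \<partial>uniform_tape) \<le> ennreal (real d * ?l)" .
  have "small (\<lambda>w. \<not> good_\<sigma> \<sigma> w) (real d * ?l / (100 * real d * ?l))"
  proof (rule small_markov[OF _ _ _ int])
    show "(\<lambda>w. \<Sum>r<R. ?g r w) \<in> borel_measurable uniform_tape"
      using gm by (intro borel_measurable_sum)
    show "0 < 100 * real d * ?l" "0 \<le> real d * ?l" using d l by auto
    fix w assume w: "w \<in> space uniform_tape" "\<not> good_\<sigma> \<sigma> w"
    have "(\<Sum>r<R. ?g r w) = (\<Sum>r<R. ennreal (\<sigma> r * min (1 / w (pu r)) (100 * real R)))"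
      using \<sigma> w R_ge by (intro sum.cong) (auto simp: ennreal_mult space_tape)
    also have "\<dots> = ennreal (\<Sum>r<R. \<sigma> r * min (1 / w (pu r)) (100 * real R))"
      using \<sigma> w by (intro sum_ennreal mult_nonneg_nonneg) (auto simp: space_tape)
    finally show "ennreal (100 * real d * ?l) \<le> (\<Sum>r<R. ?g r w)"
      using w(2) \<kappa> by (auto simp: good_\<sigma>_def intro!: ennreal_leI)
  qed
  then show ?thesis using d l by simp
qed

text \<open>With \<open>a r = \<bar>mv d B x r\<bar> powr p / w (pu r)\<close>, a squared scaled
  entry is \<open>a r powr (2 / p)\<close>. Since \<open>a\<close> sums to at most
  \<open>\<kappa>\<close> and \<open>2 / p \<le> 2\<close>, each square is at most
  \<open>\<kappa> * a r\<close>, and the sum at most \<open>\<kappa>\<^sup>2\<close>.\<close>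

lemma dnorm_upper:
  assumes \<sigma>: "\<And>r. 0 \<le> \<sigma> r" "\<And>x r. r < R \<Longrightarrow> \<bar>mv d B x r\<bar> powr p \<le> \<sigma> r * pn R p (mv d B x)"
    and w: "good_u w" "good_\<sigma> \<sigma> w" and x: "pn R p (mv d B x) = 1"
  shows "dnorm w x \<le> \<kappa>\<^sup>2"
proof -
  define a where "a r = \<bar>mv d B x r\<bar> powr p / w (pu r)" for r
  have u: "0 < w (pu r)" "1 / w (pu r) \<le> 100 * real R" if "r < R" for r
  proof -
    have "1 / (100 * real R) \<le> w (pu r)" using w(1) that by (simp add: good_u_def)
    moreover have "0 < 1 / (100 * real R)" using R_ge by simp
    ultimately show u0: "0 < w (pu r)" by linarith
    then show "1 / w (pu r) \<le> 100 * real R"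
      using \<open>1 / (100 * real R) \<le> w (pu r)\<close> R_ge by (simp add: field_simps)
  qed
  have a0: "0 \<le> a r" if "r < R" for r using u[OF that] by (simp add: a_def)
  have "(\<Sum>r<R. a r) \<le> (\<Sum>r<R. \<sigma> r * min (1 / w (pu r)) (100 * real R))"
  proof (rule sum_mono)
    fix r assume "r \<in> {..<R}"
    then have r: "r < R" by simp
    have "a r \<le> \<sigma> r / w (pu r)"
      unfolding a_def using \<sigma>(2)[OF r, of x] x u[OF r] by (intro divide_right_mono) auto
    also have "\<dots> = \<sigma> r * min (1 / w (pu r)) (100 * real R)" using u(2)[OF r] by (simp add: min_def)
    finally show "a r \<le> \<sigma> r * min (1 / w (pu r)) (100 * real R)" .
  qed
  also have "\<dots> \<le> \<kappa>" using w(2) by (simp add: good_\<sigma>_def)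
  finally have sum: "(\<Sum>r<R. a r) \<le> \<kappa>" .
  have ak: "a r \<le> \<kappa>" if "r < R" for r
    using member_le_sum[of r "{..<R}" a] a0 that sum by auto
  have sq_le: "(mv d (scaled w) x r)\<^sup>2 \<le> \<kappa> * a r" if r: "r < R" for r
  proof -
    have e: "(mv d (scaled w) x r)\<^sup>2 = (a r) powr (2 / p)"
    proof (cases "mv d B x r = 0")
      case True then show ?thesis by (simp add: mv_scaled a_def)
    next
      case False
      have "(mv d (scaled w) x r)\<^sup>2 = (w (pu r) powr (- 1 / p))\<^sup>2 * (mv d B x r)\<^sup>2"
        by (simp add: mv_scaled power_mult_distrib)
      also have "(w (pu r) powr (- 1 / p))\<^sup>2 = w (pu r) powr (- (2 / p))"
        using u(1)[OF r] by (simp add: power2_eq_square powr_add[symmetric])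
      also have "(mv d B x r)\<^sup>2 = (\<bar>mv d B x r\<bar> powr p) powr (2 / p)"
        unfolding powr_powr using False p by (simp add: powr_numeral)
      also have "w (pu r) powr (- (2 / p)) * (\<bar>mv d B x r\<bar> powr p) powr (2 / p) = (a r) powr (2 / p)"
        unfolding a_def powr_divide powr_minus by (simp add: divide_inverse mult.commute)
      finally show ?thesis .
    qed
    show ?thesis
    proof (cases "a r = 0")
      case False
      then have pos: "0 < a r" using a0[OF r] by simp
      have t: "0 \<le> 2 / p - 1" "2 / p - 1 \<le> 1" using p by (auto simp: field_simps)
      have "(a r) powr (2 / p) = a r * a r powr (2 / p - 1)"
        using pos powr_add[of "a r" 1 "2 / p - 1"] by simp
      also have "\<dots> \<le> a r * \<kappa> powr (2 / p - 1)"
        using pos ak[OF r] t by (intro mult_left_mono powr_mono2) auto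
      also have "\<dots> \<le> a r * \<kappa> powr 1"
        using pos \<kappa>_ge_1 t by (intro mult_left_mono powr_mono) auto
      finally show ?thesis unfolding e using \<kappa>_ge_1 by (simp add: mult.commute)
    qed (simp add: e)
  qed
  have "dnorm w x \<le> (\<Sum>r<R. \<kappa> * a r)"
    unfolding dnorm_def using sq_le by (intro sum_mono) auto
  also have "\<dots> \<le> \<kappa> * \<kappa>"
    using sum \<kappa>_ge_1 by (simp add: sum_distrib_left[symmetric])
  finally show ?thesis by (simp add: power2_eq_square)
qed

definition net_of :: "(nat \<Rightarrow> real) set \<Rightarrow> bool" where
  "net_of X \<longleftrightarrow> finite X \<and> card X \<le> (2 * m + 1) ^ d \<and>
     (\<forall>x. pn R p (mv d B x) = 1 \<longrightarrow>
        (\<exists>x'\<in>X. \<forall>r<R. \<bar>mv d B x r - mv d B x' r\<bar> \<le> real d / real m))"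

lemma net_exists: "\<exists>X. net_of X"
proof -
  have "0 < p" using p by simp
  from net[OF this p(2) m_pos, of d R B] show ?thesis unfolding net_of_def by metis
qed

text \<open>On positive cells this says that the \<open>p\<close>-th power of some scaled entry is
  at least the power sum divided by \<open>\<tau>\<close>. This one entry supplies the lower bound
  on \<open>dnorm\<close>.\<close>

definition good_net :: "(nat \<Rightarrow> real) set \<Rightarrow> (nat \<Rightarrow> real) \<Rightarrow> bool" where
  "good_net X w \<longleftrightarrow> (\<forall>x\<in>X. 0 < pn R p (mv d B x) \<longrightarrow>
     (\<exists>r<R. w (pu r) \<le> \<tau> * (\<bar>mv d B x r\<bar> powr p / pn R p (mv d B x))))"

lemma net_card_small:
  assumes "net_of X" "0 \<le> c" "c \<le> 2 * exp (- \<tau>)" shows "real (card X) * c \<le> 1 / 100"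
proof -
  have "real (card X) * c \<le> real ((2 * m + 1) ^ d) * (2 * exp (- \<tau>))"
    using assms by (intro mult_mono) (auto simp: net_of_def simp del: of_nat_power)
  also have "\<dots> \<le> 1 / 100" using net_small by (simp add: algebra_simps)
  finally show ?thesis .
qed

lemma good_net_small:
  assumes X: "net_of X" shows "small (\<lambda>w. \<not> good_net X w) (1 / 100)"
proof -
  have "small (\<lambda>w. 0 < pn R p (mv d B x) \<and>
      (\<forall>r<R. \<tau> * (\<bar>mv d B x r\<bar> powr p / pn R p (mv d B x)) < w (pu r))) (exp (- \<tau>))" for x
  proof (cases "0 < pn R p (mv d B x)")
    case True
    have "small (\<lambda>w. \<forall>r<R. \<tau> * (\<bar>mv d B x r\<bar> powr p / pn R p (mv d B x)) < w (pu r))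
        (exp (- \<tau> * (\<Sum>r<R. \<bar>mv d B x r\<bar> powr p / pn R p (mv d B x))))"
      using True \<tau> by (intro all_above_small inj) auto
    moreover have "(\<Sum>r<R. \<bar>mv d B x r\<bar> powr p / pn R p (mv d B x)) = 1"
      unfolding sum_divide_distrib[symmetric] pn_def[symmetric] using True by simp
    ultimately show ?thesis using True by simp
  next
    case False
    then show ?thesis unfolding small_def by (intro conjI bexI[of _ "{}"]) auto
  qed
  then have "small (\<lambda>w. \<exists>x\<in>X. 0 < pn R p (mv d B x) \<and>
      (\<forall>r<R. \<tau> * (\<bar>mv d B x r\<bar> powr p / pn R p (mv d B x)) < w (pu r))) (real (card X) * exp (- \<tau>))"
    using X by (intro small_UN) (auto simp: net_of_def)
  then show ?thesis
    by (rule small_mono) (use net_card_small[OF X, of "exp (- \<tau>)"] in \<open>auto simp: good_net_def not_le\<close>)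
qed

lemma mesh_small:
  shows "real d / real m \<le> 1 / (1000 * real R ^ 3 * \<tau>)"
    and "real d / real m \<le> 1"
proof -
  have pos: "0 < 1000 * real R ^ 3 * \<tau>" using R_ge \<tau> by simp
  show *: "real d / real m \<le> 1 / (1000 * real R ^ 3 * \<tau>)"
    using m m_pos pos by (simp add: field_simps)
  have "1 \<le> 1000 * real R ^ 3 * \<tau>"
  proof -
    have "1 \<le> real R ^ 3" using R_ge(2) by (rule one_le_power)
    then have "1 * 1 \<le> (1000 * real R ^ 3) * \<tau>" using \<tau> by (intro mult_mono) auto
    then show ?thesis by simp
  qed
  then have "1 / (1000 * real R ^ 3 * \<tau>) \<le> 1" by (simp only: divide_le_eq_1_pos[OF pos])
  with * show "real d / real m \<le> 1" by linarith
qed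

text \<open>The mesh is given in terms of \<open>R\<close>; the inequality
  \<open>1 / real R \<le> \<epsilon>\<^sup>2\<close> converts a surplus power of \<open>R\<close>
  into the dependence on \<open>\<epsilon>\<close>.\<close>

lemma perturbation_pn:
  assumes "\<And>r. r < R \<Longrightarrow> \<bar>z r\<bar> \<le> real d / real m"
  shows "pn R p z \<le> \<epsilon>\<^sup>2 / (1000 * real R)"
proof -
  have "\<bar>z r\<bar> powr p \<le> real d / real m" if "r < R" for r
  proof -
    have "\<bar>z r\<bar> powr p \<le> (real d / real m) powr p"
      using assms[OF that] p by (intro powr_mono2) auto
    also have "\<dots> \<le> (real d / real m) powr 1"
      using mesh_small p by (intro powr_mono') auto
    finally show ?thesis by simp
  qed
  then have "pn R p z \<le> real R * (real d / real m)"
    unfolding pn_def using sum_bounded_above[of "{..<R}" "\<lambda>r. \<bar>z r\<bar> powr p" "real d / real m"] by auto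
  also have "\<dots> \<le> real R * (1 / (1000 * real R ^ 3 * \<tau>))"
    using mesh_small by (intro mult_left_mono) auto
  also have "\<dots> \<le> real R * (1 / (1000 * real R ^ 3))"
  proof -
    have "1000 * real R ^ 3 * 1 \<le> 1000 * real R ^ 3 * \<tau>" using \<tau> by (intro mult_left_mono) auto
    then show ?thesis using R_ge by (intro mult_left_mono divide_left_mono) auto
  qed
  also have "\<dots> = (1 / real R) / (1000 * real R)"
    using R_ge by (simp add: power3_eq_cube field_simps)
  also have "\<dots> \<le> \<epsilon>\<^sup>2 / (1000 * real R)"
    using eps_R R_ge by (intro divide_right_mono) auto
  finally show ?thesis .
qed

text \<open>The net point has a scaled entry of size at least \<open>1 / (4 * \<tau>)\<close>. Its
  row is scaled by at most \<open>100 * real R\<close>, so moving on to \<open>x\<close> loses at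
  most half of that; squaring \<open>1 / (8 * \<tau>)\<close> gives the 64.\<close>

lemma dnorm_lower:
  assumes X: "net_of X" and w: "good_u w" "good_net X w" and x: "pn R p (mv d B x) = 1"
  shows "1 \<le> 64 * \<tau>\<^sup>2 * dnorm w x"
proof -
  obtain x' where x': "x' \<in> X" "\<And>r. r < R \<Longrightarrow> \<bar>mv d B x r - mv d B x' r\<bar> \<le> real d / real m"
    using X x unfolding net_of_def by blast
  let ?z = "\<lambda>r. mv d B x r - mv d B x' r"
  have z: "pn R p ?z \<le> 1 / 1000"
  proof -
    have "pn R p ?z \<le> \<epsilon>\<^sup>2 / (1000 * real R)" by (rule perturbation_pn) (rule x'(2))
    also have "\<dots> \<le> 1 / (1000 * 1)"
      using \<epsilon> R_ge by (intro frac_le) (auto simp: power_le_one)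
    finally show ?thesis by simp
  qed
  have "pn R p (mv d B x) \<le> (1 + 1) * (pn R p (mv d B x') + pn R p ?z / 1)"
    using pn_add_le[OF p, of 1 R "mv d B x'" ?z] by simp
  then have N': "1 / 4 \<le> pn R p (mv d B x')" using x z by simp
  then obtain r where r: "r < R" "w (pu r) \<le> \<tau> * (\<bar>mv d B x' r\<bar> powr p / pn R p (mv d B x'))"
    using w(2) x'(1) unfolding good_net_def by fastforce
  have ur: "1 / (100 * real R) \<le> w (pu r)" using w(1) r by (simp add: good_u_def)
  have ur0: "0 < w (pu r)"
    by (rule less_le_trans[OF _ ur]) (use R_ge in simp)
  define s where "s = w (pu r) powr (- 1 / p)"
  have s0: "0 < s" using ur0 by (simp add: s_def)
  have s_le: "s \<le> 100 * real R"
  proof -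
    have "s = (1 / w (pu r)) powr (1 / p)"
      unfolding s_def powr_divide using powr_minus_divide[of "w (pu r)" "1 / p"] by simp
    also have "\<dots> \<le> (100 * real R) powr (1 / p)"
      using ur ur0 R_ge p by (intro powr_mono2) (auto simp: field_simps)
    also have "\<dots> \<le> (100 * real R) powr 1"
      using R_ge p by (intro powr_mono) auto
    finally show ?thesis using R_ge by simp
  qed
  have "w (pu r) \<le> \<tau> * (\<bar>mv d B x' r\<bar> powr p / (1 / 4))"
    using r(2) N' \<tau> by (elim order_trans) (intro mult_left_mono divide_left_mono, auto)
  then have "1 / (4 * \<tau>) \<le> \<bar>mv d B x' r\<bar> powr p / w (pu r)"
    using ur0 \<tau> by (simp add: field_simps)
  then have "(1 / (4 * \<tau>)) powr (1 / p) \<le> (\<bar>mv d B x' r\<bar> powr p / w (pu r)) powr (1 / p)"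
    using \<tau> p by (intro powr_mono2) auto
  also have "\<dots> = s * \<bar>mv d B x' r\<bar>"
    using ur0 p unfolding powr_divide powr_powr s_def by (simp add: powr_minus divide_inverse)
  finally have "(1 / (4 * \<tau>)) powr (1 / p) \<le> s * \<bar>mv d B x' r\<bar>" .
  moreover have "(1 / (4 * \<tau>)) powr 1 \<le> (1 / (4 * \<tau>)) powr (1 / p)"
    using \<tau> p by (intro powr_mono') auto
  ultimately have 1: "1 / (4 * \<tau>) \<le> s * \<bar>mv d B x' r\<bar>" using \<tau> by simp
  have "s * \<bar>?z r\<bar> \<le> (100 * real R) * (1 / (1000 * real R ^ 3 * \<tau>))"
    using s_le s0 x'(2)[OF r(1)] mesh_small by (intro mult_mono) auto
  also have "\<dots> = (1 / (10 * \<tau>)) * (1 / real R ^ 2)"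
    using R_ge \<tau> by (simp add: field_simps power2_eq_square power3_eq_cube)
  also have "\<dots> \<le> 1 / (8 * \<tau>) * 1"
    using R_ge \<tau> by (intro mult_mono) (auto simp: field_simps)
  finally have 2: "s * \<bar>?z r\<bar> \<le> 1 / (8 * \<tau>)" by simp
  have "s * \<bar>mv d B x' r\<bar> \<le> s * \<bar>mv d B x r\<bar> + s * \<bar>?z r\<bar>"
    using s0 by (simp add: distrib_left[symmetric])
  with 1 2 have "1 / (4 * \<tau>) - 1 / (8 * \<tau>) \<le> s * \<bar>mv d B x r\<bar>" by linarith
  then have "1 / (8 * \<tau>) \<le> s * \<bar>mv d B x r\<bar>" using \<tau> by (simp add: field_simps)
  then have "(1 / (8 * \<tau>))\<^sup>2 \<le> (s * \<bar>mv d B x r\<bar>)\<^sup>2"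
    using \<tau> by (intro power_mono) auto
  also have "\<dots> = (mv d (scaled w) x r)\<^sup>2"
    by (simp add: mv_scaled s_def power_mult_distrib)
  also have "\<dots> \<le> dnorm w x"
    unfolding dnorm_def using r(1) by (intro member_le_sum) auto
  finally show ?thesis using \<tau> by (simp add: field_simps power2_eq_square)
qed

end

section \<open>Measurability and independence of the sampling rates\<close>

context sampler
begin

lemma measurable_sk: "(\<lambda>w. sk w i j) \<in> borel_measurable uniform_tape"
  unfolding sk_def
proof (rule borel_measurable_sum)
  fix r
  have h: "(\<lambda>w. bucket b (w (pv r))) \<in> measurable uniform_tape (count_space UNIV)"
    by (rule measurable_compose[OF measurable_tape_component measurable_bucket])
  have s: "(\<lambda>w. sign_of (w (pe r))) \<in> borel_measurable uniform_tape"
    by (rule measurable_compose[OF measurable_tape_component measurable_sign_of])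
  have "Measurable.pred uniform_tape (\<lambda>w. bucket b (w (pv r)) = i)"
    using h by measurable
  then show "(\<lambda>w. if bucket b (w (pv r)) = i then sign_of (w (pe r)) * scaled w r j else 0)
      \<in> borel_measurable uniform_tape"
    by (intro measurable_If borel_measurable_times s measurable_scaled borel_measurable_const)
       (simp add: pred_def)
qed

lemma measurable_sT: "(\<lambda>w. sT w j k) \<in> borel_measurable uniform_tape"
  unfolding sT_def by (intro measurable_gsT measurable_sk)

lemma measurable_coef: "(\<lambda>w. coef w r k) \<in> borel_measurable uniform_tape"
  unfolding coef_def mv_def
  by (intro borel_measurable_sum borel_measurable_times measurable_sT borel_measurable_const)

lemma proj_eq: "proj w l r = (\<Sum>k<d. coef w r k * w (pz l k))"
  unfolding proj_def mv_mv coef_def ..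

lemma measurable_q: "(\<lambda>w. q w r) \<in> borel_measurable uniform_tape"
proof -
  have wt: "(\<lambda>w. wt w r) \<in> borel_measurable uniform_tape"
    unfolding wt_def proj_eq
    by (intro borel_measurable_sum borel_measurable_times borel_measurable_power
        measurable_coef measurable_tape_component)
  have "(\<lambda>x. x powr (p / 2)) \<in> borel_measurable borel" by measurable
  from measurable_compose[OF wt this] show ?thesis
    unfolding q_def by (intro borel_measurable_times borel_measurable_const)
qed

lemma sk_indep:
  assumes "\<And>r. r < R \<Longrightarrow> i \<noteq> pu r \<and> i \<noteq> pv r \<and> i \<noteq> pe r"
  shows "sk (w(i := x)) = sk w"
  unfolding sk_def scaled_def using assms by (intro ext sum.cong) auto

lemma coef_indep:
  assumes "\<And>r. r < R \<Longrightarrow> i \<noteq> pu r \<and> i \<noteq> pv r \<and> i \<noteq> pe r"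
  shows "coef (w(i := x)) = coef w"
  using sk_indep[OF assms, where w=w and x=x] by (intro ext) (simp add: coef_def sT_def)

lemma q_indep:
  assumes "r < R" shows "q (w(pw r := x)) r' = q w r'"
proof -
  have c: "coef (w(pw r := x)) = coef w"
    using pos[OF assms] pos by (intro coef_indep) auto
  have "proj (w(pw r := x)) l r' = proj w l r'" if "l < L" for l
    unfolding proj_eq c using pz_pos[OF that _ assms] by (intro sum.cong) auto
  then show ?thesis by (simp add: q_def wt_def)
qed

text \<open>One projection stays below the threshold 1/32 with probability at most 1/16, hence
  \<open>(1 / 16) ^ L\<close>. Each coefficient of a row is treated separately, at the price of a
  union bound over \<open>R * d\<close> pairs.\<close>

definition good_proj :: "(nat \<Rightarrow> real) \<Rightarrow> bool" where
  "good_proj w \<longleftrightarrow> (\<forall>r<R. \<forall>k<d. coef w r k = 0 \<or> (\<exists>l<L. \<bar>coef w r k\<bar> / 32 < \<bar>proj w l r\<bar>))"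

lemma good_proj_small: "small (\<lambda>w. \<not> good_proj w) (1 / 100)"
proof -
  have one: "small (\<lambda>w. coef w r k \<noteq> 0 \<and> (\<forall>l<L. \<bar>\<Sum>k<d. coef w r k * w (pz l k)\<bar> \<le> 1 / 32 * \<bar>coef w r k\<bar>)) ((2 * (1 / 32)) ^ L)"
    if "k < d" for r k
  proof (rule projections_small)
    show "coef (w(pz l k := x)) r k' = coef w r k'" if "l < L" "k' < d" for w l x k'
      using pz_pos[OF that(1) \<open>k < d\<close>] by (subst coef_indep) auto
  qed (use that pz measurable_coef in auto)
  have "small (\<lambda>w. \<exists>k\<in>{..<d}. coef w r k \<noteq> 0 \<and> (\<forall>l<L. \<bar>\<Sum>k<d. coef w r k * w (pz l k)\<bar> \<le> 1 / 32 * \<bar>coef w r k\<bar>))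
      (real (card {..<d}) * (2 * (1 / 32)) ^ L)" for r
    using one by (intro small_UN) auto
  then have "small (\<lambda>w. \<exists>r\<in>{..<R}. \<exists>k\<in>{..<d}. coef w r k \<noteq> 0 \<and> (\<forall>l<L. \<bar>\<Sum>k<d. coef w r k * w (pz l k)\<bar> \<le> 1 / 32 * \<bar>coef w r k\<bar>))
      (real (card {..<R}) * (real (card {..<d}) * (2 * (1 / 32)) ^ L))"
    by (intro small_UN[of "{..<R}"]) auto
  then show ?thesis
  proof (rule small_mono)
    show "real (card {..<R}) * (real (card {..<d}) * (2 * (1 / 32)) ^ L) \<le> 1 / 100"
      using L by (simp add: mult.assoc)
    fix w assume "\<not> good_proj w"
    then obtain r k where "r < R" "k < d" "coef w r k \<noteq> 0" "\<forall>l<L. \<not> \<bar>coef w r k\<bar> / 32 < \<bar>proj w l r\<bar>"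
      unfolding good_proj_def by blast
    then show "\<exists>r\<in>{..<R}. \<exists>k\<in>{..<d}. coef w r k \<noteq> 0 \<and>
        (\<forall>l<L. \<bar>\<Sum>k<d. coef w r k * w (pz l k)\<bar> \<le> 1 / 32 * \<bar>coef w r k\<bar>)"
      by (intro bexI[of _ r] bexI[of _ k]) (auto simp: proj_eq not_less)
  qed
qed

definition good :: "(nat \<Rightarrow> real) \<Rightarrow> bool" where
  "good w \<longleftrightarrow> sk.err2 w R \<le> 1 / 4 \<and> good_proj w \<and>
     (\<forall>x. pn R p (mv d B x) = 1 \<longrightarrow> dnorm w x \<le> \<kappa>\<^sup>2 \<and> 1 \<le> 64 * \<tau>\<^sup>2 * dnorm w x)"

lemma good_small: "small (\<lambda>w. \<not> good w) (5 / 100)"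
proof -
  obtain \<sigma> where \<sigma>: "\<And>r. 0 \<le> \<sigma> r" "(\<Sum>r<R. \<sigma> r) \<le> real d"
    "\<And>x r. r < R \<Longrightarrow> \<bar>mv d B x r\<bar> powr p \<le> \<sigma> r * pn R p (mv d B x)"
    using sensitivities[OF p, of R d B] by blast
  obtain X where X: "net_of X" using net_exists by blast
  have "small (\<lambda>w. 1 / 4 < sk.err2 w R) (4 * (real d)\<^sup>2 / 2 ^ b / (1 / 4))"
  proof (rule sk.err2_small)
    fix w
    have "(\<Sum>r<R. sk.row2 w r) = (\<Sum>k<d. \<Sum>r<R. (gsV R d (scaled w) r k)\<^sup>2)"
      unfolding sk.row2_def by (rule sum.swap)
    also have "\<dots> \<le> (\<Sum>k<d. 1)" by (intro sum_mono) (auto intro: gsV_norm_le)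
    finally show "(\<Sum>r<R. sk.row2 w r) \<le> real d" by simp
  qed auto
  moreover have "4 * (real d)\<^sup>2 / 2 ^ b / (1 / 4) \<le> 1 / 100"
    using b by (simp add: field_simps)
  ultimately have err: "small (\<lambda>w. 1 / 4 < sk.err2 w R) (1 / 100)"
    by (elim small_mono)
  have "small (\<lambda>w. ((((1 / 4 < sk.err2 w R) \<or> \<not> good_proj w) \<or> \<not> good_u w) \<or> \<not> good_\<sigma> \<sigma> w) \<or> \<not> good_net X w)
      (1 / 100 + 1 / 100 + 1 / 100 + 1 / 100 + 1 / 100)"
    by (intro small_disj err good_proj_small good_u_small good_\<sigma>_small good_net_small X \<sigma>)
  then show ?thesis
  proof (rule small_mono)
    fix w assume "\<not> good w"
    then show "((((1 / 4 < sk.err2 w R) \<or> \<not> good_proj w) \<or> \<not> good_u w) \<or> \<not> good_\<sigma> \<sigma> w) \<or> \<not> good_net X w"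
      using dnorm_upper[OF \<sigma>(1,3), of w] dnorm_lower[OF X, of w] by (auto simp: good_def)
  qed simp
qed

section \<open>Sketched scores as upper bounds on sensitivities, and their sum\<close>

lemma snorm_scale: "snorm w (\<lambda>j. c * x j) = c\<^sup>2 * snorm w x"
  by (simp add: snorm_def mv_scale power_mult_distrib sum_distrib_left)

text \<open>By homogeneity from the unit sphere. In particular a vector that is sketched to 0 is
  mapped to 0 by \<open>B\<close>.\<close>

lemma pn_le_snorm:
  assumes "good w"
  shows "pn R p (mv d B x) powr (2 / p) \<le> 128 * \<tau>\<^sup>2 * snorm w x"
proof (cases "pn R p (mv d B x) = 0")
  case True
  then show ?thesis by (auto simp: snorm_def intro!: mult_nonneg_nonneg sum_nonneg)
next
  case False
  define N where "N = pn R p (mv d B x)"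
  have N: "0 < N" using False pn_nonneg[of R p "mv d B x"] by (simp add: N_def)
  let ?x = "\<lambda>j. N powr (- 1 / p) * x j"
  have 1: "pn R p (mv d B ?x) = 1"
    unfolding N_def by (rule pn_mv_normalize) (use p N in \<open>auto simp: N_def\<close>)
  have "1 \<le> 64 * \<tau>\<^sup>2 * dnorm w ?x" using assms 1 by (simp add: good_def)
  also have "\<dots> \<le> 64 * \<tau>\<^sup>2 * (2 * snorm w ?x)"
    using snorm_bounds(1)[of w ?x] assms by (intro mult_left_mono) (auto simp: good_def)
  also have "\<dots> = 128 * \<tau>\<^sup>2 * snorm w x * (N powr (- 1 / p))\<^sup>2"
    by (simp add: snorm_scale)
  also have "(N powr (- 1 / p))\<^sup>2 = 1 / N powr (2 / p)"
    using N powr_minus_divide[of N "2 / p"] by (simp add: power2_eq_square powr_add[symmetric])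
  finally show ?thesis using N by (simp add: N_def[symmetric] field_simps)
qed

text \<open>\<open>x\<close> and \<open>T\<close> applied to its coordinates have equal sketches, so
  their difference is sketched to 0 and hence annihilated by \<open>B\<close>. Rank-deficient inputs
  are covered in this way.\<close>

lemma gsT_image:
  assumes "good w" "r < R"
  shows "mv d B x r = (\<Sum>k<d. coef w r k * gsc (2 ^ b) d (sk w) x k)"
proof -
  let ?y = "mv d (sT w) (gsc (2 ^ b) d (sk w) x)"
  let ?z = "\<lambda>j. x j - ?y j"
  have "mv d (sk w) ?z i = 0" if "i < 2 ^ b" for i
    unfolding mv_diff sT_def using mv_gsT[OF that, of d "sk w" x] by simp
  then have "snorm w ?z = 0" by (simp add: snorm_def)
  then have "pn R p (mv d B ?z) powr (2 / p) \<le> 0" using pn_le_snorm[OF assms(1), of ?z] by simp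
  then have "pn R p (mv d B ?z) = 0" by simp
  from pn_eq_0[OF this assms(2)] have "mv d B x r = mv d B ?y r" by (simp add: mv_diff)
  also have "\<dots> = (\<Sum>k<d. coef w r k * gsc (2 ^ b) d (sk w) x k)"
    unfolding mv_mv coef_def ..
  finally show ?thesis .
qed

lemma wt_nonneg: "0 \<le> wt w r" by (auto simp: wt_def intro!: sum_nonneg)

lemma \<Lambda>_pos: "0 < \<Lambda>" using \<tau> \<epsilon> by (simp add: \<Lambda>_def)

lemma \<Lambda>_ge_1: "1 \<le> \<Lambda>"
proof -
  have "\<epsilon>\<^sup>2 \<le> 1" using \<epsilon> by (simp add: power_le_one)
  then have "\<epsilon>\<^sup>2 \<le> 64 * \<tau>" using \<tau> by linarith
  then show ?thesis using \<epsilon> by (simp add: \<Lambda>_def)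
qed

lemma lam_pos: "0 < lam"
  using \<Lambda>_pos \<kappa>_ge_1 d by (simp add: lam_def)

lemma q_nonneg: "0 \<le> q w r"
  using lam_pos by (simp add: q_def)

lemma coef_le_wt:
  assumes "good w" "r < R" "k < d"
  shows "\<bar>coef w r k\<bar> \<le> 32 * sqrt (wt w r)"
proof (cases "coef w r k = 0")
  case True then show ?thesis using wt_nonneg by simp
next
  case False
  then obtain l where l: "l < L" "\<bar>coef w r k\<bar> / 32 < \<bar>proj w l r\<bar>"
    using assms unfolding good_def good_proj_def by blast
  have "(proj w l r)\<^sup>2 \<le> wt w r"
    unfolding wt_def using l(1) by (intro member_le_sum) auto
  then have "\<bar>proj w l r\<bar> \<le> sqrt (wt w r)" by (rule real_le_rsqrt[of "\<bar>proj w l r\<bar>", simplified])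
  with l show ?thesis by simp
qed

text \<open>In the coordinates given by \<open>T\<close>, a unit vector has sketched norm at most
  \<open>2 * \<kappa>\<close>. An entry of \<open>B x\<close> is therefore a sum of \<open>d\<close>
  products of a bounded coordinate with a coefficient that \<open>wt\<close> controls.\<close>

lemma score_upper_1:
  assumes g: "good w" and r: "r < R" and x: "pn R p (mv d B x) = 1"
  shows "\<bar>mv d B x r\<bar> powr p * \<Lambda> \<le> q w r"
proof -
  have sn: "snorm w x \<le> (2 * \<kappa>)\<^sup>2"
  proof -
    have "snorm w x \<le> 2 * dnorm w x" using snorm_bounds(2)[of w x] g by (simp add: good_def)
    also have "\<dots> \<le> 2 * \<kappa>\<^sup>2" using g x by (simp add: good_def)
    also have "\<dots> \<le> (2 * \<kappa>)\<^sup>2" by (simp add: power_mult_distrib)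
    finally show ?thesis .
  qed
  have c: "\<bar>gsc (2 ^ b) d (sk w) x k\<bar> \<le> 2 * \<kappa>" if "k < d" for k
  proof -
    have "(gsc (2 ^ b) d (sk w) x k)\<^sup>2 \<le> snorm w x"
      unfolding snorm_def by (rule gsc_abs_le[OF that])
    with sn have "(gsc (2 ^ b) d (sk w) x k)\<^sup>2 \<le> (2 * \<kappa>)\<^sup>2" by linarith
    then show ?thesis using \<kappa>_ge_1 abs_le_square_iff[of _ "2 * \<kappa>"] by auto
  qed
  have "\<bar>mv d B x r\<bar> \<le> (\<Sum>k<d. \<bar>coef w r k * gsc (2 ^ b) d (sk w) x k\<bar>)"
    unfolding gsT_image[OF g r] by (rule sum_abs)
  also have "\<dots> \<le> (\<Sum>k<d. 32 * sqrt (wt w r) * (2 * \<kappa>))"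
    unfolding abs_mult using c coef_le_wt[OF g r] wt_nonneg[of w r]
    by (intro sum_mono mult_mono) auto
  also have "\<dots> = 64 * \<kappa> * real d * sqrt (wt w r)" by simp
  finally have "\<bar>mv d B x r\<bar> powr p \<le> (64 * \<kappa> * real d * sqrt (wt w r)) powr p"
    using p by (intro powr_mono2) auto
  also have "\<dots> = (64 * \<kappa> * real d) powr p * wt w r powr (p / 2)"
    using wt_nonneg[of w r] by (simp add: powr_mult powr_half_sqrt[symmetric] powr_powr)
  also have "\<dots> \<le> (64 * \<kappa> * real d) powr 2 * wt w r powr (p / 2)"
  proof -
    have "1 * 1 * 1 \<le> 64 * \<kappa> * real d" using \<kappa>_ge_1 d by (intro mult_mono) auto
    then show ?thesis using p by (intro mult_right_mono powr_mono) auto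
  qed
  also have "\<dots> = (64 * \<kappa> * real d)\<^sup>2 * wt w r powr (p / 2)"
    using \<kappa>_ge_1 d by (simp add: powr_numeral)
  finally have "\<bar>mv d B x r\<bar> powr p * \<Lambda> \<le> (64 * \<kappa> * real d)\<^sup>2 * wt w r powr (p / 2) * \<Lambda>"
    using \<Lambda>_pos by (intro mult_right_mono) auto
  then show ?thesis by (simp add: q_def lam_def mult_ac)
qed

lemma score_upper:
  assumes g: "good w" and r: "r < R"
  shows "\<bar>mv d B x r\<bar> powr p \<le> q w r * (1 / \<Lambda> * pn R p (mv d B x))"
proof (cases "pn R p (mv d B x) = 0")
  case True
  then show ?thesis using pn_eq_0[OF True r] by simp
next
  case False
  define N where "N = pn R p (mv d B x)"
  have N: "0 < N" using False pn_nonneg[of R p "mv d B x"] by (simp add: N_def)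
  let ?x = "\<lambda>j. N powr (- 1 / p) * x j"
  have 1: "pn R p (mv d B ?x) = 1"
    unfolding N_def by (rule pn_mv_normalize) (use p N in \<open>auto simp: N_def\<close>)
  have "(N powr (- 1 / p)) powr p = 1 / N" using p N by (intro powr_neg_inverse_powr) auto
  then have "\<bar>mv d B ?x r\<bar> powr p = \<bar>mv d B x r\<bar> powr p / N"
    by (simp only: mv_scale abs_mult powr_mult) simp
  with score_upper_1[OF g r 1] have "\<bar>mv d B x r\<bar> powr p / N * \<Lambda> \<le> q w r" by simp
  then show ?thesis using N \<Lambda>_pos by (simp add: N_def[symmetric] field_simps)
qed

text \<open>Column \<open>k\<close> of \<open>T\<close> has sketched norm at most 1, being
  normalised or 0; the comparison of \<open>B\<close> with its sketch does the rest.\<close>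

lemma pn_coef:
  assumes "good w" "k < d"
  shows "pn R p (\<lambda>r. coef w r k) \<le> 128 * \<tau>\<^sup>2"
proof -
  let ?x = "\<lambda>j. sT w j k"
  have "snorm w ?x \<le> 1"
    unfolding snorm_def sT_def gsV_def[symmetric] by (rule gsV_norm_le[OF assms(2)])
  then have "128 * \<tau>\<^sup>2 * snorm w ?x \<le> 128 * \<tau>\<^sup>2 * 1" by (intro mult_left_mono) auto
  with pn_le_snorm[OF assms(1), of ?x] have 1: "pn R p (mv d B ?x) powr (2 / p) \<le> 128 * \<tau>\<^sup>2" by linarith
  have "1 \<le> 128 * \<tau>\<^sup>2" using one_le_power[OF \<tau>, of 2] by simp
  have "(pn R p (mv d B ?x) powr (2 / p)) powr (p / 2) \<le> (128 * \<tau>\<^sup>2) powr (p / 2)"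
    using 1 p by (intro powr_mono2) auto
  also have "\<dots> \<le> (128 * \<tau>\<^sup>2) powr 1"
    using \<open>1 \<le> 128 * \<tau>\<^sup>2\<close> p by (intro powr_mono) auto
  also have "(pn R p (mv d B ?x) powr (2 / p)) powr (p / 2) = pn R p (mv d B ?x)"
  proof -
    have "2 / p * (p / 2) = 1" using p by simp
    then show ?thesis unfolding powr_powr using pn_nonneg by simp
  qed
  finally show ?thesis unfolding coef_def by simp
qed

lemma sum_powr_le:
  fixes t :: "nat \<Rightarrow> real"
  assumes "\<And>k. k < d \<Longrightarrow> 0 \<le> t k"
  shows "(\<Sum>k<d. t k) powr p \<le> (real d)\<^sup>2 * (\<Sum>k<d. t k powr p)"
proof -
  have fin: "finite (t ` {..<d})" "t ` {..<d} \<noteq> {}" using d by (auto simp: lessThan_empty_iff)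
  from Max_in[OF fin] obtain k0 where k0: "k0 < d" "t k0 = Max (t ` {..<d})" by auto
  have "t k \<le> t k0" if "k < d" for k
    unfolding k0(2) using that fin by (intro Max_ge) auto
  then have "(\<Sum>k<d. t k) \<le> real d * t k0"
    using sum_bounded_above[of "{..<d}" t "t k0"] by simp
  then have "(\<Sum>k<d. t k) powr p \<le> (real d * t k0) powr p"
    using assms p by (intro powr_mono2 sum_nonneg) auto
  also have "\<dots> = real d powr p * t k0 powr p" using assms k0 by (simp add: powr_mult)
  also have "\<dots> \<le> real d powr 2 * (\<Sum>k<d. t k powr p)"
    using d p k0(1) member_le_sum[of k0 "{..<d}" "\<lambda>k. t k powr p"]
    by (intro mult_mono powr_mono) auto
  finally show ?thesis using d by (simp add: powr_numeral)
qed

text \<open>Tape cells lie in the unit interval, so a projection is at most the sum of the absolute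
  coefficients of its row. Exchanging the sums leaves \<open>d\<close> columns bounded by
  \<open>pn_coef\<close>, with a factor \<open>d\<^sup>2\<close> from
  \<open>sum_powr_le\<close>.\<close>

lemma sum_q_le:
  assumes w: "w \<in> space uniform_tape" and g: "good w"
  shows "(\<Sum>r<R. q w r) \<le> lam * (128 * real L * real d ^ 3 * \<tau>\<^sup>2)"
proof -
  have wt: "wt w r powr (p / 2) \<le> real L * ((real d)\<^sup>2 * (\<Sum>k<d. \<bar>coef w r k\<bar> powr p))" for r
  proof -
    define A where "A = (\<Sum>k<d. \<bar>coef w r k\<bar>)"
    have A0: "0 \<le> A" by (auto simp: A_def intro!: sum_nonneg)
    have "(proj w l r)\<^sup>2 \<le> A\<^sup>2" for l
    proof -
      have "\<bar>proj w l r\<bar> \<le> (\<Sum>k<d. \<bar>coef w r k * w (pz l k)\<bar>)"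
        unfolding proj_eq by (rule sum_abs)
      also have "\<dots> \<le> A"
        unfolding A_def using w by (intro sum_mono) (auto simp: space_tape abs_mult mult_left_le)
      finally show ?thesis using A0 by (simp add: abs_le_square_iff[symmetric])
    qed
    then have "wt w r \<le> real L * A\<^sup>2"
      unfolding wt_def using sum_bounded_above[of "{..<L}" "\<lambda>l. (proj w l r)\<^sup>2" "A\<^sup>2"] by simp
    then have "wt w r powr (p / 2) \<le> (real L * A\<^sup>2) powr (p / 2)"
      using p wt_nonneg[of w r] by (intro powr_mono2) auto
    also have "\<dots> = real L powr (p / 2) * (A\<^sup>2) powr (p / 2)" by (simp add: powr_mult)
    also have "(A\<^sup>2) powr (p / 2) = A powr p"
    proof (cases "A = 0")
      case False
      then have "A\<^sup>2 = A powr 2" using A0 by (simp add: powr_numeral)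
      then show ?thesis by (simp add: powr_powr)
    qed simp
    also have "real L powr (p / 2) * A powr p \<le> real L powr 1 * A powr p"
      using L p by (intro mult_right_mono powr_mono) auto
    also have "\<dots> \<le> real L powr 1 * ((real d)\<^sup>2 * (\<Sum>k<d. \<bar>coef w r k\<bar> powr p))"
      unfolding A_def by (intro mult_left_mono sum_powr_le) auto
    finally show ?thesis using L by simp
  qed
  have "(\<Sum>r<R. wt w r powr (p / 2)) \<le> (\<Sum>r<R. real L * ((real d)\<^sup>2 * (\<Sum>k<d. \<bar>coef w r k\<bar> powr p)))"
    using wt by (intro sum_mono)
  also have "\<dots> = real L * (real d)\<^sup>2 * (\<Sum>k<d. pn R p (\<lambda>r. coef w r k))"
    unfolding pn_def sum.swap[of "\<lambda>k r. \<bar>coef w r k\<bar> powr p" "{..<R}" "{..<d}"]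
    by (simp add: sum_distrib_left mult.assoc)
  also have "\<dots> \<le> real L * (real d)\<^sup>2 * (\<Sum>k<d. 128 * \<tau>\<^sup>2)"
    using pn_coef[OF g] by (intro mult_left_mono sum_mono) auto
  also have "\<dots> = 128 * real L * real d ^ 3 * \<tau>\<^sup>2"
    by (simp add: power2_eq_square power3_eq_cube)
  finally have "lam * (\<Sum>r<R. wt w r powr (p / 2)) \<le> lam * (128 * real L * real d ^ 3 * \<tau>\<^sup>2)"
    using lam_pos by (intro mult_left_mono) auto
  then show ?thesis by (simp add: q_def sum_distrib_left)
qed

section \<open>Size and accuracy of the sample\<close>

definition good_count :: "(nat \<Rightarrow> real) \<Rightarrow> bool" where
  "good_count w \<longleftrightarrow> ((\<Sum>r<R. q w r) \<le> lam * (128 * real L * real d ^ 3 * \<tau>\<^sup>2) \<longrightarrow> count w \<le> Cap)"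

lemma good_count_small: "small (\<lambda>w. \<not> good_count w) (1 / 100)"
proof -
  let ?a = "lam * (128 * real L * real d ^ 3 * \<tau>\<^sup>2)"
  have a: "0 < ?a" using lam_pos L d \<tau> by simp
  have cap: "100 * ?a \<le> Cap" using Cap by (simp add: lam_def \<Lambda>_def mult.assoc)
  have "small (\<lambda>w. (\<Sum>r<R. q w r) \<le> ?a \<and> 100 * ?a < (\<Sum>r<R. if w (pw r) < q w r then 1 else 0)) (?a / (100 * ?a))"
    using a by (intro sampled_count_tail measurable_q q_nonneg q_indep) auto
  then show ?thesis
    by (rule small_mono) (use a cap in \<open>auto simp: good_count_def count_def not_le\<close>)
qed

text \<open>As in \<open>good_count\<close>, the premise on the rates is a measurable condition, in
  contrast to \<open>good\<close>, which quantifies over all vectors. The tail bound can thus be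
  applied first, and \<open>good\<close> serves afterwards to discharge the premise.\<close>

definition good_tail :: "(nat \<Rightarrow> real) set \<Rightarrow> (nat \<Rightarrow> real) \<Rightarrow> bool" where
  "good_tail X w \<longleftrightarrow> (\<forall>x\<in>X. 0 < pn R p (mv d B x) \<longrightarrow>
     (\<forall>r<R. \<bar>mv d B x r\<bar> powr p \<le> q w r * (1 / \<Lambda> * pn R p (mv d B x))) \<longrightarrow>
     \<bar>sampled w x - pn R p (mv d B x)\<bar> \<le> \<epsilon> / 4 * pn R p (mv d B x))"

lemma good_tail_small:
  assumes X: "net_of X" shows "small (\<lambda>w. \<not> good_tail X w) (1 / 100)"
proof -
  define bad where "bad x w \<longleftrightarrow> 0 < pn R p (mv d B x) \<and>
     (\<forall>r<R. \<bar>mv d B x r\<bar> powr p \<le> q w r * (1 / \<Lambda> * pn R p (mv d B x))) \<and>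
     \<epsilon> / 4 * pn R p (mv d B x) < \<bar>sampled w x - pn R p (mv d B x)\<bar>" for x w
  have "small (bad x) (2 * exp (- \<tau>))" for x
  proof (cases "0 < pn R p (mv d B x)")
    case True
    have e: "- (\<epsilon> / 4)\<^sup>2 / (4 * (1 / \<Lambda>)) = - \<tau>"
      using \<epsilon> by (simp add: \<Lambda>_def power_divide field_simps)
    have "small (\<lambda>w. (\<forall>r<R. \<bar>mv d B x r\<bar> powr p \<le> q w r * (1 / \<Lambda> * pn R p (mv d B x))) \<and>
        \<epsilon> / 4 * pn R p (mv d B x) < \<bar>(\<Sum>r<R. if w (pw r) < q w r then \<bar>mv d B x r\<bar> powr p / min 1 (q w r) else 0)
          - pn R p (mv d B x)\<bar>) (2 * exp (- (\<epsilon> / 4)\<^sup>2 / (4 * (1 / \<Lambda>))))"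
      by (rule sampled_sum_tail)
        (use True \<epsilon> \<Lambda>_pos in \<open>auto intro: inj measurable_q q_nonneg q_indep simp: pn_def\<close>)
    then show ?thesis unfolding e by (rule small_mono) (auto simp: bad_def sampled_def)
  next
    case False
    then show ?thesis unfolding small_def bad_def by (intro conjI bexI[of _ "{}"]) auto
  qed
  then have "small (\<lambda>w. \<exists>x\<in>X. bad x w) (real (card X) * (2 * exp (- \<tau>)))"
    using X by (intro small_UN) (auto simp: net_of_def)
  then show ?thesis
    by (rule small_mono) (use net_card_small[OF X, of "2 * exp (- \<tau>)"] in \<open>auto simp: good_tail_def bad_def not_le\<close>)
qed

lemma sampled_weighted:
  "sampled w x = (\<Sum>r<R. (if w (pw r) < q w r then 1 / min 1 (q w r) else 0) * \<bar>mv d B x r\<bar> powr p)"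
  unfolding sampled_def by (intro sum.cong) auto

text \<open>For the difference of a vector and its net point no tail bound is available; this bound
  holds for all vectors at once. Each kept row contributes at most the full power sum, by
  \<open>score_upper\<close> and \<open>1 \<le> \<Lambda>\<close>.\<close>

lemma sampled_crude:
  assumes g: "good w" shows "sampled w x \<le> real R * pn R p (mv d B x)"
proof -
  let ?N = "pn R p (mv d B x)"
  have "(if w (pw r) < q w r then \<bar>mv d B x r\<bar> powr p / min 1 (q w r) else 0) \<le> ?N" if r: "r < R" for r
  proof (cases "0 < q w r")
    case False
    then have "q w r = 0" using q_nonneg[of w r] by simp
    then show ?thesis using pn_nonneg by simp
  next
    case True
    have "\<bar>mv d B x r\<bar> powr p / min 1 (q w r) \<le> ?N"
    proof (cases "q w r \<le> 1")
      case q1: True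
      have "\<bar>mv d B x r\<bar> powr p \<le> q w r * (1 / \<Lambda> * ?N)" by (rule score_upper[OF g r])
      also have "\<dots> \<le> q w r * (1 * ?N)"
        using True \<Lambda>_ge_1 pn_nonneg by (intro mult_left_mono mult_right_mono) auto
      finally show ?thesis using True q1 by (simp add: field_simps min_def)
    next
      case False
      then show ?thesis using pn_member[OF r, of "mv d B x" p] by simp
    qed
    then show ?thesis using pn_nonneg by simp
  qed
  then show ?thesis
    unfolding sampled_def using sum_bounded_above[of "{..<R}" _ ?N] by auto
qed

lemma sampled_add_le:
  assumes "0 < t" "t \<le> 1"
  shows "sampled w (\<lambda>j. x j + y j) \<le> (1 + t) * (sampled w x + sampled w y / t)"
  unfolding sampled_weighted mv_add
  by (rule weighted_pn_add_le[OF p assms]) (use q_nonneg in auto)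

text \<open>The vector and its net point are compared in both directions, for the exact and for the
  sampled power sum: four uses of the approximate triangle inequality around one tail bound.\<close>

lemma embedding_1:
  assumes X: "net_of X" and g: "good w" "good_tail X w" and x: "pn R p (mv d B x) = 1"
  shows "\<bar>sampled w x - 1\<bar> \<le> \<epsilon>"
proof -
  obtain x' where x': "x' \<in> X" "\<And>r. r < R \<Longrightarrow> \<bar>mv d B x r - mv d B x' r\<bar> \<le> real d / real m"
    using X x unfolding net_of_def by blast
  \<comment> \<open>A perturbation of \<open>\<epsilon>\<^sup>2 / 1000\<close> divided by
    \<open>t\<close> is \<open>16 * \<epsilon> / 1000\<close>, just below
    \<open>\<epsilon> / 60\<close>.\<close>
  define t where "t = \<epsilon> / 16"
  have t: "0 < t" "t \<le> 1" using \<epsilon> by (auto simp: t_def)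
  let ?z = "\<lambda>j. x j - x' j" and ?z' = "\<lambda>j. x' j - x j"
  have Bz: "mv d B ?z r = mv d B x r - mv d B x' r" "mv d B ?z' r = - (mv d B x r - mv d B x' r)" for r
    by (simp_all add: mv_diff)
  have pz: "pn R p (mv d B ?z') = pn R p (mv d B ?z)" "sampled w ?z' = sampled w ?z"
    unfolding pn_def sampled_def Bz abs_minus_cancel by (rule refl)+
  have "pn R p (mv d B ?z) \<le> \<epsilon>\<^sup>2 / (1000 * real R)"
    by (rule perturbation_pn) (simp add: Bz x'(2))
  then have Rz: "real R * pn R p (mv d B ?z) \<le> \<epsilon>\<^sup>2 / 1000"
    using R_ge by (simp add: field_simps)
  have zt: "pn R p (mv d B ?z) / t \<le> \<epsilon> / 60" "sampled w ?z / t \<le> \<epsilon> / 60"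
  proof -
    have "sampled w ?z \<le> \<epsilon>\<^sup>2 / 1000" using sampled_crude[OF g(1), of ?z] Rz by linarith
    moreover have "pn R p (mv d B ?z) \<le> real R * pn R p (mv d B ?z)"
      using mult_right_mono[OF R_ge(2), of "pn R p (mv d B ?z)"] pn_nonneg by simp
    then have "pn R p (mv d B ?z) \<le> \<epsilon>\<^sup>2 / 1000" using Rz by linarith
    moreover have "\<epsilon>\<^sup>2 / 1000 / t \<le> \<epsilon> / 60" using \<epsilon> by (simp add: t_def power2_eq_square)
    moreover have "a / t \<le> c / t" if "a \<le> c" for a c :: real using that t by (simp add: divide_right_mono)
    ultimately show "pn R p (mv d B ?z) / t \<le> \<epsilon> / 60" "sampled w ?z / t \<le> \<epsilon> / 60"
      by (meson order_trans)+
  qed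
  let ?N = "pn R p (mv d B x')" and ?S = "sampled w x'"
  have N_up: "?N \<le> (1 + t) * (1 + \<epsilon> / 60)"
  proof -
    have "?N \<le> (1 + t) * (pn R p (mv d B x) + pn R p (mv d B ?z') / t)"
      using pn_add_le[OF p t, of R "mv d B x" "mv d B ?z'"] by (simp add: mv_diff)
    also have "\<dots> \<le> (1 + t) * (1 + \<epsilon> / 60)"
      using t zt pz x by (intro mult_left_mono add_mono) auto
    finally show ?thesis .
  qed
  have N_lo: "1 \<le> (1 + t) * (?N + \<epsilon> / 60)"
  proof -
    have "1 \<le> (1 + t) * (?N + pn R p (mv d B ?z) / t)"
      using pn_add_le[OF p t, of R "mv d B x'" "mv d B ?z"] x by (simp add: mv_diff)
    also have "\<dots> \<le> (1 + t) * (?N + \<epsilon> / 60)"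
      using t zt by (intro mult_left_mono add_mono) auto
    finally show ?thesis .
  qed
  have S_up: "sampled w x \<le> (1 + t) * (?S + \<epsilon> / 60)"
  proof -
    have "sampled w x \<le> (1 + t) * (?S + sampled w ?z / t)"
      using sampled_add_le[OF t, of w x' ?z] by simp
    also have "\<dots> \<le> (1 + t) * (?S + \<epsilon> / 60)"
      using t zt by (intro mult_left_mono add_mono) auto
    finally show ?thesis .
  qed
  have S_lo: "?S \<le> (1 + t) * (sampled w x + \<epsilon> / 60)"
  proof -
    have "?S \<le> (1 + t) * (sampled w x + sampled w ?z' / t)"
      using sampled_add_le[OF t, of w x ?z'] by simp
    also have "\<dots> \<le> (1 + t) * (sampled w x + \<epsilon> / 60)"
      using t zt pz by (intro mult_left_mono add_mono) auto
    finally show ?thesis .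
  qed
  \<comment> \<open>As \<open>(1 - t) * (1 + t) \<le> 1\<close>, the upper bounds turn into lower
    bounds without division.\<close>
  have inv: "y \<le> (1 + t) * z \<Longrightarrow> (1 - t) * y \<le> z" if "0 \<le> y" for y z :: real
  proof -
    assume "y \<le> (1 + t) * z"
    then have "(1 - t) * y \<le> (1 - t) * ((1 + t) * z)" using t by (intro mult_left_mono) auto
    also have "\<dots> = (1 - t * t) * z" by (simp add: algebra_simps)
    also have "\<dots> \<le> 1 * z"
    proof (rule mult_right_mono)
      have "0 \<le> (1 + t) * z" using \<open>y \<le> (1 + t) * z\<close> that by linarith
      then show "0 \<le> z" using t by (simp add: zero_le_mult_iff)
    qed (use t in auto)
    finally show "(1 - t) * y \<le> z" by simp
  qed
  have N_lo': "1 - t - \<epsilon> / 60 \<le> ?N" using inv[OF _ N_lo] by simp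
  then have Npos: "0 < ?N" using \<epsilon> by (simp add: t_def)
  have tail: "\<bar>?S - ?N\<bar> \<le> \<epsilon> / 4 * ?N"
    using g(2) x'(1) Npos score_upper[OF g(1)] unfolding good_tail_def by blast
  have up: "sampled w x \<le> 1 + \<epsilon>"
  proof -
    have "?S \<le> ?N + \<epsilon> / 4 * ?N" using tail by linarith
    then have "?S \<le> (1 + \<epsilon> / 4) * ?N" by (simp only: distrib_right mult_1)
    also have "\<dots> \<le> (1 + \<epsilon> / 4) * ((1 + t) * (1 + \<epsilon> / 60))"
      using N_up \<epsilon> by (intro mult_left_mono) auto
    finally have "sampled w x \<le> (1 + t) * ((1 + \<epsilon> / 4) * ((1 + t) * (1 + \<epsilon> / 60)) + \<epsilon> / 60)"
      using S_up t by (elim order_trans) (intro mult_left_mono add_mono, auto)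
    also have "\<dots> \<le> 1 + \<epsilon>"
    proof -
      have l: "(1 + a * \<epsilon>) * (1 + c * \<epsilon>) \<le> 1 + (a + c + a * c) * \<epsilon>" if "0 \<le> a" "0 \<le> c" for a c :: real
      proof -
        have "a * c * (\<epsilon> * \<epsilon>) \<le> a * c * (\<epsilon> * 1)" using that \<epsilon> by (intro mult_left_mono) auto
        then show ?thesis by (simp add: algebra_simps)
      qed
      have "(1 + t) * (1 + \<epsilon> / 60) \<le> 1 + 0.1 * \<epsilon>"
        using l[of "1/16" "1/60"] \<epsilon> by (simp add: t_def)
      then have "(1 + \<epsilon> / 4) * ((1 + t) * (1 + \<epsilon> / 60)) \<le> (1 + 1/4 * \<epsilon>) * (1 + 0.1 * \<epsilon>)"
        using \<epsilon> t by (intro mult_mono) auto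
      also have "\<dots> \<le> 1 + 0.4 * \<epsilon>" using l[of "1/4" "0.1"] \<epsilon> by simp
      finally have "(1 + \<epsilon> / 4) * ((1 + t) * (1 + \<epsilon> / 60)) + \<epsilon> / 60 \<le> 1 + 0.5 * \<epsilon>" using \<epsilon> by simp
      then have "(1 + t) * ((1 + \<epsilon> / 4) * ((1 + t) * (1 + \<epsilon> / 60)) + \<epsilon> / 60) \<le> (1 + 1/16 * \<epsilon>) * (1 + 0.5 * \<epsilon>)"
        using \<epsilon> by (intro mult_mono) (auto simp: t_def intro!: add_nonneg_nonneg mult_nonneg_nonneg)
      also have "\<dots> \<le> 1 + \<epsilon>" using l[of "1/16" "0.5"] \<epsilon> by simp
      finally show ?thesis .
    qed
    finally show ?thesis .
  qed
  have lo: "1 - \<epsilon> \<le> sampled w x"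
  proof -
    have l: "1 - a - c \<le> (1 - a) * (1 - c)" if "0 \<le> a" "0 \<le> c" for a c :: real
      using mult_nonneg_nonneg[OF that] by (simp add: algebra_simps)
    have "?N - \<epsilon> / 4 * ?N \<le> ?S" using tail by linarith
    then have "(1 - \<epsilon> / 4) * ?N \<le> ?S" by (simp only: left_diff_distrib mult_1)
    moreover have "(1 - \<epsilon> / 4) * (1 - (t + \<epsilon> / 60)) \<le> (1 - \<epsilon> / 4) * ?N"
      using N_lo' \<epsilon> by (intro mult_left_mono) auto
    moreover have "1 - \<epsilon> / 4 - (t + \<epsilon> / 60) \<le> (1 - \<epsilon> / 4) * (1 - (t + \<epsilon> / 60))"
      using \<epsilon> t by (intro l) auto
    ultimately have S: "1 - (\<epsilon> / 4 + t + \<epsilon> / 60) \<le> ?S" by linarith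
    then have S0: "0 \<le> ?S" using \<epsilon> by (simp add: t_def)
    have "(1 - t) * ?S \<le> sampled w x + \<epsilon> / 60" by (rule inv[OF S0 S_lo])
    moreover have "(1 - t) * (1 - (\<epsilon> / 4 + t + \<epsilon> / 60)) \<le> (1 - t) * ?S"
      using S t by (intro mult_left_mono) auto
    moreover have "1 - t - (\<epsilon> / 4 + t + \<epsilon> / 60) \<le> (1 - t) * (1 - (\<epsilon> / 4 + t + \<epsilon> / 60))"
      using \<epsilon> t by (intro l) auto
    ultimately have "1 - t - (\<epsilon> / 4 + t + \<epsilon> / 60) - \<epsilon> / 60 \<le> sampled w x" by linarith
    then show ?thesis using \<epsilon> by (simp add: t_def)
  qed
  show ?thesis using up lo by (simp add: abs_le_iff)
qed

lemma sampled_scale: "sampled w (\<lambda>j. c * x j) = \<bar>c\<bar> powr p * sampled w x"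
  unfolding sampled_weighted mv_scale abs_mult powr_mult by (simp add: sum_distrib_left mult_ac)

lemma embedding:
  assumes X: "net_of X" and g: "good w" "good_tail X w"
  shows "\<bar>sampled w x - pn R p (mv d B x)\<bar> \<le> \<epsilon> * pn R p (mv d B x)"
proof (cases "pn R p (mv d B x) = 0")
  case True
  then have "mv d B x r = 0" if "r < R" for r using pn_eq_0[OF _ that] by blast
  then have "sampled w x = 0" unfolding sampled_def by (intro sum.neutral) auto
  with True show ?thesis by simp
next
  case False
  define N where "N = pn R p (mv d B x)"
  have N: "0 < N" using False pn_nonneg[of R p "mv d B x"] by (simp add: N_def)
  let ?x = "\<lambda>j. N powr (- 1 / p) * x j"
  have 1: "pn R p (mv d B ?x) = 1"
    unfolding N_def by (rule pn_mv_normalize) (use p N in \<open>auto simp: N_def\<close>)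
  have "(N powr (- 1 / p)) powr p = 1 / N" using p N by (intro powr_neg_inverse_powr) auto
  then have "sampled w ?x = sampled w x / N"
    by (simp only: sampled_scale abs_of_nonneg powr_ge_zero) simp
  with embedding_1[OF X g 1] have "\<bar>sampled w x / N - 1\<bar> \<le> \<epsilon>" by simp
  then have "\<bar>sampled w x / N - 1\<bar> * N \<le> \<epsilon> * N" using N by (intro mult_right_mono) auto
  moreover have "\<bar>sampled w x / N - 1\<bar> * N = \<bar>sampled w x - N\<bar>"
  proof -
    have "\<bar>sampled w x / N - 1\<bar> * N = \<bar>(sampled w x / N - 1) * N\<bar>" using N by (simp add: abs_mult)
    also have "(sampled w x / N - 1) * N = sampled w x - N" using N by (simp add: field_simps)
    finally show ?thesis .
  qed
  ultimately show ?thesis by (simp add: N_def)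
qed

theorem sampler_good:
  "small (\<lambda>w. \<not> (count w \<le> Cap \<and>
     (\<forall>x. \<bar>sampled w x - pn R p (mv d B x)\<bar> \<le> \<epsilon> * pn R p (mv d B x)))) (1 / 2)"
proof -
  obtain X where X: "net_of X" using net_exists by blast
  have "small (\<lambda>w. (\<not> good w \<or> \<not> good_count w) \<or> \<not> good_tail X w) (5 / 100 + 1 / 100 + 1 / 100)"
    by (intro small_disj good_small good_count_small good_tail_small X)
  then show ?thesis
  proof (rule small_mono)
    fix w assume w: "w \<in> space uniform_tape"
      "\<not> (count w \<le> Cap \<and> (\<forall>x. \<bar>sampled w x - pn R p (mv d B x)\<bar> \<le> \<epsilon> * pn R p (mv d B x)))"
    then show "(\<not> good w \<or> \<not> good_count w) \<or> \<not> good_tail X w"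
      using sum_q_le[OF w(1)] embedding[OF X, of w] by (auto simp: good_count_def)
  qed simp
qed

end

section \<open>Counting loops\<close>

text \<open>A fragment of the language with counting loops \<open>PF v b c\<close>, in which cell 0 of array \<open>v\<close> runs
  from 0 below the value in cell 0 of array \<open>b\<close>: it has a total semantics and static time bounds.\<close>

datatype prg =
    PSkip
  | PN nat nexp nexp
  | PR nat nexp rexp
  | PD nat nexp
  | PS prg prg
  | PI test prg prg
  | PF nat nat prg

primrec compile :: "prg \<Rightarrow> com" where
  "compile PSkip = Skip"
| "compile (PN a e f) = NSet a e f"
| "compile (PR a e f) = RSet a e f"
| "compile (PD a e) = Draw a e"
| "compile (PS c c') = Seq (compile c) (compile c')"
| "compile (PI t c c') = Cond t (compile c) (compile c')"
| "compile (PF v b c) = Seq (NSet v (NLit 0) (NLit 0))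
     (Loop (NLe (NAdd (NGet v (NLit 0)) (NLit 1)) (NGet b (NLit 0)))
       (Seq (compile c) (NSet v (NLit 0) (NAdd (NGet v (NLit 0)) (NLit 1)))))"

primrec ev :: "(nat \<Rightarrow> real) \<Rightarrow> prg \<Rightarrow> store \<Rightarrow> store" where
  "ev w PSkip s = s"
| "ev w (PN a e f) s = nwrite a (nval e s) (nval f s) s"
| "ev w (PR a e f) s = rwrite a (nval e s) (rval f s) s"
| "ev w (PD a e) s = (rwrite a (nval e s) (w (drawn s)) s)\<lparr>drawn := Suc (drawn s)\<rparr>"
| "ev w (PS c c') s = ev w c' (ev w c s)"
| "ev w (PI t c c') s = (if tval t s then ev w c s else ev w c' s)"
| "ev w (PF v b c) s =
     rec_nat (nwrite v 0 0 s) (\<lambda>i s'. nwrite v 0 (Suc i) (ev w c s')) (nmem s b 0)"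

primrec wN :: "prg \<Rightarrow> nat set" where
  "wN PSkip = {}"
| "wN (PN a e f) = {a}"
| "wN (PR a e f) = {}"
| "wN (PD a e) = {}"
| "wN (PS c c') = wN c \<union> wN c'"
| "wN (PI t c c') = wN c \<union> wN c'"
| "wN (PF v b c) = insert v (wN c)"

primrec wR :: "prg \<Rightarrow> nat set" where
  "wR PSkip = {}"
| "wR (PN a e f) = {}"
| "wR (PR a e f) = {a}"
| "wR (PD a e) = {a}"
| "wR (PS c c') = wR c \<union> wR c'"
| "wR (PI t c c') = wR c \<union> wR c'"
| "wR (PF v b c) = wR c"

primrec nodraw :: "prg \<Rightarrow> bool" where
  "nodraw PSkip = True"
| "nodraw (PN a e f) = True"
| "nodraw (PR a e f) = True"
| "nodraw (PD a e) = False"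
| "nodraw (PS c c') = (nodraw c \<and> nodraw c')"
| "nodraw (PI t c c') = (nodraw c \<and> nodraw c')"
| "nodraw (PF v b c) = nodraw c"

primrec bounds :: "prg \<Rightarrow> nat set" where
  "bounds PSkip = {}"
| "bounds (PN a e f) = {}"
| "bounds (PR a e f) = {}"
| "bounds (PD a e) = {}"
| "bounds (PS c c') = bounds c \<union> bounds c'"
| "bounds (PI t c c') = bounds c \<union> bounds c'"
| "bounds (PF v b c) = insert b (bounds c)"

text \<open>No loop bound is overwritten by its own loop or by a command that precedes the loop in a
  sequence. This makes \<open>tb\<close>, evaluated in the initial store, a valid time
  bound.\<close>

primrec wf :: "prg \<Rightarrow> bool" where
  "wf PSkip = True"
| "wf (PN a e f) = True"
| "wf (PR a e f) = True"
| "wf (PD a e) = True"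
| "wf (PS c c') = (wf c \<and> wf c' \<and> bounds c' \<inter> wN c = {})"
| "wf (PI t c c') = (wf c \<and> wf c')"
| "wf (PF v b c) = (wf c \<and> v \<notin> wN c \<and> insert b (bounds c) \<inter> insert v (wN c) = {})"

primrec tb :: "prg \<Rightarrow> store \<Rightarrow> nat" where
  "tb PSkip s = 1"
| "tb (PN a e f) s = 1"
| "tb (PR a e f) s = 1"
| "tb (PD a e) s = 1"
| "tb (PS c c') s = tb c s + tb c' s"
| "tb (PI t c c') s = 1 + tb c s + tb c' s"
| "tb (PF v b c) s = 2 + nmem s b 0 * (tb c s + 2)"

lemma store_write_simps [simp]:
  "nmem (nwrite a i k s) = (nmem s)(a := (nmem s a)(i := k))"
  "rmem (nwrite a i k s) = rmem s"
  "drawn (nwrite a i k s) = drawn s"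
  "nmem (rwrite a i x s) = nmem s"
  "rmem (rwrite a i x s) = (rmem s)(a := (rmem s a)(i := x))"
  "drawn (rwrite a i x s) = drawn s"
  by (simp_all add: nwrite_def rwrite_def)

lemma nmem_frame: "a \<notin> wN c \<Longrightarrow> nmem (ev w c s) a = nmem s a"
proof (induction c arbitrary: s)
  case (PF v b c)
  have "nmem (rec_nat (nwrite v 0 0 s) (\<lambda>i s'. nwrite v 0 (Suc i) (ev w c s')) N) a = nmem s a" for N
    by (induction N) (use PF in auto)
  then show ?case by simp
qed auto

lemma rmem_frame: "a \<notin> wR c \<Longrightarrow> rmem (ev w c s) a = rmem s a"
proof (induction c arbitrary: s)
  case (PF v b c)
  have "rmem (rec_nat (nwrite v 0 0 s) (\<lambda>i s'. nwrite v 0 (Suc i) (ev w c s')) N) a = rmem s a" for N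
    by (induction N) (use PF in auto)
  then show ?case by simp
qed auto

lemma drawn_frame: "nodraw c \<Longrightarrow> drawn (ev w c s) = drawn s"
proof (induction c arbitrary: s)
  case (PF v b c)
  have "drawn (rec_nat (nwrite v 0 0 s) (\<lambda>i s'. nwrite v 0 (Suc i) (ev w c s')) N) = drawn s" for N
    by (induction N) (use PF in auto)
  then show ?case by simp
qed auto

lemma tb_cong: "(\<And>a. a \<in> bounds c \<Longrightarrow> nmem s a = nmem s' a) \<Longrightarrow> tb c s = tb c s'"
  by (induction c) auto

text \<open>The frame conditions are supplied to the induction step, so an invariant only has to
  mention memory that the body changes.\<close>

lemma for_invariant:
  assumes v: "v \<notin> wN c" and N: "N = nmem s b 0"
    and init: "P 0 (nwrite v 0 0 s)"
    and step: "\<And>i t. i < N \<Longrightarrow> P i t \<Longrightarrow> nmem t v 0 = i \<Longrightarrow>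
       (\<And>a. a \<notin> insert v (wN c) \<Longrightarrow> nmem t a = nmem s a) \<Longrightarrow>
       (\<And>a. a \<notin> wR c \<Longrightarrow> rmem t a = rmem s a) \<Longrightarrow> P (Suc i) (nwrite v 0 (Suc i) (ev w c t))"
  shows "P N (ev w (PF v b c) s)"
proof -
  define F where "F = rec_nat (nwrite v 0 0 s) (\<lambda>i s'. nwrite v 0 (Suc i) (ev w c s'))"
  have "P i (F i) \<and> nmem (F i) v 0 = i \<and> (\<forall>a. a \<notin> insert v (wN c) \<longrightarrow> nmem (F i) a = nmem s a)
      \<and> (\<forall>a. a \<notin> wR c \<longrightarrow> rmem (F i) a = rmem s a)" if "i \<le> N" for i
    using that
  proof (induction i)
    case 0 then show ?case using init by (simp add: F_def)
  next
    case (Suc i)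
    then have IH: "P i (F i)" "nmem (F i) v 0 = i" "\<And>a. a \<notin> insert v (wN c) \<Longrightarrow> nmem (F i) a = nmem s a"
       "\<And>a. a \<notin> wR c \<Longrightarrow> rmem (F i) a = rmem s a" by auto
    have F: "F (Suc i) = nwrite v 0 (Suc i) (ev w c (F i))" by (simp add: F_def)
    show ?case unfolding F
      using step[OF _ IH] IH Suc.prems nmem_frame[of _ c] rmem_frame[of _ c] by auto
  qed
  from this[of N] show ?thesis by (simp add: F_def N)
qed

lemma exec_compile:
  assumes "wf c" shows "\<exists>t\<le>tb c s. exec w (compile c) s t (ev w c s)"
  using assms
proof (induction c arbitrary: s)
  case PSkip show ?case using exec.Skip by auto
next
  case (PN a e f) show ?case using exec.NSet by auto
next
  case (PR a e f) show ?case using exec.RSet by auto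
next
  case (PD a e) show ?case using exec.Draw by auto
next
  case (PS c c')
  then obtain t where t: "t \<le> tb c s" "exec w (compile c) s t (ev w c s)" by fastforce
  obtain t' where t': "t' \<le> tb c' (ev w c s)" "exec w (compile c') (ev w c s) t' (ev w c' (ev w c s))"
    using PS by fastforce
  have "tb c' (ev w c s) = tb c' s"
    using PS.prems by (intro tb_cong nmem_frame) auto
  then show ?case using t t' exec.Seq[OF t(2) t'(2)] by (intro exI[of _ "t + t'"]) auto
next
  case (PI b c c')
  show ?case
  proof (cases "tval b s")
    case True
    obtain t where t: "t \<le> tb c s" "exec w (compile c) s t (ev w c s)" using PI by fastforce
    show ?thesis using t exec.CondTrue[OF True t(2)] True by (intro exI[of _ "Suc t"]) auto
  next
    case False
    obtain t where t: "t \<le> tb c' s" "exec w (compile c') s t (ev w c' s)" using PI by fastforce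
    show ?thesis using t exec.CondFalse[OF False t(2)] False by (intro exI[of _ "Suc t"]) auto
  qed
next
  case (PF v b c)
  let ?N = "nmem s b 0"
  let ?test = "NLe (NAdd (NGet v (NLit 0)) (NLit 1)) (NGet b (NLit 0))"
  let ?body = "Seq (compile c) (NSet v (NLit 0) (NAdd (NGet v (NLit 0)) (NLit 1)))"
  define F where "F = rec_nat (nwrite v 0 0 s) (\<lambda>i s'. nwrite v 0 (Suc i) (ev w c s'))"
  have F: "F (Suc i) = nwrite v 0 (Suc i) (ev w c (F i))" for i by (simp add: F_def)
  have frame: "nmem (F i) v 0 = i \<and> (\<forall>a. a \<notin> insert v (wN c) \<longrightarrow> nmem (F i) a = nmem s a)" for i
  proof (induction i)
    case 0 then show ?case by (simp add: F_def)
  next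
    case (Suc i) then show ?case unfolding F using nmem_frame[of _ c] by auto
  qed
  have bN: "nmem (F i) b 0 = ?N" for i using frame[of i] PF.prems by auto
  have tbF: "tb c (F i) = tb c s" for i
    using frame[of i] PF.prems by (intro tb_cong) auto
  \<comment> \<open>Induction on the number \<open>i\<close> of remaining rounds.\<close>
  have loop: "\<exists>t\<le>i * (tb c s + 2) + 1. exec w (Loop ?test ?body) (F (?N - i)) t (F ?N)" if "i \<le> ?N" for i
    using that
  proof (induction i)
    case 0
    have "\<not> tval ?test (F ?N)" using frame[of ?N] bN[of ?N] by simp
    from exec.LoopFalse[OF this] show ?case by auto
  next
    case (Suc i)
    let ?s = "F (?N - Suc i)"
    have v: "nmem ?s v 0 = ?N - Suc i" using frame by blast
    have eq: "Suc (?N - Suc i) = ?N - i" using Suc.prems by simp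
    have true: "tval ?test ?s" using v bN[of "?N - Suc i"] Suc.prems by simp
    obtain t where t: "t \<le> tb c ?s" "exec w (compile c) ?s t (ev w c ?s)"
      using PF.IH[of ?s] PF.prems by auto
    have v': "nmem (ev w c ?s) v 0 = ?N - Suc i" using v nmem_frame[of v c w ?s] PF.prems by auto
    have next_state: "nwrite v (nval (NLit 0) (ev w c ?s))
       (nval (NAdd (NGet v (NLit 0)) (NLit 1)) (ev w c ?s)) (ev w c ?s) = F (?N - i)"
      unfolding eq[symmetric] F using v' by simp
    have b: "exec w ?body ?s (t + 1) (F (?N - i))"
      using exec.Seq[OF t(2) exec.NSet, of v "NLit 0" "NAdd (NGet v (NLit 0)) (NLit 1)"]
      unfolding next_state .
    obtain t' where t': "t' \<le> i * (tb c s + 2) + 1" "exec w (Loop ?test ?body) (F (?N - i)) t' (F ?N)"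
      using Suc by auto
    from exec.LoopTrue[OF true b t'(2)]
    have "exec w (Loop ?test ?body) ?s (Suc (t + 1 + t')) (F ?N)" .
    moreover have "Suc (t + 1 + t') \<le> Suc i * (tb c s + 2) + 1"
      using t(1) t'(1) tbF[of "?N - Suc i"] by simp
    ultimately show ?case by blast
  qed
  obtain t where t: "t \<le> ?N * (tb c s + 2) + 1" "exec w (Loop ?test ?body) (F (?N - ?N)) t (F ?N)"
    using loop[of ?N] by auto
  have F0: "F (?N - ?N) = nwrite v (nval (NLit 0) s) (nval (NLit 0) s) s" by (simp add: F_def)
  have "exec w (compile (PF v b c)) s (1 + t) (F ?N)"
    unfolding compile.simps by (rule exec.Seq[OF exec.NSet t(2)[unfolded F0]])
  moreover have "F ?N = ev w (PF v b c) s" by (simp add: F_def)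
  moreover have "1 + t \<le> tb (PF v b c) s" using t(1) by simp
  ultimately show ?case by metis
qed

section \<open>The program\<close>

text \<open>Registers. Naturals: 11 \<open>d\<close>, 12 number of entries, 13 number \<open>R\<close> of nonzero rows, 14 number \<open>2\<^sup>b\<close> of
  buckets, 15 \<open>b\<close>, 16 number \<open>L\<close> of projections, 17 column length \<open>2\<^sup>b + d\<close>, 18 and 19 auxiliary counters, 20 index of
  a row among the nonzero ones (from 1; 0 for none), 21 its inverse, 22 bucket of a row, 23 start of a
  column in real array 12, 30 to 36 loop variables. Reals: 10 current draw, 11 signed scaling of a row,
  12 the columns of the sketch stacked on the identity, 13 auxiliary scalar, 14 random direction, 15 its image
  under \<open>T\<close>, 16 projected rows, 17 accumulated scores, 19 current sampling rate. Arrays 0 to 4 are those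
  of the input and output.\<close>

abbreviation nv :: "nat \<Rightarrow> nexp" where "nv a \<equiv> NGet a (NLit 0)"
abbreviation rv :: "nat \<Rightarrow> rexp" where "rv a \<equiv> RGet a (NLit 0)"
abbreviation rl :: "nat \<Rightarrow> rexp" where "rl k \<equiv> ROfNat (NLit k)"

abbreviation entry_row :: nexp where
  "entry_row \<equiv> NSub (NGet 20 (NGet 1 (nv 30))) (NLit 1)"

definition p_init :: prg where
  "p_init = PS (PN 11 (NLit 0) (NGet 0 (NLit 1))) (PN 12 (NLit 0) (NGet 0 (NLit 2)))"

definition p_enum :: prg where
  "p_enum = PF 30 12 (PI (NLe (NGet 20 (NGet 1 (nv 30))) (NLit 0))
     (PS (PN 21 (nv 13) (NGet 1 (nv 30)))
     (PS (PN 13 (NLit 0) (NAdd (nv 13) (NLit 1)))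
         (PN 20 (NGet 1 (nv 30)) (nv 13)))) PSkip)"

definition p_all :: prg where
  "p_all = PS (PF 31 13 (PS (PN 4 (nv 31) (NGet 21 (nv 31))) (PR 2 (nv 31) (rl 1))))
     (PN 3 (NLit 0) (nv 13))"

definition p_sizes_init :: prg where
  "p_sizes_init = PS (PN 14 (NLit 0) (NLit 1)) (PN 18 (NLit 0) (NLit 1))"

text \<open>Both sizes are found by doubling a counter until a test stops it, since a real logarithm
  could not be converted to a natural number. If \<open>1600 * d\<^sup>2 \<le> R\<close>, then
  \<open>R\<close> rounds are enough, because \<open>2 ^ R\<close> exceeds both thresholds.\<close>

definition p_sizes :: prg where
  "p_sizes = PF 31 13 (PS
     (PI (TNot (RLe (RMul (rl 1600) (RMul (ROfNat (nv 11)) (ROfNat (nv 11)))) (ROfNat (nv 14))))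
        (PS (PN 14 (NLit 0) (NAdd (nv 14) (nv 14))) (PN 15 (NLit 0) (NAdd (nv 15) (NLit 1)))) PSkip)
     (PI (NLe (nv 18) (nv 13))
        (PS (PN 18 (NLit 0) (NAdd (nv 18) (nv 18))) (PN 16 (NLit 0) (NAdd (nv 16) (NLit 1)))) PSkip))"

definition p_len :: prg where
  "p_len = PN 17 (NLit 0) (NAdd (nv 14) (nv 11))"

text \<open>The addresses \<open>j * len\<close> are tabulated by repeated addition, as natural
  numbers cannot be multiplied. The same loop writes the identity block below the sketch.\<close>

definition p_offsets :: prg where
  "p_offsets = PF 33 11 (PS (PN 23 (nv 33) (nv 19))
     (PS (PR 12 (NAdd (nv 19) (NAdd (nv 14) (nv 33))) (rl 1))
         (PN 19 (NLit 0) (NAdd (nv 19) (nv 17)))))"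

text \<open>In the absence of a floor function, the bucket is extracted digit by digit.\<close>

definition p_bits :: prg where
  "p_bits = PF 32 15 (PS (PR 10 (NLit 0) (RAdd (rv 10) (rv 10)))
     (PS (PN 22 (nv 31) (NAdd (NGet 22 (nv 31)) (NGet 22 (nv 31))))
         (PI (RLe (rl 1) (rv 10))
            (PS (PR 10 (NLit 0) (RSub (rv 10) (rl 1)))
                (PN 22 (nv 31) (NAdd (NGet 22 (nv 31)) (NLit 1)))) PSkip)))"

definition p_rows :: prg where
  "p_rows = PF 31 13
     (PS (PD 10 (NLit 0))
     (PS (PR 11 (nv 31) (RPowr (rv 10) (RDiv (RSub (rl 0) (rl 1)) (rv 0))))
     (PS (PD 10 (NLit 0))
     (PS (PN 22 (nv 31) (NLit 0))
     (PS p_bits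
     (PS (PD 10 (NLit 0))
         (PI (RLe (rv 10) (RDiv (rl 1) (rl 2))) PSkip
             (PR 11 (nv 31) (RSub (rl 0) (RGet 11 (nv 31)))))))))))"

definition p_sketch :: prg where
  "p_sketch = PF 30 12
     (PR 12 (NAdd (NGet 23 (NGet 2 (nv 30))) (NGet 22 entry_row))
       (RAdd (RGet 12 (NAdd (NGet 23 (NGet 2 (nv 30))) (NGet 22 entry_row)))
             (RMul (RGet 11 entry_row) (RGet 1 (nv 30)))))"

definition p_dot :: "nat \<Rightarrow> prg" where
  "p_dot a = PS (PR 13 (NLit 0) (rl 0)) (PF 35 14 (PR 13 (NLit 0) (RAdd (rv 13)
     (RMul (RGet 12 (NAdd (NGet 23 (nv 33)) (nv 35))) (RGet 12 (NAdd (NGet 23 (nv a)) (nv 35)))))))"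

definition p_gram :: prg where
  "p_gram = PF 33 11 (PS (p_dot 33)
     (PS (PR 13 (NLit 0) (RPowr (rv 13) (RDiv (rl 1) (rl 2))))
     (PS (PF 35 17 (PR 12 (NAdd (NGet 23 (nv 33)) (nv 35))
            (RDiv (RGet 12 (NAdd (NGet 23 (nv 33)) (nv 35))) (rv 13))))
         (PF 34 11 (PI (NLe (NAdd (nv 33) (NLit 1)) (nv 34))
            (PS (p_dot 34)
                (PF 35 17 (PR 12 (NAdd (NGet 23 (nv 34)) (nv 35))
                   (RSub (RGet 12 (NAdd (NGet 23 (nv 34)) (nv 35)))
                     (RMul (rv 13) (RGet 12 (NAdd (NGet 23 (nv 33)) (nv 35))))))))
            PSkip)))))"

definition p_z :: prg where
  "p_z = PF 33 11 (PD 14 (nv 33))"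

definition p_g :: prg where
  "p_g = PF 35 11 (PS (PR 15 (nv 35) (rl 0))
     (PF 33 11 (PR 15 (nv 35) (RAdd (RGet 15 (nv 35))
        (RMul (RGet 12 (NAdd (NGet 23 (nv 33)) (NAdd (nv 14) (nv 35)))) (RGet 14 (nv 33)))))))"

definition p_acc :: prg where
  "p_acc = PF 30 12 (PR 16 entry_row
     (RAdd (RGet 16 entry_row) (RMul (RGet 1 (nv 30)) (RGet 15 (NGet 2 (nv 30))))))"

definition p_wt :: prg where
  "p_wt = PF 31 13 (PS (PR 17 (nv 31) (RAdd (RGet 17 (nv 31)) (RMul (RGet 16 (nv 31)) (RGet 16 (nv 31)))))
     (PR 16 (nv 31) (rl 0)))"

definition p_proj :: prg where
  "p_proj = PF 36 16 (PS p_z (PS p_g (PS p_acc p_wt)))"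

definition e_cap :: rexp where
  "e_cap = RDiv (RMul (rl (2 ^ 32)) (RPowr (ROfNat (nv 11)) (rl 21))) (RMul (RGet 0 (NLit 1)) (RGet 0 (NLit 1)))"

text \<open>This is \<open>lam\<close> for \<open>\<tau> = \<kappa> = d^3\<close>: the constant is
  \<open>64 * 64^2\<close> and the exponent \<open>3 + 2 * 4\<close>.\<close>

definition e_lam :: rexp where
  "e_lam = RDiv (RMul (rl 262144) (RPowr (ROfNat (nv 11)) (rl 11))) (RMul (RGet 0 (NLit 1)) (RGet 0 (NLit 1)))"

text \<open>The stored value \<open>q powr (- 1 / p)\<close> has \<open>p\<close>-th power
  \<open>1 / q\<close>, the weight in \<open>sampled\<close>. Selection requires a draw strictly
  below the rate, so a selected row has a positive rate and its entry is nonzero.\<close>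

definition p_select :: prg where
  "p_select = PF 31 13 (PS (PD 10 (NLit 0))
     (PS (PR 19 (NLit 0) (RMul e_lam (RPowr (RGet 17 (nv 31)) (RDiv (rv 0) (rl 2)))))
     (PI (RLe (rv 19) (rv 10)) PSkip
       (PS (PN 4 (nv 3) (NGet 21 (nv 31)))
       (PS (PI (RLe (rl 1) (rv 19)) (PR 2 (nv 3) (rl 1))
              (PR 2 (nv 3) (RPowr (rv 19) (RDiv (RSub (rl 0) (rl 1)) (rv 0)))))
           (PN 3 (NLit 0) (NAdd (nv 3) (NLit 1))))))))"

text \<open>Makes the size bound hold on every tape and not only with high probability: an oversized
  sample is replaced by the matrix without rows, and such tapes are covered by the failure
  probability.\<close>

definition p_check :: prg where
  "p_check = PI (RLe (ROfNat (nv 3)) e_cap) PSkip (PN 3 (NLit 0) (NLit 0))"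

section \<open>Correctness of the stages of the program\<close>

lemma p_enum_spec:
  assumes N: "nmem s 12 0 = N" and z: "nmem s 20 = (\<lambda>_. 0)" "nmem s 13 0 = 0"
  shows "nmem (ev w p_enum s) 13 0 \<le> N"
    "\<And>k. k < N \<Longrightarrow> nmem (ev w p_enum s) 20 (nmem s 1 k) - 1 < nmem (ev w p_enum s) 13 0 \<and>
        nmem (ev w p_enum s) 21 (nmem (ev w p_enum s) 20 (nmem s 1 k) - 1) = nmem s 1 k"
    "bij_betw (nmem (ev w p_enum s) 21) {..<nmem (ev w p_enum s) 13 0} (nmem s 1 ` {..<N})"
proof -
  let ?row = "nmem s 1"
  \<comment> \<open>Arrays 20 and 21 are inverse to each other up to a shift by 1, which reserves
    the value 0 for rows not yet seen.\<close>
  define P where "P i t \<longleftrightarrow> nmem t 13 0 \<le> i \<and>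
     (\<forall>k<i. nmem t 20 (?row k) \<noteq> 0) \<and>
     (\<forall>x. nmem t 20 x \<noteq> 0 \<longrightarrow> x \<in> ?row ` {..<i} \<and> nmem t 20 x \<le> nmem t 13 0 \<and> nmem t 21 (nmem t 20 x - 1) = x) \<and>
     (\<forall>r<nmem t 13 0. nmem t 20 (nmem t 21 r) = Suc r)" for i and t :: store
  have P: "P N (ev w p_enum s)"
    unfolding p_enum_def
  proof (rule for_invariant)
    show "P 0 (nwrite 30 0 0 s)" using z by (simp add: P_def)
    fix i t assume i: "i < N" and t: "P i t" "nmem t 30 0 = i"
      and fr: "\<And>a. a \<notin> insert 30 (wN (PI (NLe (NGet 20 (NGet 1 (nv 30))) (NLit 0))
        (PS (PN 21 (nv 13) (NGet 1 (nv 30))) (PS (PN 13 (NLit 0) (NAdd (nv 13) (NLit 1)))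
         (PN 20 (NGet 1 (nv 30)) (nv 13)))) PSkip)) \<Longrightarrow> nmem t a = nmem s a"
    have row: "nmem t 1 = ?row" using fr[of 1] by simp
    let ?u = "ev w (PI (NLe (NGet 20 (NGet 1 (nv 30))) (NLit 0))
        (PS (PN 21 (nv 13) (NGet 1 (nv 30))) (PS (PN 13 (NLit 0) (NAdd (nv 13) (NLit 1)))
         (PN 20 (NGet 1 (nv 30)) (nv 13)))) PSkip) t"
    define t' where "t' = ?u"
    let ?R = "nmem t 13 0"
    have "P (Suc i) (nwrite 30 0 (Suc i) t')"
    proof (cases "nmem t 20 (?row i) = 0")
      case False
      then have e: "t' = t" using t(2) row by (simp add: t'_def)
      show ?thesis unfolding e using t(1) False by (auto simp: P_def less_Suc_eq lessThan_Suc)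
    next
      case True
      have e: "nmem t' 13 0 = Suc ?R" "nmem t' 20 = (nmem t 20)(?row i := Suc ?R)"
        "nmem t' 21 = (nmem t 21)(?R := ?row i)"
        using True t(2) row by (simp_all add: t'_def)
      have 1: "?R \<le> i" "\<And>k. k < i \<Longrightarrow> nmem t 20 (?row k) \<noteq> 0"
        "\<And>x. nmem t 20 x \<noteq> 0 \<Longrightarrow> x \<in> ?row ` {..<i} \<and> nmem t 20 x \<le> ?R \<and> nmem t 21 (nmem t 20 x - 1) = x"
        "\<And>r. r < ?R \<Longrightarrow> nmem t 20 (nmem t 21 r) = Suc r"
        using t(1) by (auto simp: P_def)
      have a: "nmem t' 21 r \<noteq> ?row i" if "r < ?R" for r
        using 1(4)[OF that] True that e(3) by auto
      have c: "nmem t' 21 (nmem t' 20 x - 1) = x \<and> x \<in> ?row ` {..<Suc i} \<and> nmem t' 20 x \<le> Suc ?R"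
        if "nmem t' 20 x \<noteq> 0" for x
      proof (cases "x = ?row i")
        case True then show ?thesis by (simp add: e)
      next
        case False
        then have x: "nmem t 20 x \<noteq> 0" using that e by simp
        then have "nmem t 20 x - 1 < ?R" using 1(3)[OF x] by linarith
        then show ?thesis using 1(3)[OF x] False by (auto simp: e less_Suc_eq)
      qed
      have dd: "nmem t' 20 (nmem t' 21 r) = Suc r" if "r < Suc ?R" for r
      proof (cases "r = ?R")
        case False
        then show ?thesis using that a[of r] 1(4)[of r] by (simp add: e)
      qed (simp add: e)
      show ?thesis
        using 1(1,2) c dd by (auto simp: P_def e(1) less_Suc_eq) (auto simp: e(2))
    qed
    then show "P (Suc i) (nwrite 30 0 (Suc i) ?u)" unfolding t'_def .
  qed (use N in simp_all)
  let ?t = "ev w p_enum s"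
  have Q: "nmem ?t 13 0 \<le> N" "\<And>k. k < N \<Longrightarrow> nmem ?t 20 (?row k) \<noteq> 0"
    "\<And>x. nmem ?t 20 x \<noteq> 0 \<Longrightarrow> x \<in> ?row ` {..<N} \<and> nmem ?t 20 x \<le> nmem ?t 13 0 \<and> nmem ?t 21 (nmem ?t 20 x - 1) = x"
    "\<And>r. r < nmem ?t 13 0 \<Longrightarrow> nmem ?t 20 (nmem ?t 21 r) = Suc r"
    using P by (auto simp: P_def)
  show "nmem ?t 13 0 \<le> N" by fact
  show k: "nmem ?t 20 (?row k) - 1 < nmem ?t 13 0 \<and> nmem ?t 21 (nmem ?t 20 (?row k) - 1) = ?row k"
    if "k < N" for k
  proof -
    have nz: "nmem ?t 20 (?row k) \<noteq> 0" by (rule Q(2)[OF that])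
    then have "nmem ?t 20 (?row k) - 1 < nmem ?t 20 (?row k)" by simp
    then show ?thesis using Q(3)[OF nz] by linarith
  qed
  show "bij_betw (nmem ?t 21) {..<nmem ?t 13 0} (?row ` {..<N})"
  proof (rule bij_betw_imageI)
    show "inj_on (nmem ?t 21) {..<nmem ?t 13 0}"
      by (rule inj_onI) (metis Q(4) lessThan_iff nat.inject)
    show "nmem ?t 21 ` {..<nmem ?t 13 0} = ?row ` {..<N}"
    proof
      show "nmem ?t 21 ` {..<nmem ?t 13 0} \<subseteq> ?row ` {..<N}"
      proof (rule image_subsetI)
        fix r assume "r \<in> {..<nmem ?t 13 0}"
        then have "nmem ?t 20 (nmem ?t 21 r) \<noteq> 0" using Q(4)[of r] by simp
        from Q(3)[OF this] show "nmem ?t 21 r \<in> ?row ` {..<N}" by blast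
      qed
      show "?row ` {..<N} \<subseteq> nmem ?t 21 ` {..<nmem ?t 13 0}"
      proof (rule image_subsetI)
        fix i assume "i \<in> {..<N}"
        then show "?row i \<in> nmem ?t 21 ` {..<nmem ?t 13 0}"
          using k[of i] by (intro image_eqI[of _ _ "nmem ?t 20 (?row i) - 1"]) simp_all
      qed
    qed
  qed
qed

lemma p_all_spec:
  shows "nmem (ev w p_all s) 3 0 = nmem s 13 0"
    "\<And>r. r < nmem s 13 0 \<Longrightarrow> nmem (ev w p_all s) 4 r = nmem s 21 r"
    "\<And>r. r < nmem s 13 0 \<Longrightarrow> rmem (ev w p_all s) 2 r = 1"
proof -
  define P where "P i t \<longleftrightarrow> (\<forall>r<i. nmem t 4 r = nmem s 21 r \<and> rmem t 2 r = 1)" for i and t :: store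
  let ?c = "PS (PN 4 (nv 31) (NGet 21 (nv 31))) (PR 2 (nv 31) (rl 1))"
  have P: "P (nmem s 13 0) (ev w (PF 31 13 ?c) s)"
  proof (rule for_invariant)
    fix i t assume t: "P i t" "nmem t 31 0 = i" and fr: "\<And>a. a \<notin> insert 31 (wN ?c) \<Longrightarrow> nmem t a = nmem s a"
    have "nmem t 21 = nmem s 21" using fr[of 21] by simp
    then show "P (Suc i) (nwrite 31 0 (Suc i) (ev w ?c t))"
      using t by (auto simp: P_def less_Suc_eq)
  qed (auto simp: P_def)
  have "nmem (ev w (PF 31 13 ?c) s) 13 = nmem s 13" by (rule nmem_frame) simp
  then show "nmem (ev w p_all s) 3 0 = nmem s 13 0" by (simp add: p_all_def del: ev.simps(7))
  show "nmem (ev w p_all s) 4 r = nmem s 21 r" "rmem (ev w p_all s) 2 r = 1" if "r < nmem s 13 0" for r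
    using P that by (auto simp: P_def p_all_def simp del: ev.simps(7))
qed

lemma p_sizes_spec:
  assumes R: "nmem s 13 0 = R" and d: "nmem s 11 0 = d"
    and init: "nmem s 14 0 = 1" "nmem s 18 0 = 1" "nmem s 15 0 = 0" "nmem s 16 0 = 0"
    and big: "1600 * (real d * real d) \<le> real R" and d1: "1 \<le> d"
  shows "nmem (ev w p_sizes s) 14 0 = 2 ^ nmem (ev w p_sizes s) 15 0"
    "1600 * (real d * real d) \<le> 2 ^ nmem (ev w p_sizes s) 15 0"
    "2 ^ nmem (ev w p_sizes s) 15 0 \<le> 3200 * (real d * real d)"
    "R < 2 ^ nmem (ev w p_sizes s) 16 0" "2 ^ nmem (ev w p_sizes s) 16 0 \<le> 2 * max 1 R"
proof -
  \<comment> \<open>Each exponent has passed its threshold or was increased in every round so far.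
    The upper bounds hold because doubling stops once the threshold is passed.\<close>
  define P where "P i t \<longleftrightarrow> nmem t 14 0 = 2 ^ nmem t 15 0 \<and> nmem t 18 0 = 2 ^ nmem t 16 0
     \<and> (1600 * (real d * real d) \<le> 2 ^ nmem t 15 0 \<or> nmem t 15 0 = i) \<and> 2 ^ nmem t 15 0 \<le> 3200 * (real d * real d)
     \<and> (R < 2 ^ nmem t 16 0 \<or> nmem t 16 0 = i) \<and> 2 ^ nmem t 16 0 \<le> 2 * max 1 R" for i and t :: store
  have dd: "1 \<le> real d * real d" using d1 mult_mono[of 1 "real d" 1 "real d"] by simp
  have P: "P R (ev w p_sizes s)"
    unfolding p_sizes_def
  proof (rule for_invariant)
    show "P 0 (nwrite 31 0 0 s)" using init dd by (simp add: P_def)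
    fix i t
    let ?c = "PS (PI (TNot (RLe (RMul (rl 1600) (RMul (ROfNat (nv 11)) (ROfNat (nv 11)))) (ROfNat (nv 14))))
        (PS (PN 14 (NLit 0) (NAdd (nv 14) (nv 14))) (PN 15 (NLit 0) (NAdd (nv 15) (NLit 1)))) PSkip)
     (PI (NLe (nv 18) (nv 13))
        (PS (PN 18 (NLit 0) (NAdd (nv 18) (nv 18))) (PN 16 (NLit 0) (NAdd (nv 16) (NLit 1)))) PSkip)"
    assume t: "P i t" and fr: "\<And>a. a \<notin> insert 31 (wN ?c) \<Longrightarrow> nmem t a = nmem s a"
    have "nmem t 11 0 = d" "nmem t 13 0 = R" using fr[of 11] fr[of 13] R d by simp_all
    then show "P (Suc i) (nwrite 31 0 (Suc i) (ev w ?c t))"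
      using t by (auto simp: P_def)
  qed (use R in simp_all)
  then show "nmem (ev w p_sizes s) 14 0 = 2 ^ nmem (ev w p_sizes s) 15 0"
    "2 ^ nmem (ev w p_sizes s) 15 0 \<le> 3200 * (real d * real d)"
    "2 ^ nmem (ev w p_sizes s) 16 0 \<le> 2 * max 1 R"
    by (simp_all add: P_def)
  have R2: "R < 2 ^ R" by (rule less_exp)
  have r2: "real R \<le> 2 ^ R" using R2 by (metis less_imp_le of_nat_le_iff of_nat_numeral of_nat_power)
  moreover have "1600 * (real d * real d) \<le> 2 ^ nmem (ev w p_sizes s) 15 0 \<or> nmem (ev w p_sizes s) 15 0 = R"
    using P by (simp add: P_def)
  ultimately show "1600 * (real d * real d) \<le> 2 ^ nmem (ev w p_sizes s) 15 0"
    using order_trans[OF big r2] by (elim disjE) simp_all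
  show "R < 2 ^ nmem (ev w p_sizes s) 16 0"
    using P R2 by (auto simp: P_def)
qed

lemma addr_eq:
  assumes "x < len" "x' < (len::nat)"
  shows "j * len + x = j' * len + x' \<longleftrightarrow> j = j' \<and> x = x'"
proof
  assume e: "j * len + x = j' * len + x'"
  have "(j * len + x) div len = j" "(j' * len + x') div len = j'"
    "(j * len + x) mod len = x" "(j' * len + x') mod len = x'"
    using assms by simp_all
  with e show "j = j' \<and> x = x'" by metis
qed simp

lemma p_offsets_spec:
  assumes d: "nmem s 11 0 = d" and len: "nmem s 17 0 = len" and nb: "nmem s 14 0 = nb" "len = nb + d"
    and z: "nmem s 19 0 = 0" "rmem s 12 = (\<lambda>_. 0)"
  shows "\<And>j. j < d \<Longrightarrow> nmem (ev w p_offsets s) 23 j = j * len"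
    "\<And>j x. j < d \<Longrightarrow> x < len \<Longrightarrow> rmem (ev w p_offsets s) 12 (j * len + x) = (if x = nb + j then 1 else 0)"
proof -
  define P where "P i t \<longleftrightarrow> nmem t 19 0 = i * len \<and> (\<forall>j<i. nmem t 23 j = j * len) \<and>
     (\<forall>j<d. \<forall>x<len. rmem t 12 (j * len + x) = (if j < i \<and> x = nb + j then 1 else 0))" for i and t :: store
  have P: "P d (ev w p_offsets s)"
    unfolding p_offsets_def
  proof (rule for_invariant)
    show "P 0 (nwrite 33 0 0 s)" using z by (simp add: P_def)
    fix i t
    let ?c = "PS (PN 23 (nv 33) (nv 19)) (PS (PR 12 (NAdd (nv 19) (NAdd (nv 14) (nv 33))) (rl 1))
         (PN 19 (NLit 0) (NAdd (nv 19) (nv 17))))"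
    assume i: "i < d" and t: "P i t" "nmem t 33 0 = i" and fr: "\<And>a. a \<notin> insert 33 (wN ?c) \<Longrightarrow> nmem t a = nmem s a"
    have "nmem t 14 0 = nb" "nmem t 17 0 = len" using fr[of 14] fr[of 17] len nb by simp_all
    moreover have "j * len + x = i * len + (nb + i) \<longleftrightarrow> j = i \<and> x = nb + i" if "x < len" for j x
      using that i nb(2) by (intro addr_eq) auto
    ultimately show "P (Suc i) (nwrite 33 0 (Suc i) (ev w ?c t))"
      using t by (auto simp: P_def less_Suc_eq)
  qed (use d in simp_all)
  then show "\<And>j. j < d \<Longrightarrow> nmem (ev w p_offsets s) 23 j = j * len"
    "\<And>j x. j < d \<Longrightarrow> x < len \<Longrightarrow> rmem (ev w p_offsets s) 12 (j * len + x) = (if x = nb + j then 1 else 0)"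
    by (simp_all add: P_def)
qed

lemma p_bits_spec:
  assumes b: "nmem s 15 0 = b" and r: "nmem s 31 0 = r" and h: "nmem s 22 r = 0"
  shows "nmem (ev w p_bits s) 22 = (nmem s 22)(r := bucket b (rmem s 10 0))"
proof -
  define P where "P i t \<longleftrightarrow> bits i (rmem s 10 0) = (nmem t 22 r, rmem t 10 0) \<and> (\<forall>r'. r' \<noteq> r \<longrightarrow> nmem t 22 r' = nmem s 22 r')"
    for i and t :: store
  have P: "P b (ev w p_bits s)"
    unfolding p_bits_def
  proof (rule for_invariant)
    show "P 0 (nwrite 32 0 0 s)" using h by (simp add: P_def)
    fix i t
    let ?c = "PS (PR 10 (NLit 0) (RAdd (rv 10) (rv 10)))
     (PS (PN 22 (nv 31) (NAdd (NGet 22 (nv 31)) (NGet 22 (nv 31))))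
         (PI (RLe (rl 1) (rv 10))
            (PS (PR 10 (NLit 0) (RSub (rv 10) (rl 1)))
                (PN 22 (nv 31) (NAdd (NGet 22 (nv 31)) (NLit 1)))) PSkip))"
    assume t: "P i t" and fr: "\<And>a. a \<notin> insert 32 (wN ?c) \<Longrightarrow> nmem t a = nmem s a"
    have "nmem t 31 0 = r" using fr[of 31] r by simp
    then show "P (Suc i) (nwrite 32 0 (Suc i) (ev w ?c t))"
      using t by (auto simp: P_def Let_def)
  qed (use b in simp_all)
  then show ?thesis by (auto simp: P_def bucket_def fun_eq_iff)
qed

lemma p_rows_spec:
  assumes R: "nmem s 13 0 = R" and b: "nmem s 15 0 = b" and p: "rmem s 0 0 = p"
  shows "drawn (ev w p_rows s) = drawn s + 3 * R"
    "\<And>r. r < R \<Longrightarrow> rmem (ev w p_rows s) 11 r = sign_of (w (drawn s + 3 * r + 2)) * w (drawn s + 3 * r) powr (- 1 / p)"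
    "\<And>r. r < R \<Longrightarrow> nmem (ev w p_rows s) 22 r = bucket b (w (drawn s + 3 * r + 1))"
proof -
  define P where "P i t \<longleftrightarrow> drawn t = drawn s + 3 * i \<and> (\<forall>r<i.
     rmem t 11 r = sign_of (w (drawn s + 3 * r + 2)) * w (drawn s + 3 * r) powr (- 1 / p) \<and>
     nmem t 22 r = bucket b (w (drawn s + 3 * r + 1)))" for i and t :: store
  have P: "P R (ev w p_rows s)"
    unfolding p_rows_def
  proof (rule for_invariant)
    show "P 0 (nwrite 31 0 0 s)" by (simp add: P_def)
    fix i t
    let ?last = "PI (RLe (rv 10) (RDiv (rl 1) (rl 2))) PSkip (PR 11 (nv 31) (RSub (rl 0) (RGet 11 (nv 31))))"
    let ?c = "PS (PD 10 (NLit 0))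
     (PS (PR 11 (nv 31) (RPowr (rv 10) (RDiv (RSub (rl 0) (rl 1)) (rv 0))))
     (PS (PD 10 (NLit 0))
     (PS (PN 22 (nv 31) (NLit 0))
     (PS p_bits
     (PS (PD 10 (NLit 0)) ?last)))))"
    assume i: "i < R" and t: "P i t" "nmem t 31 0 = i"
      and fr: "\<And>a. a \<notin> insert 31 (wN ?c) \<Longrightarrow> nmem t a = nmem s a"
      and fr2: "\<And>a. a \<notin> wR ?c \<Longrightarrow> rmem t a = rmem s a"
    have tb: "nmem t 15 0 = b" and tp: "rmem t 0 0 = p"
      using fr[of 15] fr2[of 0] b p by (simp_all add: p_bits_def)
    define t1 where "t1 = ev w (PN 22 (nv 31) (NLit 0)) (ev w (PD 10 (NLit 0))
       (ev w (PR 11 (nv 31) (RPowr (rv 10) (RDiv (RSub (rl 0) (rl 1)) (rv 0)))) (ev w (PD 10 (NLit 0)) t)))"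
    define t2 where "t2 = ev w p_bits t1"
    have c: "ev w ?c t = ev w ?last (ev w (PD 10 (NLit 0)) t2)"
      by (simp add: t1_def t2_def)
    have 1: "drawn t1 = drawn t + 2" "rmem t1 10 0 = w (drawn t + 1)"
      "rmem t1 11 = (rmem t 11)(i := w (drawn t) powr (- 1 / p))" "nmem t1 22 = (nmem t 22)(i := 0)"
      "nmem t1 31 0 = i" "nmem t1 15 0 = b"
      using t(2) tb tp by (simp_all add: t1_def)
    have 2: "nmem t2 22 = (nmem t 22)(i := bucket b (w (drawn t + 1)))"
      unfolding t2_def using p_bits_spec[of t1 b i w] 1 by simp
    have 3: "drawn t2 = drawn t + 2" "rmem t2 11 = rmem t1 11" "nmem t2 31 = nmem t1 31"
      unfolding t2_def using drawn_frame[of p_bits w t1] rmem_frame[of 11 p_bits w t1] nmem_frame[of 31 p_bits w t1] 1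
      by (simp_all add: p_bits_def)
    define t3 where "t3 = ev w ?c t"
    have e: "drawn t3 = drawn t + 3"
      "rmem t3 11 = (rmem t 11)(i := sign_of (w (drawn t + 2)) * w (drawn t) powr (- 1 / p))"
      "nmem t3 22 = (nmem t 22)(i := bucket b (w (drawn t + 1)))"
      unfolding t3_def c using 1 2 3 by (auto simp: sign_of_def)
    have "P (Suc i) (nwrite 31 0 (Suc i) t3)"
      using t(1) by (auto simp: P_def e less_Suc_eq)
    then show "P (Suc i) (nwrite 31 0 (Suc i) (ev w ?c t))" unfolding t3_def .
  qed (use R in \<open>simp_all add: p_bits_def\<close>)
  then show "drawn (ev w p_rows s) = drawn s + 3 * R"
    "\<And>r. r < R \<Longrightarrow> rmem (ev w p_rows s) 11 r = sign_of (w (drawn s + 3 * r + 2)) * w (drawn s + 3 * r) powr (- 1 / p)"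
    "\<And>r. r < R \<Longrightarrow> nmem (ev w p_rows s) 22 r = bucket b (w (drawn s + 3 * r + 1))"
    by (simp_all add: P_def)
qed

text \<open>Shifts the indices in array 20, which count from 1, to the row numbering of
  \<open>B\<close>.\<close>

definition rk :: "store \<Rightarrow> nat \<Rightarrow> nat" where
  "rk s k = nmem s 20 (nmem s 1 k) - 1"

lemma p_sketch_spec:
  assumes N: "nmem s 12 0 = N" and off: "\<And>j. j < d \<Longrightarrow> nmem s 23 j = j * len"
    and col: "\<And>k. k < N \<Longrightarrow> nmem s 2 k < d" and h: "\<And>k. k < N \<Longrightarrow> nmem s 22 (rk s k) < len"
    and j: "j < d" and x: "x < len"
  shows "rmem (ev w p_sketch s) 12 (j * len + x) = rmem s 12 (j * len + x) +
     (\<Sum>k<N. if nmem s 2 k = j \<and> nmem s 22 (rk s k) = x then rmem s 11 (rk s k) * rmem s 1 k else 0)"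
proof -
  define P where "P i t \<longleftrightarrow> (\<forall>j<d. \<forall>x<len. rmem t 12 (j * len + x) = rmem s 12 (j * len + x) +
     (\<Sum>k<i. if nmem s 2 k = j \<and> nmem s 22 (rk s k) = x then rmem s 11 (rk s k) * rmem s 1 k else 0))"
    for i and t :: store
  have P: "P N (ev w p_sketch s)"
    unfolding p_sketch_def
  proof (rule for_invariant)
    show "P 0 (nwrite 30 0 0 s)" by (simp add: P_def)
    fix i t
    let ?c = "PR 12 (NAdd (NGet 23 (NGet 2 (nv 30))) (NGet 22 entry_row))
       (RAdd (RGet 12 (NAdd (NGet 23 (NGet 2 (nv 30))) (NGet 22 entry_row)))
             (RMul (RGet 11 entry_row) (RGet 1 (nv 30))))"
    assume i: "i < N" and t: "P i t" "nmem t 30 0 = i"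
      and fr: "\<And>a. a \<notin> insert 30 (wN ?c) \<Longrightarrow> nmem t a = nmem s a"
      and fr2: "\<And>a. a \<notin> wR ?c \<Longrightarrow> rmem t a = rmem s a"
    have eq: "nmem t 1 = nmem s 1" "nmem t 2 = nmem s 2" "nmem t 20 = nmem s 20" "nmem t 22 = nmem s 22"
      "nmem t 23 = nmem s 23" "rmem t 11 = rmem s 11" "rmem t 1 = rmem s 1"
      using fr[of 1] fr[of 2] fr[of 20] fr[of 22] fr[of 23] fr2[of 11] fr2[of 1] by simp_all
    let ?a = "nmem s 2 i * len + nmem s 22 (rk s i)"
    define t' where "t' = ev w ?c t"
    have t': "rmem t' 12 = (rmem t 12)(?a := rmem t 12 ?a + rmem s 11 (rk s i) * rmem s 1 i)"
      using off[OF col[OF i]] t(2) eq by (simp add: t'_def rk_def)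
    have "j * len + x = ?a \<longleftrightarrow> nmem s 2 i = j \<and> nmem s 22 (rk s i) = x" if "x < len" for j x
      using that h[OF i] addr_eq by auto
    then have "P (Suc i) (nwrite 30 0 (Suc i) t')"
      using t(1) by (auto simp: P_def t')
    then show "P (Suc i) (nwrite 30 0 (Suc i) (ev w ?c t))" by (simp only: t'_def)
  qed (use N in simp_all)
  then show ?thesis using j x by (simp add: P_def)
qed

lemma p_dot_spec:
  assumes "nmem s 14 0 = nb" "a \<noteq> 35" "nmem s 33 0 = j" "nmem s a 0 = k"
  shows "rmem (ev w (p_dot a) s) 13 0
    = (\<Sum>i<nb. rmem s 12 (nmem s 23 j + i) * rmem s 12 (nmem s 23 k + i))"
proof -
  let ?c = "PR 13 (NLit 0) (RAdd (rv 13)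
     (RMul (RGet 12 (NAdd (NGet 23 (nv 33)) (nv 35))) (RGet 12 (NAdd (NGet 23 (nv a)) (nv 35)))))"
  let ?s = "rwrite 13 0 0 s"
  define P where "P i t \<longleftrightarrow> rmem t 13 0 = (\<Sum>i<i. rmem s 12 (nmem s 23 j + i) * rmem s 12 (nmem s 23 k + i))"
    for i and t :: store
  have "P nb (ev w (PF 35 14 ?c) ?s)"
  proof (rule for_invariant)
    show "P 0 (nwrite 35 0 0 ?s)" by (simp add: P_def)
    fix i t
    assume t: "P i t" "nmem t 35 0 = i"
      and fr: "\<And>a. a \<notin> insert 35 (wN ?c) \<Longrightarrow> nmem t a = nmem ?s a"
      and fr2: "\<And>a. a \<notin> wR ?c \<Longrightarrow> rmem t a = rmem ?s a"
    have "nmem t 23 = nmem s 23" "nmem t 33 0 = j" "nmem t a 0 = k" "rmem t 12 = rmem s 12"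
      using fr[of 23] fr[of 33] fr[of a] fr2[of 12] assms by simp_all
    then show "P (Suc i) (nwrite 35 0 (Suc i) (ev w ?c t))"
      using t by (simp add: P_def)
  qed (use assms in simp_all)
  then show ?thesis by (simp add: P_def p_dot_def del: ev.simps(7))
qed

text \<open>This and \<open>p_axpy\<close> are the inner loops of \<open>p_gram\<close> that update
  whole columns, named so that each gets its own invariant.\<close>

definition p_scale :: prg where
  "p_scale = PF 35 17 (PR 12 (NAdd (NGet 23 (nv 33)) (nv 35))
     (RDiv (RGet 12 (NAdd (NGet 23 (nv 33)) (nv 35))) (rv 13)))"

definition p_axpy :: prg where
  "p_axpy = PF 35 17 (PR 12 (NAdd (NGet 23 (nv 34)) (nv 35))
     (RSub (RGet 12 (NAdd (NGet 23 (nv 34)) (nv 35)))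
       (RMul (rv 13) (RGet 12 (NAdd (NGet 23 (nv 33)) (nv 35))))))"

lemma p_scale_spec:
  assumes len: "nmem s 17 0 = len" and off: "\<And>j. j < d \<Longrightarrow> nmem s 23 j = j * len"
    and j: "nmem s 33 0 = j" "j < d" and x: "x < len"
  shows "rmem (ev w p_scale s) 12 (k * len + x)
    = (if k = j then rmem s 12 (j * len + x) / rmem s 13 0 else rmem s 12 (k * len + x))"
proof -
  define P where "P i t \<longleftrightarrow> (\<forall>k. \<forall>x<len. rmem t 12 (k * len + x)
    = (if k = j \<and> x < i then rmem s 12 (j * len + x) / rmem s 13 0 else rmem s 12 (k * len + x)))" for i and t :: store
  have "P len (ev w p_scale s)"
    unfolding p_scale_def
  proof (rule for_invariant)
    show "P 0 (nwrite 35 0 0 s)" by (simp add: P_def)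
    fix i t
    let ?c = "PR 12 (NAdd (NGet 23 (nv 33)) (nv 35)) (RDiv (RGet 12 (NAdd (NGet 23 (nv 33)) (nv 35))) (rv 13))"
    assume i: "i < len" and t: "P i t" "nmem t 35 0 = i"
      and fr: "\<And>a. a \<notin> insert 35 (wN ?c) \<Longrightarrow> nmem t a = nmem s a"
      and fr2: "\<And>a. a \<notin> wR ?c \<Longrightarrow> rmem t a = rmem s a"
    have eq: "nmem t 23 j = j * len" "nmem t 33 0 = j" "rmem t 13 = rmem s 13"
      using fr[of 23] fr[of 33] fr2[of 13] j off by simp_all
    define t' where "t' = ev w ?c t"
    have t': "rmem t' 12 = (rmem t 12)(j * len + i := rmem t 12 (j * len + i) / rmem s 13 0)"
      using t(2) by (simp add: t'_def eq)
    have "k * len + x = j * len + i \<longleftrightarrow> k = j \<and> x = i" if "x < len" for k x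
      using that i by (rule addr_eq)
    then have "P (Suc i) (nwrite 35 0 (Suc i) t')"
      using t(1) i by (auto simp: P_def t' less_Suc_eq)
    then show "P (Suc i) (nwrite 35 0 (Suc i) (ev w ?c t))" by (simp only: t'_def)
  qed (use len in simp_all)
  then show ?thesis using x by (simp add: P_def)
qed

lemma p_axpy_spec:
  assumes len: "nmem s 17 0 = len" and off: "\<And>j. j < d \<Longrightarrow> nmem s 23 j = j * len"
    and j: "nmem s 33 0 = j" "j < d" and k: "nmem s 34 0 = k" "k < d" "j \<noteq> k" and x: "x < len"
  shows "rmem (ev w p_axpy s) 12 (k' * len + x)
    = (if k' = k then rmem s 12 (k * len + x) - rmem s 13 0 * rmem s 12 (j * len + x) else rmem s 12 (k' * len + x))"
proof -
  define P where "P i t \<longleftrightarrow> (\<forall>k'. \<forall>x<len. rmem t 12 (k' * len + x)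
    = (if k' = k \<and> x < i then rmem s 12 (k * len + x) - rmem s 13 0 * rmem s 12 (j * len + x) else rmem s 12 (k' * len + x)))"
    for i and t :: store
  have "P len (ev w p_axpy s)"
    unfolding p_axpy_def
  proof (rule for_invariant)
    show "P 0 (nwrite 35 0 0 s)" by (simp add: P_def)
    fix i t
    let ?c = "PR 12 (NAdd (NGet 23 (nv 34)) (nv 35))
     (RSub (RGet 12 (NAdd (NGet 23 (nv 34)) (nv 35)))
       (RMul (rv 13) (RGet 12 (NAdd (NGet 23 (nv 33)) (nv 35)))))"
    assume i: "i < len" and t: "P i t" "nmem t 35 0 = i"
      and fr: "\<And>a. a \<notin> insert 35 (wN ?c) \<Longrightarrow> nmem t a = nmem s a"
      and fr2: "\<And>a. a \<notin> wR ?c \<Longrightarrow> rmem t a = rmem s a"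
    have eq: "nmem t 23 j = j * len" "nmem t 23 k = k * len" "nmem t 33 0 = j" "nmem t 34 0 = k" "rmem t 13 = rmem s 13"
      using fr[of 23] fr[of 33] fr[of 34] fr2[of 13] j k off by simp_all
    define t' where "t' = ev w ?c t"
    have t': "rmem t' 12 = (rmem t 12)(k * len + i := rmem t 12 (k * len + i) - rmem s 13 0 * rmem t 12 (j * len + i))"
      using t(2) by (simp add: t'_def eq)
    have "k' * len + x = k * len + i \<longleftrightarrow> k' = k \<and> x = i" if "x < len" for k' x
      using that i by (rule addr_eq)
    then have "P (Suc i) (nwrite 35 0 (Suc i) t')"
      using t(1) i k by (auto simp: P_def t' less_Suc_eq)
    then show "P (Suc i) (nwrite 35 0 (Suc i) (ev w ?c t))" by (simp only: t'_def)
  qed (use len in simp_all)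
  then show ?thesis using x by (simp add: P_def)
qed

text \<open>The outer loop variable is the step count of \<open>gs\<close>. Inner products read only
  the first \<open>nb\<close> of the \<open>len\<close> cells of a column, whereas scaling and
  subtraction run through all of them.\<close>

lemma p_gram_spec:
  assumes d: "nmem s 11 0 = d" and nb: "nmem s 14 0 = nb" and len: "nmem s 17 0 = len" "nb \<le> len"
    and off: "\<And>j. j < d \<Longrightarrow> nmem s 23 j = j * len"
    and W: "\<And>k x. k < d \<Longrightarrow> x < len \<Longrightarrow> rmem s 12 (k * len + x) = W k x"
    and k: "k < d" and x: "x < len"
  shows "rmem (ev w p_gram s) 12 (k * len + x) = gs nb d W k x"
proof -
  let ?inner = "PI (NLe (NAdd (nv 33) (NLit 1)) (nv 34)) (PS (p_dot 34) p_axpy) PSkip"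
  let ?root = "PR 13 (NLit 0) (RPowr (rv 13) (RDiv (rl 1) (rl 2)))"
  let ?c = "PS (p_dot 33) (PS ?root (PS p_scale (PF 34 11 ?inner)))"
  have gram: "p_gram = PF 33 11 ?c" by (simp add: p_gram_def p_scale_def p_axpy_def)
  have ws: "wN (p_dot a) = {35}" "wR (p_dot a) = {13}" "wN p_scale = {35}" "wR p_scale = {12}"
    "wN p_axpy = {35}" "wR p_axpy = {12}" for a
    by (simp_all add: p_dot_def p_scale_def p_axpy_def)
  define P where "P j t \<longleftrightarrow> (\<forall>k<d. \<forall>x<len. rmem t 12 (k * len + x) = gs nb j W k x)" for j and t :: store
  have "P d (ev w p_gram s)"
    unfolding gram
  proof (rule for_invariant)
    show "P 0 (nwrite 33 0 0 s)" using W by (simp add: P_def)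
    fix j t
    assume j: "j < d" and t: "P j t" "nmem t 33 0 = j"
      and fr: "\<And>a. a \<notin> insert 33 (wN ?c) \<Longrightarrow> nmem t a = nmem s a"
    define Wj where "Wj = gs nb j W"
    define V where "V = gs_step nb Wj j"
    have Wt: "rmem t 12 (k * len + x) = Wj k x" if "k < d" "x < len" for k x
      using t(1) that by (simp add: P_def Wj_def)
    have cst: "nmem t 11 0 = d" "nmem t 14 0 = nb" "nmem t 17 0 = len" "\<And>j. j < d \<Longrightarrow> nmem t 23 j = j * len"
      using fr[of 11] fr[of 14] fr[of 17] fr[of 23] d nb len off by (simp_all add: ws)
    define t1 where "t1 = ev w (p_dot 33) t"
    have "rmem t1 13 0 = (\<Sum>i<nb. rmem t 12 (nmem t 23 j + i) * rmem t 12 (nmem t 23 j + i))"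
      unfolding t1_def by (rule p_dot_spec) (use cst t(2) in auto)
    also have "\<dots> = ip nb Wj j j"
      unfolding ip_def using cst(4)[OF j] Wt[OF j] len(2) by (intro sum.cong) auto
    finally have dot1: "rmem t1 13 0 = ip nb Wj j j" .
    have fr1: "nmem t1 a = nmem t a" if "a \<noteq> 35" for a
      unfolding t1_def using that by (intro nmem_frame) (simp add: ws)
    have fr1': "rmem t1 12 = rmem t 12" unfolding t1_def by (intro rmem_frame) (simp add: ws)
    define t2 where "t2 = ev w ?root t1"
    have t2: "rmem t2 13 0 = sqrt (ip nb Wj j j)" "rmem t2 12 = rmem t 12" "\<And>a. nmem t2 a = nmem t1 a"
      using dot1 fr1' powr_half_sqrt[OF ip_nonneg[of nb Wj j]] by (simp_all add: t2_def)
    define t3 where "t3 = ev w p_scale t2"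
    have t3: "rmem t3 12 (k * len + x) = (if k \<le> j then V k x else Wj k x)" if "k < d" "x < len" for k x
    proof -
      have "rmem t3 12 (k * len + x) = (if k = j then rmem t2 12 (j * len + x) / rmem t2 13 0 else rmem t2 12 (k * len + x))"
        unfolding t3_def by (rule p_scale_spec[where d=d]) (use cst t(2) t2 fr1 j that in auto)
      then show ?thesis using Wt that j
        by (cases "k = j") (auto simp: t2 V_def gs_step_eq gs_step_lt)
    qed
    have fr3: "nmem t3 a = nmem t a" if "a \<noteq> 35" for a
      using that nmem_frame[of a p_scale w t2] fr1[OF that] by (simp add: t3_def ws t2)
    \<comment> \<open>Columns up to \<open>j\<close> are final before the inner loop, and the test
      \<open>j + 1 \<le> k\<close> makes the loop skip them.\<close>
    define Q where "Q k u \<longleftrightarrow> (\<forall>k'<d. \<forall>x<len. rmem u 12 (k' * len + x) = (if k' < k \<or> k' \<le> j then V k' x else Wj k' x))"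
      for k and u :: store
    have "Q d (ev w (PF 34 11 ?inner) t3)"
    proof (rule for_invariant)
      show "Q 0 (nwrite 34 0 0 t3)" using t3 by (simp add: Q_def)
      fix k u
      assume k: "k < d" and u: "Q k u" "nmem u 34 0 = k"
        and fru: "\<And>a. a \<notin> insert 34 (wN ?inner) \<Longrightarrow> nmem u a = nmem t3 a"
      have cstu: "nmem u 33 0 = j" "nmem u 14 0 = nb" "nmem u 17 0 = len" "\<And>j. j < d \<Longrightarrow> nmem u 23 j = j * len"
        using fru[of 33] fru[of 14] fru[of 17] fru[of 23] fr3[of 33] fr3[of 14] fr3[of 17] fr3[of 23] cst t(2)
        by (simp_all add: ws)
      define u' where "u' = ev w ?inner u"
      have "Q (Suc k) (nwrite 34 0 (Suc k) u')"
      proof (cases "j < k")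
        case False
        then have "u' = u" using cstu u(2) by (simp add: u'_def)
        then show ?thesis using u(1) False by (auto simp: Q_def less_Suc_eq)
      next
        case True
        define u1 where "u1 = ev w (p_dot 34) u"
        have u': "u' = ev w p_axpy u1" using True cstu u(2) by (simp add: u'_def u1_def)
        have "rmem u1 13 0 = (\<Sum>i<nb. rmem u 12 (nmem u 23 j + i) * rmem u 12 (nmem u 23 k + i))"
          unfolding u1_def by (rule p_dot_spec) (use cstu u(2) in auto)
        also have "\<dots> = (\<Sum>i<nb. V j i * Wj k i)"
          using cstu(4)[OF j] cstu(4)[OF k] u(1) j k True len(2) by (intro sum.cong) (auto simp: Q_def)
        finally have dot: "rmem u1 13 0 = (\<Sum>i<nb. V j i * Wj k i)" .
        have fr1: "nmem u1 a = nmem u a" if "a \<noteq> 35" for a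
          unfolding u1_def using that by (intro nmem_frame) (simp add: ws)
        have fr1': "rmem u1 12 = rmem u 12" unfolding u1_def by (intro rmem_frame) (simp add: ws)
        have "rmem u' 12 (k' * len + x) = (if k' = k then rmem u1 12 (k * len + x) - rmem u1 13 0 * rmem u1 12 (j * len + x)
            else rmem u1 12 (k' * len + x))" if "x < len" for k' x
          unfolding u' by (rule p_axpy_spec[where d=d]) (use cstu u(2) fr1 j k True that in auto)
        moreover have "Wj k x - (\<Sum>i<nb. V j i * Wj k i) * V j x = V k x" for x
          unfolding V_def using gs_step_gt[OF True, of nb Wj x] by simp
        ultimately show ?thesis
          using u(1) j k True by (auto simp: Q_def dot fr1' less_Suc_eq)
      qed
      then show "Q (Suc k) (nwrite 34 0 (Suc k) (ev w ?inner u))" by (simp only: u'_def)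
    qed (use fr3[of 11] cst in \<open>simp_all add: ws\<close>)
    then have "P (Suc j) (nwrite 33 0 (Suc j) (ev w (PF 34 11 ?inner) t3))"
      by (auto simp: P_def Q_def V_def Wj_def simp del: ev.simps(7))
    then show "P (Suc j) (nwrite 33 0 (Suc j) (ev w ?c t))"
      by (simp add: t1_def t2_def t3_def del: ev.simps(3,6,7))
  qed (use d in \<open>simp_all add: ws\<close>)
  then show ?thesis using k x by (simp add: P_def)
qed

lemma p_z_spec:
  assumes d: "nmem s 11 0 = d"
  shows "drawn (ev w p_z s) = drawn s + d" "\<And>k. k < d \<Longrightarrow> rmem (ev w p_z s) 14 k = w (drawn s + k)"
proof -
  define P where "P i t \<longleftrightarrow> drawn t = drawn s + i \<and> (\<forall>k<i. rmem t 14 k = w (drawn s + k))" for i and t :: store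
  have "P d (ev w p_z s)"
    unfolding p_z_def by (rule for_invariant) (use d in \<open>auto simp: P_def less_Suc_eq\<close>)
  then show "drawn (ev w p_z s) = drawn s + d" "\<And>k. k < d \<Longrightarrow> rmem (ev w p_z s) 14 k = w (drawn s + k)"
    by (simp_all add: P_def)
qed

lemma p_g_spec:
  assumes d: "nmem s 11 0 = d" and nb: "nmem s 14 0 = nb" and i: "i < d"
  shows "rmem (ev w p_g s) 15 i = (\<Sum>k<d. rmem s 12 (nmem s 23 k + (nb + i)) * rmem s 14 k)"
proof -
  let ?in = "PR 15 (nv 35) (RAdd (RGet 15 (nv 35))
        (RMul (RGet 12 (NAdd (NGet 23 (nv 33)) (NAdd (nv 14) (nv 35)))) (RGet 14 (nv 33))))"
  let ?c = "PS (PR 15 (nv 35) (rl 0)) (PF 33 11 ?in)"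
  define S where "S i = (\<Sum>k<d. rmem s 12 (nmem s 23 k + (nb + i)) * rmem s 14 k)" for i
  define P where "P i t \<longleftrightarrow> (\<forall>i'<i. rmem t 15 i' = S i')" for i and t :: store
  have "P d (ev w p_g s)"
    unfolding p_g_def
  proof (rule for_invariant)
    show "P 0 (nwrite 35 0 0 s)" by (simp add: P_def)
    fix i t
    assume i: "i < d" and t: "P i t" "nmem t 35 0 = i"
      and fr: "\<And>a. a \<notin> insert 35 (wN ?c) \<Longrightarrow> nmem t a = nmem s a"
      and fr2: "\<And>a. a \<notin> wR ?c \<Longrightarrow> rmem t a = rmem s a"
    define t1 where "t1 = rwrite 15 i 0 t"
    define Q where "Q k u \<longleftrightarrow> rmem u 15 = (rmem t 15)(i := \<Sum>k<k. rmem s 12 (nmem s 23 k + (nb + i)) * rmem s 14 k)"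
      for k and u :: store
    have "Q d (ev w (PF 33 11 ?in) t1)"
    proof (rule for_invariant)
      show "Q 0 (nwrite 33 0 0 t1)" by (simp add: Q_def t1_def)
      fix k u
      assume u: "Q k u" "nmem u 33 0 = k" and fru: "\<And>a. a \<notin> insert 33 (wN ?in) \<Longrightarrow> nmem u a = nmem t1 a"
        and fru2: "\<And>a. a \<notin> wR ?in \<Longrightarrow> rmem u a = rmem t1 a"
      have "nmem u 35 0 = i" "nmem u 23 = nmem s 23" "nmem u 14 0 = nb" "rmem u 12 = rmem s 12" "rmem u 14 = rmem s 14"
        using fru[of 35] fru[of 23] fru[of 14] fru2[of 12] fru2[of 14] fr[of 23] fr[of 14] fr2[of 12] fr2[of 14] t(2) nb
        by (simp_all add: t1_def)
      then show "Q (Suc k) (nwrite 33 0 (Suc k) (ev w ?in u))" using u by (simp add: Q_def)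
    qed (use fr[of 11] d in \<open>simp_all add: t1_def\<close>)
    then have "P (Suc i) (nwrite 35 0 (Suc i) (ev w (PF 33 11 ?in) t1))"
      using t(1) by (auto simp: P_def Q_def S_def less_Suc_eq simp del: ev.simps(7))
    then show "P (Suc i) (nwrite 35 0 (Suc i) (ev w ?c t))"
      using t(2) by (simp add: t1_def del: ev.simps(7))
  qed (use d in simp_all)
  then show ?thesis using i by (simp add: P_def S_def)
qed

lemma p_acc_spec:
  assumes N: "nmem s 12 0 = N"
  shows "rmem (ev w p_acc s) 16 r = rmem s 16 r +
     (\<Sum>k<N. if rk s k = r then rmem s 1 k * rmem s 15 (nmem s 2 k) else 0)"
proof -
  define P where "P i t \<longleftrightarrow> (\<forall>r. rmem t 16 r = rmem s 16 r +
     (\<Sum>k<i. if rk s k = r then rmem s 1 k * rmem s 15 (nmem s 2 k) else 0))" for i and t :: store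
  have "P N (ev w p_acc s)"
    unfolding p_acc_def
  proof (rule for_invariant)
    show "P 0 (nwrite 30 0 0 s)" by (simp add: P_def)
    fix i t
    let ?c = "PR 16 entry_row (RAdd (RGet 16 entry_row) (RMul (RGet 1 (nv 30)) (RGet 15 (NGet 2 (nv 30)))))"
    assume t: "P i t" "nmem t 30 0 = i"
      and fr: "\<And>a. a \<notin> insert 30 (wN ?c) \<Longrightarrow> nmem t a = nmem s a"
      and fr2: "\<And>a. a \<notin> wR ?c \<Longrightarrow> rmem t a = rmem s a"
    have "nmem t 1 = nmem s 1" "nmem t 2 = nmem s 2" "nmem t 20 = nmem s 20" "rmem t 15 = rmem s 15" "rmem t 1 = rmem s 1"
      using fr[of 1] fr[of 2] fr[of 20] fr2[of 15] fr2[of 1] by simp_all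
    then show "P (Suc i) (nwrite 30 0 (Suc i) (ev w ?c t))"
      using t by (auto simp: P_def rk_def)
  qed (use N in simp_all)
  then show ?thesis by (simp add: P_def)
qed

lemma p_wt_spec:
  assumes R: "nmem s 13 0 = R" and r: "r < R"
  shows "rmem (ev w p_wt s) 17 r = rmem s 17 r + (rmem s 16 r)\<^sup>2" "rmem (ev w p_wt s) 16 r = 0"
proof -
  define P where "P i t \<longleftrightarrow> (\<forall>r. rmem t 17 r = (if r < i then rmem s 17 r + (rmem s 16 r)\<^sup>2 else rmem s 17 r) \<and>
     rmem t 16 r = (if r < i then 0 else rmem s 16 r))" for i and t :: store
  have "P R (ev w p_wt s)"
    unfolding p_wt_def by (rule for_invariant) (use R in \<open>auto simp: P_def less_Suc_eq power2_eq_square\<close>)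
  then show "rmem (ev w p_wt s) 17 r = rmem s 17 r + (rmem s 16 r)\<^sup>2" "rmem (ev w p_wt s) 16 r = 0"
    using r by (simp_all add: P_def)
qed

lemma p_proj_spec:
  assumes d: "nmem s 11 0 = d" and N: "nmem s 12 0 = N" and R: "nmem s 13 0 = R"
    and nb: "nmem s 14 0 = nb" and L: "nmem s 16 0 = L"
    and col: "\<And>k. k < N \<Longrightarrow> nmem s 2 k < d"
    and z: "\<And>r. r < R \<Longrightarrow> rmem s 16 r = 0" "\<And>r. r < R \<Longrightarrow> rmem s 17 r = 0"
  shows "drawn (ev w p_proj s) = drawn s + L * d"
    "\<And>r. r < R \<Longrightarrow> rmem (ev w p_proj s) 17 r = (\<Sum>l<L. (\<Sum>k<N. if rk s k = r then rmem s 1 k *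
       (\<Sum>k'<d. rmem s 12 (nmem s 23 k' + (nb + nmem s 2 k)) * w (drawn s + l * d + k')) else 0)\<^sup>2)"
proof -
  let ?c = "PS p_z (PS p_g (PS p_acc p_wt))"
  define A where "A l r = (\<Sum>k<N. if rk s k = r then rmem s 1 k *
       (\<Sum>k'<d. rmem s 12 (nmem s 23 k' + (nb + nmem s 2 k)) * w (drawn s + l * d + k')) else 0)" for l r
  \<comment> \<open>Array 16 must be 0 again after each round, because \<open>p_acc\<close>
    accumulates into it entry by entry.\<close>
  define P where "P l t \<longleftrightarrow> drawn t = drawn s + l * d \<and>
     (\<forall>r<R. rmem t 17 r = (\<Sum>l<l. (A l r)\<^sup>2) \<and> rmem t 16 r = 0)" for l and t :: store
  have ws: "wN p_z = {33}" "wN p_g = {35, 33}" "wN p_acc = {30}" "wN p_wt = {31}"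
    "wR p_z = {14}" "wR p_g = {15}" "wR p_acc = {16}" "wR p_wt = {16, 17}"
    "nodraw p_g" "nodraw p_acc" "nodraw p_wt"
    by (auto simp: p_z_def p_g_def p_acc_def p_wt_def)
  have "P L (ev w p_proj s)"
    unfolding p_proj_def
  proof (rule for_invariant)
    show "P 0 (nwrite 36 0 0 s)" using z by (simp add: P_def)
    fix l t
    assume l: "l < L" and t: "P l t" "nmem t 36 0 = l"
      and fr: "\<And>a. a \<notin> insert 36 (wN ?c) \<Longrightarrow> nmem t a = nmem s a"
      and fr2: "\<And>a. a \<notin> wR ?c \<Longrightarrow> rmem t a = rmem s a"
    define t1 where "t1 = ev w p_z t"
    define t2 where "t2 = ev w p_g t1"
    define t3 where "t3 = ev w p_acc t2"
    define t4 where "t4 = ev w p_wt t3"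
    have c: "ev w ?c t = t4" by (simp add: t1_def t2_def t3_def t4_def)
    have n1: "nmem t1 a = nmem s a" if "a \<notin> {36, 33, 35, 30, 31}" for a
      using that fr[of a] nmem_frame[of a p_z w t] by (simp add: ws t1_def)
    have n2: "nmem t2 a = nmem s a" if "a \<notin> {36, 33, 35, 30, 31}" for a
      using that n1[of a] nmem_frame[of a p_g w t1] by (simp add: ws t2_def)
    have n3: "nmem t3 a = nmem s a" if "a \<notin> {36, 33, 35, 30, 31}" for a
      using that n2[of a] nmem_frame[of a p_acc w t2] by (simp add: ws t3_def)
    have r1: "rmem t1 a = rmem t a" if "a \<noteq> 14" for a
      using that rmem_frame[of a p_z w t] by (simp add: ws t1_def)
    have r2: "rmem t2 a = rmem t a" if "a \<noteq> 14" "a \<noteq> 15" for a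
      using that r1[of a] rmem_frame[of a p_g w t1] by (simp add: ws t2_def)
    have st: "rmem t 1 = rmem s 1" "rmem t 12 = rmem s 12" using fr2[of 1] fr2[of 12] by (simp_all add: ws)
    have 1: "drawn t1 = drawn t + d" "\<And>k. k < d \<Longrightarrow> rmem t1 14 k = w (drawn t + k)"
      using p_z_spec[where s=t and d=d and w=w] fr[of 11] d by (simp_all add: t1_def ws)
    have 2: "rmem t2 15 i = (\<Sum>k'<d. rmem s 12 (nmem s 23 k' + (nb + i)) * w (drawn s + l * d + k'))" if "i < d" for i
    proof -
      have "rmem t2 15 i = (\<Sum>k'<d. rmem t1 12 (nmem t1 23 k' + (nb + i)) * rmem t1 14 k')"
        unfolding t2_def by (rule p_g_spec) (use n1 d nb that in auto)
      then show ?thesis using 1 t(1) r1[of 12] st n1[of 23] by (simp add: P_def)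
    qed
    have rks: "rk t2 k = rk s k" for k using n2[of 20] n2[of 1] by (simp add: rk_def)
    have 3: "rmem t3 16 r = A l r" if r: "r < R" for r
    proof -
      have "rmem t3 16 r = rmem t2 16 r + (\<Sum>k<N. if rk t2 k = r then rmem t2 1 k * rmem t2 15 (nmem t2 2 k) else 0)"
        unfolding t3_def by (rule p_acc_spec) (use n2 N in auto)
      also have "rmem t2 16 r = 0" using r2[of 16] t(1) r by (simp add: P_def)
      also have "(\<Sum>k<N. if rk t2 k = r then rmem t2 1 k * rmem t2 15 (nmem t2 2 k) else 0) = A l r"
        unfolding A_def using col 2 r2[of 1] st n2[of 2] by (intro sum.cong) (auto simp: rks)
      finally show ?thesis by simp
    qed
    have 4: "rmem t4 17 r = rmem t 17 r + (A l r)\<^sup>2" "rmem t4 16 r = 0" if r: "r < R" for r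
    proof -
      have "rmem t3 17 = rmem t 17" using rmem_frame[of 17 p_acc w t2] r2[of 17] by (simp add: t3_def ws)
      then show "rmem t4 17 r = rmem t 17 r + (A l r)\<^sup>2" "rmem t4 16 r = 0"
        using p_wt_spec[of t3 R r w] n3[of 13] R r 3[OF r] by (simp_all add: t4_def)
    qed
    have 5: "drawn t4 = drawn t + d"
      using drawn_frame[of p_g w t1] drawn_frame[of p_acc w t2] drawn_frame[of p_wt w t3] 1(1)
      by (simp add: ws t2_def t3_def t4_def)
    show "P (Suc l) (nwrite 36 0 (Suc l) (ev w ?c t))"
      unfolding c using t(1) 4 5 by (simp add: P_def)
  qed (use L in \<open>simp_all add: ws\<close>)
  then show "drawn (ev w p_proj s) = drawn s + L * d"
    "\<And>r. r < R \<Longrightarrow> rmem (ev w p_proj s) 17 r = (\<Sum>l<L. (\<Sum>k<N. if rk s k = r then rmem s 1 k *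
       (\<Sum>k'<d. rmem s 12 (nmem s 23 k' + (nb + nmem s 2 k)) * w (drawn s + l * d + k')) else 0)\<^sup>2)"
    by (simp_all add: P_def A_def)
qed

text \<open>\<open>F\<close> is arbitrary because two instances are needed: constantly 1 it counts
  the rows of the output, and as a \<open>p\<close>-th power it gives the norm of the sampled
  image.\<close>

lemma p_select_spec:
  fixes F :: "nat \<Rightarrow> real \<Rightarrow> real"
  assumes R: "nmem s 13 0 = R" and z: "nmem s 3 0 = 0" and p: "rmem s 0 0 = p"
    and w: "\<And>i. 0 \<le> w i"
    and q: "\<And>r. q r = rval e_lam s * rmem s 17 r powr (p / 2)"
  shows "(\<Sum>j<nmem (ev w p_select s) 3 0. F (nmem (ev w p_select s) 4 j) (rmem (ev w p_select s) 2 j))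
      = (\<Sum>r<R. if w (drawn s + r) < q r then F (nmem s 21 r) (if 1 \<le> q r then 1 else q r powr (- 1 / p)) else 0)"
    "\<And>j. j < nmem (ev w p_select s) 3 0 \<Longrightarrow>
        (\<exists>r<R. nmem (ev w p_select s) 4 j = nmem s 21 r) \<and> rmem (ev w p_select s) 2 j \<noteq> 0"
proof -
  define v where "v r = (if 1 \<le> q r then 1 else q r powr (- 1 / p))" for r
  define P where "P i t \<longleftrightarrow> drawn t = drawn s + i \<and>
     (\<Sum>j<nmem t 3 0. F (nmem t 4 j) (rmem t 2 j)) = (\<Sum>r<i. if w (drawn s + r) < q r then F (nmem s 21 r) (v r) else 0) \<and>
     (\<forall>j<nmem t 3 0. (\<exists>r<R. nmem t 4 j = nmem s 21 r) \<and> rmem t 2 j \<noteq> 0)" for i and t :: store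
  let ?sel = "PI (RLe (rv 19) (rv 10)) PSkip
       (PS (PN 4 (nv 3) (NGet 21 (nv 31)))
       (PS (PI (RLe (rl 1) (rv 19)) (PR 2 (nv 3) (rl 1))
              (PR 2 (nv 3) (RPowr (rv 19) (RDiv (RSub (rl 0) (rl 1)) (rv 0)))))
           (PN 3 (NLit 0) (NAdd (nv 3) (NLit 1)))))"
  let ?c = "PS (PD 10 (NLit 0))
     (PS (PR 19 (NLit 0) (RMul e_lam (RPowr (RGet 17 (nv 31)) (RDiv (rv 0) (rl 2))))) ?sel)"
  have "P R (ev w p_select s)"
    unfolding p_select_def
  proof (rule for_invariant)
    show "P 0 (nwrite 31 0 0 s)" using z by (simp add: P_def)
    fix i t
    assume i: "i < R" and t: "P i t" "nmem t 31 0 = i"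
      and fr: "\<And>a. a \<notin> insert 31 (wN ?c) \<Longrightarrow> nmem t a = nmem s a"
      and fr2: "\<And>a. a \<notin> wR ?c \<Longrightarrow> rmem t a = rmem s a"
    have eq: "nmem t 21 = nmem s 21" "nmem t 11 = nmem s 11" "rmem t 17 = rmem s 17" "rmem t 0 = rmem s 0"
      using fr[of 21] fr[of 11] fr2[of 17] fr2[of 0] by simp_all
    define t1 where "t1 = ev w (PR 19 (NLit 0) (RMul e_lam (RPowr (RGet 17 (nv 31)) (RDiv (rv 0) (rl 2)))))
       (ev w (PD 10 (NLit 0)) t)"
    have t1: "rmem t1 19 0 = q i" "rmem t1 10 0 = w (drawn s + i)" "drawn t1 = drawn s + Suc i"
      "nmem t1 = nmem t" "rmem t1 2 = rmem t 2" "rmem t1 0 0 = p"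
      using t p by (simp_all add: t1_def e_lam_def eq q P_def)
    define t2 where "t2 = ev w ?sel t1"
    let ?n = "nmem t 3 0"
    have "P (Suc i) (nwrite 31 0 (Suc i) t2)"
    proof (cases "w (drawn s + i) < q i")
      case False
      then have "t2 = t1" by (simp add: t2_def t1)
      then show ?thesis using t(1) t1 False by (simp add: P_def)
    next
      case True
      have t2: "nmem t2 3 0 = Suc ?n" "nmem t2 4 = (nmem t 4)(?n := nmem s 21 i)"
        "rmem t2 2 = (rmem t 2)(?n := v i)" "drawn t2 = drawn s + Suc i"
        using True t(2) by (auto simp: t2_def t1 v_def eq)
      have "q i > 0" using True w[of "drawn s + i"] by linarith
      then have "v i \<noteq> 0" by (simp add: v_def)
      moreover have "(\<Sum>j<?n. F (nmem t2 4 j) (rmem t2 2 j)) = (\<Sum>j<?n. F (nmem t 4 j) (rmem t 2 j))"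
        by (intro sum.cong) (auto simp: t2)
      ultimately show ?thesis using t(1) True i by (auto simp: P_def t2 less_Suc_eq)
    qed
    then show "P (Suc i) (nwrite 31 0 (Suc i) (ev w ?c t))"
      by (simp add: t1_def t2_def del: ev.simps(2,3,4,6))
  qed (use R in simp_all)
  then show "(\<Sum>j<nmem (ev w p_select s) 3 0. F (nmem (ev w p_select s) 4 j) (rmem (ev w p_select s) 2 j))
      = (\<Sum>r<R. if w (drawn s + r) < q r then F (nmem s 21 r) (if 1 \<le> q r then 1 else q r powr (- 1 / p)) else 0)"
    "\<And>j. j < nmem (ev w p_select s) 3 0 \<Longrightarrow>
        (\<exists>r<R. nmem (ev w p_select s) 4 j = nmem s 21 r) \<and> rmem (ev w p_select s) 2 j \<noteq> 0"
    unfolding P_def v_def by blast+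
qed

section \<open>Numerical estimates\<close>

lemma ln_2_ge_half: "1 / 2 \<le> ln (2 :: real)"
  using ln_add_one_self_le_self2 ln_one_minus_pos_upper_bound[of "1/2"] by (simp add: ln_div)

text \<open>The instance is \<open>\<tau> = \<kappa> = d^3\<close> and
  \<open>m = 1000 * R^3 * d^4\<close>. From \<open>2 ^ 32 \<le> R\<close> follows
  \<open>16 \<le> ln R\<close> and so \<open>16000 \<le> d\<close>, which absorbs most constants.
  The constant \<open>2 ^ 32\<close> in the capacity bounds
  \<open>100 * 64 * 64^2 * 128\<close>.\<close>

lemma sampler_numerics:
  fixes \<epsilon> :: real and R d b L :: nat
  assumes d: "1 \<le> d" and \<epsilon>: "0 < \<epsilon>" "\<epsilon> < 1"
    and cap: "2 ^ 32 * real d ^ 21 / \<epsilon>\<^sup>2 < real R" and lnR: "1000 * ln (real R) \<le> real d"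
    and L: "R < 2 ^ L" "2 ^ L \<le> 2 * max 1 R"
  shows "1 \<le> \<epsilon>\<^sup>2 * real R"
    "100 * real d * (1 + ln (100 * real R)) \<le> real d ^ 3"
    "1 \<le> real d ^ 3"
    "1000 * real R ^ 3 * real d * real d ^ 3 \<le> real (1000 * R ^ 3 * d ^ 4)"
    "2 * real ((2 * (1000 * R ^ 3 * d ^ 4) + 1) ^ d) * exp (- (real d ^ 3)) \<le> 1 / 100"
    "1 \<le> L" "real R * real d * (1 / 16) ^ L \<le> 1 / 100" "L \<le> d"
    "100 * (64 * real d ^ 3 / \<epsilon>\<^sup>2 * (64 * real d ^ 3 * real d)\<^sup>2 * (128 * real L * real d ^ 3 * (real d ^ 3)\<^sup>2))
       \<le> 2 ^ 32 * real d ^ 21 / \<epsilon>\<^sup>2"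
    "real d ^ 21 \<le> real R" "2 ^ 32 \<le> real R" "16000 \<le> d"
proof -
  have e2: "0 < \<epsilon>\<^sup>2" "\<epsilon>\<^sup>2 \<le> 1" using \<epsilon> by (auto simp: power_le_one)
  have d21: "1 \<le> real d ^ 21" using d by (intro one_le_power) simp
  have "2 ^ 32 * real d ^ 21 < \<epsilon>\<^sup>2 * real R" using cap e2 by (simp add: field_simps)
  moreover have "\<epsilon>\<^sup>2 * real R \<le> 1 * real R" using e2 by (intro mult_right_mono) auto
  ultimately have big: "2 ^ 32 * real d ^ 21 < \<epsilon>\<^sup>2 * real R" "2 ^ 32 * real d ^ 21 < real R" by auto
  show "1 \<le> \<epsilon>\<^sup>2 * real R" using big d21 by simp
  have "real d ^ 21 \<le> 2 ^ 32 * real d ^ 21" by simp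
  then show Rd: "real d ^ 21 \<le> real R" using big(2) by linarith
  show R32: "2 ^ 32 \<le> real R" using big d21 by simp
  have R1: "1 \<le> R" "0 < real R" using R32 by (auto intro: Suc_leI gr0I)
  have "ln ((2::real) ^ 32) = 32 * ln 2" by (subst ln_realpow) auto
  moreover have "ln ((2::real) ^ 32) \<le> ln (real R)" using R32 R1 by (subst ln_le_cancel_iff) auto
  ultimately have "32 * ln 2 \<le> ln (real R)" by (simp only:)
  then have "16 \<le> ln (real R)" using ln_2_ge_half by linarith
  then have d16: "16000 \<le> real d" using lnR by simp
  then show "16000 \<le> d" by simp
  show "1 \<le> real d ^ 3" using d by (intro one_le_power) simp
  show "1000 * real R ^ 3 * real d * real d ^ 3 \<le> real (1000 * R ^ 3 * d ^ 4)"
    by (simp add: power_numeral_reduce)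
  have lnR0: "0 \<le> ln (real R)" using R1 by simp
  show "100 * real d * (1 + ln (100 * real R)) \<le> real d ^ 3"
  proof -
    have "ln (100 * real R) \<le> ln (real R * real R)"
      using R32 R1 by (subst ln_le_cancel_iff) auto
    also have "\<dots> = 2 * ln (real R)" using R1 by (simp add: ln_mult)
    also have "\<dots> \<le> real d" using lnR lnR0 by linarith
    finally have "100 * (1 + ln (100 * real R)) \<le> 100 * (1 + real d)" by simp
    also have "\<dots> \<le> 16000 * real d" using d16 by simp
    also have "\<dots> \<le> real d * real d" by (rule mult_right_mono[OF d16 of_nat_0_le_iff])
    finally have "100 * (1 + ln (100 * real R)) \<le> real d * real d" .
    then have "real d * (100 * (1 + ln (100 * real R))) \<le> real d * (real d * real d)"
      by (intro mult_left_mono) auto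
    then show ?thesis by (simp add: power3_eq_cube algebra_simps)
  qed
  show "2 * real ((2 * (1000 * R ^ 3 * d ^ 4) + 1) ^ d) * exp (- (real d ^ 3)) \<le> 1 / 100"
  proof -
    have d4: "real d ^ 4 \<le> real R"
      by (rule order_trans[OF power_increasing Rd]) (use d in auto)
    \<comment> \<open>One grid factor is at most \<open>R^5 \<le> exp d\<close>, so the net has at
      most \<open>exp (d^2)\<close> points, against a failure probability of at most
      \<open>2 * exp (- d^3)\<close> for each.\<close>
    have "real (2 * (1000 * R ^ 3 * d ^ 4) + 1) \<le> 2001 * (real R ^ 3 * real d ^ 4)"
    proof -
      have "1 * 1 \<le> real R ^ 3 * real d ^ 4" using R1 d by (intro mult_mono one_le_power) auto
      then show ?thesis by simp
    qed
    also have "\<dots> \<le> real R * (real R ^ 3 * real R)"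
      using R32 d4 by (intro mult_mono mult_left_mono) auto
    also have "\<dots> = exp (5 * ln (real R))"
      using R1 exp_of_nat_mult[of 5 "ln (real R)"] by (simp add: power_numeral_reduce)
    also have "\<dots> \<le> exp (real d)" using lnR lnR0 by simp
    finally have "real (2 * (1000 * R ^ 3 * d ^ 4) + 1) ^ d \<le> exp (real d) ^ d"
      by (rule power_mono) simp
    also have "\<dots> = exp (real d * real d)" by (simp add: exp_of_nat_mult[symmetric])
    finally have 1: "real ((2 * (1000 * R ^ 3 * d ^ 4) + 1) ^ d) \<le> exp (real d * real d)" by simp
    have "exp (real d * real d) * exp (- (real d ^ 3)) = exp (- (real d * real d * (real d - 1)))"
      by (simp add: exp_add[symmetric] power3_eq_cube algebra_simps)
    also have "\<dots> \<le> exp (- real d)"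
    proof -
      have "real d * 1 \<le> real d * (real d * (real d - 1))"
        using d16 mult_mono[of 1 "real d" 1 "real d - 1"] by (intro mult_left_mono) auto
      then show ?thesis by (simp add: mult.assoc)
    qed
    also have "\<dots> \<le> 1 / real d"
    proof -
      have "real d \<le> exp (real d)" using exp_ge_add_one_self[of "real d"] by linarith
      then show ?thesis using d by (simp add: exp_minus divide_inverse le_imp_inverse_le)
    qed
    also have "\<dots> \<le> 1 / 16000" using d16 by (intro divide_left_mono) auto
    finally have 2: "exp (real d * real d) * exp (- (real d ^ 3)) \<le> 1 / 16000" .
    have "2 * real ((2 * (1000 * R ^ 3 * d ^ 4) + 1) ^ d) * exp (- (real d ^ 3))
        \<le> 2 * exp (real d * real d) * exp (- (real d ^ 3))"
      using 1 by (intro mult_right_mono mult_left_mono) auto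
    also have "\<dots> \<le> 1 / 100" using 2 by simp
    finally show ?thesis .
  qed
  show L1: "1 \<le> L" using L(1) R1 by (cases L) auto
  have RL: "real R \<le> 2 ^ L" using L(1) by (metis less_imp_le of_nat_le_iff of_nat_numeral of_nat_power)
  show "real R * real d * (1 / 16) ^ L \<le> 1 / 100"
  proof -
    have "real d ^ 1 \<le> real R" by (rule order_trans[OF power_increasing Rd]) (use d in auto)
    then have dR: "real d \<le> real R" by simp
    have "((2::real) ^ L) ^ 4 = (2 ^ 4) ^ L" by (simp only: power_mult[symmetric] mult.commute[of L])
    then have "(16::real) ^ L = ((2::real) ^ L) ^ 4" by simp
    then have "(1 / 16 :: real) ^ L = 1 / (2 ^ L) ^ 4" by (simp add: power_one_over)
    also have "\<dots> \<le> 1 / real R ^ 4" using RL R1 by (intro divide_left_mono power_mono) auto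
    finally have "real R * real d * (1 / 16) ^ L \<le> real R * real R * (1 / real R ^ 4)"
      using dR by (intro mult_mono) auto
    also have "\<dots> = 1 / real R * (1 / real R)" using R1 by (simp add: power_numeral_reduce)
    also have "\<dots> \<le> 1 / 100 * 1"
      using R32 R1 by (intro mult_mono) (auto simp: field_simps)
    finally show ?thesis by simp
  qed
  show Ld: "L \<le> d"
  proof -
    have "(2::real) ^ L \<le> 2 * real R"
    proof -
      have "2 ^ L \<le> 2 * R" using L(2) R1 by simp
      then have "real (2 ^ L) \<le> real (2 * R)" by (simp only: of_nat_le_iff)
      then show ?thesis by simp
    qed
    then have "ln ((2::real) ^ L) \<le> ln (2 * real R)" using R1 by (subst ln_le_cancel_iff) auto
    then have "real L * ln 2 \<le> ln 2 + ln (real R)" using R1 by (simp add: ln_realpow ln_mult)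
    moreover have "real L * (1 / 2) \<le> real L * ln 2" using ln_2_ge_half by (intro mult_left_mono) auto
    moreover have "ln 2 \<le> (1::real)" using ln_le_minus_one[of 2] by simp
    ultimately have "real L \<le> real d" using lnR lnR0 d16 by linarith
    then show ?thesis by simp
  qed
  show "100 * (64 * real d ^ 3 / \<epsilon>\<^sup>2 * (64 * real d ^ 3 * real d)\<^sup>2 * (128 * real L * real d ^ 3 * (real d ^ 3)\<^sup>2))
       \<le> 2 ^ 32 * real d ^ 21 / \<epsilon>\<^sup>2"
  proof -
    have "100 * (64 * real d ^ 3 / \<epsilon>\<^sup>2 * (64 * real d ^ 3 * real d)\<^sup>2 * (128 * real L * real d ^ 3 * (real d ^ 3)\<^sup>2))
      = 3355443200 * (real d ^ 20 * real L) / \<epsilon>\<^sup>2"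
      by (simp add: power_mult_distrib power_numeral_reduce field_simps)
    also have "\<dots> \<le> 3355443200 * (real d ^ 20 * real d) / \<epsilon>\<^sup>2"
      using Ld e2 by (intro divide_right_mono mult_left_mono) auto
    also have "real d ^ 20 * real d = real d ^ 21" by (simp add: power_Suc2[symmetric])
    also have "3355443200 * real d ^ 21 / \<epsilon>\<^sup>2 \<le> 2 ^ 32 * real d ^ 21 / \<epsilon>\<^sup>2"
      using e2 by (intro divide_right_mono mult_right_mono) auto
    finally show ?thesis .
  qed
qed

lemma log_bound:
  assumes "2 ^ L \<le> 2 * max 1 R" "R \<le> n" "1000 \<le> n"
  shows "real L \<le> 4 * ln (real n)" "1 \<le> ln (real n)"
proof -
  have e: "exp 1 \<le> (3::real)" using exp_le by simp
  then show n1: "1 \<le> ln (real n)" using assms(3) by (subst ln_ge_iff) auto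
  have "2 ^ L \<le> 2 * n" using assms by auto
  then have "real (2 ^ L) \<le> real (2 * n)" by (simp only: of_nat_le_iff)
  then have "(2::real) ^ L \<le> 2 * real n" by simp
  then have "ln ((2::real) ^ L) \<le> ln (2 * real n)" using assms by (subst ln_le_cancel_iff) auto
  then have "real L * ln 2 \<le> ln 2 + ln (real n)" using assms by (simp add: ln_realpow ln_mult)
  moreover have "real L * (1 / 2) \<le> real L * ln 2" using ln_2_ge_half by (intro mult_left_mono) auto
  moreover have "ln 2 \<le> (1::real)" using ln_le_minus_one[of 2] by simp
  ultimately show "real L \<le> 4 * ln (real n)" using n1 by linarith
qed

text \<open>Dyadic approximations make a closed condition on all real vectors a countable one.\<close>

definition dyadic :: "int list \<Rightarrow> nat \<Rightarrow> nat \<Rightarrow> real" where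
  "dyadic l i j = (if j < length l then of_int (l ! j) / 2 ^ i else 0)"

lemma dyadic_approx:
  fixes x :: "nat \<Rightarrow> real"
  obtains l where "\<And>j. j < d \<Longrightarrow> (\<lambda>i. dyadic (l i) i j) \<longlonglongrightarrow> x j"
proof
  define l where "l i = map (\<lambda>j. \<lfloor>x j * 2 ^ i\<rfloor>) [0..<d]" for i :: nat
  fix j assume j: "j < d"
  have eq: "dyadic (l i) i j = of_int \<lfloor>x j * 2 ^ i\<rfloor> / 2 ^ i" for i
    using j by (simp add: dyadic_def l_def)
  have zero: "(\<lambda>i. (1 / 2 :: real) ^ i) \<longlonglongrightarrow> 0" by (rule LIMSEQ_power_zero) simp
  show "(\<lambda>i. dyadic (l i) i j) \<longlonglongrightarrow> x j"
  proof (rule LIM_zero_cancel, rule Lim_null_comparison[OF _ zero])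
    show "\<forall>\<^sub>F i in sequentially. norm (dyadic (l i) i j - x j) \<le> (1 / 2) ^ i"
    proof (rule always_eventually, rule allI)
      fix i
      have "dyadic (l i) i j - x j = (of_int \<lfloor>x j * 2 ^ i\<rfloor> - x j * 2 ^ i) / 2 ^ i"
        by (simp add: eq diff_divide_distrib)
      then have "norm (dyadic (l i) i j - x j) = \<bar>of_int \<lfloor>x j * 2 ^ i\<rfloor> - x j * 2 ^ i\<bar> / 2 ^ i" by simp
      also have "\<dots> \<le> 1 / 2 ^ i" by (intro divide_right_mono) (linarith, simp)
      finally show "norm (dyadic (l i) i j - x j) \<le> (1 / 2) ^ i" by (simp add: power_one_over)
    qed
  qed
qed

lemma tendsto_mv:
  assumes "\<And>j. j < d \<Longrightarrow> (\<lambda>i. X i j) \<longlonglongrightarrow> x j"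
  shows "(\<lambda>i. mv d B (X i) r) \<longlonglongrightarrow> mv d B x r"
  unfolding mv_def using assms by (intro tendsto_intros) auto

lemma tendsto_abs_powr:
  fixes f :: "nat \<Rightarrow> real"
  assumes "f \<longlonglongrightarrow> a" "0 < c" shows "(\<lambda>i. \<bar>f i\<bar> powr c) \<longlonglongrightarrow> \<bar>a\<bar> powr c"
  using assms by (intro tendsto_powr' tendsto_intros) auto

section \<open>Measurability and probability of the embedding event\<close>

context sampler
begin

definition embedded :: "(nat \<Rightarrow> real) \<Rightarrow> (nat \<Rightarrow> real) \<Rightarrow> bool" where
  "embedded w x \<longleftrightarrow> (1 - \<epsilon>) * pn R p (mv d B x) powr (1 / p) \<le> sampled w x powr (1 / p)
     \<and> sampled w x powr (1 / p) \<le> (1 + \<epsilon>) * pn R p (mv d B x) powr (1 / p)"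

lemma sampled_nonneg: "0 \<le> sampled w x"
  unfolding sampled_def using q_nonneg by (intro sum_nonneg) auto

lemma embedded_dense:
  assumes "\<And>l i. embedded w (dyadic l i)" shows "embedded w x"
proof -
  obtain l where l: "\<And>j. j < d \<Longrightarrow> (\<lambda>i. dyadic (l i) i j) \<longlonglongrightarrow> x j" using dyadic_approx[of d x] by blast
  have p0: "0 < p" "0 < 1 / p" using p by auto
  have "(\<lambda>i. pn R p (mv d B (dyadic (l i) i))) \<longlonglongrightarrow> pn R p (mv d B x)"
    unfolding pn_def by (intro tendsto_sum tendsto_abs_powr tendsto_mv l p0)
  then have "(\<lambda>i. \<bar>pn R p (mv d B (dyadic (l i) i))\<bar> powr (1 / p)) \<longlonglongrightarrow> \<bar>pn R p (mv d B x)\<bar> powr (1 / p)"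
    by (rule tendsto_abs_powr) (rule p0)
  then have N: "(\<lambda>i. pn R p (mv d B (dyadic (l i) i)) powr (1 / p)) \<longlonglongrightarrow> pn R p (mv d B x) powr (1 / p)"
    by (simp add: pn_nonneg)
  have "(\<lambda>i. sampled w (dyadic (l i) i)) \<longlonglongrightarrow> sampled w x"
    unfolding sampled_weighted by (intro tendsto_sum tendsto_mult tendsto_const tendsto_abs_powr tendsto_mv l p0)
  then have "(\<lambda>i. \<bar>sampled w (dyadic (l i) i)\<bar> powr (1 / p)) \<longlonglongrightarrow> \<bar>sampled w x\<bar> powr (1 / p)"
    by (rule tendsto_abs_powr) (rule p0)
  then have S: "(\<lambda>i. sampled w (dyadic (l i) i) powr (1 / p)) \<longlonglongrightarrow> sampled w x powr (1 / p)"
    by (simp add: sampled_nonneg)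
  show ?thesis unfolding embedded_def
  proof
    show "(1 - \<epsilon>) * pn R p (mv d B x) powr (1 / p) \<le> sampled w x powr (1 / p)"
      by (rule LIMSEQ_le[OF tendsto_mult_left[OF N] S]) (use assms in \<open>auto simp: embedded_def\<close>)
    show "sampled w x powr (1 / p) \<le> (1 + \<epsilon>) * pn R p (mv d B x) powr (1 / p)"
      by (rule LIMSEQ_le[OF S tendsto_mult_left[OF N]]) (use assms in \<open>auto simp: embedded_def\<close>)
  qed
qed

lemma measurable_sel: "Measurable.pred uniform_tape (\<lambda>w. w (pw r) < q w r)"
  by (intro pred_less_real measurable_tape_component measurable_q)

lemma measurable_embedded: "Measurable.pred uniform_tape (\<lambda>w. \<forall>x. embedded w x)"
proof -
  have S: "(\<lambda>w. sampled w x powr (1 / p)) \<in> borel_measurable uniform_tape" for x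
  proof -
    have "(\<lambda>w. \<bar>mv d B x r\<bar> powr p / min 1 (q w r)) \<in> borel_measurable uniform_tape" for r
      by (intro borel_measurable_divide borel_measurable_min borel_measurable_const measurable_q)
    then have "(\<lambda>w. sampled w x) \<in> borel_measurable uniform_tape"
      unfolding sampled_def
      by (intro borel_measurable_sum measurable_If borel_measurable_const measurable_sel[unfolded pred_def])
    moreover have "(\<lambda>y. y powr (1 / p)) \<in> borel_measurable borel" by measurable
    ultimately show ?thesis by (rule measurable_compose)
  qed
  have "(\<forall>x. embedded w x) \<longleftrightarrow> (\<forall>l i. embedded w (dyadic l i))" for w
    using embedded_dense by blast
  moreover have "Measurable.pred uniform_tape (\<lambda>w. \<forall>l i. embedded w (dyadic l i))"
    unfolding embedded_def
    by (intro pred_intros_countable pred_intros_logic(3) pred_le_real S borel_measurable_const)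
  ultimately show ?thesis by simp
qed

lemma measurable_count: "count \<in> borel_measurable uniform_tape"
  unfolding count_def[abs_def]
  by (intro borel_measurable_sum measurable_If borel_measurable_const measurable_sel[unfolded pred_def])

text \<open>Raising to the power \<open>1 / p \<le> 1\<close> can only bring the factors
  \<open>1 - \<epsilon>\<close> and \<open>1 + \<epsilon>\<close> closer to 1.\<close>

lemma powr_distortion:
  fixes a c :: real
  assumes "\<bar>a - c\<bar> \<le> \<epsilon> * c" "0 \<le> c" "0 \<le> a"
  shows "(1 - \<epsilon>) * c powr (1 / p) \<le> a powr (1 / p)" "a powr (1 / p) \<le> (1 + \<epsilon>) * c powr (1 / p)"
proof -
  have p1: "0 < 1 / p" "1 / p \<le> 1" using p by auto
  have lo: "(1 - \<epsilon>) * c \<le> a" and up: "a \<le> (1 + \<epsilon>) * c"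
    using assms(1) by (auto simp: left_diff_distrib distrib_right abs_le_iff)
  have "(1 - \<epsilon>) powr 1 * c powr (1 / p) \<le> (1 - \<epsilon>) powr (1 / p) * c powr (1 / p)"
    using \<epsilon> p1 by (intro mult_right_mono powr_mono') auto
  also have "\<dots> = ((1 - \<epsilon>) * c) powr (1 / p)" by (simp add: powr_mult)
  also have "\<dots> \<le> a powr (1 / p)" using lo \<epsilon> assms p1 by (intro powr_mono2) auto
  finally show "(1 - \<epsilon>) * c powr (1 / p) \<le> a powr (1 / p)" using \<epsilon> by simp
  have "a powr (1 / p) \<le> ((1 + \<epsilon>) * c) powr (1 / p)" using up assms p1 by (intro powr_mono2) auto
  also have "\<dots> = (1 + \<epsilon>) powr (1 / p) * c powr (1 / p)" by (simp add: powr_mult)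
  also have "\<dots> \<le> (1 + \<epsilon>) powr 1 * c powr (1 / p)"
    using \<epsilon> p1 by (intro mult_right_mono powr_mono) auto
  finally show "a powr (1 / p) \<le> (1 + \<epsilon>) * c powr (1 / p)" using \<epsilon> by simp
qed

text \<open>\<open>E0\<close> stands for the embedding property of the matrix without rows, which
  the final check may output; it does not depend on the tape.\<close>

lemma success_probability:
  fixes E0 :: bool
  shows "1 / 2 \<le> measure uniform_tape {w \<in> space uniform_tape.
    if count w \<le> Cap then \<forall>x. embedded w x else E0}"
proof -
  have "small (\<lambda>w. \<not> (if count w \<le> Cap then \<forall>x. embedded w x else E0)) (1 / 2)"
    using sampler_good
  proof (rule small_mono)
    fix w assume "\<not> (if count w \<le> Cap then \<forall>x. embedded w x else E0)"
    moreover have "embedded w x" if "\<bar>sampled w x - pn R p (mv d B x)\<bar> \<le> \<epsilon> * pn R p (mv d B x)" for x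
      unfolding embedded_def using powr_distortion[OF that pn_nonneg sampled_nonneg] by (rule conjI)
    ultimately show "\<not> (count w \<le> Cap \<and> (\<forall>x. \<bar>sampled w x - pn R p (mv d B x)\<bar> \<le> \<epsilon> * pn R p (mv d B x)))"
      by (cases "count w \<le> Cap") auto
  qed simp
  moreover have "{w \<in> space uniform_tape. if count w \<le> Cap then \<forall>x. embedded w x else E0} \<in> sets uniform_tape"
  proof -
    have c: "Measurable.pred uniform_tape (\<lambda>w. count w \<le> Cap)"
      by (intro pred_le_real measurable_count borel_measurable_const)
    have "Measurable.pred uniform_tape (\<lambda>w. (count w \<le> Cap \<and> (\<forall>x. embedded w x)) \<or> (\<not> count w \<le> Cap \<and> E0))"
      by (intro pred_intros_logic(2,3,5) c measurable_embedded) simp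
    then have "{w \<in> space uniform_tape. (count w \<le> Cap \<and> (\<forall>x. embedded w x)) \<or> (\<not> count w \<le> Cap \<and> E0)} \<in> sets uniform_tape"
      by (simp add: pred_def)
    moreover have "(if count w \<le> Cap then \<forall>x. embedded w x else E0)
        \<longleftrightarrow> (count w \<le> Cap \<and> (\<forall>x. embedded w x)) \<or> (\<not> count w \<le> Cap \<and> E0)" for w by simp
    ultimately show ?thesis by (simp only:)
  qed
  ultimately show ?thesis using small_imp_measure_ge[of _ "1 / 2"] by fastforce
qed

end

section \<open>Runs of the program\<close>

text \<open>Stages that draw nothing may be evaluated on the constant tape 0. The number of rows,
  the sizes and the matrix \<open>B\<close> are then constants, as the locale \<open>sampler\<close>
  requires, rather than functions of the tape.\<close>

lemma ev_nodraw: "nodraw c \<Longrightarrow> ev w c s = ev w' c s"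
proof (induction c arbitrary: s)
  case (PF v b c)
  have "rec_nat (nwrite v 0 0 s) (\<lambda>i s'. nwrite v 0 (Suc i) (ev w c s')) N
      = rec_nat (nwrite v 0 0 s) (\<lambda>i s'. nwrite v 0 (Suc i) (ev w' c s')) N" for N
    by (induction N) (use PF in auto)
  then show ?case by simp
next
  case (PS c c')
  then show ?case by (metis ev.simps(5) nodraw.simps(5))
qed auto

lemma p_sets:
  "wN p_init = {11, 12}" "wN p_enum = {30, 13, 20, 21}" "wN p_all = {31, 4, 3}"
  "wN p_sizes_init = {14, 18}" "wN p_sizes = {31, 14, 15, 18, 16}" "wN p_len = {17}"
  "wN p_offsets = {33, 23, 19}" "wN p_rows = {31, 22, 32}" "wN p_sketch = {30}"
  "wN p_gram = {33, 34, 35}" "wN p_proj = {36, 33, 35, 30, 31}" "wN p_select = {31, 3, 4}" "wN p_check = {3}"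
  "wR p_init = {}" "wR p_enum = {}" "wR p_all = {2}"
  "wR p_sizes_init = {}" "wR p_sizes = {}" "wR p_len = {}"
  "wR p_offsets = {12}" "wR p_rows = {10, 11}" "wR p_sketch = {12}"
  "wR p_gram = {12, 13}" "wR p_proj = {14, 15, 16, 17}" "wR p_select = {10, 19, 2}" "wR p_check = {}"
  by (auto simp: p_init_def p_enum_def p_all_def p_sizes_init_def p_sizes_def p_len_def p_offsets_def
      p_rows_def p_bits_def p_sketch_def p_gram_def p_dot_def p_proj_def p_z_def p_g_def p_acc_def p_wt_def
      p_select_def p_check_def)

lemma p_nodraw:
  "nodraw p_init" "nodraw p_enum" "nodraw p_all" "nodraw p_sizes_init" "nodraw p_sizes" "nodraw p_len"
  "nodraw p_offsets" "nodraw p_sketch" "nodraw p_gram" "nodraw p_check"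
  by (simp_all add: p_init_def p_enum_def p_all_def p_sizes_init_def p_sizes_def p_len_def p_offsets_def
      p_sketch_def p_gram_def p_dot_def p_check_def)

lemma p_wf:
  "wf p_init" "wf p_enum" "wf p_all" "wf p_sizes_init" "wf p_sizes" "wf p_len" "wf p_offsets" "wf p_rows"
  "wf p_sketch" "wf p_gram" "wf p_proj" "wf p_select" "wf p_check"
  by (simp_all add: p_init_def p_enum_def p_all_def p_sizes_init_def p_sizes_def p_len_def p_offsets_def
      p_rows_def p_bits_def p_sketch_def p_gram_def p_dot_def p_proj_def p_z_def p_g_def p_acc_def p_wt_def
      p_select_def p_check_def)

lemma p_time:
  "tb p_init s = 2"
  "tb p_enum s = 2 + nmem s 12 0 * 7"
  "tb p_all s = 3 + nmem s 13 0 * 4"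
  "tb p_sizes_init s = 2"
  "tb p_sizes s = 2 + nmem s 13 0 * 10"
  "tb p_len s = 1"
  "tb p_offsets s = 2 + nmem s 11 0 * 5"
  "tb p_rows s = 2 + nmem s 13 0 * (12 + nmem s 15 0 * 8)"
  "tb p_sketch s = 2 + nmem s 12 0 * 3"
  "tb p_gram s = 2 + nmem s 11 0 * (10 + nmem s 14 0 * 3 + nmem s 17 0 * 3
      + nmem s 11 0 * (9 + nmem s 14 0 * 3 + nmem s 17 0 * 3))"
  "tb p_proj s = 2 + nmem s 16 0 * (10 + nmem s 11 0 * 3 + nmem s 11 0 * (5 + nmem s 11 0 * 3)
      + nmem s 12 0 * 3 + nmem s 13 0 * 4)"
  "tb p_select s = 2 + nmem s 13 0 * 11"
  "tb p_check s = 3"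
  by (simp_all add: p_init_def p_enum_def p_all_def p_sizes_init_def p_sizes_def p_len_def p_offsets_def
      p_rows_def p_bits_def p_sketch_def p_gram_def p_dot_def p_proj_def p_z_def p_g_def p_acc_def p_wt_def
      p_select_def p_check_def)
    (simp_all add: algebra_simps)

definition runs :: "(nat \<Rightarrow> real) \<Rightarrow> com \<Rightarrow> store \<Rightarrow> nat \<Rightarrow> store \<Rightarrow> bool" where
  "runs w c s T s' \<longleftrightarrow> (\<exists>t\<le>T. exec w c s t s')"

lemma runs_compile: "wf c \<Longrightarrow> tb c s \<le> T \<Longrightarrow> runs w (compile c) s T (ev w c s)"
  using exec_compile[of c s w] order_trans by (auto simp: runs_def)

lemma runs_Seq: "runs w c s T s' \<Longrightarrow> runs w c' s' T' s'' \<Longrightarrow> runs w (Seq c c') s (T + T') s''"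
  unfolding runs_def by (meson add_mono exec.Seq)

lemma runs_CondTrue: "tval b s \<Longrightarrow> runs w c s T s' \<Longrightarrow> runs w (Cond b c c') s (Suc T) s'"
  unfolding runs_def by (meson Suc_le_mono exec.CondTrue)

lemma runs_CondFalse: "\<not> tval b s \<Longrightarrow> runs w c' s T s' \<Longrightarrow> runs w (Cond b c c') s (Suc T) s'"
  unfolding runs_def by (meson Suc_le_mono exec.CondFalse)

definition sketch_and_sample :: com where
  "sketch_and_sample = Seq (compile p_sizes_init) (Seq (compile p_sizes) (Seq (compile p_len)
     (Seq (compile p_offsets) (Seq (compile p_rows) (Seq (compile p_sketch) (Seq (compile p_gram)
     (Seq (compile p_proj) (Seq (compile p_select) (compile p_check)))))))))"

definition embedding_program :: com where
  "embedding_program = Cond (RLe (rl 1) (RGet 0 (NLit 1))) Skip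
     (Seq (compile p_init) (Seq (compile p_enum)
       (Cond (RLe (ROfNat (nv 13)) e_cap) (compile p_all) sketch_and_sample)))"

lemma output_matrix_sampling:
  assumes "\<And>j. j < nmem s 3 0 \<Longrightarrow> nmem s 4 j < n \<and> rmem s 2 j \<noteq> 0"
  shows "output_matrix n s \<in> carrier_mat (nmem s 3 0) n" "sampling_matrix (output_matrix n s)"
proof -
  show "output_matrix n s \<in> carrier_mat (nmem s 3 0) n" by (simp add: output_matrix_def)
  show "sampling_matrix (output_matrix n s)"
    unfolding sampling_matrix_def
  proof (intro allI impI)
    fix r assume "r < dim_row (output_matrix n s)"
    then have r: "r < nmem s 3 0" by (simp add: output_matrix_def)
    show "\<exists>!j. j < dim_col (output_matrix n s) \<and> output_matrix n s $$ (r, j) \<noteq> 0"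
      using r assms[OF r] by (intro ex1I[of _ "nmem s 4 r"]) (auto simp: output_matrix_def split: if_splits)
  qed
qed

lemma output_matrix_mult:
  assumes "\<And>j. j < nmem s 3 0 \<Longrightarrow> nmem s 4 j < n" and y: "y \<in> carrier_vec n"
  shows "lp_norm p (output_matrix n s *\<^sub>v y)
    = (\<Sum>j<nmem s 3 0. \<bar>rmem s 2 j * y $ nmem s 4 j\<bar> powr p) powr (1 / p)"
proof -
  have "(output_matrix n s *\<^sub>v y) $ j = rmem s 2 j * y $ nmem s 4 j" if j: "j < nmem s 3 0" for j
  proof -
    have "(output_matrix n s *\<^sub>v y) $ j = (\<Sum>i\<in>{0..<n}. (if i = nmem s 4 j then rmem s 2 j else 0) * y $ i)"
      using j y by (simp add: output_matrix_def scalar_prod_def)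
    also have "\<dots> = (\<Sum>i\<in>{0..<n}. if i = nmem s 4 j then rmem s 2 j * y $ i else 0)"
      by (intro sum.cong) auto
    also have "\<dots> = rmem s 2 j * y $ nmem s 4 j" using assms(1)[OF j] by simp
    finally show ?thesis .
  qed
  then show ?thesis by (simp add: lp_norm_def output_matrix_def)
qed

section \<open>The preprocessing stages and the two branches without sampling\<close>

locale run =
  fixes n d :: nat and p \<epsilon> :: real and A :: "real mat" and es :: "(nat \<times> nat \<times> real) list"
  assumes A: "A \<in> carrier_mat n d" and es: "lists_entries A es" and d1: "1 \<le> d" and n: "1000 \<le> n"
    and p: "1 \<le> p" "p < 2" and \<epsilon>: "0 < \<epsilon>" and lnn: "1000 * ln (real n) \<le> real d"
begin

definition N :: nat where "N = length es"

definition s0 :: store where "s0 = input_store n d p \<epsilon> es"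

definition s2 :: store where "s2 = ev (\<lambda>_. 0) p_enum (ev (\<lambda>_. 0) p_init s0)"

definition R :: nat where "R = nmem s2 13 0"

definition rowof :: "nat \<Rightarrow> nat" where "rowof = nmem s2 21"

definition B :: "nat \<Rightarrow> nat \<Rightarrow> real" where "B r j = A $$ (rowof r, j)"

definition Cap :: real where "Cap = 2 ^ 32 * real d ^ 21 / \<epsilon>\<^sup>2"

lemma N_nnz: "N = nnz A"
  unfolding N_def by (rule lists_entries_length[OF es])

lemma s0_mem:
  "nmem s0 0 = (\<lambda>_. 0)(0 := n, 1 := d, 2 := N)"
  "\<And>k. k < N \<Longrightarrow> nmem s0 1 k = fst (es ! k)" "\<And>k. k < N \<Longrightarrow> nmem s0 2 k = fst (snd (es ! k))"
  "\<And>k. k < N \<Longrightarrow> rmem s0 1 k = snd (snd (es ! k))"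
  "rmem s0 0 0 = p" "rmem s0 0 1 = \<epsilon>" "drawn s0 = 0"
  "\<And>a. 2 < a \<Longrightarrow> nmem s0 a = (\<lambda>_. 0)" "\<And>a. 1 < a \<Longrightarrow> rmem s0 a = (\<lambda>_. 0)"
  by (auto simp: s0_def input_store_def N_def)

lemma mem_es: "(i, j, v) \<in> set es \<longleftrightarrow> i < n \<and> j < d \<and> v = A $$ (i, j) \<and> v \<noteq> 0"
proof -
  have "set es = {(i, j, v). i < dim_row A \<and> j < dim_col A \<and> v = A $$ (i, j) \<and> v \<noteq> 0}"
    using es unfolding lists_entries_def by (rule conjunct2)
  then have "(i, j, v) \<in> set es \<longleftrightarrow>
      (i, j, v) \<in> {(i, j, v). i < dim_row A \<and> j < dim_col A \<and> v = A $$ (i, j) \<and> v \<noteq> 0}"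
    by (rule arg_cong)
  then show ?thesis using carrier_matD[OF A] by simp
qed

lemma entry:
  assumes "k < N"
  shows "fst (es ! k) < n" "fst (snd (es ! k)) < d" "snd (snd (es ! k)) = A $$ (fst (es ! k), fst (snd (es ! k)))"
proof -
  have "es ! k \<in> set es" using assms by (simp add: N_def)
  then show "fst (es ! k) < n" "fst (snd (es ! k)) < d" "snd (snd (es ! k)) = A $$ (fst (es ! k), fst (snd (es ! k)))"
    using mem_es[of "fst (es ! k)" "fst (snd (es ! k))" "snd (snd (es ! k))"] by simp_all
qed

lemma s1_mem: "nmem (ev w p_init s0) 11 0 = d" "nmem (ev w p_init s0) 12 0 = N"
  by (simp_all add: p_init_def s0_mem)

lemma s2_frame: "a \<notin> {11, 12, 30, 13, 20, 21} \<Longrightarrow> nmem s2 a = nmem s0 a" "rmem s2 a = rmem s0 a" "drawn s2 = 0"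
  unfolding s2_def by (simp_all add: nmem_frame rmem_frame drawn_frame p_sets p_nodraw s0_mem)

lemma s2_mem: "nmem s2 11 0 = d" "nmem s2 12 0 = N" "nmem s2 13 0 = R"
  "\<And>k. k < N \<Longrightarrow> nmem s2 1 k = fst (es ! k)" "\<And>k. k < N \<Longrightarrow> nmem s2 2 k = fst (snd (es ! k))"
  "\<And>k. k < N \<Longrightarrow> rmem s2 1 k = snd (snd (es ! k))" "rmem s2 0 0 = p" "rmem s2 0 (Suc 0) = \<epsilon>" "rmem s2 0 1 = \<epsilon>"
  "nmem s2 21 = rowof"
proof -
  have "nmem s2 11 = nmem (ev (\<lambda>_. 0) p_init s0) 11" "nmem s2 12 = nmem (ev (\<lambda>_. 0) p_init s0) 12"
    unfolding s2_def by (simp_all add: nmem_frame p_sets)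
  then show "nmem s2 11 0 = d" "nmem s2 12 0 = N" by (simp_all add: s1_mem)
  show "\<And>k. k < N \<Longrightarrow> nmem s2 1 k = fst (es ! k)" using s2_frame(1)[of 1] s0_mem(2) by simp
  show "\<And>k. k < N \<Longrightarrow> nmem s2 2 k = fst (snd (es ! k))" using s2_frame(1)[of 2] s0_mem(3) by simp
  show "\<And>k. k < N \<Longrightarrow> rmem s2 1 k = snd (snd (es ! k))" using s2_frame(2)[of 1] s0_mem(4) by simp
  show "rmem s2 0 0 = p" "rmem s2 0 1 = \<epsilon>" using s2_frame(2)[of 0] s0_mem by simp_all
  then show "rmem s2 0 (Suc 0) = \<epsilon>" by simp
qed (simp_all add: R_def rowof_def)

lemma enum:
  shows "R \<le> N" "\<And>k. k < N \<Longrightarrow> rk s2 k < R \<and> rowof (rk s2 k) = fst (es ! k)"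
    and "bij_betw rowof {..<R} (fst ` set es)"
proof -
  let ?s1 = "ev (\<lambda>_. 0) p_init s0"
  have z: "nmem ?s1 20 = (\<lambda>_. 0)" "nmem ?s1 13 0 = 0"
    by (simp_all add: nmem_frame p_sets s0_mem)
  have row: "nmem ?s1 1 k = fst (es ! k)" if "k < N" for k
    using s0_mem(2)[OF that] nmem_frame[of 1 p_init "\<lambda>_. 0" s0] by (simp add: p_sets)
  note sp = p_enum_spec[where w="\<lambda>_. 0", OF s1_mem(2) z, folded s2_def]
  show "R \<le> N" using sp(1) by (simp add: R_def)
  have eq1: "nmem s2 1 k = nmem ?s1 1 k" for k
    unfolding s2_def by (simp add: nmem_frame p_sets)
  show "rk s2 k < R \<and> rowof (rk s2 k) = fst (es ! k)" if "k < N" for k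
    using sp(2)[OF that] row[OF that] unfolding rk_def rowof_def R_def eq1 by simp
  have "nmem ?s1 1 ` {..<N} = fst ` set es"
  proof -
    have "nmem ?s1 1 ` {..<N} = (\<lambda>k. fst (es ! k)) ` {..<N}" using row by (intro image_cong) auto
    also have "\<dots> = fst ` ((!) es ` {..<N})" by (simp add: image_image)
    also have "(!) es ` {..<N} = set es" unfolding N_def by (simp add: set_conv_nth image_def Bex_def) blast
    finally show ?thesis .
  qed
  then show "bij_betw rowof {..<R} (fst ` set es)" using sp(3) by (simp add: rowof_def R_def)
qed

lemma rowof_less: "r < R \<Longrightarrow> rowof r < n"
proof -
  assume "r < R"
  then have "rowof r \<in> fst ` set es" using bij_betw_apply[OF enum(3)] by simp
  then obtain j v where "(rowof r, j, v) \<in> set es" by auto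
  then show "rowof r < n" by (simp only: mem_es)
qed

lemma R_le_n: "R \<le> n"
proof -
  have "card (rowof ` {..<R}) \<le> card {..<n}" using rowof_less by (intro card_mono) auto
  moreover have "card (rowof ` {..<R}) = R"
    using card_image[of rowof "{..<R}"] bij_betw_imp_inj_on[OF enum(3)] by simp
  ultimately show ?thesis by simp
qed

text \<open>\<open>g\<close> is arbitrary because both passes over the entries use this: with a unit
  vector for the sketch, and with the image of a random direction for the projections. Each nonzero
  entry is listed exactly once, so the order of the list is irrelevant.\<close>

lemma entry_sum:
  assumes r: "r < R"
  shows "(\<Sum>k<N. if rk s2 k = r then rmem s2 1 k * g (nmem s2 2 k) else 0) = mv d B g r"
proof -
  have inj: "inj_on rowof {..<R}" using enum(3) by (simp add: bij_betw_def)
  have "(\<Sum>k<N. if rk s2 k = r then rmem s2 1 k * g (nmem s2 2 k) else 0)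
      = (\<Sum>k<N. if fst (es ! k) = rowof r then snd (snd (es ! k)) * g (fst (snd (es ! k))) else 0)"
  proof (intro sum.cong refl)
    fix k assume "k \<in> {..<N}"
    then have k: "k < N" by simp
    have "rk s2 k = r \<longleftrightarrow> fst (es ! k) = rowof r"
      using enum(2)[OF k] inj_onD[OF inj, of "rk s2 k" r] r by auto
    then show "(if rk s2 k = r then rmem s2 1 k * g (nmem s2 2 k) else 0)
      = (if fst (es ! k) = rowof r then snd (snd (es ! k)) * g (fst (snd (es ! k))) else 0)"
      using s2_mem(5)[OF k] s2_mem(6)[OF k] by simp
  qed
  also have "\<dots> = (\<Sum>e\<in>set es. if fst e = rowof r then snd (snd e) * g (fst (snd e)) else 0)"
  proof (rule sum.reindex_bij_betw)
    show "bij_betw ((!) es) {..<N} (set es)"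
      by (rule bij_betw_nth[OF conjunct1[OF es[unfolded lists_entries_def]]]) (simp_all add: N_def)
  qed
  also have "\<dots> = (\<Sum>e\<in>{e \<in> set es. fst e = rowof r}. snd (snd e) * g (fst (snd e)))"
    by (intro sum.inter_filter[symmetric]) simp
  also have "{e \<in> set es. fst e = rowof r} = (\<lambda>j. (rowof r, j, B r j)) ` {j \<in> {..<d}. B r j \<noteq> 0}"
    using rowof_less[OF r] by (auto simp: mem_es B_def image_iff)
  also have "(\<Sum>e\<in>(\<lambda>j. (rowof r, j, B r j)) ` {j \<in> {..<d}. B r j \<noteq> 0}. snd (snd e) * g (fst (snd e)))
      = (\<Sum>j\<in>{j \<in> {..<d}. B r j \<noteq> 0}. B r j * g j)"
    by (subst sum.reindex) (auto simp: inj_on_def)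
  also have "\<dots> = (\<Sum>j<d. B r j * g j)"
    by (intro sum.mono_neutral_left) auto
  finally show ?thesis by (simp add: mv_def)
qed

lemma mult_A:
  assumes x: "x \<in> carrier_vec d" and i: "i < n"
  shows "(A *\<^sub>v x) $ i = (\<Sum>j<d. A $$ (i, j) * x $ j)"
  using A x i by (auto simp: scalar_prod_def atLeast0LessThan intro!: sum.cong)

lemma mult_B: "x \<in> carrier_vec d \<Longrightarrow> r < R \<Longrightarrow> (A *\<^sub>v x) $ rowof r = mv d B (vec_index x) r"
  using mult_A[of x "rowof r"] rowof_less by (simp add: mv_def B_def)

lemma sum_rows:
  assumes x: "x \<in> carrier_vec d" and F: "\<And>i. i < n \<Longrightarrow> (A *\<^sub>v x) $ i = 0 \<Longrightarrow> F i = 0"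
  shows "(\<Sum>i<n. F i) = (\<Sum>r<R. F (rowof r) :: real)"
proof -
  have "(\<Sum>r<R. F (rowof r)) = (\<Sum>i\<in>fst ` set es. F i)"
    by (rule sum.reindex_bij_betw[OF enum(3)])
  also have "\<dots> = (\<Sum>i<n. F i)"
  proof (rule sum.mono_neutral_left)
    show "fst ` set es \<subseteq> {..<n}" by (auto simp: mem_es)
    show "\<forall>i\<in>{..<n} - fst ` set es. F i = 0"
    proof
      fix i assume i: "i \<in> {..<n} - fst ` set es"
      have "A $$ (i, j) = 0" if "j < d" for j
      proof (rule ccontr)
        assume "A $$ (i, j) \<noteq> 0"
        then have "(i, j, A $$ (i, j)) \<in> set es" using i that by (simp add: mem_es)
        then show False using i by force
      qed
      then have "(A *\<^sub>v x) $ i = 0" using mult_A[OF x, of i] i by simp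
      then show "F i = 0" using F i by simp
    qed
  qed simp
  finally show ?thesis by simp
qed

lemma lp_norm_A:
  assumes "x \<in> carrier_vec d"
  shows "lp_norm p (A *\<^sub>v x) = pn R p (mv d B (vec_index x)) powr (1 / p)"
proof -
  have "(\<Sum>i<n. \<bar>(A *\<^sub>v x) $ i\<bar> powr p) = (\<Sum>r<R. \<bar>(A *\<^sub>v x) $ rowof r\<bar> powr p)"
    by (rule sum_rows[OF assms]) simp
  also have "\<dots> = pn R p (mv d B (vec_index x))"
    unfolding pn_def using mult_B[OF assms] by (intro sum.cong) auto
  finally show ?thesis using A by (simp add: lp_norm_def)
qed

lemma lp_norm_nonneg: "0 \<le> lp_norm p v"
  by (simp add: lp_norm_def)

lemma e_cap: "nmem s 11 0 = d \<Longrightarrow> rmem s 0 1 = \<epsilon> \<Longrightarrow> rval e_cap s = Cap"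
  using d1 by (simp add: e_cap_def Cap_def powr_numeral power2_eq_square)

definition s_all :: store where "s_all = ev (\<lambda>_. 0) p_all s2"

lemma run_big_eps: "1 \<le> \<epsilon> \<Longrightarrow> runs w embedding_program s0 2 s0"
  unfolding embedding_program_def numeral_2_eq_2
proof (rule runs_CondTrue)
  show "1 \<le> \<epsilon> \<Longrightarrow> tval (RLe (rl 1) (RGet 0 (NLit 1))) s0" using s0_mem(6) by simp
  show "runs w Skip s0 (Suc 0) s0" unfolding runs_def using exec.Skip[of w s0] by auto
qed

lemma run_prefix:
  assumes "\<epsilon> < 1" "runs w (Cond (RLe (ROfNat (nv 13)) e_cap) (compile p_all) sketch_and_sample) s2 T s'"
  shows "runs w embedding_program s0 (Suc (2 + ((2 + N * 7) + T))) s'"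
proof -
  let ?s1 = "ev (\<lambda>_. 0) p_init s0"
  have 1: "runs w (compile p_init) s0 2 ?s1"
    using runs_compile[OF p_wf(1), of s0 2 w] ev_nodraw[OF p_nodraw(1), of w s0 "\<lambda>_. 0"] by (simp add: p_time)
  have 2: "runs w (compile p_enum) ?s1 (2 + N * 7) s2"
    using runs_compile[OF p_wf(2), of ?s1 "2 + N * 7" w] ev_nodraw[OF p_nodraw(2), of w ?s1 "\<lambda>_. 0"]
    by (simp add: p_time s1_mem s2_def)
  show ?thesis
    unfolding embedding_program_def
  proof (rule runs_CondFalse)
    show "\<not> tval (RLe (rl 1) (RGet 0 (NLit 1))) s0" using assms(1) s0_mem(6) by simp
    show "runs w (Seq (compile p_init) (Seq (compile p_enum)
       (Cond (RLe (ROfNat (nv 13)) e_cap) (compile p_all) sketch_and_sample))) s0 (2 + ((2 + N * 7) + T)) s'"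
      by (rule runs_Seq[OF 1 runs_Seq[OF 2 assms(2)]])
  qed
qed

lemma run_all:
  assumes "\<epsilon> < 1" "real R \<le> Cap"
  shows "runs w embedding_program s0 (Suc (2 + ((2 + N * 7) + Suc (3 + R * 4)))) s_all"
proof (rule run_prefix[OF assms(1)], rule runs_CondTrue)
  show "tval (RLe (ROfNat (nv 13)) e_cap) s2"
    using e_cap[OF s2_mem(1,9)] assms(2) by (simp add: s2_mem)
  show "runs w (compile p_all) s2 (3 + R * 4) s_all"
    using runs_compile[OF p_wf(3), of s2 "3 + R * 4" w] ev_nodraw[OF p_nodraw(3), of w s2 "\<lambda>_. 0"]
    by (simp add: p_time s2_mem s_all_def)
qed

lemma s_all_mem: "nmem s_all 3 0 = R" "\<And>r. r < R \<Longrightarrow> nmem s_all 4 r = rowof r" "\<And>r. r < R \<Longrightarrow> rmem s_all 2 r = 1"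
  using p_all_spec[where s=s2] by (simp_all add: s_all_def s2_mem)

lemma embeds_all: "embeds_col_space p \<epsilon> A (output_matrix n s_all)"
  unfolding embeds_col_space_def
proof
  fix x :: "real Matrix.vec"
  assume "x \<in> carrier_vec (dim_col A)"
  then have x: "x \<in> carrier_vec d" using A by simp
  have y: "A *\<^sub>v x \<in> carrier_vec n" using A x by simp
  have "lp_norm p (output_matrix n s_all *\<^sub>v (A *\<^sub>v x))
      = (\<Sum>j<nmem s_all 3 0. \<bar>rmem s_all 2 j * (A *\<^sub>v x) $ nmem s_all 4 j\<bar> powr p) powr (1 / p)"
    by (rule output_matrix_mult) (use y s_all_mem rowof_less in auto)
  also have "(\<Sum>j<nmem s_all 3 0. \<bar>rmem s_all 2 j * (A *\<^sub>v x) $ nmem s_all 4 j\<bar> powr p) = pn R p (mv d B (vec_index x))"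
    unfolding pn_def s_all_mem using s_all_mem mult_B[OF x] by (intro sum.cong) auto
  finally have eq: "lp_norm p (output_matrix n s_all *\<^sub>v (A *\<^sub>v x)) = lp_norm p (A *\<^sub>v x)"
    by (simp add: lp_norm_A[OF x])
  show "(1 - \<epsilon>) * lp_norm p (A *\<^sub>v x) \<le> lp_norm p (output_matrix n s_all *\<^sub>v (A *\<^sub>v x)) \<and>
      lp_norm p (output_matrix n s_all *\<^sub>v (A *\<^sub>v x)) \<le> (1 + \<epsilon>) * lp_norm p (A *\<^sub>v x)"
    unfolding eq using \<epsilon> lp_norm_nonneg[of "A *\<^sub>v x"]
    by (simp add: algebra_simps)
qed

text \<open>For \<open>1 \<le> \<epsilon>\<close> the lower bound is nonpositive, so a norm of 0
  satisfies it.\<close>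

lemma embeds_empty:
  assumes "1 \<le> \<epsilon>" "nmem s 3 0 = 0"
  shows "embeds_col_space p \<epsilon> A (output_matrix n s)"
proof -
  have "lp_norm p (output_matrix n s *\<^sub>v y) = 0" for y
    using assms(2) by (simp add: lp_norm_def output_matrix_def)
  then show ?thesis
    unfolding embeds_col_space_def using assms(1) lp_norm_nonneg
    by (auto simp: mult_nonpos_nonneg)
qed

end

section \<open>The sampling branch as an instance of the sampler\<close>

locale sampling_run = run +
  assumes \<epsilon>1: "\<epsilon> < 1" and cap: "Cap < real R"
begin

definition s3 :: store where
  "s3 = ev (\<lambda>_. 0) p_sizes (ev (\<lambda>_. 0) p_sizes_init s2)"

definition b :: nat where "b = nmem s3 15 0"
definition L :: nat where "L = nmem s3 16 0"
definition len :: nat where "len = 2 ^ b + d"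

definition s4 :: store where
  "s4 = ev (\<lambda>_. 0) p_offsets (ev (\<lambda>_. 0) p_len s3)"

lemma lnR: "1000 * ln (real R) \<le> real d"
proof -
  have "0 \<le> Cap" using \<epsilon> by (simp add: Cap_def)
  then have "0 < real R" using cap by linarith
  then have "ln (real R) \<le> ln (real n)" using R_le_n by (subst ln_le_cancel_iff) auto
  with lnn show ?thesis by linarith
qed

lemma d_R: "1600 * (real d * real d) \<le> real R"
proof -
  have e2: "0 < \<epsilon>\<^sup>2" "\<epsilon>\<^sup>2 \<le> 1" using \<epsilon> \<epsilon>1 by (auto simp: power_le_one)
  have "1600 * (real d * real d) \<le> 2 ^ 32 * real d ^ 21"
  proof -
    have "real d ^ 2 \<le> real d ^ 21" using d1 by (intro power_increasing) auto
    then have "1600 * (real d * real d) \<le> 1600 * real d ^ 21" by (simp add: power2_eq_square)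
    also have "\<dots> \<le> 2 ^ 32 * real d ^ 21" by (intro mult_right_mono) auto
    finally show ?thesis .
  qed
  also have "\<dots> \<le> Cap"
    unfolding Cap_def using e2 by (subst pos_le_divide_eq) (auto intro: mult_left_le)
  finally show ?thesis using cap by linarith
qed

lemma sizes: "nmem s3 14 0 = 2 ^ b" "1600 * (real d * real d) \<le> 2 ^ b" "2 ^ b \<le> 3200 * (real d * real d)"
  "R < 2 ^ L" "2 ^ L \<le> 2 * max 1 R"
proof -
  let ?s = "ev (\<lambda>_. 0) p_sizes_init s2"
  have "nmem ?s 13 0 = R" "nmem ?s 11 0 = d" "nmem ?s 14 0 = 1" "nmem ?s 18 0 = 1" "nmem ?s 15 0 = 0" "nmem ?s 16 0 = 0"
    by (simp_all add: p_sizes_init_def s2_mem s2_frame s0_mem)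
  from p_sizes_spec[where w="\<lambda>_. 0", OF this d_R d1, folded s3_def]
  show "nmem s3 14 0 = 2 ^ b" "1600 * (real d * real d) \<le> 2 ^ b" "2 ^ b \<le> 3200 * (real d * real d)"
    "R < 2 ^ L" "2 ^ L \<le> 2 * max 1 R"
    by (simp_all add: b_def L_def)
qed

lemmas numerics = sampler_numerics[OF d1 \<epsilon> \<epsilon>1 cap[unfolded Cap_def] lnR sizes(4,5)]

lemma pz_less: "l < L \<Longrightarrow> k < d \<Longrightarrow> l * d + k < L * d"
proof -
  assume "l < L" "k < d"
  then have "l * d + k < l * d + d" "Suc l * d \<le> L * d" by (simp, intro mult_le_mono1, simp)
  then show ?thesis by simp
qed

text \<open>The tape positions mirror the order of the draws: three cells per row for scaling,
  bucket and sign, then \<open>L\<close> blocks of \<open>d\<close> cells for the directions, then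
  one selection cell per row.\<close>

sublocale sampler R d b L "1000 * R ^ 3 * d ^ 4" p \<epsilon> "real d ^ 3" "real d ^ 3" Cap B
  "\<lambda>r. 3 * r" "\<lambda>r. 3 * r + 1" "\<lambda>r. 3 * r + 2" "\<lambda>r. 3 * R + L * d + r" "\<lambda>l k. 3 * R + l * d + k"
proof
  show "3 * R + l * d + k = 3 * R + l' * d + k' \<longleftrightarrow> l = l' \<and> k = k'" if "k < d" "k' < d" for l l' k k'
    using addr_eq[OF that, of l l'] by auto
  show "3 * R + l * d + k \<noteq> 3 * r \<and> 3 * R + l * d + k \<noteq> 3 * r + 1 \<and> 3 * R + l * d + k \<noteq> 3 * r + 2
      \<and> 3 * R + l * d + k \<noteq> 3 * R + L * d + r" if "l < L" "k < d" "r < R" for l k r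
    using pz_less[OF that(1,2)] that(3) by auto
  show "3 * r \<noteq> 3 * r' + 1 \<and> 3 * r \<noteq> 3 * r' + 2 \<and> 3 * r + 1 \<noteq> 3 * r' + 2 \<and> 3 * R + L * d + r \<noteq> 3 * r' \<and>
      3 * R + L * d + r \<noteq> 3 * r' + 1 \<and> 3 * R + L * d + r \<noteq> 3 * r' + 2" if "r < R" "r' < R" for r r'
  proof -
    have "3 * r \<noteq> 3 * r' + 1" "3 * r \<noteq> 3 * r' + 2" "3 * r + 1 \<noteq> 3 * r' + 2" by presburger+
    moreover have "3 * r' + 2 < 3 * R + L * d + r" using that by linarith
    ultimately show ?thesis by linarith
  qed
  show "1600 * (real d)\<^sup>2 \<le> 2 ^ b" using sizes(2) by (simp add: power2_eq_square)
  show "100 * (64 * real d ^ 3 / \<epsilon>\<^sup>2 * (64 * real d ^ 3 * real d)\<^sup>2 *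
      (128 * real L * real d ^ 3 * (real d ^ 3)\<^sup>2)) \<le> Cap"
    unfolding Cap_def by (rule numerics(9))
qed (use p \<epsilon> \<epsilon>1 d1 numerics in \<open>auto simp: inj_on_def\<close>)

lemma s4_frame: "a \<notin> {14, 18, 31, 15, 16, 17, 33, 23, 19} \<Longrightarrow> nmem s4 a = nmem s2 a"
  "a \<noteq> 12 \<Longrightarrow> rmem s4 a = rmem s2 a" "drawn s4 = 0"
  unfolding s4_def s3_def by (simp_all add: nmem_frame rmem_frame drawn_frame p_sets p_nodraw s2_frame)

lemma s4_mem: "nmem s4 11 0 = d" "nmem s4 12 0 = N" "nmem s4 13 0 = R" "nmem s4 14 0 = 2 ^ b"
  "nmem s4 15 0 = b" "nmem s4 16 0 = L" "nmem s4 17 0 = len"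
  "\<And>j. j < d \<Longrightarrow> nmem s4 23 j = j * len"
  "\<And>j x. j < d \<Longrightarrow> x < len \<Longrightarrow> rmem s4 12 (j * len + x) = (if x = 2 ^ b + j then 1 else 0)"
  "nmem s4 3 0 = 0" "rmem s4 16 = (\<lambda>_. 0)" "rmem s4 17 = (\<lambda>_. 0)"
proof -
  let ?s = "ev (\<lambda>_. 0) p_len s3"
  have d3: "nmem s3 11 0 = d" unfolding s3_def by (simp add: nmem_frame p_sets s2_mem)
  have m: "nmem ?s 11 0 = d" "nmem ?s 17 0 = len" "nmem ?s 14 0 = 2 ^ b"
    using d3 sizes(1) by (simp_all add: p_len_def len_def)
  have z: "nmem ?s 19 0 = 0" "rmem ?s 12 = (\<lambda>_. 0)"
    unfolding s3_def by (simp_all add: nmem_frame rmem_frame p_sets s2_frame s0_mem)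
  from p_offsets_spec[where w="\<lambda>_. 0", OF m(1,2,3) len_def z, folded s4_def]
  show "\<And>j. j < d \<Longrightarrow> nmem s4 23 j = j * len"
    "\<And>j x. j < d \<Longrightarrow> x < len \<Longrightarrow> rmem s4 12 (j * len + x) = (if x = 2 ^ b + j then 1 else 0)" by auto
  show "nmem s4 11 0 = d" "nmem s4 12 0 = N" "nmem s4 13 0 = R" "nmem s4 3 0 = 0"
    "rmem s4 16 = (\<lambda>_. 0)" "rmem s4 17 = (\<lambda>_. 0)"
    by (simp_all add: s4_frame s2_mem s2_frame s0_mem)
  show "nmem s4 14 0 = 2 ^ b" "nmem s4 17 0 = len"
    using m unfolding s4_def by (simp_all add: nmem_frame p_sets)
  show "nmem s4 15 0 = b" "nmem s4 16 0 = L"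
    unfolding s4_def by (simp_all add: nmem_frame p_sets b_def L_def)
qed

definition s5 :: "(nat \<Rightarrow> real) \<Rightarrow> store" where "s5 w = ev w p_rows s4"
definition s6 :: "(nat \<Rightarrow> real) \<Rightarrow> store" where "s6 w = ev w p_sketch (s5 w)"
definition s7 :: "(nat \<Rightarrow> real) \<Rightarrow> store" where "s7 w = ev w p_gram (s6 w)"
definition s8 :: "(nat \<Rightarrow> real) \<Rightarrow> store" where "s8 w = ev w p_proj (s7 w)"
definition s9 :: "(nat \<Rightarrow> real) \<Rightarrow> store" where "s9 w = ev w p_select (s8 w)"
definition s10 :: "(nat \<Rightarrow> real) \<Rightarrow> store" where "s10 w = ev w p_check (s9 w)"

lemma s8_frame:
  "a \<notin> {31, 22, 32, 30, 33, 34, 35, 36} \<Longrightarrow> nmem (s5 w) a = nmem s4 a"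
  "a \<notin> {31, 22, 32, 30, 33, 34, 35, 36} \<Longrightarrow> nmem (s6 w) a = nmem s4 a"
  "a \<notin> {31, 22, 32, 30, 33, 34, 35, 36} \<Longrightarrow> nmem (s7 w) a = nmem s4 a"
  "a \<notin> {31, 22, 32, 30, 33, 34, 35, 36} \<Longrightarrow> nmem (s8 w) a = nmem s4 a"
  "a \<notin> {10, 11, 12, 13} \<Longrightarrow> rmem (s5 w) a = rmem s4 a"
  "a \<notin> {10, 11, 12, 13} \<Longrightarrow> rmem (s6 w) a = rmem s4 a"
  "a \<notin> {10, 11, 12, 13} \<Longrightarrow> rmem (s7 w) a = rmem s4 a"
  "a \<notin> {10, 11, 12, 13, 14, 15, 16, 17} \<Longrightarrow> rmem (s8 w) a = rmem s4 a"
  unfolding s5_def s6_def s7_def s8_def by (simp_all add: nmem_frame rmem_frame p_sets)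

lemma rk_frame: "rk (s5 w) k = rk s2 k" "rk (s7 w) k = rk s2 k"
  using s8_frame(1,3)[of 20 w] s8_frame(1,3)[of 1 w] s4_frame(1)[of 20] s4_frame(1)[of 1]
  by (simp_all add: rk_def)

lemma s5_mem:
  shows "drawn (s5 w) = 3 * R"
    "\<And>r. r < R \<Longrightarrow> rmem (s5 w) 11 r = sign_of (w (3 * r + 2)) * w (3 * r) powr (- 1 / p)"
    "\<And>r. r < R \<Longrightarrow> nmem (s5 w) 22 r = bucket b (w (3 * r + 1))"
  using p_rows_spec[where w=w and p=p, OF s4_mem(3,5)] s4_frame(2)[of 0] s2_mem(7) s4_frame(3)
  by (simp_all add: s5_def)

lemma s6_W:
  assumes w: "w \<in> space uniform_tape" and j: "j < d" and x: "x < len"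
  shows "rmem (s6 w) 12 (j * len + x) = stack (2 ^ b) (sk w) j x"
proof -
  let ?S = "\<lambda>r. sign_of (w (3 * r + 2)) * w (3 * r) powr (- 1 / p)"
  let ?h = "\<lambda>r. bucket b (w (3 * r + 1))"
  have h: "?h r < 2 ^ b" for r using w by (intro bucket_less) (auto simp: space_tape)
  have c: "nmem (s5 w) 2 k = nmem s2 2 k" "rmem (s5 w) 1 k = rmem s2 1 k" "rmem (s5 w) (Suc 0) k = rmem s2 (Suc 0) k" for k
    using s8_frame(1)[of 2 w] s4_frame(1)[of 2] s8_frame(5)[of 1 w] s4_frame(2)[of 1] by simp_all
  have "rmem (s6 w) 12 (j * len + x) = rmem (s5 w) 12 (j * len + x) +
     (\<Sum>k<N. if nmem (s5 w) 2 k = j \<and> nmem (s5 w) 22 (rk (s5 w) k) = x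
        then rmem (s5 w) 11 (rk (s5 w) k) * rmem (s5 w) 1 k else 0)"
    unfolding s6_def
  proof (rule p_sketch_spec[where d=d and len=len])
    show "nmem (s5 w) 22 (rk (s5 w) k) < len" if "k < N" for k
      using enum(2)[OF that] h[of "rk s2 k"] by (simp add: s5_mem rk_frame len_def trans_less_add1)
    show "nmem (s5 w) 2 k < d" if "k < N" for k using that entry(2) by (simp add: c s2_mem)
  qed (use j x s4_mem s8_frame(1) in auto)
  also have "rmem (s5 w) 12 = rmem s4 12" unfolding s5_def by (simp add: rmem_frame p_sets)
  also have "rmem s4 12 (j * len + x) = (if x = 2 ^ b + j then 1 else 0)" by (rule s4_mem(9)[OF j x])
  \<comment> \<open>The entries are grouped by rows: for each entry, the inserted sum over
    \<open>r\<close> has a nonzero term at most at \<open>rk s2 k\<close>.\<close>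
  also have "(\<Sum>k<N. if nmem (s5 w) 2 k = j \<and> nmem (s5 w) 22 (rk (s5 w) k) = x
        then rmem (s5 w) 11 (rk (s5 w) k) * rmem (s5 w) 1 k else 0)
      = (\<Sum>k<N. \<Sum>r<R. if rk s2 k = r then (if ?h r = x then ?S r else 0) * (rmem s2 1 k * (if nmem s2 2 k = j then 1 else 0)) else 0)"
    using enum(2) by (intro sum.cong) (auto simp: rk_frame c s5_mem)
  also have "\<dots> = (\<Sum>r<R. (if ?h r = x then ?S r else 0) *
      (\<Sum>k<N. if rk s2 k = r then rmem s2 1 k * (if nmem s2 2 k = j then 1 else 0) else 0))"
    unfolding sum_distrib_left by (subst sum.swap) (intro sum.cong, auto)
  also have "\<dots> = (\<Sum>r<R. (if ?h r = x then ?S r else 0) * B r j)"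
  proof (intro sum.cong refl arg_cong2[where f="(*)"])
    fix r assume "r \<in> {..<R}"
    then have "(\<Sum>k<N. if rk s2 k = r then rmem s2 1 k * (if nmem s2 2 k = j then 1 else 0) else 0)
        = mv d B (\<lambda>j'. if j' = j then 1 else 0) r" by (intro entry_sum) simp
    also have "\<dots> = B r j" using j by (simp add: mv_def if_distrib cong: if_cong)
    finally show "(\<Sum>k<N. if rk s2 k = r then rmem s2 1 k * (if nmem s2 2 k = j then 1 else 0) else 0) = B r j" .
  qed
  also have "\<dots> = sk w x j"
    unfolding sk_def scaled_def by (intro sum.cong) auto
  finally have eq: "rmem (s6 w) 12 (j * len + x) = (if x = 2 ^ b + j then 1 else 0) + sk w x j" .
  show ?thesis
  proof (cases "x < 2 ^ b")
    case False
    \<comment> \<open>No bucket reaches \<open>2 ^ b\<close>, so only the identity block is left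
      there.\<close>
    then have "sk w x j = 0" using h unfolding sk_def by (intro sum.neutral) (metis (no_types, lifting))
    then show ?thesis using eq False by (simp add: stack_def)
  qed (use eq in \<open>simp add: stack_def\<close>)
qed

lemma s7_W:
  assumes w: "w \<in> space uniform_tape" and k: "k < d" and j: "j < d"
  shows "rmem (s7 w) 12 (k * len + (2 ^ b + j)) = sT w j k"
proof -
  have "rmem (s7 w) 12 (k * len + (2 ^ b + j)) = gs (2 ^ b) d (stack (2 ^ b) (sk w)) k (2 ^ b + j)"
    unfolding s7_def
    by (rule p_gram_spec) (use s8_frame(2) s4_mem s6_W[OF w] k j in \<open>auto simp: len_def\<close>)
  then show ?thesis unfolding sT_def gsT_def by simp
qed

lemma s7_drawn: "drawn (s7 w) = 3 * R"
  unfolding s7_def s6_def by (simp add: drawn_frame p_nodraw s5_mem)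

lemma s8_mem:
  assumes w: "w \<in> space uniform_tape"
  shows "drawn (s8 w) = 3 * R + L * d" "\<And>r. r < R \<Longrightarrow> rmem (s8 w) 17 r = wt w r"
proof -
  have m: "nmem (s7 w) 11 0 = d" "nmem (s7 w) 12 0 = N" "nmem (s7 w) 13 0 = R" "nmem (s7 w) 14 0 = 2 ^ b" "nmem (s7 w) 16 0 = L"
    by (simp_all add: s8_frame s4_mem)
  have c: "nmem (s7 w) 2 k = nmem s2 2 k" "rmem (s7 w) 1 k = rmem s2 1 k" "rmem (s7 w) (Suc 0) k = rmem s2 (Suc 0) k" for k
    using s8_frame(3)[of 2 w] s4_frame(1)[of 2] s8_frame(7)[of 1 w] s4_frame(2)[of 1] by simp_all
  have col: "nmem (s7 w) 2 k < d" if "k < N" for k using that entry(2) by (simp add: c s2_mem)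
  have z: "rmem (s7 w) 16 r = 0" "rmem (s7 w) 17 r = 0" for r by (simp_all add: s8_frame s4_mem)
  have "drawn (s8 w) = drawn (s7 w) + L * d"
    unfolding s8_def by (rule p_proj_spec(1)[OF m]) (use col z in auto)
  then show "drawn (s8 w) = 3 * R + L * d" by (simp add: s7_drawn)
  have sp: "rmem (s8 w) 17 r = (\<Sum>l<L. (\<Sum>k<N. if rk (s7 w) k = r then rmem (s7 w) 1 k *
       (\<Sum>k'<d. rmem (s7 w) 12 (nmem (s7 w) 23 k' + (2 ^ b + nmem (s7 w) 2 k)) * w (drawn (s7 w) + l * d + k')) else 0)\<^sup>2)"
    if "r < R" for r
    unfolding s8_def by (rule p_proj_spec(2)[OF m]) (use col z that in auto)
  show "rmem (s8 w) 17 r = wt w r" if r: "r < R" for r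
  proof -
    have "(\<Sum>k<N. if rk (s7 w) k = r then rmem (s7 w) 1 k *
       (\<Sum>k'<d. rmem (s7 w) 12 (nmem (s7 w) 23 k' + (2 ^ b + nmem (s7 w) 2 k)) * w (drawn (s7 w) + l * d + k')) else 0)
      = proj w l r" for l
    proof -
      have off: "nmem (s7 w) 23 k' = k' * len" if "k' < d" for k'
        using s8_frame(3)[of 23 w] s4_mem(8)[OF that] by simp
      have "(\<Sum>k<N. if rk (s7 w) k = r then rmem (s7 w) 1 k *
       (\<Sum>k'<d. rmem (s7 w) 12 (nmem (s7 w) 23 k' + (2 ^ b + nmem (s7 w) 2 k)) * w (drawn (s7 w) + l * d + k')) else 0)
        = (\<Sum>k<N. if rk s2 k = r then rmem s2 1 k * mv d (sT w) (\<lambda>k'. w (3 * R + l * d + k')) (nmem s2 2 k) else 0)"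
      proof (intro sum.cong refl)
        fix k assume "k \<in> {..<N}"
        then have k: "nmem s2 2 k < d" using col[of k] by (simp add: c)
        have "(\<Sum>k'<d. rmem (s7 w) 12 (nmem (s7 w) 23 k' + (2 ^ b + nmem (s7 w) 2 k)) * w (drawn (s7 w) + l * d + k'))
            = mv d (sT w) (\<lambda>k'. w (3 * R + l * d + k')) (nmem s2 2 k)"
          unfolding mv_def using k by (intro sum.cong) (auto simp: off c s7_drawn s7_W[OF w])
        then show "(if rk (s7 w) k = r then rmem (s7 w) 1 k *
           (\<Sum>k'<d. rmem (s7 w) 12 (nmem (s7 w) 23 k' + (2 ^ b + nmem (s7 w) 2 k)) * w (drawn (s7 w) + l * d + k')) else 0)
          = (if rk s2 k = r then rmem s2 1 k * mv d (sT w) (\<lambda>k'. w (3 * R + l * d + k')) (nmem s2 2 k) else 0)"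
          by (simp add: rk_frame c)
      qed
      also have "\<dots> = proj w l r" unfolding proj_def by (rule entry_sum[OF r])
      finally show ?thesis .
    qed
    then show ?thesis unfolding wt_def using sp[OF r] by simp
  qed
qed

lemma q_eq:
  assumes "w \<in> space uniform_tape" "r < R"
  shows "q w r = rval e_lam (s8 w) * rmem (s8 w) 17 r powr (p / 2)"
proof -
  have "nmem (s8 w) 11 0 = d" "rmem (s8 w) 0 1 = \<epsilon>"
    by (simp_all add: s8_frame s4_mem s4_frame s2_mem)
  then have "rval e_lam (s8 w) = 262144 * real d ^ 11 / (\<epsilon> * \<epsilon>)"
    using d1 by (simp add: e_lam_def powr_numeral)
  also have "\<dots> = lam"
    unfolding lam_def \<Lambda>_def
    using \<epsilon> by (simp add: power_mult_distrib power2_eq_square field_simps power_numeral_reduce)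
  finally show ?thesis unfolding q_def using s8_mem(2)[OF assms] by simp
qed

lemma s9_sum:
  fixes F :: "nat \<Rightarrow> real \<Rightarrow> real"
  assumes w: "w \<in> space uniform_tape"
  shows "(\<Sum>j<nmem (s9 w) 3 0. F (nmem (s9 w) 4 j) (rmem (s9 w) 2 j))
      = (\<Sum>r<R. if w (3 * R + L * d + r) < q w r then F (rowof r) (if 1 \<le> q w r then 1 else q w r powr (- 1 / p)) else 0)"
    "\<And>j. j < nmem (s9 w) 3 0 \<Longrightarrow> nmem (s9 w) 4 j < n \<and> rmem (s9 w) 2 j \<noteq> 0"
proof -
  define qq where "qq r = rval e_lam (s8 w) * rmem (s8 w) 17 r powr (p / 2)" for r
  have m: "nmem (s8 w) 13 0 = R" "nmem (s8 w) 3 0 = 0" "rmem (s8 w) 0 0 = p" "nmem (s8 w) 21 = rowof"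
    using s4_mem(10) by (simp_all add: s8_frame s4_mem(3)) (simp_all add: s4_frame s2_mem)
  have w0: "0 \<le> w i" for i using w by (simp add: space_tape)
  note sp = p_select_spec[where w=w, OF m(1,2,3) w0 qq_def, folded s9_def, unfolded s8_mem(1)[OF w] m(4)]
  have "(\<Sum>j<nmem (s9 w) 3 0. F (nmem (s9 w) 4 j) (rmem (s9 w) 2 j))
      = (\<Sum>r<R. if w (3 * R + L * d + r) < qq r then F (rowof r) (if 1 \<le> qq r then 1 else qq r powr (- 1 / p)) else 0)"
    by (rule sp(1))
  also have "\<dots> = (\<Sum>r<R. if w (3 * R + L * d + r) < q w r then F (rowof r) (if 1 \<le> q w r then 1 else q w r powr (- 1 / p)) else 0)"
    using q_eq[OF w] by (intro sum.cong) (auto simp: qq_def)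
  finally show "(\<Sum>j<nmem (s9 w) 3 0. F (nmem (s9 w) 4 j) (rmem (s9 w) 2 j))
      = (\<Sum>r<R. if w (3 * R + L * d + r) < q w r then F (rowof r) (if 1 \<le> q w r then 1 else q w r powr (- 1 / p)) else 0)" .
  show "nmem (s9 w) 4 j < n \<and> rmem (s9 w) 2 j \<noteq> 0" if "j < nmem (s9 w) 3 0" for j
    using sp(2)[OF that] rowof_less by auto
qed

lemma s9_count: "w \<in> space uniform_tape \<Longrightarrow> real (nmem (s9 w) 3 0) = count w"
  unfolding count_def using s9_sum(1)[of w "\<lambda>_ _. 1"] by simp

lemma s10_mem:
  assumes w: "w \<in> space uniform_tape"
  shows "nmem (s10 w) 3 0 = (if count w \<le> Cap then nmem (s9 w) 3 0 else 0)"
    "nmem (s10 w) 4 = nmem (s9 w) 4" "rmem (s10 w) 2 = rmem (s9 w) 2"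
proof -
  have "nmem (s9 w) 11 = nmem (s8 w) 11" "rmem (s9 w) 0 = rmem (s8 w) 0"
    unfolding s9_def by (simp_all add: nmem_frame rmem_frame p_sets)
  then have "rval e_cap (s9 w) = Cap"
    by (intro e_cap) (simp_all add: s8_frame s4_mem s4_frame s2_mem)
  then show "nmem (s10 w) 3 0 = (if count w \<le> Cap then nmem (s9 w) 3 0 else 0)"
    using s9_count[OF w] by (simp add: s10_def p_check_def)
  show "nmem (s10 w) 4 = nmem (s9 w) 4" "rmem (s10 w) 2 = rmem (s9 w) 2"
    unfolding s10_def by (simp_all add: nmem_frame rmem_frame p_sets)
qed

lemma output_size:
  assumes "w \<in> space uniform_tape" shows "real (nmem (s10 w) 3 0) \<le> Cap"
  using s9_count[OF assms] \<epsilon> by (simp add: s10_mem[OF assms] Cap_def)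

lemma output_norm:
  assumes w: "w \<in> space uniform_tape" and c: "count w \<le> Cap" and x: "x \<in> carrier_vec d"
  shows "lp_norm p (output_matrix n (s10 w) *\<^sub>v (A *\<^sub>v x)) = sampled w (vec_index x) powr (1 / p)"
proof -
  have y: "A *\<^sub>v x \<in> carrier_vec n" using A x by simp
  have "lp_norm p (output_matrix n (s10 w) *\<^sub>v (A *\<^sub>v x))
      = (\<Sum>j<nmem (s10 w) 3 0. \<bar>rmem (s10 w) 2 j * (A *\<^sub>v x) $ nmem (s10 w) 4 j\<bar> powr p) powr (1 / p)"
    by (rule output_matrix_mult) (use y s9_sum(2)[OF w] c in \<open>auto simp: s10_mem[OF w]\<close>)
  also have "(\<Sum>j<nmem (s10 w) 3 0. \<bar>rmem (s10 w) 2 j * (A *\<^sub>v x) $ nmem (s10 w) 4 j\<bar> powr p)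
      = (\<Sum>j<nmem (s9 w) 3 0. \<bar>rmem (s9 w) 2 j * (A *\<^sub>v x) $ nmem (s9 w) 4 j\<bar> powr p)"
    using c by (simp add: s10_mem[OF w])
  also have "\<dots> = (\<Sum>r<R. if w (3 * R + L * d + r) < q w r
      then \<bar>(if 1 \<le> q w r then 1 else q w r powr (- 1 / p)) * (A *\<^sub>v x) $ rowof r\<bar> powr p else 0)"
    by (rule s9_sum(1)[OF w, of "\<lambda>i v. \<bar>v * (A *\<^sub>v x) $ i\<bar> powr p"])
  also have "\<dots> = sampled w (vec_index x)"
    unfolding sampled_def
  proof (intro sum.cong refl)
    fix r assume "r \<in> {..<R}"
    then have r: "(A *\<^sub>v x) $ rowof r = mv d B (vec_index x) r" using mult_B[OF x] by simp
    have v: "(q w r powr (- 1 / p)) powr p = 1 / q w r" if "0 < q w r"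
      using p that by (intro powr_neg_inverse_powr) auto
    show "(if w (3 * R + L * d + r) < q w r
        then \<bar>(if 1 \<le> q w r then 1 else q w r powr (- 1 / p)) * (A *\<^sub>v x) $ rowof r\<bar> powr p else 0)
      = (if w (3 * R + L * d + r) < q w r then \<bar>mv d B (vec_index x) r\<bar> powr p / min 1 (q w r) else 0)"
    proof (cases "w (3 * R + L * d + r) < q w r")
      case True
      moreover have "0 \<le> w (3 * R + L * d + r)" using w by (simp add: space_tape)
      ultimately have "0 < q w r" by linarith
      with True v show ?thesis
        unfolding r abs_mult powr_mult by (simp add: min_def)
    qed simp
  qed
  finally show ?thesis .
qed

lemma mv_vec: "mv d B (vec_index (vec d x)) = mv d B x"
  by (rule ext) (simp add: mv_def)

text \<open>What the embedding property amounts to for the matrix without rows, whose images all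
  have norm 0.\<close>

definition trivial_embedding :: bool where
  "trivial_embedding \<longleftrightarrow> (\<forall>x\<in>carrier_vec d. (1 - \<epsilon>) * lp_norm p (A *\<^sub>v x) \<le> 0 \<and> 0 \<le> (1 + \<epsilon>) * lp_norm p (A *\<^sub>v x))"

text \<open>An equivalence is required because the measure of the output event itself is to be
  bounded, so this event has to coincide with the one shown to be measurable.\<close>

lemma embeds_iff:
  assumes w: "w \<in> space uniform_tape"
  shows "embeds_col_space p \<epsilon> A (output_matrix n (s10 w))
    \<longleftrightarrow> (if count w \<le> Cap then \<forall>x. embedded w x else trivial_embedding)"
proof (cases "count w \<le> Cap")
  case False
  have "lp_norm p (output_matrix n (s10 w) *\<^sub>v y) = 0" for y
    using False by (simp add: lp_norm_def output_matrix_def s10_mem[OF w])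
  then show ?thesis using False A by (simp add: embeds_col_space_def trivial_embedding_def)
next
  case True
  have "embeds_col_space p \<epsilon> A (output_matrix n (s10 w)) \<longleftrightarrow> (\<forall>x\<in>carrier_vec d. embedded w (vec_index x))"
    unfolding embeds_col_space_def embedded_def using A lp_norm_A output_norm[OF w True] by auto
  also have "\<dots> \<longleftrightarrow> (\<forall>x. embedded w x)"
  proof
    assume *: "\<forall>x\<in>carrier_vec d. embedded w (vec_index x)"
    show "\<forall>x. embedded w x"
    proof
      fix x
      have "embedded w (vec_index (vec d x))" using * by simp
      then show "embedded w x" unfolding embedded_def sampled_def mv_vec .
    qed
  qed auto
  finally show ?thesis using True by simp
qed

text \<open>Here \<open>Cap < real R\<close>, so the polynomial cost of Gram--Schmidt is at most a
  multiple of \<open>R \<le> N\<close>. The logarithmic factor \<open>L\<close> arises from the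
  projections and, through \<open>b \<le> L\<close>, from the digits of the buckets.\<close>

lemma run_sampling:
  "runs w embedding_program s0 (100000 * N * L) (s10 w)"
proof -
  let ?nb = "2 ^ b :: nat"
  let ?s1 = "ev (\<lambda>_. 0) p_sizes_init s2" and ?s2 = "ev (\<lambda>_. 0) p_len s3"
  have nd: "ev w c s = ev (\<lambda>_. 0) c s" if "nodraw c" for c s by (rule ev_nodraw[OF that])
  have m3: "nmem ?s1 13 0 = R" "nmem ?s2 11 0 = d"
    unfolding s3_def by (simp_all add: nmem_frame p_sets s2_mem)
  have "runs w (compile p_sizes_init) s2 2 ?s1"
    unfolding nd[OF p_nodraw(4), symmetric] by (rule runs_compile) (simp_all add: p_wf p_time)
  moreover have "runs w (compile p_sizes) ?s1 (2 + R * 10) s3"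
    unfolding s3_def nd[OF p_nodraw(5), symmetric] by (rule runs_compile) (use m3 in \<open>simp_all add: p_wf p_time\<close>)
  moreover have "runs w (compile p_len) s3 1 ?s2"
    unfolding nd[OF p_nodraw(6), symmetric] by (rule runs_compile) (simp_all add: p_wf p_time)
  moreover have "runs w (compile p_offsets) ?s2 (2 + d * 5) s4"
    unfolding s4_def nd[OF p_nodraw(7), symmetric]
    by (rule runs_compile) (use m3 in \<open>simp_all add: p_wf p_time nd[OF p_nodraw(6)]\<close>)
  moreover have "runs w (compile p_rows) s4 (2 + R * (12 + b * 8)) (s5 w)"
    unfolding s5_def by (rule runs_compile) (simp_all add: p_wf p_time s4_mem)
  moreover have "runs w (compile p_sketch) (s5 w) (2 + N * 3) (s6 w)"
    unfolding s6_def by (rule runs_compile) (simp_all add: p_wf p_time s4_mem s8_frame)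
  moreover have "runs w (compile p_gram) (s6 w)
      (2 + d * (10 + ?nb * 3 + len * 3 + d * (9 + ?nb * 3 + len * 3))) (s7 w)"
    unfolding s7_def by (rule runs_compile) (simp_all add: p_wf p_time s4_mem s8_frame)
  moreover have "runs w (compile p_proj) (s7 w)
      (2 + L * (10 + d * 3 + d * (5 + d * 3) + N * 3 + R * 4)) (s8 w)"
    unfolding s8_def by (rule runs_compile) (simp_all add: p_wf p_time s4_mem s8_frame)
  moreover have "runs w (compile p_select) (s8 w) (2 + R * 11) (s9 w)"
    unfolding s9_def by (rule runs_compile) (simp_all add: p_wf p_time s4_mem s8_frame)
  moreover have "runs w (compile p_check) (s9 w) 3 (s10 w)"
    unfolding s10_def by (rule runs_compile) (simp_all add: p_wf p_time)
  ultimately have "runs w sketch_and_sample s2 (2 + ((2 + R * 10) + (1 + ((2 + d * 5) + ((2 + R * (12 + b * 8)) +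
      ((2 + N * 3) + ((2 + d * (10 + ?nb * 3 + len * 3 + d * (9 + ?nb * 3 + len * 3))) +
      ((2 + L * (10 + d * 3 + d * (5 + d * 3) + N * 3 + R * 4)) + ((2 + R * 11) + 3))))))))) (s10 w)"
    (is "runs w _ s2 ?T _")
    unfolding sketch_and_sample_def by (intro runs_Seq)
  moreover have "\<not> tval (RLe (ROfNat (nv 13)) e_cap) s2"
    using e_cap[OF s2_mem(1,9)] cap by (simp add: s2_mem)
  ultimately have run: "runs w embedding_program s0 (Suc (2 + ((2 + N * 7) + Suc ?T))) (s10 w)"
    by (intro run_prefix[OF \<epsilon>1] runs_CondFalse)
  have "Suc (2 + ((2 + N * 7) + Suc ?T)) \<le> 100000 * N * L"
  proof -
    have RN: "R \<le> N" by (rule enum(1))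
    have dlen: "d * d * len \<le> N"
    proof -
      have "real (2 ^ b) \<le> 3200 * (real d * real d)" using sizes(3) by simp
      moreover have "real d * 1 \<le> real d * real d" using d1 by (intro mult_left_mono) auto
      ultimately have "real len \<le> 3201 * (real d * real d)" by (simp add: len_def)
      then have "real d * real d * real len \<le> real d * real d * (3201 * (real d * real d))"
        by (intro mult_left_mono) auto
      also have "\<dots> = 3201 * real d ^ 4" by (simp add: power_numeral_reduce)
      also have "\<dots> \<le> real d * real d ^ 4" using numerics(12) by (intro mult_right_mono) auto
      also have "\<dots> = real d ^ 5" by (simp add: power_numeral_reduce)
      also have "\<dots> \<le> real d ^ 21" using d1 by (intro power_increasing) auto
      also have "\<dots> \<le> real R" by (rule numerics(10))
      finally have "real (d * d * len) \<le> real R" by simp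
      then show ?thesis using RN by (simp only: of_nat_le_iff)
    qed
    have nl: "?nb \<le> len" "1 \<le> len" "d \<le> len" using d1 by (auto simp: len_def)
    have le: "d * d * ?nb \<le> N" "d * d \<le> N" "d * len \<le> N" "d * ?nb \<le> N" "d \<le> N"
    proof -
      have "d * d * ?nb \<le> d * d * len" "d * d * 1 \<le> d * d * len" using nl by (intro mult_le_mono2; simp)+
      with dlen show "d * d * ?nb \<le> N" "d * d \<le> N" by linarith+
      have 1: "1 * (d * len) \<le> d * (d * len)" using d1 by (intro mult_le_mono1)
      then show "d * len \<le> N" using dlen by (simp only: mult.assoc mult_1)
      then show "d * ?nb \<le> N" using mult_le_mono2[OF nl(1), of d] by linarith
      have "1 * d \<le> d * d" using d1 by (intro mult_le_mono1)
      then show "d \<le> N" using \<open>d * d \<le> N\<close> by linarith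
    qed
    have bL: "b \<le> L"
    proof -
      have "real (2 ^ b) \<le> real R"
      proof -
        have "real (2 ^ b) \<le> 3200 * (real d * real d)" using sizes(3) by simp
        also have "\<dots> \<le> real d * (real d * real d)" using numerics(12) by (intro mult_right_mono) auto
        also have "\<dots> = real d ^ 3" by (simp add: power3_eq_cube)
        also have "\<dots> \<le> real d ^ 21" using d1 by (intro power_increasing) auto
        also have "\<dots> \<le> real R" by (rule numerics(10))
        finally show ?thesis .
      qed
      then have "2 ^ b \<le> R" by (simp only: of_nat_le_iff)
      then have "(2::nat) ^ b < 2 ^ L" using sizes(4) by linarith
      then show ?thesis by simp
    qed
    have L1: "1 \<le> L" by (rule numerics(6))
    have N1: "1 \<le> N" using le(5) d1 by linarith
    have NL: "N \<le> N * L" "1 \<le> N * L" "L \<le> N * L"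
      using L1 N1 mult_le_mono2[OF L1, of N] mult_le_mono1[OF N1, of L] by auto
    have t: "R * b \<le> N * L" using RN bL by (rule mult_le_mono)
    have Ls: "L * d \<le> N * L" "L * (d * d) \<le> N * L" "L * R \<le> N * L"
      using mult_le_mono2[OF le(5), of L] mult_le_mono2[OF le(2), of L] mult_le_mono2[OF RN, of L]
      by (simp_all add: mult.commute)
    have "Suc (2 + ((2 + N * 7) + Suc ?T)) = 26 + 10 * N + 33 * R + 5 * d + 8 * (R * b)
       + 10 * d + 3 * (d * ?nb) + 3 * (d * len) + 9 * (d * d) + 3 * (d * d * ?nb) + 3 * (d * d * len)
       + 10 * L + 8 * (L * d) + 3 * (L * (d * d)) + 3 * (N * L) + 4 * (L * R)"
      by (simp add: algebra_simps)
    \<comment> \<open>Every product is at most \<open>N * L\<close>, and the coefficients add up to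
      141.\<close>
    also have "\<dots> \<le> 100000 * (N * L)"
      using NL t Ls le dlen RN by linarith
    finally show ?thesis by (simp add: mult.assoc)
  qed
  with run show ?thesis unfolding runs_def using order_trans by blast
qed

end

context sampling_run
begin

lemma sampling_outcome:
  shows "w \<in> space uniform_tape \<Longrightarrow> output_matrix n (s10 w) \<in> carrier_mat (nmem (s10 w) 3 0) n"
    "w \<in> space uniform_tape \<Longrightarrow> sampling_matrix (output_matrix n (s10 w))"
    "1 / 2 \<le> measure uniform_tape {w \<in> space uniform_tape. embeds_col_space p \<epsilon> A (output_matrix n (s10 w))}"
    "real (100000 * N * L) \<le> 2 ^ 32 * real (max 1 (nnz A)) * ln (real n)"
proof -
  assume w: "w \<in> space uniform_tape"
  have "nmem (s10 w) 4 j < n \<and> rmem (s10 w) 2 j \<noteq> 0" if "j < nmem (s10 w) 3 0" for j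
    using s9_sum(2)[OF w, of j] that by (simp add: s10_mem[OF w] split: if_splits)
  then show "output_matrix n (s10 w) \<in> carrier_mat (nmem (s10 w) 3 0) n" "sampling_matrix (output_matrix n (s10 w))"
    by (intro output_matrix_sampling; blast)+
next
  have "{w \<in> space uniform_tape. embeds_col_space p \<epsilon> A (output_matrix n (s10 w))}
      = {w \<in> space uniform_tape. if count w \<le> Cap then \<forall>x. embedded w x else trivial_embedding}"
    using embeds_iff by auto
  then show "1 / 2 \<le> measure uniform_tape {w \<in> space uniform_tape. embeds_col_space p \<epsilon> A (output_matrix n (s10 w))}"
    using success_probability by simp
  have "real L \<le> 4 * ln (real n)" "1 \<le> ln (real n)"
    using log_bound[OF sizes(5) R_le_n n] by auto
  then have "(100000 * real N) * real L \<le> (100000 * real (max 1 (nnz A))) * (4 * ln (real n))"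
    by (intro mult_mono) (auto simp: N_nnz)
  also have "\<dots> \<le> 2 ^ 32 * real (max 1 (nnz A)) * ln (real n)"
    using \<open>1 \<le> ln (real n)\<close> by (simp add: mult_right_mono)
  finally show "real (100000 * N * L) \<le> 2 ^ 32 * real (max 1 (nnz A)) * ln (real n)" by simp
qed

end

section \<open>Time, size and success probability of the program\<close>

context run
begin

text \<open>The final store is abstracted to a function of the tape, so that the three branches of
  the program can be treated alike.\<close>

definition outcome :: "((nat \<Rightarrow> real) \<Rightarrow> store) \<Rightarrow> bool" where
  "outcome \<sigma> \<longleftrightarrow> (\<forall>w\<in>space uniform_tape.
     (\<exists>T. runs w embedding_program s0 T (\<sigma> w) \<and> real T \<le> 2 ^ 32 * real (max 1 (nnz A)) * ln (real n)) \<and>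
     output_matrix n (\<sigma> w) \<in> carrier_mat (nmem (\<sigma> w) 3 0) n \<and> sampling_matrix (output_matrix n (\<sigma> w)) \<and>
     real (nmem (\<sigma> w) 3 0) \<le> Cap) \<and>
   1 / 2 \<le> measure uniform_tape {w \<in> space uniform_tape. embeds_col_space p \<epsilon> A (output_matrix n (\<sigma> w))}"

lemma sure_measure:
  assumes "\<And>w. w \<in> space uniform_tape \<Longrightarrow> Q w"
  shows "1 / 2 \<le> measure uniform_tape {w \<in> space uniform_tape. Q w}"
proof -
  have "{w \<in> space uniform_tape. Q w} = space uniform_tape" using assms by auto
  then show ?thesis using prob_space.prob_space[OF prob_space_tape] by simp
qed

lemma outcome_exists: "\<exists>\<sigma>. outcome \<sigma>"
proof -
  have Cap0: "0 \<le> Cap" by (simp add: Cap_def)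
  have ln1: "1 \<le> ln (real n)" using log_bound(2)[of 0 0 n] n by simp
  have base: "c * real (max 1 (nnz A)) \<le> 2 ^ 32 * real (max 1 (nnz A)) * ln (real n)" if "c \<le> 2 ^ 32" for c :: real
  proof -
    have "c * real (max 1 (nnz A)) * 1 \<le> 2 ^ 32 * real (max 1 (nnz A)) * ln (real n)"
      using that ln1 by (intro mult_mono mult_right_mono) auto
    then show ?thesis by simp
  qed
  consider "1 \<le> \<epsilon>" | "\<epsilon> < 1" "real R \<le> Cap" | "\<epsilon> < 1" "Cap < real R" by linarith
  then show ?thesis
  proof cases
    case 1
    have z: "nmem s0 3 0 = 0" by (simp add: s0_mem)
    have "real 2 \<le> 2 ^ 32 * real (max 1 (nnz A)) * ln (real n)"
      using base[of 2] by (rule order_trans[rotated]) auto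
    then have run: "\<exists>T. runs w embedding_program s0 T s0 \<and> real T \<le> 2 ^ 32 * real (max 1 (nnz A)) * ln (real n)" for w
      using run_big_eps[OF 1] by blast
    have m: "nmem s0 4 j < n \<and> rmem s0 2 j \<noteq> 0" if "j < nmem s0 3 0" for j
      using that z by simp
    have "real (nmem s0 3 0) \<le> Cap" using Cap0 z by simp
    then have "outcome (\<lambda>_. s0)"
      unfolding outcome_def using run output_matrix_sampling[of s0 n, OF m]
        sure_measure[of "\<lambda>_. embeds_col_space p \<epsilon> A (output_matrix n s0)"] embeds_empty[OF 1 z]
      by blast
    then show ?thesis by (rule exI[of outcome])
  next
    case 2
    let ?T = "Suc (2 + ((2 + N * 7) + Suc (3 + R * 4)))"
    have "real ?T \<le> 20 * real (max 1 (nnz A))"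
      using enum(1) unfolding N_nnz by simp
    also have "\<dots> \<le> 2 ^ 32 * real (max 1 (nnz A)) * ln (real n)" by (rule base) simp
    finally have T: "real ?T \<le> 2 ^ 32 * real (max 1 (nnz A)) * ln (real n)" .
    have m: "nmem s_all 4 j < n \<and> rmem s_all 2 j \<noteq> 0" if "j < nmem s_all 3 0" for j
      using that by (simp add: s_all_mem rowof_less)
    have "real (nmem s_all 3 0) \<le> Cap" using 2 by (simp add: s_all_mem)
    then have "outcome (\<lambda>_. s_all)"
      unfolding outcome_def using run_all[OF 2] T output_matrix_sampling[of s_all n, OF m]
        sure_measure[of "\<lambda>_. embeds_col_space p \<epsilon> A (output_matrix n s_all)"] embeds_all
      by blast
    then show ?thesis by (rule exI[of outcome])
  next
    case 3
    then interpret sampling_run n d p \<epsilon> A es by unfold_locales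
    have "outcome s10"
      unfolding outcome_def using run_sampling sampling_outcome output_size by blast
    then show ?thesis by (rule exI[of outcome])
  qed
qed

text \<open>Determinism turns the existential over running times and outputs into a statement about
  the one final store.\<close>

lemma computes_iff:
  assumes "outcome \<sigma>" "w \<in> space uniform_tape"
  shows "\<exists>t. real t \<le> 2 ^ 32 * real (max 1 (nnz A)) * ln (real n) \<and>
      (\<forall>t' S. computes embedding_program p \<epsilon> n d es w t' S \<longleftrightarrow> t' = t \<and> S = output_matrix n (\<sigma> w))"
proof -
  obtain T where T: "runs w embedding_program s0 T (\<sigma> w)" "real T \<le> 2 ^ 32 * real (max 1 (nnz A)) * ln (real n)"
    using assms unfolding outcome_def by blast
  then obtain t where t: "t \<le> T" "exec w embedding_program s0 t (\<sigma> w)" unfolding runs_def by blast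
  have "computes embedding_program p \<epsilon> n d es w t' S \<longleftrightarrow> t' = t \<and> S = output_matrix n (\<sigma> w)" for t' S
    unfolding computes_def s0_def[symmetric] using t(2) exec_deterministic[OF t(2)] by blast
  moreover have "real t \<le> 2 ^ 32 * real (max 1 (nnz A)) * ln (real n)" using t(1) T(2) by linarith
  ultimately show ?thesis by blast
qed

lemma guarantee:
  shows "\<forall>\<omega>\<in>space uniform_tape. \<exists>t s S. computes embedding_program p \<epsilon> n d es \<omega> t S \<and>
      real t \<le> 2 ^ 32 * real (max 1 (nnz A)) * ln (real n) \<and> S \<in> carrier_mat s n \<and> sampling_matrix S \<and>
      real s \<le> 2 ^ 32 * real d ^ 21 * max 1 (ln (1 / \<epsilon>)) / \<epsilon>\<^sup>2"
    and "measure uniform_tape {\<omega> \<in> space uniform_tape. \<exists>t S.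
      computes embedding_program p \<epsilon> n d es \<omega> t S \<and> embeds_col_space p \<epsilon> A S} \<ge> 1 / 2"
proof -
  obtain \<sigma> where \<sigma>: "outcome \<sigma>" using outcome_exists by blast
  have "Cap * 1 \<le> Cap * max 1 (ln (1 / \<epsilon>))" by (intro mult_left_mono) (auto simp: Cap_def)
  then have cap: "Cap \<le> 2 ^ 32 * real d ^ 21 * max 1 (ln (1 / \<epsilon>)) / \<epsilon>\<^sup>2" by (simp add: Cap_def)
  show "\<forall>\<omega>\<in>space uniform_tape. \<exists>t s S. computes embedding_program p \<epsilon> n d es \<omega> t S \<and>
      real t \<le> 2 ^ 32 * real (max 1 (nnz A)) * ln (real n) \<and> S \<in> carrier_mat s n \<and> sampling_matrix S \<and>
      real s \<le> 2 ^ 32 * real d ^ 21 * max 1 (ln (1 / \<epsilon>)) / \<epsilon>\<^sup>2"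
  proof
    fix w assume w: "w \<in> space uniform_tape"
    obtain t where "real t \<le> 2 ^ 32 * real (max 1 (nnz A)) * ln (real n)"
      "computes embedding_program p \<epsilon> n d es w t (output_matrix n (\<sigma> w))"
      using computes_iff[OF \<sigma> w] by blast
    moreover have "output_matrix n (\<sigma> w) \<in> carrier_mat (nmem (\<sigma> w) 3 0) n" "sampling_matrix (output_matrix n (\<sigma> w))"
      "real (nmem (\<sigma> w) 3 0) \<le> 2 ^ 32 * real d ^ 21 * max 1 (ln (1 / \<epsilon>)) / \<epsilon>\<^sup>2"
      using \<sigma> w cap unfolding outcome_def by (blast, blast, blast intro: order_trans)
    ultimately show "\<exists>t s S. computes embedding_program p \<epsilon> n d es w t S \<and>
      real t \<le> 2 ^ 32 * real (max 1 (nnz A)) * ln (real n) \<and> S \<in> carrier_mat s n \<and> sampling_matrix S \<and>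
      real s \<le> 2 ^ 32 * real d ^ 21 * max 1 (ln (1 / \<epsilon>)) / \<epsilon>\<^sup>2"
      by blast
  qed
  have "{\<omega> \<in> space uniform_tape. \<exists>t S. computes embedding_program p \<epsilon> n d es \<omega> t S \<and> embeds_col_space p \<epsilon> A S}
      = {\<omega> \<in> space uniform_tape. embeds_col_space p \<epsilon> A (output_matrix n (\<sigma> \<omega>))}"
  proof (intro Collect_cong conj_cong refl)
    fix w assume "w \<in> space uniform_tape"
    from computes_iff[OF \<sigma> this] obtain t where
      "\<And>t' S. computes embedding_program p \<epsilon> n d es w t' S \<longleftrightarrow> t' = t \<and> S = output_matrix n (\<sigma> w)"
      by blast
    then show "(\<exists>t S. computes embedding_program p \<epsilon> n d es w t S \<and> embeds_col_space p \<epsilon> A S)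
        \<longleftrightarrow> embeds_col_space p \<epsilon> A (output_matrix n (\<sigma> w))"
      by simp
  qed
  then show "measure uniform_tape {\<omega> \<in> space uniform_tape. \<exists>t S.
      computes embedding_program p \<epsilon> n d es \<omega> t S \<and> embeds_col_space p \<epsilon> A S} \<ge> 1 / 2"
    using \<sigma> unfolding outcome_def by simp
qed

end

theorem theorem5:
  shows "\<exists>prog. \<forall>p::real. 1 \<le> p \<and> p < 2 \<longrightarrow>
    (\<exists>(K::real) (m::nat) (C::real) (k::nat) (\<delta>::real). \<delta> > 0 \<and>
      (\<forall>(n::nat) (d::nat) (\<epsilon>::real) (A::real mat) (es::(nat \<times> nat \<times> real) list).
         1 \<le> n \<and> 1 \<le> d \<and> K * real d ^ m \<le> real n \<and> K * ln (real n) \<le> real d \<and> 0 < \<epsilon> \<and>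
         A \<in> carrier_mat n d \<and> lists_entries A es \<longrightarrow>
           (\<forall>\<omega>\<in>space uniform_tape. \<exists>t s S.
              computes prog p \<epsilon> n d es \<omega> t S \<and>
              real t \<le> C * real (max 1 (nnz A)) * ln (real n) \<and>
              S \<in> carrier_mat s n \<and> sampling_matrix S \<and>
              real s \<le> C * real d ^ k * max 1 (ln (1 / \<epsilon>)) / \<epsilon>\<^sup>2) \<and>
           measure uniform_tape
             {\<omega> \<in> space uniform_tape. \<exists>t S.
                computes prog p \<epsilon> n d es \<omega> t S \<and> embeds_col_space p \<epsilon> A S} \<ge> \<delta>))"
proof (rule exI[of _ embedding_program], intro allI impI, elim conjE)
  fix p :: real assume p: "1 \<le> p" "p < 2"
  show "\<exists>(K::real) (m::nat) (C::real) (k::nat) (\<delta>::real). \<delta> > 0 \<and>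
      (\<forall>(n::nat) (d::nat) (\<epsilon>::real) (A::real mat) (es::(nat \<times> nat \<times> real) list).
         1 \<le> n \<and> 1 \<le> d \<and> K * real d ^ m \<le> real n \<and> K * ln (real n) \<le> real d \<and> 0 < \<epsilon> \<and>
         A \<in> carrier_mat n d \<and> lists_entries A es \<longrightarrow>
           (\<forall>\<omega>\<in>space uniform_tape. \<exists>t s S.
              computes embedding_program p \<epsilon> n d es \<omega> t S \<and>
              real t \<le> C * real (max 1 (nnz A)) * ln (real n) \<and>
              S \<in> carrier_mat s n \<and> sampling_matrix S \<and>
              real s \<le> C * real d ^ k * max 1 (ln (1 / \<epsilon>)) / \<epsilon>\<^sup>2) \<and>
           measure uniform_tape
             {\<omega> \<in> space uniform_tape. \<exists>t S.
                computes embedding_program p \<epsilon> n d es \<omega> t S \<and> embeds_col_space p \<epsilon> A S} \<ge> \<delta>)"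
  \<comment> \<open>With exponent 0 the size condition reads \<open>1000 \<le> real n\<close>; the
    other values are those of \<open>Cap\<close>, of the time bound and of
    \<open>success_probability\<close>.\<close>
  proof (rule exI[of _ 1000], rule exI[of _ 0], rule exI[of _ "2 ^ 32"], rule exI[of _ 21], rule exI[of _ "1 / 2"],
      rule conjI, simp, intro allI impI, elim conjE)
    fix n d :: nat and \<epsilon> :: real and A :: "real mat" and es :: "(nat \<times> nat \<times> real) list"
    assume "1 \<le> d" "1000 * real d ^ 0 \<le> real n" "1000 * ln (real n) \<le> real d" "0 < \<epsilon>"
      "A \<in> carrier_mat n d" "lists_entries A es"
    then interpret run n d p \<epsilon> A es
      using p by unfold_locales auto
    show "(\<forall>\<omega>\<in>space uniform_tape. \<exists>t s S.
              computes embedding_program p \<epsilon> n d es \<omega> t S \<and>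
              real t \<le> 2 ^ 32 * real (max 1 (nnz A)) * ln (real n) \<and>
              S \<in> carrier_mat s n \<and> sampling_matrix S \<and>
              real s \<le> 2 ^ 32 * real d ^ 21 * max 1 (ln (1 / \<epsilon>)) / \<epsilon>\<^sup>2) \<and>
           measure uniform_tape
             {\<omega> \<in> space uniform_tape. \<exists>t S.
                computes embedding_program p \<epsilon> n d es \<omega> t S \<and> embeds_col_space p \<epsilon> A S} \<ge> 1 / 2"
      using guarantee by blast
  qed
qed

end
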